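(* Let $\frac12<\beta<1$ and $\sigma\in\mathbb{R}$ satisfy $\sigma>-2\beta+1$. Then there exists (small) $s>0$ such that, given any Fourier multiplier operator $\phi\in \mathrm{HS}(L^2(\mathbb{T});H^\sigma(\mathbb{T}))$, the stochastic heat equation $$\partial_t u+(1-\partial_x^2)u=u\,\phi\,\zeta,\qquad u|_{t=0}=u_0,\qquad \zeta=\partial_t W^\beta,$$ on $\mathbb{T}$ is pathwise globally well-posed in $H^s(\mathbb{T})$ (in the sense of the convolution Young formulation given in the context).
   Context: **Setting.** $\mathbb{T}=\mathbb{R}/(2\pi\mathbb{Z})$ with normalized Lebesgue measure, $e_n(x)=e^{inx}$, $\langle n\rangle=(1+n^2)^{1/2}$, $\|f\|_{H^s}^2=\sum_{n\in\mathbb{Z}}\langle n\rangle^{2s}|\widehat f(n)|^2$. $S_t=S(t)=e^{t(\partial_x^2-1)}$ is the heat semigroup. $\mathcal{L}(V)$ denotes bounded linear operators on $V$. **Noise.** $\phi$ is a Fourier multiplier, $\phi(e_n)=\phi_n e_n$, so $\|\phi\|_{\mathrm{HS}(L^2;H^\sigma)}=\|\langle n\rangle^\sigma\phi_n\|_{\ell^2_n}$. $W^\beta(t)=\sum_{n\in\mathbb{Z}}B_n(t)e_n$, where $\{B_n\}_{n\in\mathbb{Z}}$ are complex-valued fractional Brownian motions with Hurst parameter $\beta$, independent except for the constraint $B_{-n}=\overline{B_n}$. That is, $\{B_0\}\cup\{\sqrt2\,\mathrm{Re}\,B_n,\sqrt2\,\mathrm{Im}\,B_n\}_{n\ge1}$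 are independent real fractional Brownian motions, i.e. centered Gaussian processes with covariance $\frac12(t_1^{2\beta}+t_2^{2\beta}-|t_1-t_2|^{2\beta})$. **First order driver.** For $t>r\ge0$, $\mathbf{X}^1_{t,r}(f)=\int_r^tS(t-t')\big[(S(t'-r)f)\,\phi\,dW^\beta(t')\big]$, i.e. (with Wiener integrals) $$\mathbf{X}^1_{t,r}(f)=\sum_{n}e_n\sum_{n_1+n_2=n}\widehat f(n_2)\,\phi_{n_1}\int_r^te^{-(t-t')\langle n\rangle^2}e^{-(t'-r)\langle n_2\rangle^2}dB_{n_1}(t').$$ **Spaces.** $\Delta_{2,T}=\{(t,r)\in[0,T]^2:t>r\}$. For a Banach space $V$ and a continuous $g:\Delta_{2,T}\to V$, $\|g\|_{C^\gamma_{2,T}V}=\sup_{(t,r)\in\Delta_{2,T}}\|g_{t,r}\|_V/|t-r|^\gamma$. For $f:[0,T]\to H^s(\mathbb{T})$, $(\widehat\delta f)_{t,r}=f_t-S_{t-r}f_r$. $\widehat{\mathcal{C}}^\alpha_TH^s$ is the space of $f$ with $\|f\|_{\widehat{\mathcal{C}}^\alpha_TH^s}=\|f\|_{L^\infty([0,T];H^s)}+\|\widehat\delta f\|_{C^\alpha_{2,T}H^s}<\infty$. **Convolution Young integral.** If $\mathbf{X}^1\in C^\gamma_{2,T}\mathcal{L}(H^s)$ and $u\in\widehat{\mathcal{C}}^\alpha_TH^s$ with $\alpha+\gamma>1$, then $$\mathcal{I}^{\mathbf{X}^1}(u)(t)=\lim_{|\Pi|\to0}\sum_{j=0}^{n-1}S_{t-t_j}\mathbf{X}^1_{t_j,t_{j+1}}(u_{t_{j+1}})\quad\text{in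 }H^s(\mathbb{T}),$$ the limit being over partitions $\Pi=\{0=t_n<\dots<t_1<t_0=t\}$ of $[0,t]$ with mesh tending to $0$. This limit exists and gives the meaning of the stochastic convolution $\int_0^tS(t-t')[u(t')\phi\,dW^\beta(t')]$ in the Duhamel (mild) formulation. **Pathwise global well-posedness in $H^s(\mathbb{T})$** means: there exist $\frac12<\alpha<\gamma<1$, a version of $\mathbf{X}^1$, and an event $\Sigma$ with $\mathbb{P}(\Sigma)=1$ such that for every $\omega\in\Sigma$: $\mathbf{X}^1(\omega)\in C^\gamma_{2,T}\mathcal{L}(H^s(\mathbb{T}))$ for all $T>0$; and for every $u_0\in H^s(\mathbb{T})$ there is a unique $u:[0,\infty)\to H^s(\mathbb{T})$ such that, for every $T>0$, $u|_{[0,T]}\in\widehat{\mathcal{C}}^\alpha_TH^s(\mathbb{T})$ and $$u(t)=S(t)u_0+\mathcal{I}^{\mathbf{X}^1(\omega)}(u)(t),\qquad 0\le t\le T$$ (uniqueness holding in $\widehat{\mathcal{C}}^\alpha_TH^s(\mathbb{T})$ on each $[0,T]$); and, for each $T>0$, the solution map $u_0\mapsto u$ is continuous from $H^s(\mathbb{T})$ to $C([0,T];H^s(\mathbb{T}))$. *)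

theory Defs
  imports "HOL-Probability.Probability"
begin

section \<open>Sobolev spaces on the torus\<close>

text \<open>
  A function (or distribution) on \<open>\<real>/(2\<pi>\<int>)\<close> is represented by its sequence of Fourier
  coefficients with respect to \<open>e\<^sub>n(x) = exp (inx)\<close> and normalized Lebesgue measure. In particular
  \<open>sobolev 0\<close> is \<open>L\<^sup>2\<close>.
\<close>

type_synonym torus_fun = "int \<Rightarrow> complex"

definition jap :: "int \<Rightarrow> real" where
  "jap n = sqrt (1 + (of_int n)\<^sup>2)"

definition mode :: "int \<Rightarrow> torus_fun" where
  "mode n = (\<lambda>k. if k = n then 1 else 0)"

definition sobolev :: "real \<Rightarrow> torus_fun set" where
  "sobolev s = {f. (\<lambda>n. jap n powr (2 * s) * (cmod (f n))\<^sup>2) summable_on UNIV}"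

text \<open>Only meaningful on \<open>sobolev s\<close>.\<close>
definition sobolev_norm :: "real \<Rightarrow> torus_fun \<Rightarrow> real" where
  "sobolev_norm s f = sqrt (\<Sum>\<^sub>\<infinity>n. jap n powr (2 * s) * (cmod (f n))\<^sup>2)"

definition fourier_multiplier :: "(int \<Rightarrow> complex) \<Rightarrow> torus_fun \<Rightarrow> torus_fun" where
  "fourier_multiplier \<phi> f = (\<lambda>n. \<phi> n * f n)"

text \<open>Hilbert--Schmidt operators from \<open>L\<^sup>2\<close> to \<open>H\<^sup>\<sigma>\<close>, through the orthonormal basis
  \<open>mode n\<close> of \<open>L\<^sup>2\<close>.\<close>
definition hilbert_schmidt :: "real \<Rightarrow> (torus_fun \<Rightarrow> torus_fun) \<Rightarrow> bool" where
  "hilbert_schmidt \<sigma> A \<longleftrightarrow>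
     (\<forall>n. A (mode n) \<in> sobolev \<sigma>) \<and>
     (\<lambda>n. (sobolev_norm \<sigma> (A (mode n)))\<^sup>2) summable_on UNIV"

text \<open>\<open>S(t) = exp (t (\<partial>\<^sub>x\<^sup>2 - 1))\<close>.\<close>
definition heat :: "real \<Rightarrow> torus_fun \<Rightarrow> torus_fun" where
  "heat t = fourier_multiplier (\<lambda>n. of_real (exp (- t * (jap n)\<^sup>2)))"

definition bounded_ops :: "real \<Rightarrow> (torus_fun \<Rightarrow> torus_fun) set" where
  "bounded_ops s = {A.
     (\<forall>f\<in>sobolev s. A f \<in> sobolev s) \<and>
     (\<forall>f\<in>sobolev s. \<forall>g\<in>sobolev s. A (\<lambda>n. f n + g n) = (\<lambda>n. A f n + A g n)) \<and>
     (\<forall>c. \<forall>f\<in>sobolev s. A (\<lambda>n. c * f n) = (\<lambda>n. c * A f n)) \<and>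
     (\<exists>C. \<forall>f\<in>sobolev s. sobolev_norm s (A f) \<le> C * sobolev_norm s f)}"

text \<open>Only meaningful on \<open>bounded_ops s\<close>.\<close>
definition op_norm :: "real \<Rightarrow> (torus_fun \<Rightarrow> torus_fun) \<Rightarrow> real" where
  "op_norm s A = (SUP f\<in>{f \<in> sobolev s. sobolev_norm s f \<le> 1}. sobolev_norm s (A f))"


section \<open>Hoelder-type spaces\<close>

definition simplex2 :: "real \<Rightarrow> (real \<times> real) set" where
  "simplex2 T = {(t, r). 0 \<le> r \<and> r < t \<and> t \<le> T}"

text \<open>\<open>C2 V N \<gamma> T g\<close>: \<open>g\<close> is a continuous map into the space \<open>V\<close> with norm \<open>N\<close>, of finite
  \<open>C\<^sup>\<gamma>\<^sub>2\<^sub>,\<^sub>T V\<close> norm.\<close>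
definition C2 :: "'v::minus set \<Rightarrow> ('v \<Rightarrow> real) \<Rightarrow> real \<Rightarrow> real \<Rightarrow> (real \<Rightarrow> real \<Rightarrow> 'v) \<Rightarrow> bool" where
  "C2 V N \<gamma> T g \<longleftrightarrow>
     (\<forall>(t, r)\<in>simplex2 T. g t r \<in> V) \<and>
     (\<forall>(t, r)\<in>simplex2 T.
        ((\<lambda>(t', r'). N (g t' r' - g t r)) \<longlongrightarrow> 0) (at (t, r) within simplex2 T)) \<and>
     (\<exists>C. \<forall>(t, r)\<in>simplex2 T. N (g t r) / \<bar>t - r\<bar> powr \<gamma> \<le> C)"

definition delta_hat :: "(real \<Rightarrow> torus_fun) \<Rightarrow> real \<Rightarrow> real \<Rightarrow> torus_fun" where
  "delta_hat u t r = u t - heat (t - r) (u r)"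

text \<open>The \<open>L\<^sup>\<infinity>\<close> part is a genuine supremum; members are continuous on \<open>[0,T]\<close>, so it agrees with
  the essential one.\<close>
definition hat_C :: "real \<Rightarrow> real \<Rightarrow> real \<Rightarrow> (real \<Rightarrow> torus_fun) set" where
  "hat_C s \<alpha> T = {u.
     (\<forall>t\<in>{0..T}. u t \<in> sobolev s) \<and>
     (\<exists>C. \<forall>t\<in>{0..T}. sobolev_norm s (u t) \<le> C) \<and>
     C2 (sobolev s) (sobolev_norm s) \<alpha> T (delta_hat u)}"


section \<open>Fractional Brownian motion and the noise\<close>

definition centered_gaussian :: "'a measure \<Rightarrow> ('a \<Rightarrow> real) \<Rightarrow> bool" where
  "centered_gaussian M X \<longleftrightarrow> X \<in> borel_measurable M \<and>
     ((AE \<omega> in M. X \<omega> = 0) \<or> (\<exists>\<sigma>>0. distributed M lborel X (normal_density 0 \<sigma>)))"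

text \<open>Real processes are indexed by \<open>{0..}\<close>; values at negative times are irrelevant.\<close>
definition fbm :: "'a measure \<Rightarrow> real \<Rightarrow> (real \<Rightarrow> 'a \<Rightarrow> real) \<Rightarrow> bool" where
  "fbm M \<beta> Y \<longleftrightarrow>
     (\<forall>F c. finite F \<longrightarrow> F \<subseteq> {0..} \<longrightarrow> centered_gaussian M (\<lambda>\<omega>. \<Sum>t\<in>F. c t * Y t \<omega>)) \<and>
     (\<forall>t\<^sub>1\<ge>0. \<forall>t\<^sub>2\<ge>0. (LINT \<omega>|M. Y t\<^sub>1 \<omega> * Y t\<^sub>2 \<omega>) =
        (t\<^sub>1 powr (2 * \<beta>) + t\<^sub>2 powr (2 * \<beta>) - \<bar>t\<^sub>1 - t\<^sub>2\<bar> powr (2 * \<beta>)) / 2)"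

text \<open>Enumerates \<open>B\<^sub>0\<close>, \<open>\<surd>2 Re B\<^sub>n\<close> and \<open>\<surd>2 Im B\<^sub>n\<close> (\<open>n \<ge> 1\<close>) by the indices \<open>0\<close>, \<open>n\<close> and \<open>-n\<close>.\<close>
definition noise_component ::
  "(int \<Rightarrow> real \<Rightarrow> 'a \<Rightarrow> complex) \<Rightarrow> int \<Rightarrow> real \<Rightarrow> 'a \<Rightarrow> real" where
  "noise_component B k t \<omega> =
     (if k = 0 then Re (B 0 t \<omega>)
      else if 0 < k then sqrt 2 * Re (B k t \<omega>)
      else sqrt 2 * Im (B (- k) t \<omega>))"

text \<open>Independence is that of the components as whole processes. The case \<open>n = 0\<close> of the
  conjugation constraint makes \<open>B\<^sub>0\<close> real.\<close>
definition fbm_noise :: "'a measure \<Rightarrow> real \<Rightarrow> (int \<Rightarrow> real \<Rightarrow> 'a \<Rightarrow> complex) \<Rightarrow> bool" where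
  "fbm_noise M \<beta> B \<longleftrightarrow>
     (\<forall>n. \<forall>t\<ge>0. \<forall>\<omega>\<in>space M. B (- n) t \<omega> = cnj (B n t \<omega>)) \<and>
     (\<forall>k. fbm M \<beta> (noise_component B k)) \<and>
     prob_space.indep_vars M (\<lambda>_. PiM {0..} (\<lambda>_. borel))
       (\<lambda>k \<omega>. \<lambda>t\<in>{0..}. noise_component B k t \<omega>) UNIV"


section \<open>Wiener integrals\<close>

text \<open>A list of triples \<open>(c, a, b)\<close> stands for the step function \<open>\<Sum> c 1\<^bsub>(a,b]\<^esub>\<close>.\<close>

definition step_fun :: "(real \<times> real \<times> real) list \<Rightarrow> real \<Rightarrow> real" where
  "step_fun xs x = (\<Sum>(c, a, b)\<leftarrow>xs. c * indicator {a<..b} x)"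

definition step_integral ::
  "(real \<Rightarrow> 'a \<Rightarrow> real) \<Rightarrow> (real \<times> real \<times> real) list \<Rightarrow> 'a \<Rightarrow> real" where
  "step_integral Y xs \<omega> = (\<Sum>(c, a, b)\<leftarrow>xs. c * (Y b \<omega> - Y a \<omega>))"

text \<open>The squared norm of the integrand space of fractional Brownian motion with Hurst parameter
  \<open>\<beta> > 1/2\<close>, on \<open>[r,t]\<close>. The absolute values (which give the customary space \<open>|\<H>|\<close>) make it
  dominate the variance of the integral.\<close>
definition integrand_norm2 :: "real \<Rightarrow> real \<Rightarrow> real \<Rightarrow> (real \<Rightarrow> real) \<Rightarrow> ennreal" where
  "integrand_norm2 \<beta> r t f =
     (\<integral>\<^sup>+x\<in>{r..t}. (\<integral>\<^sup>+y\<in>{r..t}.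
        ennreal (\<beta> * (2 * \<beta> - 1) * \<bar>f x\<bar> * \<bar>f y\<bar> * \<bar>x - y\<bar> powr (2 * \<beta> - 2)) \<partial>lborel) \<partial>lborel)"

text \<open>\<open>I\<close> is (a version of) the Wiener integral \<open>\<integral>\<^sub>r\<^sup>t f dY\<close>: the extension, by continuity into
  \<open>L\<^sup>2(M)\<close>, of the elementary integral of step functions.\<close>
definition wiener_integral ::
  "'a measure \<Rightarrow> real \<Rightarrow> (real \<Rightarrow> 'a \<Rightarrow> real) \<Rightarrow> real \<Rightarrow> real \<Rightarrow> (real \<Rightarrow> real) \<Rightarrow> ('a \<Rightarrow> real) \<Rightarrow> bool" where
  "wiener_integral M \<beta> Y r t f I \<longleftrightarrow> I \<in> borel_measurable M \<and>
     (\<exists>xs :: nat \<Rightarrow> (real \<times> real \<times> real) list.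
        (\<forall>k. \<forall>(c, a, b)\<in>set (xs k). r \<le> a \<and> a \<le> b \<and> b \<le> t) \<and>
        (\<lambda>k. integrand_norm2 \<beta> r t (\<lambda>x. f x - step_fun (xs k) x)) \<longlonglongrightarrow> 0 \<and>
        (\<lambda>k. \<integral>\<^sup>+\<omega>. ennreal ((step_integral Y (xs k) \<omega> - I \<omega>)\<^sup>2) \<partial>M) \<longlonglongrightarrow> 0)"

text \<open>Real integrand, complex process.\<close>
definition wiener_integral_complex ::
  "'a measure \<Rightarrow> real \<Rightarrow> (real \<Rightarrow> 'a \<Rightarrow> complex) \<Rightarrow> real \<Rightarrow> real \<Rightarrow> (real \<Rightarrow> real) \<Rightarrow> ('a \<Rightarrow> complex) \<Rightarrow> bool" where
  "wiener_integral_complex M \<beta> Z r t f I \<longleftrightarrow>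
     wiener_integral M \<beta> (\<lambda>x \<omega>. Re (Z x \<omega>)) r t f (\<lambda>\<omega>. Re (I \<omega>)) \<and>
     wiener_integral M \<beta> (\<lambda>x \<omega>. Im (Z x \<omega>)) r t f (\<lambda>\<omega>. Im (I \<omega>))"


section \<open>The first order driver\<close>

text \<open>\<open>X \<omega> t r\<close> is a version of the random operator \<open>X\<^sup>1\<^sub>t\<^sub>,\<^sub>r\<close> on \<open>H\<^sup>s\<close>: for every fixed pair \<open>t > r\<close>
  it almost surely equals, on all of \<open>H\<^sup>s\<close>, the operator given by the Fourier expansion. The
  \<open>I n\<^sub>1 n\<^sub>2\<close> are the Wiener integrals in that expansion (unique up to null sets).\<close>
definition driver_version ::
  "'a measure \<Rightarrow> real \<Rightarrow> (int \<Rightarrow> real \<Rightarrow> 'a \<Rightarrow> complex) \<Rightarrow> (int \<Rightarrow> complex) \<Rightarrow> real \<Rightarrow>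
   ('a \<Rightarrow> real \<Rightarrow> real \<Rightarrow> torus_fun \<Rightarrow> torus_fun) \<Rightarrow> bool" where
  "driver_version M \<beta> B \<phi> s X \<longleftrightarrow>
     (\<forall>t r. 0 \<le> r \<longrightarrow> r < t \<longrightarrow>
        (\<forall>f\<in>sobolev s. \<forall>n. (\<lambda>\<omega>. X \<omega> t r f n) \<in> borel_measurable M) \<and>
        (\<exists>I :: int \<Rightarrow> int \<Rightarrow> 'a \<Rightarrow> complex.
           (\<forall>n\<^sub>1 n\<^sub>2. wiener_integral_complex M \<beta> (B n\<^sub>1) r t
              (\<lambda>t'. exp (- (t - t') * (jap (n\<^sub>1 + n\<^sub>2))\<^sup>2) * exp (- (t' - r) * (jap n\<^sub>2)\<^sup>2))
              (I n\<^sub>1 n\<^sub>2)) \<and>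
           (AE \<omega> in M. \<forall>f\<in>sobolev s. \<forall>n.
              ((\<lambda>n\<^sub>2. f n\<^sub>2 * \<phi> (n - n\<^sub>2) * I (n - n\<^sub>2) n\<^sub>2 \<omega>) has_sum X \<omega> t r f n) UNIV)))"


section \<open>The convolution Young integral and well-posedness\<close>

text \<open>Decreasing partitions \<open>0 = p\<^sub>N < \<dots> < p\<^sub>0 = t\<close>; for \<open>t = 0\<close> only \<open>N = 0\<close> is possible.\<close>
definition is_partition :: "real \<Rightarrow> nat \<Rightarrow> (nat \<Rightarrow> real) \<Rightarrow> bool" where
  "is_partition t N p \<longleftrightarrow> p 0 = t \<and> p N = 0 \<and> (\<forall>j<N. p (Suc j) < p j)"

definition young_sum ::
  "(real \<Rightarrow> real \<Rightarrow> torus_fun \<Rightarrow> torus_fun) \<Rightarrow> (real \<Rightarrow> torus_fun) \<Rightarrow> real \<Rightarrow>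
   nat \<Rightarrow> (nat \<Rightarrow> real) \<Rightarrow> torus_fun" where
  "young_sum X u t N p =
     (\<lambda>n. \<Sum>j<N. heat (t - p j) (X (p j) (p (Suc j)) (u (p (Suc j)))) n)"

text \<open>\<open>J\<close> is the limit in \<open>H\<^sup>s\<close> of the sums over partitions of \<open>[0,t]\<close> as the mesh tends to \<open>0\<close>.\<close>
definition has_young_integral ::
  "real \<Rightarrow> (real \<Rightarrow> real \<Rightarrow> torus_fun \<Rightarrow> torus_fun) \<Rightarrow> (real \<Rightarrow> torus_fun) \<Rightarrow> real \<Rightarrow> torus_fun \<Rightarrow> bool" where
  "has_young_integral s X u t J \<longleftrightarrow> J \<in> sobolev s \<and>
     (\<forall>\<epsilon>>0. \<exists>\<delta>>0. \<forall>N p. is_partition t N p \<longrightarrow> (\<forall>j<N. p j - p (Suc j) < \<delta>) \<longrightarrow>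
        young_sum X u t N p \<in> sobolev s \<and> sobolev_norm s (young_sum X u t N p - J) < \<epsilon>)"

definition mild_solution ::
  "real \<Rightarrow> real \<Rightarrow> real \<Rightarrow> (real \<Rightarrow> real \<Rightarrow> torus_fun \<Rightarrow> torus_fun) \<Rightarrow> torus_fun \<Rightarrow>
   (real \<Rightarrow> torus_fun) \<Rightarrow> bool" where
  "mild_solution s \<alpha> T X u\<^sub>0 u \<longleftrightarrow> u \<in> hat_C s \<alpha> T \<and>
     (\<forall>t\<in>{0..T}. \<exists>J. has_young_integral s X u t J \<and> u t = (\<lambda>n. heat t u\<^sub>0 n + J n))"

text \<open>\<open>extensional\<close> makes \<open>u\<close> a function on \<open>[0,\<infinity>)\<close>, so that uniqueness is literal.\<close>
definition global_solution ::
  "real \<Rightarrow> real \<Rightarrow> (real \<Rightarrow> real \<Rightarrow> torus_fun \<Rightarrow> torus_fun) \<Rightarrow> torus_fun \<Rightarrow>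
   (real \<Rightarrow> torus_fun) \<Rightarrow> bool" where
  "global_solution s \<alpha> X u\<^sub>0 u \<longleftrightarrow>
     u \<in> extensional {0..} \<and> (\<forall>T>0. mild_solution s \<alpha> T X u\<^sub>0 u)"

definition solution_map ::
  "real \<Rightarrow> real \<Rightarrow> (real \<Rightarrow> real \<Rightarrow> torus_fun \<Rightarrow> torus_fun) \<Rightarrow> torus_fun \<Rightarrow> real \<Rightarrow> torus_fun" where
  "solution_map s \<alpha> X u\<^sub>0 = (THE u. global_solution s \<alpha> X u\<^sub>0 u)"

definition continuous_path :: "real \<Rightarrow> real \<Rightarrow> (real \<Rightarrow> torus_fun) \<Rightarrow> bool" where
  "continuous_path s T u \<longleftrightarrow>
     (\<forall>t\<in>{0..T}. u t \<in> sobolev s) \<and>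
     (\<forall>t\<in>{0..T}. ((\<lambda>t'. sobolev_norm s (u t' - u t)) \<longlongrightarrow> 0) (at t within {0..T}))"

text \<open>Continuity of \<open>F\<close> from \<open>H\<^sup>s\<close> to \<open>C([0,T]; H\<^sup>s)\<close> with the uniform norm.\<close>
definition continuous_into_paths ::
  "real \<Rightarrow> real \<Rightarrow> (torus_fun \<Rightarrow> real \<Rightarrow> torus_fun) \<Rightarrow> bool" where
  "continuous_into_paths s T F \<longleftrightarrow>
     (\<forall>u\<^sub>0\<in>sobolev s. continuous_path s T (F u\<^sub>0)) \<and>
     (\<forall>u\<^sub>0\<in>sobolev s. \<forall>\<epsilon>>0. \<exists>\<delta>>0. \<forall>v\<^sub>0\<in>sobolev s. sobolev_norm s (v\<^sub>0 - u\<^sub>0) < \<delta> \<longrightarrow>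
        (\<forall>t\<in>{0..T}. sobolev_norm s (F v\<^sub>0 t - F u\<^sub>0 t) < \<epsilon>))"

definition well_posed ::
  "real \<Rightarrow> real \<Rightarrow> (real \<Rightarrow> real \<Rightarrow> torus_fun \<Rightarrow> torus_fun) \<Rightarrow> bool" where
  "well_posed s \<alpha> X \<longleftrightarrow>
     (\<forall>u\<^sub>0\<in>sobolev s.
        (\<exists>!u. global_solution s \<alpha> X u\<^sub>0 u) \<and>
        (\<forall>T>0. \<forall>u v. mild_solution s \<alpha> T X u\<^sub>0 u \<longrightarrow> mild_solution s \<alpha> T X u\<^sub>0 v \<longrightarrow>
           (\<forall>t\<in>{0..T}. u t = v t))) \<and>
     (\<forall>T>0. continuous_into_paths s T (solution_map s \<alpha> X))"

definition pathwise_globally_well_posed ::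
  "'a measure \<Rightarrow> real \<Rightarrow> (int \<Rightarrow> real \<Rightarrow> 'a \<Rightarrow> complex) \<Rightarrow> (int \<Rightarrow> complex) \<Rightarrow> real \<Rightarrow> bool" where
  "pathwise_globally_well_posed M \<beta> B \<phi> s \<longleftrightarrow>
     (\<exists>\<alpha> \<gamma> X \<Sigma>. 1 / 2 < \<alpha> \<and> \<alpha> < \<gamma> \<and> \<gamma> < 1 \<and>
        driver_version M \<beta> B \<phi> s X \<and>
        \<Sigma> \<in> sets M \<and> measure M \<Sigma> = 1 \<and>
        (\<forall>\<omega>\<in>\<Sigma>. (\<forall>T>0. C2 (bounded_ops s) (op_norm s) \<gamma> T (X \<omega>)) \<and> well_posed s \<alpha> (X \<omega>)))"

end

theory Submission
  imports Defs
begin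

text \<open>The driver of the equation is a matrix in Fourier space. Its entry from frequency \<open>m\<close> to frequency
\<open>n\<close> is \<open>\<phi>\<^sub>k\<close>, with \<open>k = n - m\<close>, times the Wiener integral of
\<open>exp (-(t - \<tau>) \<langle>n\<rangle>\<^sup>2) exp (-(\<tau> - r) \<langle>m\<rangle>\<^sup>2)\<close> against the fractional Brownian motion \<open>B\<^sub>k\<close>. The
theorem separates into a deterministic part, valid path by path, and a probabilistic part which bounds
this matrix almost surely.

For the deterministic part, let \<open>S\<close> be a contraction semigroup on a Banach space and \<open>X\<close> a family of bounded
operators of size \<open>(t - r)\<^sup>\<gamma>\<close> with Chen's relation
\<open>X\<^sub>t\<^sub>r = X\<^sub>t\<^sub>q S\<^sub>q\<^sub>-\<^sub>r + S\<^sub>t\<^sub>-\<^sub>q X\<^sub>q\<^sub>r\<close>. For a fixed terminal time \<open>t\<close> the germ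
\<open>G(a,b) = S\<^sub>t\<^sub>-\<^sub>b X\<^sub>b\<^sub>a u\<^sub>a\<close> fails to be additive only by
\<open>S\<^sub>t\<^sub>-\<^sub>c X\<^sub>c\<^sub>b\<close> applied to the increment \<open>u\<^sub>b - S\<^sub>b\<^sub>-\<^sub>a u\<^sub>a\<close>, which has order \<open>\<gamma> + \<alpha> > 1\<close> in
the time step. The sewing lemma (\<open>sewing\<close>) therefore produces the Young integral together with an estimate of
its increments. In norms weighted by \<open>exp (\<mu> t)\<close> the integral gains a factor \<open>\<mu>\<^bsup>\<alpha>-\<gamma>\<^esup>\<close>, so for
large \<open>\<mu>\<close> the solution map is a contraction on all of \<open>[0,T]\<close> at once (\<open>young_bnd\<close>, \<open>contraction\<close>). A
Picard series gives existence (\<open>solution_exists\<close>), and the same estimate applied to a difference of two solutions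
gives uniqueness and Lipschitz dependence on the initial value (\<open>solution_gap\<close>). Since \<open>H\<^sup>s\<close> is isometric
to the sequence space \<open>\<ell>\<^sup>2\<close>, a matrix with the right operator bounds yields well-posedness (the locale
\<open>driver_path\<close>).

To bound the driver, note that a Wiener integral of a smooth function is defined path by path after an integration by
parts. Split the matrix into shells \<open>max |n| |m| \<sim> 2\<^sup>j\<close>, each a union of two rectangles: the output
frequency \<open>n\<close> or the input frequency \<open>m\<close> is comparable to \<open>2\<^sup>j\<close>. In the first case the integration by parts
is centred at \<open>t\<close>, in the second at \<open>r\<close>, so that the heat factor of the large frequency damps exactly where
the increment of the noise is not small. A noise of Hoelder regularity \<open>\<beta>'\<close> then gives a block of size
\<open>(t - r)\<^sup>\<gamma> 4\<^bsup>-j(\<beta>'-\<gamma>)\<^esup>\<close> times the Hoelder constant of the Toeplitz blocks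
\<open>(\<phi>\<^sub>n\<^sub>-\<^sub>m B\<^sub>n\<^sub>-\<^sub>m)\<close>, \<open>|n|, |m| \<le> 2\<^sup>j\<close> (\<open>block_bound_kern_output\<close>, \<open>block_bound_kern_input\<close>). If these
constants grow like \<open>2\<^bsup>\<kappa>j\<^esup>\<close>, the weights of \<open>H\<^sup>s\<close> cost another \<open>2\<^bsup>sj\<^esup>\<close>, and the sum over
shells converges as soon as \<open>\<kappa> + s < 2 (\<beta>' - \<gamma>)\<close> (\<open>level_bound\<close>).

It remains to control these Hoelder constants. The Toeplitz blocks are multiplication operators, and their norm is at most the maximum
of a random trigonometric polynomial over \<open>4 \<sdot> 2\<^sup>j + 1\<close> grid points (\<open>toeplitz_grid_bound\<close>). At each grid point the
polynomial is Gaussian with variance governed by \<open>\<Sum> |\<phi>\<^sub>k|\<^sup>2\<close>, which the Hilbert-Schmidt hypothesis bounds by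
\<open>2\<^bsup>2j max(0,-\<sigma>)\<^esup>\<close>. High moments, as in Kolmogorov's continuity theorem, make the maximum
over grid points and the passage to a Hoelder norm cost only arbitrarily small powers of \<open>2\<^sup>j\<close>
(\<open>R_finite_AE\<close>, \<open>good_noise_path\<close>). Adding up absolute values of the Fourier modes instead would lose
\<open>2\<^bsup>j/2\<^esup>\<close>; the independence of the modes is what is used here. Thus \<open>\<kappa>\<close> may be any number above
\<open>max 0 (-\<sigma>)\<close>, \<open>\<beta>'\<close> any number below \<open>\<beta>\<close> and \<open>\<gamma>\<close> any number above \<open>1/2\<close>, and
\<open>\<kappa> + s < 2 (\<beta>' - \<gamma>)\<close> can be met with some \<open>s > 0\<close> precisely because \<open>max 0 (-\<sigma>) < 2 \<beta> - 1\<close>.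

That the matrix obtained from a continuous modification of the noise really consists of Wiener integrals
follows since Riemann sums converge to the integrated-by-parts expression both pathwise and in \<open>L\<^sup>2\<close>
(\<open>wint_wiener\<close>, \<open>driver_is_version\<close>).\<close>

section \<open>The sewing lemma\<close>

definition sewing_const :: "real \<Rightarrow> real" where
  "sewing_const \<theta> = 2 * 4 powr \<theta> + 7 * 2 powr (\<theta> - 1) / (1 - 2 powr (1 - \<theta>))"

lemma sewing_const_nonneg: "\<theta> > 1 \<Longrightarrow> sewing_const \<theta> \<ge> 0"
proof -
  assume "\<theta> > 1"
  then have "2 powr (1 - \<theta>) \<le> (2::real) powr 0" by (intro powr_mono) auto
  then show ?thesis unfolding sewing_const_def by auto
qed

lemma sum_even_odd: "(\<Sum>k<2 * m. g k) = (\<Sum>k<m. g (2 * k) + g (2 * k + 1 :: nat) :: 'b::comm_monoid_add)"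
  by (induction m) (auto simp: algebra_simps)

text \<open>The usual proof refines partitions of each interval \<open>[a,b]\<close> separately. Here one family of dyadic grids of
\<open>[0,T]\<close> serves all intervals: summing \<open>G\<close> over the cells of generation \<open>n\<close> to the left of \<open>x\<close>, plus the
incomplete last cell, gives functions \<open>J n\<close> of a single variable whose limit \<open>I\<close> has exactly additive increments. Passing
from generation \<open>n\<close> to \<open>n + 1\<close> changes \<open>J\<close> by one defect per cell, so on \<open>[y,x]\<close> it changes the increment
by about \<open>(x - y) / h\<close> defects of size \<open>K h\<^sup>\<theta>\<close>, \<open>h = T / 2\<^sup>n\<close>, which is summable as \<open>\<theta> > 1\<close>. For the
comparison with \<open>G y x\<close> the sum is started at the generation where \<open>h\<close> is comparable to \<open>x - y\<close>.\<close>
lemma sewing: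
  fixes G :: "real \<Rightarrow> real \<Rightarrow> 'b::banach"
  assumes T: "T > 0" and \<theta>: "\<theta> > 1" and K: "K \<ge> 0"
    and defect: "\<And>a b c. 0 \<le> a \<Longrightarrow> a \<le> b \<Longrightarrow> b \<le> c \<Longrightarrow> c \<le> T \<Longrightarrow>
      norm (G a c - G a b - G b c) \<le> K * (c - a) powr \<theta>"
  shows "\<exists>I. \<forall>a b. 0 \<le> a \<longrightarrow> a \<le> b \<longrightarrow> b \<le> T \<longrightarrow>
      norm (I b - I a - G a b) \<le> sewing_const \<theta> * K * (b - a) powr \<theta>"
proof -
  define h where "h n = T / 2 ^ n" for n :: nat
  define m where "m n x = nat \<lfloor>x / h n\<rfloor>" for n x
  define d where "d a b c = G a c - G a b - G b c" for a b c
  define J where "J n x = (\<Sum>k<m n x. G (k * h n) (Suc k * h n)) + G (m n x * h n) x" for n x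
  define D where "D n x = J (Suc n) x - J n x" for n x
  define q where "q = (2::real) powr (1 - \<theta>)"
  have h0: "h n > 0" for n using T by (simp add: h_def)
  have hS: "h n = 2 * h (Suc n)" for n by (simp add: h_def)
  have hanti: "h (n + i) = h n / 2 ^ i" for n i by (simp add: h_def power_add)
  have q: "0 < q" "q < 1"
  proof -
    have "2 powr (1 - \<theta>) < (2::real) powr 0" using \<theta> by (intro powr_less_mono) auto
    then show "q < 1" by (simp add: q_def)
  qed (simp add: q_def)
  have dd: "norm (d a b c) \<le> K * r powr \<theta>" if "0 \<le> a" "a \<le> b" "b \<le> c" "c \<le> T" "c - a \<le> r" for a b c r
  proof -
    have "norm (d a b c) \<le> K * (c - a) powr \<theta>" using defect that by (simp add: d_def)
    also have "\<dots> \<le> K * r powr \<theta>" using that \<theta> K by (intro mult_left_mono powr_mono2) auto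
    finally show ?thesis .
  qed
  have G0: "G a a = 0" if "0 \<le> a" "a \<le> T" for a
    using dd[of a a a 0] that \<theta> by (simp add: d_def)
  have m_le: "real (m n x) * h n \<le> x" and m_gt: "x < (real (m n x) + 1) * h n"
    if "0 \<le> x" for n x
  proof -
    have "0 \<le> x / h n" using that h0[of n] by simp
    then have "real (m n x) = of_int \<lfloor>x / h n\<rfloor>" unfolding m_def by simp
    then have "real (m n x) \<le> x / h n" "x / h n < real (m n x) + 1" by linarith+
    then show "real (m n x) * h n \<le> x" "x < (real (m n x) + 1) * h n"
      using h0[of n] by (simp_all add: pos_le_divide_eq pos_divide_less_eq)
  qed
  have m_unique: "m n x = k" if "0 \<le> x" "real k * h n \<le> x" "x < (real k + 1) * h n" for n x k
  proof -
    have "real k \<le> x / h n" "x / h n < real k + 1" using that h0[of n] 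
      by (simp_all add: pos_le_divide_eq pos_divide_less_eq)
    then have "\<lfloor>x / h n\<rfloor> = int k" by linarith
    then show ?thesis by (simp add: m_def)
  qed
  have m_mono: "m n y \<le> m n x" if "0 \<le> y" "y \<le> x" for n x y
    unfolding m_def using that h0[of n] by (intro nat_mono floor_mono divide_right_mono) auto
  define e where "e n k = d (real k * h n) (real (2 * k + 1) * h (Suc n)) (real (Suc k) * h n)" for n k
  \<comment> \<open>\<open>e n k\<close> is the defect of a full cell, \<open>\<rho> n x\<close> that of the cell containing \<open>x\<close>, present only if \<open>x\<close> lies in its right half\<close>
  define \<rho> where "\<rho> n x = (if m (Suc n) x = 2 * m n x then 0 
     else d (real (m n x) * h n) (real (2 * m n x + 1) * h (Suc n)) x)" for n x
  have Deq: "D n x = - (\<Sum>k<m n x. e n k) - \<rho> n x" and \<rho>b: "norm (\<rho> n x) \<le> K * h n powr \<theta>"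
    if x: "0 \<le> x" "x \<le> T" for n x
  proof -
    let ?m = "m n x"
    have c: "m (Suc n) x = 2 * ?m \<or> m (Suc n) x = 2 * ?m + 1"
    proof (cases "x < (2 * real ?m + 1) * h (Suc n)")
      case True
      have "m (Suc n) x = 2 * ?m"
        by (rule m_unique) (use x True m_le[of x n] in \<open>auto simp: hS[of n]\<close>)
      then show ?thesis by simp
    next
      case False
      have "m (Suc n) x = 2 * ?m + 1"
        by (rule m_unique) (use x False m_gt[of x n] in \<open>auto simp: hS[of n] algebra_simps\<close>)
      then show ?thesis by simp
    qed
    have S: "(\<Sum>k<2 * ?m. G (k * h (Suc n)) (Suc k * h (Suc n))) 
       = (\<Sum>k<?m. G (k * h n) (Suc k * h n)) - (\<Sum>k<?m. e n k)"
      unfolding sum_even_odd sum_subtractf[symmetric]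
      by (rule sum.cong) (auto simp: e_def d_def hS[of n] algebra_simps)
    show "D n x = - (\<Sum>k<m n x. e n k) - \<rho> n x"
    proof (cases "m (Suc n) x = 2 * ?m")
      case True
      then have "\<rho> n x = 0" by (simp add: \<rho>_def)
      then show ?thesis unfolding D_def J_def True S by (simp add: hS[of n] algebra_simps)
    next
      case False
      then have F: "m (Suc n) x = Suc (2 * ?m)" using c by simp
      have "J (Suc n) x = (\<Sum>k<?m. G (k * h n) (Suc k * h n)) - (\<Sum>k<?m. e n k) +
         G (real (2 * ?m) * h (Suc n)) (real (Suc (2 * ?m)) * h (Suc n)) + G (real (Suc (2 * ?m)) * h (Suc n)) x"
        unfolding J_def F sum.lessThan_Suc S by simp
      moreover have "real (2 * ?m) * h (Suc n) = ?m * h n" by (simp add: hS[of n])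
      moreover have "\<rho> n x = d (real ?m * h n) (real (Suc (2 * ?m)) * h (Suc n)) x"
        using False by (simp add: \<rho>_def)
      ultimately show ?thesis unfolding D_def J_def[of n] d_def
        by (simp only: minus_diff_eq diff_diff_eq2) (simp only: algebra_simps add_minus_cancel)
    qed
    show "norm (\<rho> n x) \<le> K * h n powr \<theta>"
    proof (cases "m (Suc n) x = 2 * ?m")
      case True
      then show ?thesis using K h0[of n] by (simp add: \<rho>_def)
    next
      case False
      then have F: "m (Suc n) x = Suc (2 * ?m)" using c by simp
      have "real (2 * ?m + 1) * h (Suc n) \<le> x" using m_le[of x "Suc n"] x F by simp
      moreover have "x - real ?m * h n \<le> h n" using m_gt[of x n] x by (simp add: algebra_simps)
      ultimately show ?thesis using False x h0 unfolding \<rho>_def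
        apply (simp only: if_False)
        apply (rule dd)
        using h0[of "Suc n"] by (auto simp: hS[of n] algebra_simps)
    qed
  qed
  have eb: "norm (e n k) \<le> K * h n powr \<theta>" if "real (Suc k) * h n \<le> T" for n k
    unfolding e_def by (rule dd) (use that h0[of n] in \<open>auto simp: hS[of n] algebra_simps\<close>)
  have DD: "norm (D n x - D n y) \<le> K * h n powr \<theta> * ((x - y) / h n + 3)"
    if y: "0 \<le> y" "y \<le> x" "x \<le> T" for n x y
  proof -
    have mm: "m n y \<le> m n x" using m_mono y by simp
    have "(\<Sum>k<m n x. e n k) = (\<Sum>k<m n y. e n k) + (\<Sum>k=m n y..<m n x. e n k)"
      using sum.atLeastLessThan_concat[of 0 "m n y" "m n x" "e n"] mm by (simp add: lessThan_atLeast0)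
    then have eq: "D n x - D n y = - (\<Sum>k=m n y..<m n x. e n k) - \<rho> n x + \<rho> n y"
      using Deq[of x n] Deq[of y n] y by simp
    have "norm (\<Sum>k=m n y..<m n x. e n k) \<le> (\<Sum>k=m n y..<m n x. K * h n powr \<theta>)"
    proof (rule sum_norm_le)
      fix k assume k: "k \<in> {m n y..<m n x}"
      have "real (Suc k) * h n \<le> real (m n x) * h n" using k h0[of n] by (intro mult_right_mono) auto
      also have "\<dots> \<le> T" using m_le[of x n] y by linarith
      finally show "norm (e n k) \<le> K * h n powr \<theta>" by (rule eb)
    qed
    also have "\<dots> = K * h n powr \<theta> * (real (m n x) - real (m n y))" using mm by (simp add: of_nat_diff)
    finally have s: "norm (\<Sum>k=m n y..<m n x. e n k) \<le> K * h n powr \<theta> * (real (m n x) - real (m n y))" .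
    have "norm (D n x - D n y) \<le> norm (\<Sum>k=m n y..<m n x. e n k) + norm (\<rho> n x) + norm (\<rho> n y)"
      unfolding eq using norm_triangle_ineq[of "- (\<Sum>k=m n y..<m n x. e n k) - \<rho> n x" "\<rho> n y"]
        norm_triangle_ineq4[of "- (\<Sum>k=m n y..<m n x. e n k)" "\<rho> n x"] by (simp only: norm_minus_cancel) 
    also have "\<dots> \<le> K * h n powr \<theta> * (real (m n x) - real (m n y)) + K * h n powr \<theta> + K * h n powr \<theta>"
      using s \<rho>b[of x n] \<rho>b[of y n] y by linarith
    also have "\<dots> = K * h n powr \<theta> * (real (m n x) - real (m n y) + 2)" by (simp add: algebra_simps)
    also have "\<dots> \<le> K * h n powr \<theta> * ((x - y) / h n + 3)"
    proof (rule mult_left_mono)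
      have "real (m n x) * h n - (real (m n y) + 1) * h n \<le> x - y" 
        using m_le[of x n] m_gt[of y n] y by linarith
      then have "(real (m n x) - real (m n y) - 1) * h n \<le> x - y" by (simp add: algebra_simps)
      then have "(real (m n x) - real (m n y) - 1) \<le> (x - y) / h n" using h0[of n] by (simp add: pos_le_divide_eq)
      then show "real (m n x) - real (m n y) + 2 \<le> (x - y) / h n + 3" by simp
    qed (use K in auto)
    finally show ?thesis .
  qed
  have hq: "h (N + i) powr (\<theta> - 1) = h N powr (\<theta> - 1) * q ^ i" for N i
  proof -
    have "q ^ i = (2 ^ i) powr (- (\<theta> - 1))"
      unfolding q_def by (induction i) (simp_all add: powr_mult)
    then have "q ^ i = inverse ((2 ^ i) powr (\<theta> - 1))" by (simp only: powr_minus)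
    then show ?thesis unfolding hanti using h0[of N] by (simp add: powr_divide) (simp only: divide_inverse)
  qed
  have hsplit: "h n powr \<theta> = h n powr (\<theta> - 1) * h n" for n
    using h0[of n] by (simp add: powr_diff)
  have DDb: "norm (D (N + i) x - D (N + i) y) \<le> 7 * K * (x - y) * h N powr (\<theta> - 1) * q ^ i"
    if y: "0 \<le> y" "y \<le> x" "x \<le> T" and N: "h N \<le> 2 * (x - y)" for N i x y
  proof -
    let ?n = "N + i"
    have "h ?n \<le> h N" using h0[of N] unfolding hanti by (simp add: divide_le_eq)
    then have "h ?n \<le> 2 * (x - y)" using N by simp
    then have "3 \<le> 6 * ((x - y) / h ?n)" using h0[of ?n] by (simp add: field_simps)
    then have "(x - y) / h ?n + 3 \<le> 7 * ((x - y) / h ?n)" by linarith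
    then have "K * h ?n powr \<theta> * ((x - y) / h ?n + 3) \<le> K * h ?n powr \<theta> * (7 * ((x - y) / h ?n))"
      using K by (intro mult_left_mono) auto
    also have "\<dots> = 7 * K * (x - y) * h ?n powr (\<theta> - 1)" unfolding hsplit using h0[of ?n] by simp
    finally show ?thesis using DD[OF y, of ?n] unfolding hq by (simp add: mult.assoc)
  qed
  have D0: "D n 0 = 0" for n
  proof -
    have "m n 0 = 0" for n by (simp add: m_def)
    then show ?thesis using T G0[of 0] by (simp add: D_def J_def)
  qed
  have Dsum: "summable (\<lambda>n. D n x)" if x: "0 \<le> x" "x \<le> T" for x
  proof (cases "x = 0")
    case True
    then show ?thesis by (simp add: D0)
  next
    case False
    then have "x > 0" using x by simp
    have "\<exists>N. T / (2 * x) < 2 ^ N" by (rule real_arch_pow) simp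
    then obtain N where N: "T / (2 * x) < 2 ^ N" ..
    then have "h N \<le> 2 * (x - 0)" using \<open>x > 0\<close> unfolding h_def by (simp add: field_simps)
    then have b: "norm (D (i + N) x) \<le> 7 * K * x * h N powr (\<theta> - 1) * q ^ i" for i
      using DDb[of 0 x N i] x by (simp add: D0 add.commute)
    have s: "summable (\<lambda>i. 7 * K * x * h N powr (\<theta> - 1) * q ^ i)"
      using q by (intro summable_mult summable_geometric) auto
    have "summable (\<lambda>i. D (i + N) x)" by (rule summable_comparison_test'[OF s b])
    then show ?thesis using summable_iff_shift[of "\<lambda>n. D n x" N] by blast
  qed
  define I where "I x = J 0 x + (\<Sum>n. D n x)" for x
  have Ieq: "I x = J N x + (\<Sum>i. D (N + i) x)" if x: "0 \<le> x" "x \<le> T" for N x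
  proof -
    have "(\<Sum>n<N. D n x) = J N x - J 0 x" unfolding D_def by (rule sum_lessThan_telescope)
    then show ?thesis unfolding I_def using suminf_split_initial_segment[OF Dsum[OF x], of N]
      by (simp add: add.commute)
  qed
  show ?thesis
  proof (rule exI[of _ I], intro allI impI)
    fix y x assume y: "0 \<le> y" "y \<le> x" and xT: "x \<le> T"
    show "norm (I x - I y - G y x) \<le> sewing_const \<theta> * K * (x - y) powr \<theta>"
    proof (cases "y = x")
      case True
      then show ?thesis using G0[of x] y xT by simp
    next
      case False
      then have xy: "x - y > 0" using y by simp
      have ex: "\<exists>N. h (Suc N) < x - y"
      proof -
        obtain N where N: "T / (x - y) < 2 ^ N" using real_arch_pow[of 2 "T / (x - y)"] by auto
        have "h (Suc N) < h N" using h0[of "Suc N"] hS[of N] by linarith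
        moreover have "h N < x - y" using N xy unfolding h_def by (simp add: field_simps)
        ultimately show ?thesis by (intro exI[of _ N]) simp
      qed
      \<comment> \<open>the first generation with \<open>x - y \<le> h N < 2 (x - y)\<close>: \<open>x\<close> and \<open>y\<close> lie in the same or in adjacent cells\<close>
      define N where "N = (LEAST N. h (Suc N) < x - y)"
      have N1: "h N < 2 * (x - y)" using LeastI_ex[OF ex] hS[of N] unfolding N_def by simp
      have N2: "x - y \<le> h N"
      proof (cases N)
        case 0
        then show ?thesis using y xT by (simp add: h_def)
      next
        case (Suc N')
        then show ?thesis using not_less_Least[of N' "\<lambda>N. h (Suc N) < x - y"] by (simp add: N_def[symmetric])
      qed
      have J: "norm (J N x - J N y - G y x) \<le> 2 * K * (2 * h N) powr \<theta>"
      proof -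
        let ?a = "real (m N y) * h N"
        have a: "0 \<le> ?a" "?a \<le> y" "y < ?a + h N" using m_le[of y N] m_gt[of y N] y h0[of N] by (auto simp: algebra_simps)
        have mm: "m N y \<le> m N x" using m_mono y by simp
        have "real (m N x) * h N < (real (m N y) + 2) * h N" using m_le[of x N] y a N2 by (simp add: algebra_simps)
        then have "real (m N x) < real (m N y) + 2" using h0[of N] by simp
        then have "m N x < m N y + 2" by linarith
        then consider "m N x = m N y" | "m N x = Suc (m N y)" using mm by linarith
        then show ?thesis
        proof cases
          case 1
          then have eq: "J N x - J N y - G y x = d ?a y x" by (simp add: J_def d_def)
          have "norm (d ?a y x) \<le> K * (2 * h N) powr \<theta>"
            by (rule dd) (use a y xT N2 in auto)
          moreover have "0 \<le> K * (2 * h N) powr \<theta>" using K by simp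
          ultimately show ?thesis unfolding mult.assoc eq by linarith
        next
          case 2
          let ?b = "real (Suc (m N y)) * h N"
          have b: "?b = ?a + h N" by (simp add: algebra_simps)
          have bx: "?b \<le> x" using m_le[of x N] y 2 by simp
          have eq: "J N x - J N y - G y x = d ?a y ?b - d y ?b x" unfolding J_def 2 by (simp add: d_def)
          have "norm (d ?a y ?b) \<le> K * (2 * h N) powr \<theta>"
            by (rule dd) (use a y xT N2 b bx h0[of N] in auto)
          moreover have "norm (d y ?b x) \<le> K * (2 * h N) powr \<theta>"
            by (rule dd) (use a y xT N2 b bx h0[of N] in auto)
          ultimately show ?thesis using norm_triangle_ineq4[of "d ?a y ?b" "d y ?b x"]
            unfolding mult.assoc eq by linarith
        qed
      qed
      let ?c = "7 * K * (x - y) * h N powr (\<theta> - 1)"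
      have sx: "summable (\<lambda>i. D (N + i) x)" "summable (\<lambda>i. D (N + i) y)"
        using Dsum[of x] Dsum[of y] y xT summable_iff_shift[of "\<lambda>n. D n x" N] summable_iff_shift[of "\<lambda>n. D n y" N] by (simp_all add: add.commute)
      have "norm (\<Sum>i. D (N + i) x - D (N + i) y) \<le> (\<Sum>i. ?c * q ^ i)"
        by (rule norm_suminf_le) (use DDb[OF y xT, of N] N1 q in \<open>auto intro!: summable_mult summable_geometric\<close>)
      also have "\<dots> = ?c / (1 - q)" using q by (simp add: suminf_mult suminf_geometric)
      finally have tail: "norm (\<Sum>i. D (N + i) x - D (N + i) y) \<le> ?c / (1 - q)" .
      have eq: "I x - I y - G y x = (J N x - J N y - G y x) + (\<Sum>i. D (N + i) x - D (N + i) y)"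
        using Ieq[of x N] Ieq[of y N] y xT suminf_diff[OF sx] by simp
      have "norm (I x - I y - G y x) \<le> 2 * K * (2 * h N) powr \<theta> + ?c / (1 - q)"
        unfolding eq using norm_triangle_ineq[of "J N x - J N y - G y x" "\<Sum>i. D (N + i) x - D (N + i) y"] J tail by linarith
      also have "\<dots> \<le> 2 * K * (4 * (x - y)) powr \<theta> + 7 * K * (x - y) * (2 * (x - y)) powr (\<theta> - 1) / (1 - q)"
      proof (rule add_mono)
        have "(2 * h N) powr \<theta> \<le> (4 * (x - y)) powr \<theta>" using N1 h0[of N] \<theta> by (intro powr_mono2) auto
        then show "2 * K * (2 * h N) powr \<theta> \<le> 2 * K * (4 * (x - y)) powr \<theta>"
          using K by (intro mult_mono) auto
        have "h N powr (\<theta> - 1) \<le> (2 * (x - y)) powr (\<theta> - 1)" using N1 h0[of N] \<theta> by (intro powr_mono2) auto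
        then show "?c / (1 - q) \<le> 7 * K * (x - y) * (2 * (x - y)) powr (\<theta> - 1) / (1 - q)"
          using K q xy by (intro divide_right_mono mult_left_mono) auto
      qed
      also have "\<dots> = sewing_const \<theta> * K * (x - y) powr \<theta>"
      proof -
        define z where "z = x - y"
        have "z * (2 * z) powr (\<theta> - 1) = 2 powr (\<theta> - 1) * z powr \<theta>"
          using xy powr_mult_base[of z "\<theta> - 1"] powr_mult[of 2 z "\<theta> - 1"] unfolding z_def[symmetric] by simp
        then have "7 * K * z * (2 * z) powr (\<theta> - 1) = 7 * K * (2 powr (\<theta> - 1) * z powr \<theta>)"
          by (simp add: mult.assoc)
        moreover have "(4 * z) powr \<theta> = 4 powr \<theta> * z powr \<theta>"
          using xy powr_mult[of 4 z \<theta>] unfolding z_def[symmetric] by simp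
        ultimately show ?thesis unfolding z_def[symmetric]
          by (simp add: sewing_const_def q_def[symmetric] distrib_right)
      qed
      finally show ?thesis .
    qed
  qed
qed

text \<open>After the substitution \<open>y = c x\<close> this is \<open>y\<^sup>p \<le> max 1 y \<le> exp y\<close>. It is the source of both small factors
of the proof: the power of the weight \<open>\<mu>\<close> in the contraction estimate and the power of the frequency
in the bounds on the driver.\<close>
lemma powr_exp_decay:
  fixes x c p :: real
  assumes "x \<ge> 0" "c > 0" "0 < p" "p \<le> 1"
  shows "x powr p * exp (- c * x) \<le> c powr - p"
proof (cases "x = 0")
  case False
  then have x: "x > 0" using assms by simp
  define y where "y = c * x"
  have y: "y > 0" using x assms by (simp add: y_def)
  have "y powr p \<le> max 1 y"
  proof (cases "y \<le> 1")
    case True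
    then have "y powr p \<le> 1 powr p" using y assms by (intro powr_mono2) auto
    then show ?thesis by simp
  next
    case False
    then have "y powr p \<le> y powr 1" using assms by (intro powr_mono) auto
    then show ?thesis using y by simp
  qed
  also have "\<dots> \<le> exp y" using exp_ge_add_one_self[of y] y by (intro max.boundedI) linarith+
  finally have "y powr p * exp (- y) \<le> 1" by (simp add: exp_minus field_simps)
  then have "c powr p * (x powr p * exp (- c * x)) \<le> 1"
    using x assms by (simp add: y_def powr_mult mult.assoc)
  then show ?thesis using assms by (simp add: powr_minus field_simps)
qed simp

section \<open>Riemann sums over partitions\<close>

lemma is_partition_range:
  assumes "is_partition t N p" "j \<le> N"
  shows "0 \<le> p j \<and> p j \<le> t"
proof -
  have step: "p (Suc i) < p i" if "i < N" for i using assms that by (simp add: is_partition_def)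
  have down: "i \<le> N \<Longrightarrow> p i \<le> p 0" for i
  proof (induction i)
    case (Suc i)
    then show ?case using step[of i] by simp
  qed simp
  have up: "i \<le> N \<Longrightarrow> p N \<le> p (N - i)" for i
  proof (induction i)
    case (Suc i)
    then have "p (Suc (N - Suc i)) < p (N - Suc i)" "Suc (N - Suc i) = N - i" using step[of "N - Suc i"] by auto
    then show ?case using Suc by simp
  qed simp
  show ?thesis using down[of j] up[of "N - j"] assms by (simp add: is_partition_def)
qed

text \<open>The increments of \<open>I\<close> telescope, so the errors \<open>C (b - a)\<^sup>\<theta> \<le> C (b - a) \<delta>\<^bsup>\<theta>-1\<^esup>\<close> of the cells add up to
\<open>C t \<delta>\<^bsup>\<theta>-1\<^esup>\<close>.\<close>
lemma partition_sum_estimate: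
  fixes G :: "real \<Rightarrow> real \<Rightarrow> 'b::real_normed_vector"
  assumes \<theta>: "\<theta> > 1" and C: "C \<ge> 0" and \<delta>: "\<delta> > 0"
    and I: "\<And>a b. 0 \<le> a \<Longrightarrow> a \<le> b \<Longrightarrow> b \<le> t \<Longrightarrow> norm (I b - I a - G a b) \<le> C * (b - a) powr \<theta>"
    and p: "is_partition t N p" and mesh: "\<And>j. j < N \<Longrightarrow> p j - p (Suc j) < \<delta>"
  shows "norm ((\<Sum>j<N. G (p (Suc j)) (p j)) - (I t - I 0)) \<le> C * t * \<delta> powr (\<theta> - 1)"
proof -
  have tel: "(\<Sum>j<n. f (p j) - f (p (Suc j))) = f (p 0) - f (p n)" for f :: "real \<Rightarrow> 'c::ab_group_add" and n
    by (induction n) auto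
  have "norm ((\<Sum>j<N. G (p (Suc j)) (p j)) - (I t - I 0))
      = norm (\<Sum>j<N. - (I (p j) - I (p (Suc j)) - G (p (Suc j)) (p j)))"
    using tel[of I N] p by (simp add: sum_subtractf is_partition_def sum_negf)
  also have "\<dots> \<le> (\<Sum>j<N. C * (p j - p (Suc j)) * \<delta> powr (\<theta> - 1))"
  proof (rule sum_norm_le)
    fix j assume "j \<in> {..<N}"
    then have j: "j < N" by simp
    have r: "0 \<le> p (Suc j)" "p j \<le> t" "p (Suc j) < p j"
      using is_partition_range[OF p, of "Suc j"] is_partition_range[OF p, of j] j p
      by (auto simp: is_partition_def)
    define z where "z = p j - p (Suc j)"
    have z: "z > 0" "z \<le> \<delta>" using r mesh[OF j] by (auto simp: z_def)
    have "z powr \<theta> = z * z powr (\<theta> - 1)" using z powr_mult_base[of z "\<theta> - 1"] by simp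
    also have "\<dots> \<le> z * \<delta> powr (\<theta> - 1)" using z \<theta> by (intro mult_left_mono powr_mono2) auto
    finally have "C * z powr \<theta> \<le> C * (z * \<delta> powr (\<theta> - 1))" using C by (intro mult_left_mono) auto
    moreover have "norm (I (p j) - I (p (Suc j)) - G (p (Suc j)) (p j)) \<le> C * z powr \<theta>"
      unfolding z_def using I r by simp
    ultimately show "norm (- (I (p j) - I (p (Suc j)) - G (p (Suc j)) (p j))) \<le> C * (p j - p (Suc j)) * \<delta> powr (\<theta> - 1)"
      unfolding z_def norm_minus_cancel by (simp add: mult.assoc)
  qed
  also have "\<dots> = C * t * \<delta> powr (\<theta> - 1)"
    using tel[of "\<lambda>x. x" N] p
    by (simp add: sum_distrib_right[symmetric] sum_distrib_left[symmetric] is_partition_def)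
  finally show ?thesis .
qed

section \<open>Contraction semigroups\<close>

locale contraction_semigroup =
  fixes S :: "real \<Rightarrow> 'b::banach \<Rightarrow> 'b"
  assumes S_linear: "0 \<le> t \<Longrightarrow> linear (S t)"
    and S_contraction: "0 \<le> t \<Longrightarrow> norm (S t x) \<le> norm x"
    and S_0: "S 0 x = x"
    and S_add: "0 \<le> a \<Longrightarrow> 0 \<le> b \<Longrightarrow> S (a + b) x = S a (S b x)"
    and S_strong: "((\<lambda>h. S h x) \<longlongrightarrow> x) (at_right 0)"
begin

text \<open>The mild increment of a path: its deviation from the free evolution between two times.\<close>
definition dlt :: "(real \<Rightarrow> 'b) \<Rightarrow> real \<Rightarrow> real \<Rightarrow> 'b" where
  "dlt u t r = u t - S (t - r) (u r)"

lemma S_blin: "0 \<le> t \<Longrightarrow> bounded_linear (S t)"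
  using S_linear[of t] S_contraction[of t]
  by (intro bounded_linear_intro[where K = 1]) (auto simp: linear_add linear_scale)

lemmas S_diff = linear_diff[OF S_linear]

text \<open>Contractivity removes the common factor \<open>S (min h h')\<close>; strong continuity at \<open>0\<close> thus becomes uniform on
\<open>[0,\<infinity>)\<close>.\<close>
lemma S_lipschitz_in_time:
  assumes "0 \<le> h" "0 \<le> h'"
  shows "norm (S h' x - S h x) \<le> norm (S \<bar>h' - h\<bar> x - x)"
proof -
  have *: "norm (S b x - S a x) \<le> norm (S (b - a) x - x)" if "0 \<le> a" "a \<le> b" for a b
  proof -
    have "S b x - S a x = S a (S (b - a) x - x)" using that S_add[of a "b - a" x] S_diff[of a] by simp
    then show ?thesis using S_contraction[of a] that by simp
  qed
  show ?thesis
    using *[of h h'] *[of h' h] assms by (cases "h \<le> h'") (auto simp: norm_minus_commute abs_if)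
qed

lemma S_uniform_small:
  assumes "\<epsilon> > 0"
  obtains \<eta> where "\<eta> > 0" "\<And>h h'. 0 \<le> h \<Longrightarrow> 0 \<le> h' \<Longrightarrow> \<bar>h' - h\<bar> < \<eta> \<Longrightarrow> norm (S h' x - S h x) < \<epsilon>"
proof -
  from S_strong[of x] assms have "\<forall>\<^sub>F h in at_right 0. dist (S h x) x < \<epsilon>" by (rule tendstoD)
  then obtain \<eta> where \<eta>: "\<eta> > 0" "\<And>h. 0 < h \<Longrightarrow> h < \<eta> \<Longrightarrow> dist (S h x) x < \<epsilon>"
    unfolding eventually_at_right_field by auto
  have "norm (S h' x - S h x) < \<epsilon>" if "0 \<le> h" "0 \<le> h'" "\<bar>h' - h\<bar> < \<eta>" for h h'
  proof (cases "h' = h")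
    case True
    then show ?thesis using assms by simp
  next
    case False
    then have "norm (S \<bar>h' - h\<bar> x - x) < \<epsilon>" using \<eta>(2)[of "\<bar>h' - h\<bar>"] that by (simp add: dist_norm)
    then show ?thesis using S_lipschitz_in_time[OF that(1,2), of x] by linarith
  qed
  with \<eta>(1) show thesis using that by blast
qed

text \<open>For times \<open>r\<close> near \<open>t\<close> a comparison with the earlier time \<open>q = max 0 (t - \<eta>)\<close> is needed, since strong continuity
of \<open>S\<close> can only be used at a fixed vector: \<open>u r - u t\<close> is a difference of two mild increments from \<open>q\<close>, both of size
\<open>\<eta>\<^sup>\<alpha>\<close>, plus \<open>(S (r - q) - S (t - q)) (u q)\<close>.\<close>
lemma holder_continuous:
  assumes \<alpha>: "\<alpha> > 0" and A: "A \<ge> 0"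
    and d: "\<And>r t. 0 \<le> r \<Longrightarrow> r \<le> t \<Longrightarrow> t \<le> T \<Longrightarrow> norm (dlt u t r) \<le> A * (t - r) powr \<alpha>"
    and t: "t \<in> {0..T}"
  shows "(u \<longlongrightarrow> u t) (at t within {0..T})"
proof (rule tendstoI)
  fix \<epsilon> :: real assume \<epsilon>: "\<epsilon> > 0"
  define \<eta> where "\<eta> = (\<epsilon> / (4 * (A + 1))) powr (1 / \<alpha>) / 2"
  have \<eta>: "\<eta> > 0" using \<epsilon> A by (simp add: \<eta>_def)
  have sm: "A * z powr \<alpha> < \<epsilon> / 3" if "0 \<le> z" "z \<le> 2 * \<eta>" for z
  proof -
    have "z powr \<alpha> \<le> (2 * \<eta>) powr \<alpha>" using that \<alpha> by (intro powr_mono2) auto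
    also have "\<dots> = \<epsilon> / (4 * (A + 1))" using \<alpha> \<epsilon> A by (simp add: \<eta>_def powr_powr)
    finally have "A * z powr \<alpha> \<le> A * (\<epsilon> / (4 * (A + 1)))" using A by (rule mult_left_mono)
    also have "\<dots> \<le> \<epsilon> / 4" using A \<epsilon> by (simp add: field_simps)
    also have "\<dots> < \<epsilon> / 3" using \<epsilon> by simp
    finally show ?thesis .
  qed
  define q where "q = max 0 (t - \<eta>)"
  obtain \<eta>' where \<eta>': "\<eta>' > 0" "\<And>h h'. 0 \<le> h \<Longrightarrow> 0 \<le> h' \<Longrightarrow> \<bar>h' - h\<bar> < \<eta>' \<Longrightarrow> norm (S h' (u q) - S h (u q)) < \<epsilon> / 3"
    using S_uniform_small[of "\<epsilon> / 3" "u q"] \<epsilon> by auto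
  have "dist (u r) (u t) < \<epsilon>" if r: "r \<in> {0..T}" "\<bar>r - t\<bar> < min \<eta> \<eta>'" for r
  proof -
    have q: "0 \<le> q" "q \<le> t" "q \<le> r" "t - q \<le> 2 * \<eta>" "r - q \<le> 2 * \<eta>" using r t \<eta> by (auto simp: q_def)
    have "u r - u t = dlt u r q - dlt u t q + (S (r - q) (u q) - S (t - q) (u q))"
      by (simp add: dlt_def)
    then have "norm (u r - u t) \<le> norm (dlt u r q) + norm (dlt u t q) + norm (S (r - q) (u q) - S (t - q) (u q))"
      by (metis (no_types, lifting) add_right_mono norm_triangle_ineq norm_triangle_ineq4 order_trans)
    moreover have "norm (dlt u r q) < \<epsilon> / 3" using d[of q r] sm[of "r - q"] q r t by auto
    moreover have "norm (dlt u t q) < \<epsilon> / 3" using d[of q t] sm[of "t - q"] q r t by auto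
    moreover have "norm (S (r - q) (u q) - S (t - q) (u q)) < \<epsilon> / 3" using \<eta>'(2)[of "t - q" "r - q"] q r by auto
    ultimately show ?thesis by (simp add: dist_norm)
  qed
  then show "\<forall>\<^sub>F r in at t within {0..T}. dist (u r) (u t) < \<epsilon>"
    unfolding eventually_at using \<eta> \<eta>' by (intro exI[of _ "min \<eta> \<eta>'"]) (auto simp: dist_real_def)
qed

lemma dlt_continuous:
  assumes "\<alpha> > 0" "A \<ge> 0"
    and "\<And>r t. 0 \<le> r \<Longrightarrow> r \<le> t \<Longrightarrow> t \<le> T \<Longrightarrow> norm (dlt u t r) \<le> A * (t - r) powr \<alpha>"
    and tr: "(t, r) \<in> simplex2 T"
  shows "((\<lambda>(t', r'). dlt u t' r') \<longlongrightarrow> dlt u t r) (at (t, r) within simplex2 T)"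
proof (rule tendstoI)
  fix \<epsilon> :: real assume \<epsilon>: "\<epsilon> > 0"
  have t: "t \<in> {0..T}" "r \<in> {0..T}" "r < t" using tr by (auto simp: simplex2_def)
  have cont: "\<exists>\<eta>>0. \<forall>x'\<in>{0..T}. \<bar>x' - x\<bar> < \<eta> \<longrightarrow> norm (u x' - u x) < \<epsilon> / 3" if "x \<in> {0..T}" for x
  proof -
    have "\<forall>\<^sub>F x' in at x within {0..T}. dist (u x') (u x) < \<epsilon> / 3"
      using holder_continuous[OF assms(1-3) that] \<epsilon> by (intro tendstoD) auto
    then obtain \<eta> where "\<eta> > 0" "\<forall>x'\<in>{0..T}. x' \<noteq> x \<and> dist x' x < \<eta> \<longrightarrow> dist (u x') (u x) < \<epsilon> / 3"
      unfolding eventually_at by auto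
    then show ?thesis using \<epsilon> by (intro exI[of _ \<eta>]) (metis dist_norm dist_real_def diff_self norm_zero divide_pos_pos zero_less_numeral)
  qed
  obtain \<eta>1 where 1: "\<eta>1 > 0" "\<And>x'. x'\<in>{0..T} \<Longrightarrow> \<bar>x' - t\<bar> < \<eta>1 \<Longrightarrow> norm (u x' - u t) < \<epsilon> / 3" using cont[OF t(1)] by blast
  obtain \<eta>2 where 2: "\<eta>2 > 0" "\<And>x'. x'\<in>{0..T} \<Longrightarrow> \<bar>x' - r\<bar> < \<eta>2 \<Longrightarrow> norm (u x' - u r) < \<epsilon> / 3" using cont[OF t(2)] by blast
  obtain \<eta>3 where 3: "\<eta>3 > 0" "\<And>h h'. 0 \<le> h \<Longrightarrow> 0 \<le> h' \<Longrightarrow> \<bar>h' - h\<bar> < \<eta>3 \<Longrightarrow> norm (S h' (u r) - S h (u r)) < \<epsilon> / 3"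
    using S_uniform_small[of "\<epsilon> / 3" "u r"] \<epsilon> by auto
  define \<eta> where "\<eta> = min \<eta>1 (min \<eta>2 (\<eta>3 / 2))"
  have \<eta>: "\<eta> > 0" using 1 2 3 by (simp add: \<eta>_def)
  have "dist (dlt u t' r') (dlt u t r) < \<epsilon>" if s: "(t', r') \<in> simplex2 T" and d: "dist (t', r') (t, r) < \<eta>" for t' r'
  proof -
    have s': "t' \<in> {0..T}" "r' \<in> {0..T}" "r' < t'" using s by (auto simp: simplex2_def)
    have d': "\<bar>t' - t\<bar> < \<eta>" "\<bar>r' - r\<bar> < \<eta>"
      using d dist_fst_le[of "(t', r')" "(t, r)"] dist_snd_le[of "(t', r')" "(t, r)"] by (auto simp: dist_real_def)
    have "dlt u t' r' - dlt u t r = (u t' - u t) - (S (t' - r') (u r' - u r)) - (S (t' - r') (u r) - S (t - r) (u r))"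
      using S_diff[of "t' - r'"] s' by (simp add: dlt_def)
    then have "norm (dlt u t' r' - dlt u t r) \<le> norm (u t' - u t) + norm (S (t' - r') (u r' - u r)) + norm (S (t' - r') (u r) - S (t - r) (u r))"
      by (metis (no_types, lifting) add_right_mono norm_triangle_ineq4 order_trans)
    moreover have "norm (u t' - u t) < \<epsilon> / 3" using 1(2)[of t'] s' d' by (simp add: \<eta>_def)
    moreover have "norm (S (t' - r') (u r' - u r)) < \<epsilon> / 3"
      using 2(2)[of r'] s' d' S_contraction[of "t' - r'" "u r' - u r"] by (simp add: \<eta>_def)
    moreover have "\<bar>(t' - r') - (t - r)\<bar> < \<eta>3" using d' unfolding \<eta>_def by linarith
    then have "norm (S (t' - r') (u r) - S (t - r) (u r)) < \<epsilon> / 3"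
      using 3(2)[of "t - r" "t' - r'"] s' t by simp
    ultimately show ?thesis by (simp add: dist_norm)
  qed
  then show "\<forall>\<^sub>F z in at (t, r) within simplex2 T. dist (case z of (t', r') \<Rightarrow> dlt u t' r') (dlt u t r) < \<epsilon>"
    unfolding eventually_at using \<eta> by (intro exI[of _ \<eta>]) auto
qed

end

section \<open>The linear Young equation\<close>

definition uniform_partition :: "real \<Rightarrow> nat \<Rightarrow> nat \<Rightarrow> real" where
  "uniform_partition t n j = t * (1 - real j / real n)"

lemma uniform_partition: "t > 0 \<Longrightarrow> n > 0 \<Longrightarrow> is_partition t n (uniform_partition t n)"
  by (auto simp: is_partition_def uniform_partition_def divide_strict_right_mono)

lemma uniform_partition_mesh:
  "uniform_partition t n j - uniform_partition t n (Suc j) = t / real n"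
  by (simp add: uniform_partition_def field_simps add_divide_distrib)

locale young_equation = contraction_semigroup S for S :: "real \<Rightarrow> 'b::banach \<Rightarrow> 'b" +
  fixes X :: "real \<Rightarrow> real \<Rightarrow> 'b \<Rightarrow> 'b" and K \<gamma> \<alpha> T :: real
  assumes T: "T > 0" and K: "K \<ge> 0" and \<alpha>: "1 / 2 < \<alpha>" and \<alpha>\<gamma>: "\<alpha> < \<gamma>" and \<gamma>: "\<gamma> < 1"
    and X_linear: "0 \<le> r \<Longrightarrow> r \<le> t \<Longrightarrow> t \<le> T \<Longrightarrow> linear (X t r)"
    and X_bound: "0 \<le> r \<Longrightarrow> r \<le> t \<Longrightarrow> t \<le> T \<Longrightarrow> norm (X t r x) \<le> K * (t - r) powr \<gamma> * norm x"
    and chen: "0 \<le> r \<Longrightarrow> r \<le> q \<Longrightarrow> q \<le> t \<Longrightarrow> t \<le> T \<Longrightarrow>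
      X t r x = X t q (S (q - r) x) + S (t - q) (X q r x)"
begin

text \<open>\<open>bnd \<mu> A u\<close>: the path \<open>u\<close> has norm at most \<open>A\<close> in the space of bounded paths with \<open>\<alpha>\<close>-Hoelder mild increments, in the
variant of that norm which is weighted by \<open>exp (\<mu> t)\<close> at the later time.\<close>
definition bnd :: "real \<Rightarrow> real \<Rightarrow> (real \<Rightarrow> 'b) \<Rightarrow> bool" where
  "bnd \<mu> A u \<longleftrightarrow> (\<forall>t\<in>{0..T}. norm (u t) \<le> A * exp (\<mu> * t)) \<and>
     (\<forall>r t. 0 \<le> r \<longrightarrow> r \<le> t \<longrightarrow> t \<le> T \<longrightarrow> norm (dlt u t r) \<le> A * exp (\<mu> * t) * (t - r) powr \<alpha>)"

text \<open>The contribution of \<open>[a,b]\<close> to the integral, transported to the terminal time \<open>t\<close>.\<close>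
definition inc :: "(real \<Rightarrow> 'b) \<Rightarrow> real \<Rightarrow> real \<Rightarrow> real \<Rightarrow> 'b" where
  "inc u t a b = S (t - b) (X b a (u a))"

definition psum :: "(real \<Rightarrow> 'b) \<Rightarrow> real \<Rightarrow> nat \<Rightarrow> (nat \<Rightarrow> real) \<Rightarrow> 'b" where
  "psum u t N p = (\<Sum>j<N. inc u t (p (Suc j)) (p j))"

definition young_at :: "(real \<Rightarrow> 'b) \<Rightarrow> real \<Rightarrow> 'b \<Rightarrow> bool" where
  "young_at u t J \<longleftrightarrow> (\<forall>\<epsilon>>0. \<exists>\<delta>>0. \<forall>N p. is_partition t N p \<longrightarrow>
     (\<forall>j<N. p j - p (Suc j) < \<delta>) \<longrightarrow> norm (psum u t N p - J) < \<epsilon>)"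

definition solves :: "'b \<Rightarrow> (real \<Rightarrow> 'b) \<Rightarrow> bool" where
  "solves x u \<longleftrightarrow> (\<exists>A\<ge>0. bnd 0 A u) \<and> (\<forall>t\<in>{0..T}. \<exists>J. young_at u t J \<and> u t = S t x + J)"

lemma bndD1: "bnd \<mu> A u \<Longrightarrow> 0 \<le> t \<Longrightarrow> t \<le> T \<Longrightarrow> norm (u t) \<le> A * exp (\<mu> * t)"
  and bndD2: "bnd \<mu> A u \<Longrightarrow> 0 \<le> r \<Longrightarrow> r \<le> t \<Longrightarrow> t \<le> T \<Longrightarrow> norm (dlt u t r) \<le> A * exp (\<mu> * t) * (t - r) powr \<alpha>"
  by (auto simp: bnd_def)

lemma bnd_cong: "(\<And>t. 0 \<le> t \<Longrightarrow> t \<le> T \<Longrightarrow> u t = v t) \<Longrightarrow> bnd \<mu> A u = bnd \<mu> A v"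
  unfolding bnd_def dlt_def by auto

lemma bnd_mono: assumes "bnd \<mu> A u" "A \<le> A'" shows "bnd \<mu> A' u"
  unfolding bnd_def
proof (intro conjI ballI allI impI)
  fix t assume "t \<in> {0..T}"
  then have "norm (u t) \<le> A * exp (\<mu> * t)" using bndD1[OF assms(1)] by auto
  also have "\<dots> \<le> A' * exp (\<mu> * t)" using assms by simp
  finally show "norm (u t) \<le> A' * exp (\<mu> * t)" .
next
  fix r t assume "0 \<le> r" "r \<le> t" "t \<le> T"
  then have "norm (dlt u t r) \<le> A * exp (\<mu> * t) * (t - r) powr \<alpha>" using bndD2[OF assms(1)] by auto
  also have "\<dots> \<le> A' * exp (\<mu> * t) * (t - r) powr \<alpha>" using assms by (intro mult_right_mono) auto
  finally show "norm (dlt u t r) \<le> A' * exp (\<mu> * t) * (t - r) powr \<alpha>" .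
qed

lemma bnd_change_weight:
  assumes "bnd \<mu> A u" "A \<ge> 0" and e: "\<And>t. 0 \<le> t \<Longrightarrow> t \<le> T \<Longrightarrow> exp (\<mu> * t) \<le> c * exp (\<nu> * t)"
  shows "bnd \<nu> (A * c) u"
  unfolding bnd_def
proof (intro conjI ballI allI impI)
  fix t assume "t \<in> {0..T}"
  then have t: "0 \<le> t" "t \<le> T" by auto
  have "norm (u t) \<le> A * exp (\<mu> * t)" using bndD1[OF assms(1)] t by auto
  also have "\<dots> \<le> A * (c * exp (\<nu> * t))" using e[OF t] assms(2) by (rule mult_left_mono)
  finally show "norm (u t) \<le> A * c * exp (\<nu> * t)" by simp
next
  fix r t assume t: "0 \<le> r" "r \<le> t" "t \<le> T"
  then have "norm (dlt u t r) \<le> A * exp (\<mu> * t) * (t - r) powr \<alpha>" using bndD2[OF assms(1)] by auto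
  also have "\<dots> \<le> A * (c * exp (\<nu> * t)) * (t - r) powr \<alpha>"
    using e[of t] assms(2) t by (intro mult_right_mono mult_left_mono) auto
  finally show "norm (dlt u t r) \<le> A * c * exp (\<nu> * t) * (t - r) powr \<alpha>" by simp
qed

lemma dlt_add: "0 \<le> r \<Longrightarrow> r \<le> t \<Longrightarrow> dlt (\<lambda>s. u s + v s) t r = dlt u t r + dlt v t r"
  using linear_add[OF S_linear, of "t - r"] by (simp add: dlt_def)

lemma dlt_diff: "0 \<le> r \<Longrightarrow> r \<le> t \<Longrightarrow> dlt (\<lambda>s. u s - v s) t r = dlt u t r - dlt v t r"
  using S_diff[of "t - r"] by (simp add: dlt_def)

lemma bnd_add: 
  assumes "bnd \<mu> A u" "bnd \<mu> A' v" shows "bnd \<mu> (A + A') (\<lambda>t. u t + v t)"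
  unfolding bnd_def
proof (intro conjI ballI allI impI)
  fix t assume "t \<in> {0..T}"
  then show "norm (u t + v t) \<le> (A + A') * exp (\<mu> * t)"
    using bndD1[OF assms(1), of t] bndD1[OF assms(2), of t] norm_triangle_ineq[of "u t" "v t"] by (auto simp: distrib_right)
next
  fix r t assume "0 \<le> r" "r \<le> t" "t \<le> T"
  then show "norm (dlt (\<lambda>t. u t + v t) t r) \<le> (A + A') * exp (\<mu> * t) * (t - r) powr \<alpha>"
    using bndD2[OF assms(1), of r t] bndD2[OF assms(2), of r t] norm_triangle_ineq[of "dlt u t r" "dlt v t r"]
    by (auto simp: distrib_right dlt_add)
qed

lemma bnd_diff: 
  assumes "bnd \<mu> A u" "bnd \<mu> A' v" shows "bnd \<mu> (A + A') (\<lambda>t. u t - v t)"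
  unfolding bnd_def
proof (intro conjI ballI allI impI)
  fix t assume "t \<in> {0..T}"
  then show "norm (u t - v t) \<le> (A + A') * exp (\<mu> * t)"
    using bndD1[OF assms(1), of t] bndD1[OF assms(2), of t] norm_triangle_ineq4[of "u t" "v t"] by (auto simp: distrib_right)
next
  fix r t assume "0 \<le> r" "r \<le> t" "t \<le> T"
  then show "norm (dlt (\<lambda>t. u t - v t) t r) \<le> (A + A') * exp (\<mu> * t) * (t - r) powr \<alpha>"
    using bndD2[OF assms(1), of r t] bndD2[OF assms(2), of r t] norm_triangle_ineq4[of "dlt u t r" "dlt v t r"]
    by (auto simp: distrib_right dlt_diff)
qed

lemma bnd_free: "\<mu> \<ge> 0 \<Longrightarrow> bnd \<mu> (norm x) (\<lambda>t. S t x)"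
  unfolding bnd_def
proof (intro conjI ballI allI impI)
  fix t assume "\<mu> \<ge> 0" "t \<in> {0..T}"
  then have "norm (S t x) \<le> norm x * 1" "1 \<le> exp (\<mu> * t)" using S_contraction[of t] by auto
  then show "norm (S t x) \<le> norm x * exp (\<mu> * t)" by (meson mult_left_mono norm_ge_zero order_trans)
next
  fix r t assume "0 \<le> r" "r \<le> t" "t \<le> T"
  then have "dlt (\<lambda>t. S t x) t r = 0" using S_add[of "t - r" r x] by (simp add: dlt_def)
  then show "norm (dlt (\<lambda>t. S t x) t r) \<le> norm x * exp (\<mu> * t) * (t - r) powr \<alpha>" by simp
qed

lemma X_self: "0 \<le> t \<Longrightarrow> t \<le> T \<Longrightarrow> X t t x = 0"
  using X_bound[of t t x] \<alpha> \<alpha>\<gamma> by simp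

lemma X_diff: "0 \<le> r \<Longrightarrow> r \<le> t \<Longrightarrow> t \<le> T \<Longrightarrow> X t r (x - y) = X t r x - X t r y"
  using linear_diff[OF X_linear] by blast

text \<open>By Chen's relation the contributions over \<open>[a,b]\<close> and \<open>[b,c]\<close> would match that over \<open>[a,c]\<close> exactly if
\<open>u\<close> were carried from \<open>a\<close> to \<open>b\<close> by the semigroup alone.\<close>
lemma inc_defect:
  assumes "0 \<le> a" "a \<le> b" "b \<le> c" "c \<le> t" "t \<le> T"
  shows "inc u t a c - inc u t a b - inc u t b c = - S (t - c) (X c b (dlt u b a))"
proof -
  have "S (t - b) y = S (t - c) (S (c - b) y)" for y using S_add[of "t - c" "c - b" y] assms by simp
  then show ?thesis unfolding inc_def dlt_def
    using assms chen[of a b c "u a"] X_diff[of b c] linear_add[OF S_linear, of "t - c"] S_diff[of "t - c"]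
    by simp
qed

text \<open>The defect has order \<open>\<alpha> + \<gamma>\<close>. Spending \<open>\<gamma> - \<alpha>\<close> of it on the ratio of the weights at \<open>b\<close> and \<open>c\<close>
produces the factor \<open>\<mu>\<^bsup>\<alpha>-\<gamma>\<^esup>\<close> and leaves order \<open>2 \<alpha> > 1\<close>, enough for sewing.\<close>
lemma inc_sewing:
  assumes u: "bnd \<mu> A u" and A: "A \<ge> 0" and \<mu>: "\<mu> > 0" and t: "0 < t" "t \<le> T"
  obtains I where "\<And>a b. 0 \<le> a \<Longrightarrow> a \<le> b \<Longrightarrow> b \<le> t \<Longrightarrow> 
    norm (I b - I a - inc u t a b) \<le> sewing_const (2 * \<alpha>) * (K * A * \<mu> powr (\<alpha> - \<gamma>) * exp (\<mu> * t)) * (b - a) powr (2 * \<alpha>)"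
proof -
  let ?K = "K * A * \<mu> powr (\<alpha> - \<gamma>) * exp (\<mu> * t)"
  have "\<exists>I. \<forall>a b. 0 \<le> a \<longrightarrow> a \<le> b \<longrightarrow> b \<le> t \<longrightarrow>
      norm (I b - I a - inc u t a b) \<le> sewing_const (2 * \<alpha>) * ?K * (b - a) powr (2 * \<alpha>)"
  proof (rule sewing)
    fix a b c assume abc: "0 \<le> a" "a \<le> b" "b \<le> c" "c \<le> t"
    have "norm (inc u t a c - inc u t a b - inc u t b c) \<le> norm (X c b (dlt u b a))"
      using inc_defect[OF abc t(2)] S_contraction[of "t - c"] abc by simp
    also have "\<dots> \<le> K * (c - b) powr \<gamma> * norm (dlt u b a)" using X_bound abc t by simp
    also have "\<dots> \<le> K * (c - b) powr \<gamma> * (A * exp (\<mu> * b) * (b - a) powr \<alpha>)"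
      using bndD2[OF u, of a b] abc t K by (intro mult_left_mono) auto
    also have "\<dots> = K * A * (b - a) powr \<alpha> * (c - b) powr \<alpha> * exp (\<mu> * c) * ((c - b) powr (\<gamma> - \<alpha>) * exp (- \<mu> * (c - b)))"
    proof -
      have "(c - b) powr \<gamma> = (c - b) powr \<alpha> * (c - b) powr (\<gamma> - \<alpha>)" by (simp add: powr_add[symmetric])
      moreover have "exp (\<mu> * b) = exp (\<mu> * c) * exp (- \<mu> * (c - b))" by (simp add: exp_add[symmetric] algebra_simps)
      ultimately show ?thesis by simp
    qed
    also have "\<dots> \<le> K * A * (c - a) powr \<alpha> * (c - a) powr \<alpha> * exp (\<mu> * t) * \<mu> powr (- (\<gamma> - \<alpha>))"
    proof (intro mult_mono)
      show "(c - b) powr (\<gamma> - \<alpha>) * exp (- \<mu> * (c - b)) \<le> \<mu> powr - (\<gamma> - \<alpha>)"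
        using abc \<mu> \<alpha> \<alpha>\<gamma> \<gamma> by (intro powr_exp_decay) auto
      show "(b - a) powr \<alpha> \<le> (c - a) powr \<alpha>" "(c - b) powr \<alpha> \<le> (c - a) powr \<alpha>"
        using abc \<alpha> by (auto intro!: powr_mono2)
      show "exp (\<mu> * c) \<le> exp (\<mu> * t)" using abc \<mu> by simp
    qed (use K A in auto)
    also have "\<dots> = ?K * (c - a) powr (2 * \<alpha>)"
      unfolding mult_2 powr_add by simp
    finally show "norm (inc u t a c - inc u t a b - inc u t b c) \<le> ?K * (c - a) powr (2 * \<alpha>)" .
  qed (use \<alpha> K A t in auto)
  then show thesis using that by blast
qed

lemma young_at_unique_seq:
  assumes "young_at u t J" "t > 0"
  shows "(\<lambda>n. psum u t (Suc n) (uniform_partition t (Suc n))) \<longlonglongrightarrow> J"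
proof (rule LIMSEQ_I)
  fix \<epsilon> :: real assume "\<epsilon> > 0"
  then obtain \<delta> where \<delta>: "\<delta> > 0" "\<And>N p. is_partition t N p \<Longrightarrow> (\<forall>j<N. p j - p (Suc j) < \<delta>) \<Longrightarrow> norm (psum u t N p - J) < \<epsilon>"
    using assms(1) unfolding young_at_def by blast
  obtain n0 where n0: "t / \<delta> < real n0" using reals_Archimedean2 by blast
  have "norm (psum u t (Suc n) (uniform_partition t (Suc n)) - J) < \<epsilon>" if "n \<ge> n0" for n
  proof (rule \<delta>(2)[OF uniform_partition[OF assms(2)]])
    have "t / \<delta> < real (Suc n)" using n0 that by simp
    then have "t / real (Suc n) < \<delta>" using \<delta>(1) by (simp add: field_simps)
    then show "\<forall>j<Suc n. uniform_partition t (Suc n) j - uniform_partition t (Suc n) (Suc j) < \<delta>"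
      by (simp only: uniform_partition_mesh) simp
  qed simp
  then show "\<exists>n0. \<forall>n\<ge>n0. norm (psum u t (Suc n) (uniform_partition t (Suc n)) - J) < \<epsilon>" by blast
qed

lemma young_at_0: "young_at u 0 J \<longleftrightarrow> J = 0"
proof
  assume J: "young_at u 0 J"
  have "is_partition 0 0 (\<lambda>_. 0)" by (simp add: is_partition_def)
  moreover have "psum u 0 0 (\<lambda>_. 0) = 0" by (simp add: psum_def)
  ultimately have small: "norm J < \<epsilon>" if "\<epsilon> > 0" for \<epsilon>
    using J that unfolding young_at_def by fastforce
  show "J = 0" using small[of "norm J"] by (cases "J = 0") auto
next
  have "N = 0" if p: "is_partition 0 N p" for N p
  proof (rule ccontr)
    assume "N \<noteq> 0"
    then show False using p is_partition_range[OF p, of 1] by (auto simp: is_partition_def)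
  qed
  then have "psum u 0 N p = 0" if "is_partition 0 N p" for N p
    using that unfolding psum_def by (metis lessThan_0 sum.empty)
  then show "J = 0 \<Longrightarrow> young_at u 0 J" unfolding young_at_def
    by (intro allI impI exI[of _ 1]) auto
qed

lemma young_at_unique: "young_at u t J \<Longrightarrow> young_at u t J' \<Longrightarrow> t \<ge> 0 \<Longrightarrow> J = J'"
  using young_at_unique_seq[of u t J] young_at_unique_seq[of u t J'] LIMSEQ_unique young_at_0
  by (cases "t = 0") auto

lemma young_at_cong:
  assumes "\<And>s. 0 \<le> s \<Longrightarrow> s \<le> t \<Longrightarrow> u s = v s"
  shows "young_at u t J = young_at v t J"
proof -
  have "psum u t N p = psum v t N p" if "is_partition t N p" for N p
    unfolding psum_def inc_def using is_partition_range[OF that] assms by (intro sum.cong) auto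
  then show ?thesis unfolding young_at_def by auto
qed

lemma young_at_diff:
  assumes "young_at u t J" "young_at v t J'" "t \<le> T"
  shows "young_at (\<lambda>s. u s - v s) t (J - J')"
  unfolding young_at_def
proof (intro allI impI)
  fix \<epsilon> :: real assume "\<epsilon> > 0"
  then have e: "\<epsilon> / 2 > 0" by simp
  obtain \<delta> where \<delta>: "\<delta> > 0" "\<And>N p. is_partition t N p \<Longrightarrow> (\<forall>j<N. p j - p (Suc j) < \<delta>) \<Longrightarrow> norm (psum u t N p - J) < \<epsilon> / 2"
    using assms(1) e unfolding young_at_def by blast
  obtain \<delta>' where \<delta>': "\<delta>' > 0" "\<And>N p. is_partition t N p \<Longrightarrow> (\<forall>j<N. p j - p (Suc j) < \<delta>') \<Longrightarrow> norm (psum v t N p - J') < \<epsilon> / 2"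
    using assms(2) e unfolding young_at_def by blast
  have "norm (psum (\<lambda>s. u s - v s) t N p - (J - J')) < \<epsilon>" 
    if p: "is_partition t N p" and m: "\<forall>j<N. p j - p (Suc j) < min \<delta> \<delta>'" for N p
  proof -
    have eq: "psum (\<lambda>s. u s - v s) t N p = psum u t N p - psum v t N p"
      unfolding psum_def sum_subtractf[symmetric]
    proof (rule sum.cong)
      fix j assume "j \<in> {..<N}"
      then have j: "j < N" by simp
      have "0 \<le> p (Suc j)" "p (Suc j) \<le> p j" "p j \<le> t"
        using is_partition_range[OF p, of "Suc j"] is_partition_range[OF p, of j] j p by (auto simp: is_partition_def less_imp_le)
      then show "inc (\<lambda>s. u s - v s) t (p (Suc j)) (p j) = inc u t (p (Suc j)) (p j) - inc v t (p (Suc j)) (p j)"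
        unfolding inc_def using X_diff[of "p (Suc j)" "p j"] S_diff[of "t - p j"] assms(3) by simp
    qed simp
    have eq': "psum u t N p - psum v t N p - (J - J') = (psum u t N p - J) - (psum v t N p - J')" by simp
    have "norm (psum u t N p - J) < \<epsilon> / 2" "norm (psum v t N p - J') < \<epsilon> / 2"
      using \<delta>(2)[OF p] \<delta>'(2)[OF p] m by auto
    then show ?thesis using norm_triangle_ineq4[of "psum u t N p - J" "psum v t N p - J'"]
      unfolding eq eq' by linarith
  qed
  then show "\<exists>\<delta>>0. \<forall>N p. is_partition t N p \<longrightarrow> (\<forall>j<N. p j - p (Suc j) < \<delta>) \<longrightarrow>
      norm (psum (\<lambda>s. u s - v s) t N p - (J - J')) < \<epsilon>" using \<delta>(1) \<delta>'(1)
    by (intro exI[of _ "min \<delta> \<delta>'"]) auto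
qed

lemma sewing_young_at:
  assumes I: "\<And>a b. 0 \<le> a \<Longrightarrow> a \<le> b \<Longrightarrow> b \<le> t \<Longrightarrow> norm (I b - I a - inc u t a b) \<le> C * (b - a) powr (2 * \<alpha>)"
    and C: "C \<ge> 0" and t: "0 \<le> t" and p: "is_partition t N p" and \<delta>: "\<delta> > 0" "\<And>j. j < N \<Longrightarrow> p j - p (Suc j) < \<delta>"
  shows "norm (psum u t N p - (I t - I 0)) \<le> C * t * \<delta> powr (2 * \<alpha> - 1)"
  unfolding psum_def using \<alpha> C \<delta> p I by (intro partition_sum_estimate) auto

lemma young_at_sewing:
  assumes I: "\<And>a b. 0 \<le> a \<Longrightarrow> a \<le> b \<Longrightarrow> b \<le> t \<Longrightarrow> norm (I b - I a - inc u t a b) \<le> C * (b - a) powr (2 * \<alpha>)"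
    and C: "C \<ge> 0" and t: "0 \<le> t"
  shows "young_at u t (I t - I 0)"
  unfolding young_at_def
proof (intro allI impI)
  fix \<epsilon> :: real assume \<epsilon>: "\<epsilon> > 0"
  have Ct: "C * t + 1 > 0" using C t by (simp add: add_nonneg_pos)
  define \<delta> where "\<delta> = (\<epsilon> / (C * t + 1)) powr (1 / (2 * \<alpha> - 1))"
  have \<delta>: "\<delta> > 0" using \<epsilon> Ct by (simp add: \<delta>_def)
  have "\<delta> powr (2 * \<alpha> - 1) = \<epsilon> / (C * t + 1)" using \<alpha> \<epsilon> Ct by (simp add: \<delta>_def powr_powr)
  then have "C * t * \<delta> powr (2 * \<alpha> - 1) = \<epsilon> * (C * t) / (C * t + 1)" by simp
  also have "\<dots> < \<epsilon>" using \<epsilon> Ct by (simp add: field_simps)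
  finally have "C * t * \<delta> powr (2 * \<alpha> - 1) < \<epsilon>" .
  then show "\<exists>\<delta>>0. \<forall>N p. is_partition t N p \<longrightarrow> (\<forall>j<N. p j - p (Suc j) < \<delta>) \<longrightarrow> norm (psum u t N p - (I t - I 0)) < \<epsilon>"
    using \<delta> sewing_young_at[OF I C t, of _ _ \<delta>] by (intro exI[of _ \<delta>]) force
qed

lemma young_exists:
  assumes u: "bnd \<mu> A u" and A: "A \<ge> 0" and \<mu>: "\<mu> > 0" and t: "0 \<le> t" "t \<le> T"
  shows "\<exists>J. young_at u t J"
proof (cases "t = 0")
  case True
  then show ?thesis using young_at_0 by blast
next
  case False
  then have tp: "t > 0" using t by simp
  let ?C = "sewing_const (2 * \<alpha>) * (K * A * \<mu> powr (\<alpha> - \<gamma>) * exp (\<mu> * t))"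
  obtain I where I: "\<And>a b. 0 \<le> a \<Longrightarrow> a \<le> b \<Longrightarrow> b \<le> t \<Longrightarrow> norm (I b - I a - inc u t a b) \<le> ?C * (b - a) powr (2 * \<alpha>)"
    using inc_sewing[OF u A \<mu> tp t(2)] by blast
  have C: "?C \<ge> 0" using sewing_const_nonneg[of "2 * \<alpha>"] \<alpha> K A by simp
  show ?thesis using young_at_sewing[OF I C t(1)] by blast
qed

text \<open>The sewn function \<open>I\<close> for terminal time \<open>t\<close> computes the integral up to \<open>t\<close> as \<open>I t - I 0\<close>. On \<open>[0,r]\<close> its germ
is \<open>S (t - r)\<close> applied to the germ for terminal time \<open>r\<close>, hence \<open>I r - I 0\<close> is the image under \<open>S (t - r)\<close> of the
integral up to \<open>r\<close>. The claim is thus the sewing estimate on \<open>[r,t]\<close>.\<close>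
lemma young_increment_bound:
  assumes u: "bnd \<mu> A u" and A: "A \<ge> 0" and \<mu>: "\<mu> > 0" and t: "0 \<le> r" "r \<le> t" "t \<le> T"
    and Jt: "young_at u t Jt" and Jr: "young_at u r Jr"
  shows "norm (Jt - S (t - r) Jr - X t r (u r)) \<le>
     sewing_const (2 * \<alpha>) * (K * A * \<mu> powr (\<alpha> - \<gamma>) * exp (\<mu> * t)) * (t - r) powr (2 * \<alpha>)"
proof (cases "t = 0")
  case True
  then show ?thesis using t Jt Jr young_at_0 X_self[of 0] by (simp add: S_0)
next
  case False
  then have tp: "t > 0" using t by simp
  let ?C = "sewing_const (2 * \<alpha>) * (K * A * \<mu> powr (\<alpha> - \<gamma>) * exp (\<mu> * t))"
  obtain I where I: "\<And>a b. 0 \<le> a \<Longrightarrow> a \<le> b \<Longrightarrow> b \<le> t \<Longrightarrow> norm (I b - I a - inc u t a b) \<le> ?C * (b - a) powr (2 * \<alpha>)"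
    using inc_sewing[OF u A \<mu> tp t(3)] by blast
  have C: "?C \<ge> 0" using sewing_const_nonneg[of "2 * \<alpha>"] \<alpha> K A by simp
  have 1: "Jt = I t - I 0" using young_at_unique[OF Jt young_at_sewing[OF I C]] t by simp
  have 2: "S (t - r) Jr = I r - I 0"
  proof (cases "r = 0")
    case True
    then show ?thesis using Jr young_at_0 linear_0[OF S_linear, of t] t by simp
  next
    case False
    then have r: "r > 0" using t by simp
    let ?p = "\<lambda>n. psum u r (Suc n) (uniform_partition r (Suc n))"
    have "?p \<longlonglongrightarrow> Jr" by (rule young_at_unique_seq[OF Jr r])
    then have l1: "(\<lambda>n. S (t - r) (?p n)) \<longlonglongrightarrow> S (t - r) Jr"
      using bounded_linear.tendsto[OF S_blin, of "t - r"] t by simp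
    have b: "norm (S (t - r) (?p n) - (I r - I 0)) \<le> ?C * r * (2 * (r / real (Suc n))) powr (2 * \<alpha> - 1)" for n
    proof -
      have part: "is_partition r (Suc n) (uniform_partition r (Suc n))" by (rule uniform_partition[OF r]) simp
      have "S (t - r) (?p n) = (\<Sum>j<Suc n. inc u t (uniform_partition r (Suc n) (Suc j)) (uniform_partition r (Suc n) j))"
        unfolding psum_def linear_sum[OF S_linear[OF diff_ge_0_iff_ge[THEN iffD2, OF t(2)]]]
      proof (rule sum.cong)
        fix j assume "j \<in> {..<Suc n}"
        then have j: "uniform_partition r (Suc n) j \<le> r" using is_partition_range[OF part, of j] by simp
        show "S (t - r) (inc u r (uniform_partition r (Suc n) (Suc j)) (uniform_partition r (Suc n) j)) =
          inc u t (uniform_partition r (Suc n) (Suc j)) (uniform_partition r (Suc n) j)"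
          unfolding inc_def using S_add[of "t - r" "r - uniform_partition r (Suc n) j"] j t by simp
      qed simp
      moreover have "norm ((\<Sum>j<Suc n. inc u t (uniform_partition r (Suc n) (Suc j)) (uniform_partition r (Suc n) j)) - (I r - I 0))
          \<le> ?C * r * (2 * (r / real (Suc n))) powr (2 * \<alpha> - 1)"
      proof (rule partition_sum_estimate[OF _ C _ _ part])
        show "1 < 2 * \<alpha>" using \<alpha> by simp
        show "0 < 2 * (r / real (Suc n))" using r by simp
        show "norm (I b - I a - inc u t a b) \<le> ?C * (b - a) powr (2 * \<alpha>)" if "0 \<le> a" "a \<le> b" "b \<le> r" for a b
          using I that t by simp
        have "0 < r / real (Suc n)" using r by simp
        then show "uniform_partition r (Suc n) j - uniform_partition r (Suc n) (Suc j) < 2 * (r / real (Suc n))" for j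
          unfolding uniform_partition_mesh by linarith
      qed
      ultimately show ?thesis by simp
    qed
    have g: "(\<lambda>n. ?C * r * (2 * (r / real (Suc n))) powr (2 * \<alpha> - 1)) \<longlonglongrightarrow> 0"
    proof -
      have "(\<lambda>n. 2 * (r / real (Suc n))) \<longlonglongrightarrow> 2 * 0"
        by (intro tendsto_mult_left) (rule LIMSEQ_Suc[OF lim_const_over_n])
      then have "(\<lambda>n. (2 * (r / real (Suc n))) powr (2 * \<alpha> - 1)) \<longlonglongrightarrow> 0"
        using \<alpha> r by (intro tendsto_zero_powrI[OF _ tendsto_const]) auto
      then show ?thesis by (rule tendsto_mult_right_zero)
    qed
    have "(\<lambda>n. S (t - r) (?p n) - (I r - I 0)) \<longlonglongrightarrow> 0"
      by (rule Lim_null_comparison[OF always_eventually g]) (use b in blast)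
    then have "(\<lambda>n. S (t - r) (?p n)) \<longlonglongrightarrow> I r - I 0" by (rule LIM_zero_cancel)
    then show ?thesis using l1 LIMSEQ_unique by blast
  qed
  have "Jt - S (t - r) Jr - X t r (u r) = I t - I r - inc u t r t" unfolding 1 2 by (simp add: inc_def S_0)
  then show ?thesis using I[of r t] t by simp
qed

definition contraction_factor :: "real \<Rightarrow> real" where
  "contraction_factor \<mu> = K * \<mu> powr (\<alpha> - \<gamma>) * (1 + sewing_const (2 * \<alpha>) * T powr \<alpha>) * (1 + T powr \<alpha>)"

text \<open>Both terms of the mild increment of the integral gain \<open>\<mu>\<^bsup>\<alpha>-\<gamma>\<^esup>\<close>: the remainder by sewing, and the main term
\<open>X t r (u r)\<close> because \<open>(t - r)\<^bsup>\<gamma>-\<alpha>\<^esup> exp (-\<mu> (t - r)) \<le> \<mu>\<^bsup>\<alpha>-\<gamma>\<^esup>\<close>. The supremum norm is controlled by the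
increment from time \<open>0\<close>, where the integral vanishes.\<close>
lemma young_bnd:
  assumes u: "bnd \<mu> A u" and A: "A \<ge> 0" and \<mu>: "\<mu> > 0"
    and J: "\<And>t. 0 \<le> t \<Longrightarrow> t \<le> T \<Longrightarrow> young_at u t (J t)"
  shows "bnd \<mu> (A * contraction_factor \<mu>) J"
proof -
  let ?s = "sewing_const (2 * \<alpha>)" and ?m = "\<mu> powr (\<alpha> - \<gamma>)"
  have s: "?s \<ge> 0" using sewing_const_nonneg[of "2 * \<alpha>"] \<alpha> by simp
  let ?q = "K * ?m * (1 + ?s * T powr \<alpha>)"
  have q: "?q \<ge> 0" using s K by simp
  have main: "norm (dlt J t r) \<le> A * ?q * exp (\<mu> * t) * (t - r) powr \<alpha>" if t: "0 \<le> r" "r \<le> t" "t \<le> T" for r t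
  proof -
    have "dlt J t r = (J t - S (t - r) (J r) - X t r (u r)) + X t r (u r)" by (simp add: dlt_def)
    then have "norm (dlt J t r) \<le> norm (J t - S (t - r) (J r) - X t r (u r)) + norm (X t r (u r))"
      by (metis norm_triangle_ineq)
    also have "\<dots> \<le> ?s * (K * A * ?m * exp (\<mu> * t)) * (t - r) powr (2 * \<alpha>) + K * (t - r) powr \<gamma> * norm (u r)"
      using young_increment_bound[OF u A \<mu> t J J] X_bound[of r t "u r"] t by simp
    also have "\<dots> \<le> ?s * (K * A * ?m * exp (\<mu> * t)) * (T powr \<alpha> * (t - r) powr \<alpha>) + K * A * ?m * exp (\<mu> * t) * (t - r) powr \<alpha>"
    proof (rule add_mono)
      have "(t - r) powr (2 * \<alpha>) = (t - r) powr \<alpha> * (t - r) powr \<alpha>" unfolding mult_2 powr_add by simp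
      also have "\<dots> \<le> T powr \<alpha> * (t - r) powr \<alpha>" using t \<alpha> by (intro mult_right_mono powr_mono2) auto
      finally show "?s * (K * A * ?m * exp (\<mu> * t)) * (t - r) powr (2 * \<alpha>) \<le> ?s * (K * A * ?m * exp (\<mu> * t)) * (T powr \<alpha> * (t - r) powr \<alpha>)"
        using s K A by (intro mult_left_mono) auto
      have "K * (t - r) powr \<gamma> * norm (u r) \<le> K * (t - r) powr \<gamma> * (A * exp (\<mu> * r))"
        using bndD1[OF u, of r] t K by (intro mult_left_mono) auto
      also have "\<dots> = K * A * exp (\<mu> * t) * (t - r) powr \<alpha> * ((t - r) powr (\<gamma> - \<alpha>) * exp (- \<mu> * (t - r)))"
      proof -
        have "(t - r) powr \<gamma> = (t - r) powr \<alpha> * (t - r) powr (\<gamma> - \<alpha>)" by (simp add: powr_add[symmetric])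
        moreover have "exp (\<mu> * r) = exp (\<mu> * t) * exp (- \<mu> * (t - r))" by (simp add: exp_add[symmetric] algebra_simps)
        ultimately show ?thesis by simp
      qed
      also have "\<dots> \<le> K * A * exp (\<mu> * t) * (t - r) powr \<alpha> * \<mu> powr - (\<gamma> - \<alpha>)"
        using t \<mu> \<alpha> \<alpha>\<gamma> \<gamma> K A by (intro mult_left_mono powr_exp_decay) auto
      finally show "K * (t - r) powr \<gamma> * norm (u r) \<le> K * A * ?m * exp (\<mu> * t) * (t - r) powr \<alpha>" by (simp add: mult.commute mult.left_commute)
    qed
    also have "\<dots> = A * ?q * exp (\<mu> * t) * (t - r) powr \<alpha>" by (simp add: algebra_simps)
    finally show ?thesis .
  qed
  have cf: "contraction_factor \<mu> = ?q * (1 + T powr \<alpha>)" by (simp add: contraction_factor_def)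
  show ?thesis unfolding bnd_def
  proof (intro conjI ballI allI impI)
    fix t assume "t \<in> {0..T}"
    then have t: "0 \<le> t" "t \<le> T" by auto
    have "J 0 = 0" using J[of 0] young_at_0 T by simp
    then have "dlt J t 0 = J t" using linear_0[OF S_linear, of t] t by (simp add: dlt_def)
    then have "norm (J t) \<le> A * ?q * exp (\<mu> * t) * t powr \<alpha>" using main[of 0 t] t by simp
    also have "\<dots> \<le> A * ?q * exp (\<mu> * t) * (1 + T powr \<alpha>)"
      using t \<alpha> A q powr_mono2[of \<alpha> t T] by (intro mult_left_mono) auto
    finally show "norm (J t) \<le> A * contraction_factor \<mu> * exp (\<mu> * t)" unfolding cf by (simp add: mult.commute mult.left_commute)
  next
    fix r t assume t: "0 \<le> r" "r \<le> t" "t \<le> T"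
    have "A * ?q * exp (\<mu> * t) * (t - r) powr \<alpha> * 1 \<le> A * ?q * exp (\<mu> * t) * (t - r) powr \<alpha> * (1 + T powr \<alpha>)"
      using A q by (intro mult_left_mono) auto
    then show "norm (dlt J t r) \<le> A * contraction_factor \<mu> * exp (\<mu> * t) * (t - r) powr \<alpha>"
      using main[OF t] unfolding cf by (simp add: mult.commute mult.left_commute)
  qed
qed

text \<open>A single weight serves all of \<open>[0,T]\<close>, which spares a subdivision into short intervals and the gluing of solutions.\<close>
lemma contraction:
  obtains \<mu> where "\<mu> > 0" "contraction_factor \<mu> \<le> 1 / 2"
proof -
  define M where "M = K * (1 + sewing_const (2 * \<alpha>) * T powr \<alpha>) * (1 + T powr \<alpha>)"
  have M: "M \<ge> 0" using K sewing_const_nonneg[of "2 * \<alpha>"] \<alpha> by (simp add: M_def)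
  define \<mu> where "\<mu> = (2 * M + 1) powr (1 / (\<gamma> - \<alpha>))"
  have "\<mu> powr (\<alpha> - \<gamma>) = (2 * M + 1) powr (-1)"
    unfolding \<mu>_def powr_powr using \<alpha>\<gamma> by (intro arg_cong[where f = "\<lambda>e. _ powr e"]) (simp add: field_simps)
  then have "contraction_factor \<mu> = M / (2 * M + 1)"
    unfolding contraction_factor_def M_def[symmetric] using M
    by (simp add: powr_minus M_def divide_inverse mult.commute mult.left_commute)
  also have "\<dots> \<le> 1 / 2" using M by (simp add: field_simps)
  finally show thesis using that[of \<mu>] M by (simp add: \<mu>_def)
qed

definition \<Phi> :: "(real \<Rightarrow> 'b) \<Rightarrow> real \<Rightarrow> 'b" where
  "\<Phi> u t = (THE J. young_at u t J)"

lemma young_at_\<Phi>: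
  assumes "bnd \<mu> A u" "A \<ge> 0" "\<mu> > 0" "0 \<le> t" "t \<le> T"
  shows "young_at u t (\<Phi> u t)"
proof -
  obtain J where J: "young_at u t J" using young_exists[OF assms] by blast
  then have "\<Phi> u t = J" unfolding \<Phi>_def using young_at_unique assms(4) by blast
  then show ?thesis using J by simp
qed

lemma bnd_bounded_iff:
  assumes "\<mu> \<ge> 0"
  shows "(\<exists>A\<ge>0. bnd \<mu> A u) \<longleftrightarrow> (\<exists>A\<ge>0. bnd 0 A u)"
proof
  assume "\<exists>A\<ge>0. bnd \<mu> A u"
  then obtain A where A: "A \<ge> 0" "bnd \<mu> A u" by blast
  have "bnd 0 (A * exp (\<mu> * T)) u"
    by (rule bnd_change_weight[OF A(2,1)]) (use assms in \<open>auto intro: mult_left_mono\<close>)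
  then show "\<exists>A\<ge>0. bnd 0 A u" using A(1) by (intro exI[of _ "A * exp (\<mu> * T)"]) auto
next
  assume "\<exists>A\<ge>0. bnd 0 A u"
  then obtain A where A: "A \<ge> 0" "bnd 0 A u" by blast
  have "bnd \<mu> (A * 1) u"
    by (rule bnd_change_weight[OF A(2,1)]) (use assms in auto)
  then show "\<exists>A\<ge>0. bnd \<mu> A u" using A(1) by (intro exI[of _ A]) auto
qed

text \<open>The difference of two solutions solves the equation with initial value \<open>x - y\<close>. If its weighted norm is at most \<open>B\<close>,
then it is at most \<open>\<parallel>x - y\<parallel> + B / 2\<close>; iterating this a priori bound leaves \<open>2 \<parallel>x - y\<parallel>\<close>.\<close>
lemma solution_gap:
  obtains C where "C > 0" "\<And>x y u w t. solves x u \<Longrightarrow> solves y w \<Longrightarrow> t \<in> {0..T} \<Longrightarrow> norm (u t - w t) \<le> C * norm (x - y)"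
proof -
  obtain \<mu> where \<mu>: "\<mu> > 0" "contraction_factor \<mu> \<le> 1 / 2" using contraction by blast
  have "norm (u t - w t) \<le> 2 * exp (\<mu> * T) * norm (x - y)"
    if u: "solves x u" and w: "solves y w" and t: "t \<in> {0..T}" for x y u w t
  proof -
    let ?d = "\<lambda>s. u s - w s"
    let ?n = "norm (x - y)"
    obtain A0 A1 where A: "A0 \<ge> 0" "bnd 0 A0 u" "A1 \<ge> 0" "bnd 0 A1 w" using u w unfolding solves_def by blast
    have "bnd 0 (A0 + A1) ?d" using bnd_diff A by blast
    then obtain A where A: "A \<ge> 0" "bnd \<mu> A ?d" using bnd_bounded_iff[of \<mu> ?d] \<mu> A by force
    have J: "\<exists>J. young_at ?d s J \<and> ?d s = S s (x - y) + J" if "0 \<le> s" "s \<le> T" for s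
    proof -
      obtain J1 J2 where "young_at u s J1" "u s = S s x + J1" "young_at w s J2" "w s = S s y + J2"
        using u w \<open>0 \<le> s\<close> \<open>s \<le> T\<close> unfolding solves_def by force
      then show ?thesis using young_at_diff[of u s J1 w J2] that linear_diff[OF S_linear, of s] 
        by (intro exI[of _ "J1 - J2"]) auto
    qed
    then obtain J where J: "\<And>s. 0 \<le> s \<Longrightarrow> s \<le> T \<Longrightarrow> young_at ?d s (J s)" "\<And>s. 0 \<le> s \<Longrightarrow> s \<le> T \<Longrightarrow> ?d s = S s (x - y) + J s"
      by metis
    have step: "bnd \<mu> (?n + B / 2) ?d" if B: "B \<ge> 0" "bnd \<mu> B ?d" for B
    proof -
      have "bnd \<mu> (B * contraction_factor \<mu>) J" by (rule young_bnd[OF B(2,1) \<mu>(1) J(1)])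
      moreover have "B * contraction_factor \<mu> \<le> B / 2" using mult_left_mono[OF \<mu>(2) B(1)] by simp
      ultimately have "bnd \<mu> (B / 2) J" by (rule bnd_mono)
      then have "bnd \<mu> (?n + B / 2) (\<lambda>s. S s (x - y) + J s)" using bnd_add[OF bnd_free] \<mu>(1) by simp
      then show ?thesis using bnd_cong[of "\<lambda>s. S s (x - y) + J s" ?d] J(2) by simp
    qed
    have it: "bnd \<mu> (2 * ?n + A / 2 ^ k) ?d" for k
    proof (induction k)
      case 0
      then show ?case using bnd_mono[OF A(2), of "2 * ?n + A"] by simp
    next
      case (Suc k)
      have "bnd \<mu> (?n + (2 * ?n + A / 2 ^ k) / 2) ?d" using step[OF _ Suc] A(1) by simp
      then show ?case by (simp add: add_divide_distrib mult.commute)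
    qed
    have "norm (?d t) \<le> (2 * ?n + A / 2 ^ k) * exp (\<mu> * t)" for k
      using bndD1[OF it] t by auto
    moreover have "(\<lambda>k. (2 * ?n + A / 2 ^ k) * exp (\<mu> * t)) \<longlonglongrightarrow> (2 * ?n + 0) * exp (\<mu> * t)"
      by (intro tendsto_intros LIMSEQ_divide_realpow_zero) auto
    ultimately have "norm (?d t) \<le> (2 * ?n + 0) * exp (\<mu> * t)"
      by (intro LIMSEQ_le_const[of "\<lambda>k. (2 * ?n + A / 2 ^ k) * exp (\<mu> * t)"]) blast+
    also have "\<dots> \<le> 2 * ?n * exp (\<mu> * T)" using t \<mu> by (simp add: mult_left_mono)
    finally show ?thesis by (simp add: mult.commute mult.left_commute)
  qed
  then show thesis using that[of "2 * exp (\<mu> * T)"] by simp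
qed

lemma solution_unique:
  assumes "solves x u" "solves x w" "t \<in> {0..T}"
  shows "u t = w t"
proof -
  obtain C where "norm (u t - w t) \<le> C * norm (x - x)" using solution_gap assms by metis
  then show ?thesis by simp
qed

text \<open>The solution is the Neumann series of the iterates of \<open>\<Phi>\<close> on the free evolution, whose weighted norms are halved in
each step. Continuity of \<open>\<Phi>\<close> along the series needs no topology on the space of paths: the tails
again satisfy a weighted bound, and \<open>\<Phi>\<close> of a tail is estimated by the contraction property.\<close>
lemma solution_exists: "\<exists>u. solves x u"
proof -
  obtain \<mu> where \<mu>: "\<mu> > 0" "contraction_factor \<mu> \<le> 1 / 2" using contraction by blast
  define v where "v k = (\<Phi> ^^ k) (\<lambda>t. S t x)" for k
  define a where "a k = norm x / 2 ^ k" for k :: nat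
  have a0: "a k \<ge> 0" for k by (simp add: a_def)
  have vS: "v (Suc k) = \<Phi> (v k)" for k by (simp add: v_def)
  have v: "bnd \<mu> (a k) (v k)" for k
  proof (induction k)
    case 0
    then show ?case using bnd_free \<mu> by (simp add: v_def a_def)
  next
    case (Suc k)
    have "bnd \<mu> (a k * contraction_factor \<mu>) (\<Phi> (v k))"
      by (rule young_bnd[OF Suc a0 \<mu>(1)]) (rule young_at_\<Phi>[OF Suc a0 \<mu>(1)])
    moreover have "a k * contraction_factor \<mu> \<le> a (Suc k)" using mult_left_mono[OF \<mu>(2) a0[of k]] by (simp add: a_def)
    ultimately show ?case unfolding vS by (rule bnd_mono)
  qed
  have asum: "(\<lambda>k. a (k + n)) sums (2 * a n)" for n
    using sums_mult[OF geometric_sums[of "1 / 2 :: real"], of "a n"] 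
    by (simp add: a_def power_add power_divide mult.commute)
  have tail: "bnd \<mu> (2 * a n) (\<lambda>t. \<Sum>k. v (k + n) t)" and vs: "\<And>t. 0 \<le> t \<Longrightarrow> t \<le> T \<Longrightarrow> summable (\<lambda>k. v (k + n) t)" for n
  proof -
    have vb: "norm (v (k + n) t) \<le> a (k + n) * exp (\<mu> * t)" if "0 \<le> t" "t \<le> T" for k t
      using bndD1[OF v] that by simp
    have s1: "(\<lambda>k. a (k + n) * c) sums (2 * a n * c)" for c using sums_mult2[OF asum] .
    show sm: "summable (\<lambda>k. v (k + n) t)" if "0 \<le> t" "t \<le> T" for t
      using vb[OF that] sums_summable[OF s1] by (rule summable_comparison_test'[rotated])
    show "bnd \<mu> (2 * a n) (\<lambda>t. \<Sum>k. v (k + n) t)"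
      unfolding bnd_def
    proof (intro conjI ballI allI impI)
      fix t assume "t \<in> {0..T}"
      then have t: "0 \<le> t" "t \<le> T" by auto
      have "norm (\<Sum>k. v (k + n) t) \<le> (\<Sum>k. a (k + n) * exp (\<mu> * t))"
        using vb[OF t] sums_summable[OF s1] by (rule norm_suminf_le)
      then show "norm (\<Sum>k. v (k + n) t) \<le> 2 * a n * exp (\<mu> * t)" using sums_unique[OF s1] by simp
    next
      fix r t assume t: "0 \<le> r" "r \<le> t" "t \<le> T"
      have "dlt (\<lambda>t. \<Sum>k. v (k + n) t) t r = (\<Sum>k. v (k + n) t) - (\<Sum>k. S (t - r) (v (k + n) r))"
        unfolding dlt_def using bounded_linear.suminf[OF S_blin sm, of "t - r" r] t by simp
      also have "\<dots> = (\<Sum>k. dlt (v (k + n)) t r)"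
        unfolding dlt_def using sm[of t] bounded_linear.summable[OF S_blin sm, of "t - r" r] t by (intro suminf_diff) auto
      finally have "norm (dlt (\<lambda>t. \<Sum>k. v (k + n) t) t r) \<le> (\<Sum>k. a (k + n) * (exp (\<mu> * t) * (t - r) powr \<alpha>))"
        using bndD2[OF v t] sums_summable[OF s1] by (simp add: mult.assoc) (rule norm_suminf_le)
      then show "norm (dlt (\<lambda>t. \<Sum>k. v (k + n) t) t r) \<le> 2 * a n * exp (\<mu> * t) * (t - r) powr \<alpha>"
        using sums_unique[OF s1[of "exp (\<mu> * t) * (t - r) powr \<alpha>"]] by (simp only: mult.assoc)
    qed
  qed
  define U where "U = (\<lambda>t. \<Sum>k. v k t)"
  have Ub: "bnd \<mu> (2 * a 0) U" using tail[of 0] by (simp add: U_def)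
  define V where "V n = (\<lambda>t. U t - (\<Sum>k<n. v k t))" for n
  have Vt: "V n t = (\<Sum>k. v (k + n) t)" if "0 \<le> t" "t \<le> T" for n t
    unfolding V_def U_def using suminf_minus_initial_segment[of "\<lambda>k. v k t" n] vs[of t 0] that by simp
  have Vb: "bnd \<mu> (2 * a n) (V n)" for n using tail[of n] bnd_cong[of "V n"] Vt by simp
  have "U t = S t x + \<Phi> U t" if t: "0 \<le> t" "t \<le> T" for t
  proof -
    have yV: "young_at (V n) t (\<Phi> U t - (\<Sum>k<n. v (Suc k) t))" for n
    proof (induction n)
      case 0
      have "V 0 = U" by (simp add: V_def)
      then show ?case using young_at_\<Phi>[OF Ub _ \<mu>(1) t] a0 by simp
    next
      case (Suc n)
      have "young_at (v n) t (v (Suc n) t)" unfolding vS by (rule young_at_\<Phi>[OF v a0 \<mu>(1) t])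
      from young_at_diff[OF Suc this t(2)]
      show ?case by (simp add: V_def algebra_simps)
    qed
    have b: "norm (\<Phi> U t - (\<Sum>k<n. v (Suc k) t)) \<le> 2 * a n * exp (\<mu> * t)" for n
    proof -
      have y: "young_at (V n) s (\<Phi> (V n) s)" if "0 \<le> s" "s \<le> T" for s using young_at_\<Phi>[OF Vb _ \<mu>(1) that] a0 by simp
      have "bnd \<mu> (2 * a n * contraction_factor \<mu>) (\<Phi> (V n))" by (rule young_bnd[OF Vb _ \<mu>(1) y]) (use a0 in auto)
      moreover have "2 * a n * contraction_factor \<mu> \<le> 2 * a n" using mult_left_mono[OF \<mu>(2), of "2 * a n"] a0[of n] by simp
      ultimately have "bnd \<mu> (2 * a n) (\<Phi> (V n))" by (rule bnd_mono)
      moreover have "\<Phi> (V n) t = \<Phi> U t - (\<Sum>k<n. v (Suc k) t)" using young_at_unique[OF y[OF t] yV t(1)] .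
      ultimately show ?thesis using bndD1[of \<mu> "2 * a n" "\<Phi> (V n)" t] t by simp
    qed
    have "(\<lambda>n. 2 * a n * exp (\<mu> * t)) \<longlonglongrightarrow> 2 * 0 * exp (\<mu> * t)"
      unfolding a_def
      by (intro tendsto_intros LIMSEQ_divide_realpow_zero) auto
    then have g: "(\<lambda>n. 2 * a n * exp (\<mu> * t)) \<longlonglongrightarrow> 0" by simp
    have "(\<lambda>n. \<Phi> U t - (\<Sum>k<n. v (Suc k) t)) \<longlonglongrightarrow> 0"
      by (rule Lim_null_comparison[OF always_eventually g]) (use b in blast)
    then have "(\<lambda>n. \<Phi> U t - (\<Phi> U t - (\<Sum>k<n. v (Suc k) t))) \<longlonglongrightarrow> \<Phi> U t - 0"
      by (intro tendsto_diff tendsto_const)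
    then have "(\<lambda>n. \<Sum>k<n. v (Suc k) t) \<longlonglongrightarrow> \<Phi> U t" by simp
    moreover have "(\<lambda>k. v (Suc k) t) sums (U t - v 0 t)"
      using sums_Suc_iff[of "\<lambda>k. v k t" "U t - v 0 t"] summable_sums[OF vs[of t 0]] t by (simp add: U_def)
    ultimately have "\<Phi> U t = U t - v 0 t" unfolding sums_def using LIMSEQ_unique by blast
    then show ?thesis by (simp add: v_def)
  qed
  moreover have "\<exists>A\<ge>0. bnd 0 A U" using bnd_bounded_iff[of \<mu> U] Ub a0[of 0] \<mu> by force
  ultimately have "solves x U" unfolding solves_def
    using young_at_\<Phi>[OF Ub _ \<mu>(1)] a0[of 0] by force
  then show ?thesis by blast
qed

end

section \<open>The Hilbert space of square summable sequences\<close>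

text \<open>Bounds on finite sections replace summability throughout: they are stable under the algebraic operations and under
coordinatewise limits without any convergence argument.\<close>
typedef l2 = "{f :: int \<Rightarrow> complex. \<exists>C. \<forall>F. finite F \<longrightarrow> L2_set (\<lambda>n. cmod (f n)) F \<le> C}"
  morphisms coord Abs_l2
  by (rule exI[of _ "\<lambda>_. 0"]) (auto simp: L2_set_def)

setup_lifting type_definition_l2

lemma L2_set_cmod_add: "L2_set (\<lambda>n. cmod (f n + g n)) F \<le> L2_set (\<lambda>n. cmod (f n)) F + L2_set (\<lambda>n. cmod (g n)) F"
  by (rule order_trans[OF L2_set_mono L2_set_triangle_ineq]) (auto intro: norm_triangle_ineq)

lemma L2_set_cmod_diff: "L2_set (\<lambda>n. cmod (f n - g n)) F \<le> L2_set (\<lambda>n. cmod (f n)) F + L2_set (\<lambda>n. cmod (g n)) F"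
  using L2_set_cmod_add[of f "\<lambda>n. - g n" F] by simp

lemma L2_set_cmod_scale: "L2_set (\<lambda>n. cmod (c * f n)) F = cmod c * L2_set (\<lambda>n. cmod (f n)) F"
  by (simp add: norm_mult L2_set_right_distrib)

instantiation l2 :: real_normed_vector
begin

lift_definition zero_l2 :: l2 is "\<lambda>_. 0" by (auto simp: L2_set_def)

lift_definition plus_l2 :: "l2 \<Rightarrow> l2 \<Rightarrow> l2" is "\<lambda>f g n. f n + g n"
proof -
  fix f g :: "int \<Rightarrow> complex"
  assume "\<exists>C. \<forall>F. finite F \<longrightarrow> L2_set (\<lambda>n. cmod (f n)) F \<le> C" "\<exists>C. \<forall>F. finite F \<longrightarrow> L2_set (\<lambda>n. cmod (g n)) F \<le> C"
  then obtain C C' where "\<And>F. finite F \<Longrightarrow> L2_set (\<lambda>n. cmod (f n)) F \<le> C" "\<And>F. finite F \<Longrightarrow> L2_set (\<lambda>n. cmod (g n)) F \<le> C'" by blast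
  then show "\<exists>C. \<forall>F. finite F \<longrightarrow> L2_set (\<lambda>n. cmod (f n + g n)) F \<le> C"
    by (intro exI[of _ "C + C'"] allI impI order_trans[OF L2_set_cmod_add add_mono]) auto
qed

lift_definition uminus_l2 :: "l2 \<Rightarrow> l2" is "\<lambda>f n. - f n" by simp

lift_definition minus_l2 :: "l2 \<Rightarrow> l2 \<Rightarrow> l2" is "\<lambda>f g n. f n - g n"
proof -
  fix f g :: "int \<Rightarrow> complex"
  assume "\<exists>C. \<forall>F. finite F \<longrightarrow> L2_set (\<lambda>n. cmod (f n)) F \<le> C" "\<exists>C. \<forall>F. finite F \<longrightarrow> L2_set (\<lambda>n. cmod (g n)) F \<le> C"
  then obtain C C' where "\<And>F. finite F \<Longrightarrow> L2_set (\<lambda>n. cmod (f n)) F \<le> C" "\<And>F. finite F \<Longrightarrow> L2_set (\<lambda>n. cmod (g n)) F \<le> C'" by blast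
  then show "\<exists>C. \<forall>F. finite F \<longrightarrow> L2_set (\<lambda>n. cmod (f n - g n)) F \<le> C"
    by (intro exI[of _ "C + C'"] allI impI order_trans[OF L2_set_cmod_diff add_mono]) auto
qed

lift_definition scaleR_l2 :: "real \<Rightarrow> l2 \<Rightarrow> l2" is "\<lambda>c f n. of_real c * f n"
proof -
  fix c and f :: "int \<Rightarrow> complex"
  assume "\<exists>C. \<forall>F. finite F \<longrightarrow> L2_set (\<lambda>n. cmod (f n)) F \<le> C"
  then obtain C where "\<And>F. finite F \<Longrightarrow> L2_set (\<lambda>n. cmod (f n)) F \<le> C" by blast
  then show "\<exists>C. \<forall>F. finite F \<longrightarrow> L2_set (\<lambda>n. cmod (of_real c * f n)) F \<le> C"
    unfolding L2_set_cmod_scale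
    by (intro exI[of _ "cmod (of_real c) * C"] allI impI mult_left_mono) simp_all
qed

lift_definition norm_l2 :: "l2 \<Rightarrow> real" is "\<lambda>f. SUP F\<in>{F. finite F}. L2_set (\<lambda>n. cmod (f n)) F" .

definition sgn_l2 :: "l2 \<Rightarrow> l2" where "sgn_l2 x = scaleR (inverse (norm x)) x"
definition dist_l2 :: "l2 \<Rightarrow> l2 \<Rightarrow> real" where "dist_l2 x y = norm (x - y)"
definition uniformity_l2 :: "(l2 \<times> l2) filter" where
  "uniformity_l2 = (INF e\<in>{0<..}. principal {(x, y). dist x y < e})"
definition open_l2 :: "l2 set \<Rightarrow> bool" where
  "open_l2 U = (\<forall>x\<in>U. eventually (\<lambda>(x', y). x' = x \<longrightarrow> y \<in> U) uniformity)"

lemma coord_bdd: "bdd_above ((\<lambda>F. L2_set (\<lambda>n. cmod (coord x n)) F) ` {F. finite F})"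
  using coord[of x] by (auto simp: bdd_above_def)

lemma L2_set_le_norm: "finite F \<Longrightarrow> L2_set (\<lambda>n. cmod (coord x n)) F \<le> norm x"
  unfolding norm_l2.rep_eq by (rule cSUP_upper) (auto simp: coord_bdd)

lemma norm_l2_le: "(\<And>F. finite F \<Longrightarrow> L2_set (\<lambda>n. cmod (coord x n)) F \<le> C) \<Longrightarrow> norm x \<le> C"
  unfolding norm_l2.rep_eq by (rule cSUP_least) auto

lemma norm_l2_nonneg: "norm (x :: l2) \<ge> 0"
  using L2_set_le_norm[of "{}" x] by simp

instance
proof
  fix x y z :: l2 and a b :: real
  show "x + y + z = x + (y + z)" "x + y = y + x" "0 + x = x" "- x + x = 0" "x - y = x + - y"
    "a *\<^sub>R (x + y) = a *\<^sub>R x + a *\<^sub>R y" "(a + b) *\<^sub>R x = a *\<^sub>R x + b *\<^sub>R x" "a *\<^sub>R b *\<^sub>R x = (a * b) *\<^sub>R x" "1 *\<^sub>R x = x"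
    by (transfer; auto simp: algebra_simps)+
  show "sgn x = inverse (norm x) *\<^sub>R x" by (rule sgn_l2_def)
  show "dist x y = norm (x - y)" by (rule dist_l2_def)
  show "uniformity = (INF e\<in>{0<..}. principal {(x, y :: l2). dist x y < e})" by (rule uniformity_l2_def)
  show "open U = (\<forall>x\<in>U. \<forall>\<^sub>F (x', y) in uniformity. x' = x \<longrightarrow> y \<in> U)" for U :: "l2 set" by (rule open_l2_def)
  show "norm x = 0 \<longleftrightarrow> x = 0"
  proof
    assume "norm x = 0"
    then have "cmod (coord x n) \<le> 0" for n using L2_set_le_norm[of "{n}" x] by (simp add: L2_set_def)
    then show "x = 0" by (intro coord_inject[THEN iffD1]) (auto simp: zero_l2.rep_eq fun_eq_iff)
  next
    assume "x = 0"
    then have "norm x \<le> 0" by (intro norm_l2_le) (auto simp: zero_l2.rep_eq L2_set_def)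
    then show "norm x = 0" using norm_l2_nonneg[of x] by simp
  qed
  show "norm (x + y) \<le> norm x + norm y"
    by (rule norm_l2_le) (auto simp: plus_l2.rep_eq intro!: order_trans[OF L2_set_cmod_add] add_mono L2_set_le_norm)
  have le: "norm (a *\<^sub>R x) \<le> \<bar>a\<bar> * norm x" for a and x :: l2
    by (rule norm_l2_le) (auto simp: scaleR_l2.rep_eq L2_set_cmod_scale intro: mult_left_mono L2_set_le_norm)
  show "norm (a *\<^sub>R x) = \<bar>a\<bar> * norm x"
  proof (cases "a = 0")
    case True
    then show ?thesis using le[of a x] norm_l2_nonneg[of "a *\<^sub>R x"] by simp
  next
    case False
    have "norm (inverse a *\<^sub>R a *\<^sub>R x) \<le> \<bar>inverse a\<bar> * norm (a *\<^sub>R x)" by (rule le)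
    moreover have "inverse a *\<^sub>R a *\<^sub>R x = x" using False by (transfer; simp add: mult.assoc[symmetric] of_real_mult[symmetric] del: of_real_mult)
    ultimately have "\<bar>a\<bar> * norm x \<le> norm (a *\<^sub>R x)" using False by (simp add: field_simps)
    then show ?thesis using le[of a x] by simp
  qed
qed

end

lemma cmod_coord_le_norm: "cmod (coord x n) \<le> norm x"
  using L2_set_le_norm[of "{n}" x] by (simp add: L2_set_def)

lemma l2_eqI: "(\<And>n. coord x n = coord y n) \<Longrightarrow> x = y"
  by (simp add: coord_inject[symmetric] fun_eq_iff)

lemma coord_Abs_l2: "(\<And>F. finite F \<Longrightarrow> L2_set (\<lambda>n. cmod (f n)) F \<le> C) \<Longrightarrow> coord (Abs_l2 f) = f"
  by (rule Abs_l2_inverse) auto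

instance l2 :: banach
proof
  fix X :: "nat \<Rightarrow> l2"
  assume X: "Cauchy X"
  have "Cauchy (\<lambda>k. coord (X k) n)" for n
  proof (rule CauchyI)
    fix e :: real assume "e > 0"
    then obtain M where "\<And>m k. m \<ge> M \<Longrightarrow> k \<ge> M \<Longrightarrow> norm (X m - X k) < e" using CauchyD[OF X] by blast
    then have "\<forall>m\<ge>M. \<forall>k\<ge>M. norm (coord (X m) n - coord (X k) n) < e"
      by (metis cmod_coord_le_norm minus_l2.rep_eq order_le_less_trans)
    then show "\<exists>M. \<forall>m\<ge>M. \<forall>k\<ge>M. norm (coord (X m) n - coord (X k) n) < e" ..
  qed
  then have "\<exists>l. (\<lambda>k. coord (X k) n) \<longlonglongrightarrow> l" for n using Cauchy_convergent_iff convergent_def by blast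
  then obtain f where f: "\<And>n. (\<lambda>k. coord (X k) n) \<longlonglongrightarrow> f n" by metis
  have close: "\<exists>M. \<forall>m\<ge>M. \<forall>F. finite F \<longrightarrow> L2_set (\<lambda>n. cmod (coord (X m) n - f n)) F \<le> e" if e: "e > 0" for e
  proof -
    obtain M where M: "\<And>m k. m \<ge> M \<Longrightarrow> k \<ge> M \<Longrightarrow> norm (X m - X k) < e" using CauchyD[OF X e] by blast
    have "L2_set (\<lambda>n. cmod (coord (X m) n - f n)) F \<le> e" if "m \<ge> M" "finite F" for m F
    proof (rule LIMSEQ_le_const2)
      show "(\<lambda>k. L2_set (\<lambda>n. cmod (coord (X m) n - coord (X k) n)) F) \<longlonglongrightarrow> L2_set (\<lambda>n. cmod (coord (X m) n - f n)) F"
        unfolding L2_set_def by (intro tendsto_intros f)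
      show "\<exists>N. \<forall>k\<ge>N. L2_set (\<lambda>n. cmod (coord (X m) n - coord (X k) n)) F \<le> e"
        using M[OF that(1)] L2_set_le_norm[OF that(2), of "X m - X _"]
        by (intro exI[of _ M]) (metis (no_types, lifting) ext less_imp_le minus_l2.rep_eq order_trans)
    qed
    then show ?thesis by blast
  qed
  obtain M where M: "\<And>F. finite F \<Longrightarrow> L2_set (\<lambda>n. cmod (coord (X M) n - f n)) F \<le> 1" using close[of 1] by auto
  have "L2_set (\<lambda>n. cmod (f n)) F \<le> norm (X M) + 1" if "finite F" for F
  proof -
    have "L2_set (\<lambda>n. cmod (f n)) F \<le> L2_set (\<lambda>n. cmod (coord (X M) n)) F + L2_set (\<lambda>n. cmod (- (coord (X M) n - f n))) F"
      using L2_set_cmod_add[of "coord (X M)" "\<lambda>n. - (coord (X M) n - f n)" F] by simp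
    then show ?thesis using L2_set_le_norm[OF that, of "X M"] M[OF that] by (simp only: norm_minus_cancel)
  qed
  then have c: "coord (Abs_l2 f) = f" by (rule coord_Abs_l2)
  have "X \<longlonglongrightarrow> Abs_l2 f"
  proof (rule LIMSEQ_I)
    fix e :: real assume "e > 0"
    then obtain M where M: "\<And>m F. m \<ge> M \<Longrightarrow> finite F \<Longrightarrow> L2_set (\<lambda>n. cmod (coord (X m) n - f n)) F \<le> e / 2"
      using close[of "e / 2"] by auto
    have "norm (X m - Abs_l2 f) \<le> e / 2" if "m \<ge> M" for m
      by (rule norm_l2_le) (use M[OF that] in \<open>simp add: minus_l2.rep_eq c\<close>)
    then show "\<exists>M. \<forall>m\<ge>M. norm (X m - Abs_l2 f) < e" using \<open>e > 0\<close> by (intro exI[of _ M]) force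
  qed
  then show "convergent X" by (auto simp: convergent_def)
qed

lemma norm_l2_infsum:
  shows "(\<lambda>n. (cmod (coord x n))\<^sup>2) summable_on UNIV" and "norm x = sqrt (\<Sum>\<^sub>\<infinity>n. (cmod (coord x n))\<^sup>2)"
proof -
  have fin: "(\<Sum>n\<in>F. (cmod (coord x n))\<^sup>2) \<le> (norm x)\<^sup>2" if "finite F" for F
    using L2_set_le_norm[OF that, of x] norm_ge_zero[of x] unfolding L2_set_def
    by (metis real_sqrt_le_iff real_sqrt_abs abs_of_nonneg)
  show s: "(\<lambda>n. (cmod (coord x n))\<^sup>2) summable_on UNIV"
    by (rule nonneg_bdd_above_summable_on) (auto simp: bdd_above_def intro!: exI[of _ "(norm x)\<^sup>2"] fin)
  have "(\<Sum>\<^sub>\<infinity>n. (cmod (coord x n))\<^sup>2) \<le> (norm x)\<^sup>2"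
    by (rule infsum_le_finite_sums[OF s]) (auto simp: fin)
  then have "sqrt (\<Sum>\<^sub>\<infinity>n. (cmod (coord x n))\<^sup>2) \<le> sqrt ((norm x)\<^sup>2)" by (rule real_sqrt_le_mono)
  then have "sqrt (\<Sum>\<^sub>\<infinity>n. (cmod (coord x n))\<^sup>2) \<le> norm x" by simp
  moreover have "norm x \<le> sqrt (\<Sum>\<^sub>\<infinity>n. (cmod (coord x n))\<^sup>2)"
    by (rule norm_l2_le) (auto simp: L2_set_def intro!: finite_sum_le_infsum s)
  ultimately show "norm x = sqrt (\<Sum>\<^sub>\<infinity>n. (cmod (coord x n))\<^sup>2)" by simp
qed

lemma square_summable_bound:
  assumes "(\<lambda>n. (cmod (f n))\<^sup>2) summable_on UNIV" "finite F"
  shows "L2_set (\<lambda>n. cmod (f n)) F \<le> sqrt (\<Sum>\<^sub>\<infinity>n. (cmod (f n))\<^sup>2)"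
  unfolding L2_set_def using assms by (intro real_sqrt_le_mono finite_sum_le_infsum) auto

lemma coord_multiplier_exists:
  assumes "\<And>n. cmod (c n) \<le> C"
  shows "coord (Abs_l2 (\<lambda>n. c n * coord x n)) = (\<lambda>n. c n * coord x n)"
    and "norm (Abs_l2 (\<lambda>n. c n * coord x n)) \<le> C * norm x"
proof -
  have C: "C \<ge> 0" using assms[of 0] norm_ge_zero[of "c 0"] by linarith
  have b: "L2_set (\<lambda>n. cmod (c n * coord x n)) F \<le> C * norm x" if "finite F" for F
  proof -
    have "L2_set (\<lambda>n. cmod (c n * coord x n)) F \<le> L2_set (\<lambda>n. C * cmod (coord x n)) F"
      by (rule L2_set_mono) (auto simp: norm_mult intro: mult_right_mono assms)
    also have "\<dots> = C * L2_set (\<lambda>n. cmod (coord x n)) F" using C by (simp add: L2_set_right_distrib)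
    also have "\<dots> \<le> C * norm x" using C L2_set_le_norm[OF that] by (rule mult_left_mono[rotated])
    finally show ?thesis .
  qed
  show c: "coord (Abs_l2 (\<lambda>n. c n * coord x n)) = (\<lambda>n. c n * coord x n)"
    by (rule coord_Abs_l2[OF b])
  show "norm (Abs_l2 (\<lambda>n. c n * coord x n)) \<le> C * norm x"
    by (rule norm_l2_le) (simp add: c b)
qed

definition heat_l2 :: "real \<Rightarrow> l2 \<Rightarrow> l2" where
  "heat_l2 t x = Abs_l2 (\<lambda>n. of_real (exp (- t * (jap n)\<^sup>2)) * coord x n)"

lemma coord_heat_l2: "t \<ge> 0 \<Longrightarrow> coord (heat_l2 t x) n = of_real (exp (- t * (jap n)\<^sup>2)) * coord x n"
  and norm_heat_l2: "t \<ge> 0 \<Longrightarrow> norm (heat_l2 t x) \<le> norm x"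
proof -
  assume t: "t \<ge> 0"
  have b: "cmod (of_real (exp (- t * (jap n)\<^sup>2))) \<le> 1" for n using t by simp
  show "coord (heat_l2 t x) n = of_real (exp (- t * (jap n)\<^sup>2)) * coord x n"
    unfolding heat_l2_def by (subst coord_multiplier_exists(1)[OF b]) simp
  show "norm (heat_l2 t x) \<le> norm x"
    using coord_multiplier_exists(2)[where c = "\<lambda>n. of_real (exp (- t * (jap n)\<^sup>2))", OF b]
    unfolding heat_l2_def by simp
qed

text \<open>The sections of the series for \<open>\<parallel>x\<parallel>\<^sup>2\<close> form a Cauchy net.\<close>
lemma l2_tail_small:
  fixes x :: l2
  assumes "e > 0"
  obtains F where "finite F" "\<And>G. finite G \<Longrightarrow> G \<inter> F = {} \<Longrightarrow> L2_set (\<lambda>n. cmod (coord x n)) G \<le> e"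
proof -
  let ?q = "\<lambda>n. (cmod (coord x n))\<^sup>2"
  have s: "(?q has_sum infsum ?q UNIV) UNIV" using norm_l2_infsum(1) by simp
  then have "\<forall>\<^sub>F F in finite_subsets_at_top UNIV. dist (sum ?q F) (infsum ?q UNIV) < e\<^sup>2"
    unfolding has_sum_def using assms by (intro tendstoD) auto
  then obtain F where F: "finite F" "dist (sum ?q F) (infsum ?q UNIV) < e\<^sup>2"
    unfolding eventually_finite_subsets_at_top by blast
  have "L2_set (\<lambda>n. cmod (coord x n)) G \<le> e" if G: "finite G" "G \<inter> F = {}" for G
  proof -
    have "sum ?q (G \<union> F) \<le> infsum ?q UNIV" using G F norm_l2_infsum(1) by (intro finite_sum_le_infsum) auto
    moreover have "sum ?q (G \<union> F) = sum ?q G + sum ?q F" using G F by (intro sum.union_disjoint) auto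
    ultimately have "sum ?q G \<le> e\<^sup>2" using F(2) by (simp add: dist_real_def)
    then show ?thesis unfolding L2_set_def using assms by (intro real_le_lsqrt) (auto intro: sum_nonneg)
  qed
  with F(1) show thesis using that by blast
qed

text \<open>On finitely many modes the convergence is that of exponentials; the remaining modes are uniformly small since the multiplier
minus one is bounded by one.\<close>
lemma heat_l2_strong: "((\<lambda>h. heat_l2 h x) \<longlongrightarrow> x) (at_right 0)"
proof (rule tendstoI)
  fix e :: real assume e: "e > 0"
  obtain F where F: "finite F" "\<And>G. finite G \<Longrightarrow> G \<inter> F = {} \<Longrightarrow> L2_set (\<lambda>n. cmod (coord x n)) G \<le> e / 3"
    using l2_tail_small[of "e / 3" x] e by auto
  let ?d = "\<lambda>h n. cmod (coord (heat_l2 h x - x) n)"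
  have d: "?d h n = \<bar>exp (- h * (jap n)\<^sup>2) - 1\<bar> * cmod (coord x n)" if "h \<ge> 0" for h n
  proof -
    have "coord (heat_l2 h x - x) n = of_real (exp (- h * (jap n)\<^sup>2) - 1) * coord x n"
      using that by (simp add: minus_l2.rep_eq coord_heat_l2 algebra_simps)
    then show ?thesis by (simp only: norm_mult norm_of_real)
  qed
  have "((\<lambda>h. L2_set (\<lambda>n. \<bar>exp (- h * (jap n)\<^sup>2) - 1\<bar> * cmod (coord x n)) F) \<longlongrightarrow>
      L2_set (\<lambda>n. \<bar>exp (- 0 * (jap n)\<^sup>2) - 1\<bar> * cmod (coord x n)) F) (at_right 0)"
    unfolding L2_set_def by (intro tendsto_intros)
  then have "((\<lambda>h. L2_set (\<lambda>n. \<bar>exp (- h * (jap n)\<^sup>2) - 1\<bar> * cmod (coord x n)) F) \<longlongrightarrow> 0) (at_right 0)"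
    by (simp add: L2_set_def)
  then have ev: "\<forall>\<^sub>F h in at_right 0. L2_set (\<lambda>n. \<bar>exp (- h * (jap n)\<^sup>2) - 1\<bar> * cmod (coord x n)) F < e / 3"
    by (rule order_tendstoD) (use e in simp)
  have ev0: "\<forall>\<^sub>F h in at_right (0::real). h > 0" by (rule eventually_at_right_less)
  show "\<forall>\<^sub>F h in at_right 0. dist (heat_l2 h x) x < e"
    using ev ev0
  proof eventually_elim
    fix h :: real
    assume h: "L2_set (\<lambda>n. \<bar>exp (- h * (jap n)\<^sup>2) - 1\<bar> * cmod (coord x n)) F < e / 3" "h > 0"
    have "norm (heat_l2 h x - x) \<le> e / 3 + e / 3"
    proof (rule norm_l2_le)
      fix G :: "int set" assume G: "finite G"
      have "L2_set (?d h) G \<le> L2_set (\<lambda>n. if n \<in> F then ?d h n else 0) G + L2_set (\<lambda>n. if n \<in> F then 0 else ?d h n) G"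
        by (rule order_trans[OF _ L2_set_triangle_ineq]) (auto intro!: L2_set_mono)
      moreover have "L2_set (\<lambda>n. if n \<in> F then ?d h n else 0) G \<le> e / 3"
      proof -
        have "L2_set (\<lambda>n. if n \<in> F then ?d h n else 0) G \<le> L2_set (?d h) F"
          unfolding L2_set_def
        proof (rule real_sqrt_le_mono)
          have "(\<Sum>n\<in>G. (if n \<in> F then ?d h n else 0)\<^sup>2) = (\<Sum>n\<in>G \<inter> F. (?d h n)\<^sup>2)"
            using G by (simp add: sum.inter_restrict if_distrib[of "\<lambda>x. x\<^sup>2"] cong: if_cong)
          also have "\<dots> \<le> (\<Sum>n\<in>F. (?d h n)\<^sup>2)" using F(1) by (intro sum_mono2) auto
          finally show "(\<Sum>n\<in>G. (if n \<in> F then ?d h n else 0)\<^sup>2) \<le> (\<Sum>n\<in>F. (?d h n)\<^sup>2)" .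
        qed
        then show ?thesis using h d[of h] by simp
      qed
      moreover have "L2_set (\<lambda>n. if n \<in> F then 0 else ?d h n) G \<le> e / 3"
      proof -
        have le: "?d h n \<le> cmod (coord x n)" for n
        proof -
          have "exp (- h * (jap n)\<^sup>2) \<le> 1" using h(2) by simp
          then have "\<bar>exp (- h * (jap n)\<^sup>2) - 1\<bar> \<le> 1" using exp_gt_zero[of "- h * (jap n)\<^sup>2"] by linarith
          then show ?thesis using h(2) d[of h n] mult_right_mono[of _ 1 "cmod (coord x n)"] by auto
        qed
        have "L2_set (\<lambda>n. if n \<in> F then 0 else ?d h n) G \<le> L2_set (\<lambda>n. cmod (coord x n)) (G - F)"
          unfolding L2_set_def
        proof (rule real_sqrt_le_mono)
          have "(\<Sum>n\<in>G. (if n \<in> F then 0 else ?d h n)\<^sup>2) = (\<Sum>n\<in>G - F. (if n \<in> F then 0 else ?d h n)\<^sup>2)"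
            using G by (intro sum.mono_neutral_right) auto
          also have "\<dots> \<le> (\<Sum>n\<in>G - F. (cmod (coord x n))\<^sup>2)" using le by (intro sum_mono power_mono) auto
          finally show "(\<Sum>n\<in>G. (if n \<in> F then 0 else ?d h n)\<^sup>2) \<le> (\<Sum>n\<in>G - F. (cmod (coord x n))\<^sup>2)" .
        qed
        also have "\<dots> \<le> e / 3" using G by (intro F(2)) auto
        finally show ?thesis .
      qed
      ultimately show "L2_set (?d h) G \<le> e / 3 + e / 3" by linarith
    qed
    then show "dist (heat_l2 h x) x < e" using e by (simp add: dist_norm)
  qed
qed

interpretation heat_l2: contraction_semigroup heat_l2
proof (rule contraction_semigroup.intro)
  show "linear (heat_l2 t)" if "0 \<le> t" for t
    by (rule linearI; rule l2_eqI) (use that in \<open>auto simp: coord_heat_l2 plus_l2.rep_eq scaleR_l2.rep_eq algebra_simps\<close>)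
  show "norm (heat_l2 t x) \<le> norm x" if "0 \<le> t" for t x using norm_heat_l2 that .
  show "heat_l2 0 x = x" for x by (rule l2_eqI) (simp add: coord_heat_l2)
  show "heat_l2 (a + b) x = heat_l2 a (heat_l2 b x)" if "0 \<le> a" "0 \<le> b" for a b x
  proof (rule l2_eqI)
    fix n
    have "exp (- (a + b) * (jap n)\<^sup>2) = exp (- a * (jap n)\<^sup>2) * exp (- b * (jap n)\<^sup>2)"
      by (simp add: exp_add[symmetric] algebra_simps)
    then have "coord (heat_l2 (a + b) x) n = of_real (exp (- a * (jap n)\<^sup>2) * exp (- b * (jap n)\<^sup>2)) * coord x n"
      using that coord_heat_l2[of "a + b"] by simp
    then show "coord (heat_l2 (a + b) x) n = coord (heat_l2 a (heat_l2 b x)) n"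
      using that by (simp only: coord_heat_l2 of_real_mult mult.assoc)
  qed
  show "((\<lambda>h. heat_l2 h x) \<longlongrightarrow> x) (at_right 0)" for x by (rule heat_l2_strong)
qed

section \<open>Infinite matrices\<close>

text \<open>A bound on the operator norm in terms of finite bilinear sections, meaningful before the matrix is known to define an
operator.\<close>
definition mat_bound :: "(int \<Rightarrow> int \<Rightarrow> complex) \<Rightarrow> real \<Rightarrow> bool" where
  "mat_bound A C \<longleftrightarrow> (\<forall>F G g f. finite F \<longrightarrow> finite G \<longrightarrow>
     cmod (\<Sum>n\<in>F. \<Sum>m\<in>G. g n * A n m * f m) \<le> C * L2_set (\<lambda>n. cmod (g n)) F * L2_set (\<lambda>m. cmod (f m)) G)"

definition mat_apply :: "(int \<Rightarrow> int \<Rightarrow> complex) \<Rightarrow> l2 \<Rightarrow> l2" where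
  "mat_apply A x = Abs_l2 (\<lambda>n. \<Sum>\<^sub>\<infinity>m. A n m * coord x m)"

lemma mat_boundD: "mat_bound A C \<Longrightarrow> finite F \<Longrightarrow> finite G \<Longrightarrow>
     cmod (\<Sum>n\<in>F. \<Sum>m\<in>G. g n * A n m * f m) \<le> C * L2_set (\<lambda>n. cmod (g n)) F * L2_set (\<lambda>m. cmod (f m)) G"
  by (simp add: mat_bound_def)

lemma mat_bound_nonneg: "mat_bound A C \<Longrightarrow> C \<ge> 0"
  using mat_boundD[of A C "{0}" "{0}" "\<lambda>_. 1" "\<lambda>_. 1"]
  by (simp add: L2_set_def) (meson norm_ge_zero order_trans)

lemma mat_bound_mono: "mat_bound A C \<Longrightarrow> C \<le> C' \<Longrightarrow> mat_bound A C'"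
  unfolding mat_bound_def by (meson mult_right_mono L2_set_nonneg order_trans)

lemma mat_bound_add: "mat_bound A C \<Longrightarrow> mat_bound A' C' \<Longrightarrow> mat_bound (\<lambda>n m. A n m + A' n m) (C + C')"
  unfolding mat_bound_def
proof (intro allI impI)
  fix F G :: "int set" and g f :: "int \<Rightarrow> complex"
  assume A: "\<forall>F G g f. finite F \<longrightarrow> finite G \<longrightarrow> cmod (\<Sum>n\<in>F. \<Sum>m\<in>G. g n * A n m * f m) \<le> C * L2_set (\<lambda>n. cmod (g n)) F * L2_set (\<lambda>m. cmod (f m)) G"
   "\<forall>F G g f. finite F \<longrightarrow> finite G \<longrightarrow> cmod (\<Sum>n\<in>F. \<Sum>m\<in>G. g n * A' n m * f m) \<le> C' * L2_set (\<lambda>n. cmod (g n)) F * L2_set (\<lambda>m. cmod (f m)) G"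
   and F: "finite F" "finite G"
  have "(\<Sum>n\<in>F. \<Sum>m\<in>G. g n * (A n m + A' n m) * f m) = (\<Sum>n\<in>F. \<Sum>m\<in>G. g n * A n m * f m) + (\<Sum>n\<in>F. \<Sum>m\<in>G. g n * A' n m * f m)"
    by (simp add: sum.distrib[symmetric] algebra_simps)
  then have "cmod (\<Sum>n\<in>F. \<Sum>m\<in>G. g n * (A n m + A' n m) * f m) \<le> cmod (\<Sum>n\<in>F. \<Sum>m\<in>G. g n * A n m * f m) + cmod (\<Sum>n\<in>F. \<Sum>m\<in>G. g n * A' n m * f m)"
    by (simp add: norm_triangle_ineq)
  then show "cmod (\<Sum>n\<in>F. \<Sum>m\<in>G. g n * (A n m + A' n m) * f m) \<le> (C + C') * L2_set (\<lambda>n. cmod (g n)) F * L2_set (\<lambda>m. cmod (f m)) G"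
    using A F by (simp add: distrib_right) (meson add_mono order_trans)
qed

text \<open>Testing the finite sections of a single row with the phases that make every term nonnegative gives absolute convergence, as
demanded by unconditional summation.\<close>
lemma mat_row_summable:
  assumes A: "mat_bound A C"
  shows "(\<lambda>m. cmod (A n m * coord x m)) summable_on UNIV"
proof (rule nonneg_bdd_above_summable_on)
  have "(\<Sum>m\<in>G. cmod (A n m * coord x m)) \<le> C * norm x" if G: "finite G" for G
  proof -
    \<comment> \<open>at zeros of \<open>A\<close> the convention \<open>z / 0 = 0\<close> gives the right value\<close>
    define f where "f m = of_real (cmod (A n m * coord x m)) / A n m" for m
    have f: "cmod (f m) \<le> cmod (coord x m)" for m by (simp add: f_def norm_divide norm_mult)
    have Af: "A n m * f m = of_real (cmod (A n m * coord x m))" for m by (simp add: f_def)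
    have "(\<Sum>m\<in>G. cmod (A n m * coord x m)) = cmod (\<Sum>m\<in>G. A n m * f m)"
      unfolding Af of_real_sum[symmetric] norm_of_real by (simp add: sum_nonneg)
    also have "\<dots> \<le> C * L2_set (\<lambda>m. cmod (f m)) G"
      using mat_boundD[OF A, of "{n}" G "\<lambda>_. 1" f] G by (simp add: L2_set_def)
    also have "\<dots> \<le> C * L2_set (\<lambda>m. cmod (coord x m)) G"
      using mat_bound_nonneg[OF A] f by (intro mult_left_mono L2_set_mono) auto
    also have "\<dots> \<le> C * norm x" using mat_bound_nonneg[OF A] L2_set_le_norm[OF G] by (rule mult_left_mono[rotated])
    finally show ?thesis .
  qed
  then show "bdd_above (sum (\<lambda>m. cmod (A n m * coord x m)) ` {F. F \<subseteq> UNIV \<and> finite F})"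
    by (auto simp: bdd_above_def)
qed simp

lemma mat_row_has_sum: "mat_bound A C \<Longrightarrow> ((\<lambda>m. A n m * coord x m) has_sum (\<Sum>\<^sub>\<infinity>m. A n m * coord x m)) UNIV"
  by (rule has_sum_infsum[OF Infinite_Sum.abs_summable_summable[OF mat_row_summable]])

text \<open>Duality on finite sections: pairing the image with its own conjugate gives \<open>L\<^sup>2 \<le> C L \<parallel>x\<parallel>\<close> for the length \<open>L\<close> of a section.\<close>
lemma mat_apply:
  assumes A: "mat_bound A C"
  shows "coord (mat_apply A x) n = (\<Sum>\<^sub>\<infinity>m. A n m * coord x m)" and "norm (mat_apply A x) \<le> C * norm x"
proof -
  define y where "y n = (\<Sum>\<^sub>\<infinity>m. A n m * coord x m)" for n
  have C: "C \<ge> 0" by (rule mat_bound_nonneg[OF A])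
  have b: "L2_set (\<lambda>n. cmod (y n)) F \<le> C * norm x" if F: "finite F" for F
  proof -
    let ?L = "L2_set (\<lambda>n. cmod (y n)) F"
    have lim: "((\<lambda>G. \<Sum>n\<in>F. cnj (y n) * (\<Sum>m\<in>G. A n m * coord x m)) \<longlongrightarrow> (\<Sum>n\<in>F. cnj (y n) * y n)) (finite_subsets_at_top UNIV)"
      using mat_row_has_sum[OF A] unfolding has_sum_def y_def by (intro tendsto_sum tendsto_mult_left)
    have "cmod (\<Sum>n\<in>F. cnj (y n) * (\<Sum>m\<in>G. A n m * coord x m)) \<le> C * ?L * norm x" if G: "finite G" for G
    proof -
      have "cmod (\<Sum>n\<in>F. cnj (y n) * (\<Sum>m\<in>G. A n m * coord x m)) \<le> C * ?L * L2_set (\<lambda>m. cmod (coord x m)) G"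
        using mat_boundD[OF A F G, of "\<lambda>n. cnj (y n)" "coord x"] by (simp add: sum_distrib_left mult.assoc)
      also have "\<dots> \<le> C * ?L * norm x" using C L2_set_le_norm[OF G] by (intro mult_left_mono) (auto simp: L2_set_nonneg)
      finally show ?thesis .
    qed
    then have "cmod (\<Sum>n\<in>F. cnj (y n) * y n) \<le> C * ?L * norm x"
      by (intro tendsto_upperbound[OF tendsto_norm[OF lim]]) (auto simp: eventually_finite_subsets_at_top)
    also have "(\<Sum>n\<in>F. cnj (y n) * y n) = of_real (?L\<^sup>2)"
      unfolding L2_set_def by (simp add: sum_nonneg complex_norm_square mult.commute del: of_real_power)
    finally have "?L\<^sup>2 \<le> C * ?L * norm x" by (simp only: norm_of_real abs_power2)
    then have "?L * ?L \<le> ?L * (C * norm x)" by (simp add: power2_eq_square mult.commute mult.left_commute)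
    then show ?thesis
      using C L2_set_nonneg[of "\<lambda>n. cmod (y n)" F] by (cases "?L = 0") auto
  qed
  have c: "coord (mat_apply A x) = y" unfolding mat_apply_def y_def[symmetric] by (rule coord_Abs_l2[OF b])
  show "coord (mat_apply A x) n = (\<Sum>\<^sub>\<infinity>m. A n m * coord x m)" by (simp add: c y_def)
  show "norm (mat_apply A x) \<le> C * norm x" by (rule norm_l2_le) (simp add: c b)
qed

lemma mat_apply_has_sum: "mat_bound A C \<Longrightarrow> ((\<lambda>m. A n m * coord x m) has_sum coord (mat_apply A x) n) UNIV"
  using mat_row_has_sum mat_apply(1) by metis

lemma mat_apply_coordI: "mat_bound A C \<Longrightarrow> ((\<lambda>m. A n m * coord x m) has_sum s) UNIV \<Longrightarrow> coord (mat_apply A x) n = s"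
  using mat_apply_has_sum infsumI by metis

lemma mat_apply_linear: assumes A: "mat_bound A C" shows "linear (mat_apply A)"
proof (rule linearI; rule l2_eqI)
  fix x y n and r :: real
  show "coord (mat_apply A (x + y)) n = coord (mat_apply A x + mat_apply A y) n"
    using has_sum_add[OF mat_apply_has_sum[OF A, of n x] mat_apply_has_sum[OF A, of n y]]
    by (intro mat_apply_coordI[OF A]) (simp add: plus_l2.rep_eq distrib_left)
  show "coord (mat_apply A (r *\<^sub>R x)) n = coord (r *\<^sub>R mat_apply A x) n"
    using has_sum_cmult_right[OF mat_apply_has_sum[OF A, of n x], of "of_real r"]
    by (intro mat_apply_coordI[OF A]) (simp add: scaleR_l2.rep_eq mult.left_commute)
qed

section \<open>Sobolev spaces as weighted sequence spaces\<close>

lemma jap_ge_1: "jap n \<ge> 1"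
  by (simp add: jap_def)

lemma jap_pos: "jap n > 0"
  using jap_ge_1[of n] by linarith

text \<open>The isometry \<open>f \<mapsto> (\<langle>n\<rangle>\<^sup>s f\<^sub>n)\<close> from \<open>H\<^sup>s\<close> onto \<open>\<ell>\<^sup>2\<close>, which commutes with the heat semigroup.\<close>
definition emb :: "real \<Rightarrow> torus_fun \<Rightarrow> l2" where
  "emb s f = Abs_l2 (\<lambda>n. of_real (jap n powr s) * f n)"

definition unemb :: "real \<Rightarrow> l2 \<Rightarrow> torus_fun" where
  "unemb s x = (\<lambda>n. of_real (jap n powr - s) * coord x n)"

lemma weight_square: "(cmod (of_real (jap n powr s) * z))\<^sup>2 = jap n powr (2 * s) * (cmod z)\<^sup>2"
proof -
  have "(jap n powr s)\<^sup>2 = jap n powr (2 * s)" unfolding power2_eq_square powr_add[symmetric] by simp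
  then show ?thesis by (simp add: norm_mult power_mult_distrib)
qed

lemma coord_emb:
  assumes "f \<in> sobolev s" shows "coord (emb s f) n = of_real (jap n powr s) * f n"
proof -
  let ?g = "\<lambda>n. of_real (jap n powr s) * f n"
  have "(\<lambda>n. (cmod (?g n))\<^sup>2) summable_on UNIV" using assms unfolding sobolev_def weight_square by simp
  then have "coord (emb s f) = ?g" unfolding emb_def by (rule coord_Abs_l2[OF square_summable_bound])
  then show ?thesis by simp
qed

lemma norm_emb: "f \<in> sobolev s \<Longrightarrow> norm (emb s f) = sobolev_norm s f"
  unfolding norm_l2_infsum(2) sobolev_norm_def by (simp add: coord_emb weight_square)

lemma unemb_sobolev: "unemb s x \<in> sobolev s"
proof -
  have "jap n powr (2 * s) * (cmod (unemb s x n))\<^sup>2 = (cmod (coord x n))\<^sup>2" for n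
    unfolding weight_square[symmetric] unemb_def mult.assoc[symmetric] of_real_mult[symmetric] powr_add[symmetric]
    using jap_pos[of n] by simp
  then show ?thesis unfolding sobolev_def using norm_l2_infsum(1)[of x] by simp
qed

lemma emb_unemb: "emb s (unemb s x) = x"
proof (rule l2_eqI)
  fix n
  have "jap n powr s * jap n powr - s = 1" using jap_pos[of n] by (simp add: powr_add[symmetric])
  then show "coord (emb s (unemb s x)) n = coord x n"
    unfolding coord_emb[OF unemb_sobolev] unfolding unemb_def mult.assoc[symmetric] of_real_mult[symmetric] by simp
qed

lemma unemb_emb: assumes "f \<in> sobolev s" shows "unemb s (emb s f) = f"
proof
  fix n
  have "jap n powr - s * jap n powr s = 1" using jap_pos[of n] by (simp add: powr_add[symmetric])
  then show "unemb s (emb s f) n = f n"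
    by (simp add: unemb_def coord_emb[OF assms] mult.assoc[symmetric] of_real_mult[symmetric] del: of_real_mult)
qed

lemma emb_eqD: "emb s f = emb s g \<Longrightarrow> f \<in> sobolev s \<Longrightarrow> g \<in> sobolev s \<Longrightarrow> f = g"
  using unemb_emb by metis

lemma unemb_add: "unemb s (x + y) = (\<lambda>n. unemb s x n + unemb s y n)"
  and unemb_diff: "unemb s (x - y) = unemb s x - unemb s y"
  and unemb_sum: "unemb s (\<Sum>j\<in>I. z j) = (\<lambda>n. \<Sum>j\<in>I. unemb s (z j) n)"
proof -
  show a: "unemb s (x + y) = (\<lambda>n. unemb s x n + unemb s y n)" for x y
    by (simp add: unemb_def plus_l2.rep_eq distrib_left)
  show "unemb s (x - y) = unemb s x - unemb s y"
    by (simp add: unemb_def minus_l2.rep_eq right_diff_distrib fun_eq_iff)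
  have z: "unemb s 0 = (\<lambda>n. 0)" by (simp add: unemb_def zero_l2.rep_eq)
  show "unemb s (\<Sum>j\<in>I. z j) = (\<lambda>n. \<Sum>j\<in>I. unemb s (z j) n)"
    by (induction I rule: infinite_finite_induct) (auto simp: a z)
qed

lemma sobolev_add: "f \<in> sobolev s \<Longrightarrow> g \<in> sobolev s \<Longrightarrow> (\<lambda>n. f n + g n) \<in> sobolev s"
  and sobolev_diff: "f \<in> sobolev s \<Longrightarrow> g \<in> sobolev s \<Longrightarrow> f - g \<in> sobolev s"
  using unemb_add[of s "emb s f" "emb s g"] unemb_diff[of s "emb s f" "emb s g"]
    unemb_sobolev[of s "emb s f + emb s g"] unemb_sobolev[of s "emb s f - emb s g"] by (simp_all add: unemb_emb)

lemma emb_add: "f \<in> sobolev s \<Longrightarrow> g \<in> sobolev s \<Longrightarrow> emb s (\<lambda>n. f n + g n) = emb s f + emb s g"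
  and emb_diff: "f \<in> sobolev s \<Longrightarrow> g \<in> sobolev s \<Longrightarrow> emb s (f - g) = emb s f - emb s g"
  using unemb_add[of s "emb s f" "emb s g"] unemb_diff[of s "emb s f" "emb s g"] 
    emb_unemb[of s "emb s f + emb s g"] emb_unemb[of s "emb s f - emb s g"] by (simp_all add: unemb_emb)

lemma unemb_heat: "t \<ge> 0 \<Longrightarrow> unemb s (heat_l2 t x) = heat t (unemb s x)"
  by (simp add: unemb_def heat_def fourier_multiplier_def coord_heat_l2 mult.left_commute)

lemma heat_sobolev: "t \<ge> 0 \<Longrightarrow> f \<in> sobolev s \<Longrightarrow> heat t f \<in> sobolev s"
  and emb_heat: "t \<ge> 0 \<Longrightarrow> f \<in> sobolev s \<Longrightarrow> emb s (heat t f) = heat_l2 t (emb s f)"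
  using unemb_heat[of t s "emb s f"] unemb_sobolev[of s "heat_l2 t (emb s f)"] emb_unemb[of s "heat_l2 t (emb s f)"]
  by (simp_all add: unemb_emb)

section \<open>From matrix bounds to well-posedness\<close>

text \<open>The deterministic properties of one path of the driver that suffice for well-posedness. The matrix \<open>A t r\<close> acts on
\<open>\<ell>\<^sup>2\<close>, that is, it includes the Sobolev weights. Only for \<open>r < t\<close> is \<open>X\<close> tied to \<open>A\<close>, since \<open>X\<close> is a driver only there.\<close>
locale driver_path =
  fixes s \<alpha> \<gamma> :: real and A :: "real \<Rightarrow> real \<Rightarrow> int \<Rightarrow> int \<Rightarrow> complex"
    and X :: "real \<Rightarrow> real \<Rightarrow> torus_fun \<Rightarrow> torus_fun"
  assumes \<alpha>: "1 / 2 < \<alpha>" and \<alpha>\<gamma>: "\<alpha> < \<gamma>" and \<gamma>: "\<gamma> < 1"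
    and A_bound: "T > 0 \<Longrightarrow> \<exists>K. \<forall>r t. 0 \<le> r \<longrightarrow> r \<le> t \<longrightarrow> t \<le> T \<longrightarrow> mat_bound (A t r) (K * (t - r) powr \<gamma>)"
    and A_chen: "0 \<le> r \<Longrightarrow> r \<le> q \<Longrightarrow> q \<le> t \<Longrightarrow>
      A t r n m = A t q n m * of_real (exp (- (q - r) * (jap m)\<^sup>2)) + of_real (exp (- (t - q) * (jap n)\<^sup>2)) * A q r n m"
    and A_continuous: "(t, r) \<in> simplex2 T \<Longrightarrow> \<epsilon> > 0 \<Longrightarrow>
      \<forall>\<^sub>F z in at (t, r) within simplex2 T. mat_bound (\<lambda>n m. A (fst z) (snd z) n m - A t r n m) \<epsilon>"
    and X_eq: "0 \<le> r \<Longrightarrow> r < t \<Longrightarrow> f \<in> sobolev s \<Longrightarrow> X t r f = unemb s (mat_apply (A t r) (emb s f))"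
begin

definition XL :: "real \<Rightarrow> real \<Rightarrow> l2 \<Rightarrow> l2" where "XL t r = mat_apply (A t r)"

lemma A_bounded: "0 \<le> r \<Longrightarrow> r \<le> t \<Longrightarrow> \<exists>C. mat_bound (A t r) C"
  using A_bound[of "t + 1"] by fastforce

text \<open>Chen's relation passes from the entries to the operators since matrix rows are absolutely summable against \<open>\<ell>\<^sup>2\<close>.\<close>
lemma young_T:
  assumes T: "T > 0"
  shows "\<exists>K. young_equation heat_l2 XL K \<gamma> \<alpha> T"
proof -
  obtain K where K: "\<And>r t. 0 \<le> r \<Longrightarrow> r \<le> t \<Longrightarrow> t \<le> T \<Longrightarrow> mat_bound (A t r) (K * (t - r) powr \<gamma>)"
    using A_bound[OF T] by blast
  have "mat_bound (A T 0) (K * (T - 0) powr \<gamma>)" using T by (intro K) auto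
  then have K0: "K \<ge> 0" using mat_bound_nonneg T by (fastforce simp: zero_le_mult_iff)
  have "young_equation_axioms heat_l2 XL K \<gamma> \<alpha> T"
  proof (rule young_equation_axioms.intro)
    fix r t :: real and x assume r: "0 \<le> r" "r \<le> t" "t \<le> T"
    show "linear (XL t r)" unfolding XL_def by (rule mat_apply_linear[OF K[OF r]])
    show "norm (XL t r x) \<le> K * (t - r) powr \<gamma> * norm x" unfolding XL_def by (rule mat_apply(2)[OF K[OF r]])
  next
    fix r q t :: real and x assume r: "0 \<le> r" "r \<le> q" "q \<le> t" "t \<le> T"
    note b = K[of r t] K[of q t] K[of r q]
    show "XL t r x = XL t q (heat_l2 (q - r) x) + heat_l2 (t - q) (XL q r x)"
    proof (rule l2_eqI)
      fix n
      have "((\<lambda>m. A t q n m * coord (heat_l2 (q - r) x) m) has_sum coord (XL t q (heat_l2 (q - r) x)) n) UNIV"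
        "((\<lambda>m. of_real (exp (- (t - q) * (jap n)\<^sup>2)) * (A q r n m * coord x m)) has_sum
           of_real (exp (- (t - q) * (jap n)\<^sup>2)) * coord (XL q r x) n) UNIV"
        unfolding XL_def using b r by (auto intro!: mat_apply_has_sum has_sum_cmult_right)
      then have "((\<lambda>m. A t q n m * coord (heat_l2 (q - r) x) m + of_real (exp (- (t - q) * (jap n)\<^sup>2)) * (A q r n m * coord x m)) has_sum
        coord (XL t q (heat_l2 (q - r) x)) n + of_real (exp (- (t - q) * (jap n)\<^sup>2)) * coord (XL q r x) n) UNIV"
        by (rule has_sum_add)
      moreover have "A t q n m * coord (heat_l2 (q - r) x) m + of_real (exp (- (t - q) * (jap n)\<^sup>2)) * (A q r n m * coord x m)
         = A t r n m * coord x m" for m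
        using r by (simp only: A_chen[OF r(1-3)] coord_heat_l2 diff_ge_0_iff_ge distrib_right mult.assoc)
      ultimately show "coord (XL t r x) n = coord (XL t q (heat_l2 (q - r) x) + heat_l2 (t - q) (XL q r x)) n"
        unfolding plus_l2.rep_eq using r b(1) by (simp add: coord_heat_l2) (simp add: XL_def mat_apply_coordI)
    qed
  qed (use T K0 \<alpha> \<alpha>\<gamma> \<gamma> in auto)
  then show ?thesis using heat_l2.contraction_semigroup_axioms young_equation.intro by blast
qed

abbreviation sol :: "real \<Rightarrow> l2 \<Rightarrow> (real \<Rightarrow> l2) \<Rightarrow> bool" where
  "sol T \<equiv> young_equation.solves heat_l2 XL \<alpha> T"

lemma delta_hat_emb:
  assumes "0 \<le> r" "r \<le> t" "u t \<in> sobolev s" "u r \<in> sobolev s"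
  shows "delta_hat u t r \<in> sobolev s" "emb s (delta_hat u t r) = heat_l2.dlt (\<lambda>t. emb s (u t)) t r"
  using assms unfolding delta_hat_def heat_l2.dlt_def
  by (simp_all add: sobolev_diff heat_sobolev emb_diff emb_heat)

text \<open>The Hoelder bound alone characterises the path space, as it implies that the path and hence its mild
increment are continuous.\<close>
lemma hat_C_iff:
  assumes T: "T > 0" and Y: "young_equation heat_l2 XL K \<gamma> \<alpha> T"
  shows "u \<in> hat_C s \<alpha> T \<longleftrightarrow> (\<forall>t\<in>{0..T}. u t \<in> sobolev s) \<and> (\<exists>C\<ge>0. young_equation.bnd heat_l2 \<alpha> T 0 C (\<lambda>t. emb s (u t)))"
proof -
  interpret Y: young_equation heat_l2 XL K \<gamma> \<alpha> T by (rule Y)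
  let ?U = "\<lambda>t. emb s (u t)"
  show ?thesis
  proof (intro iffI conjI)
    assume u: "u \<in> hat_C s \<alpha> T"
    then show us: "\<forall>t\<in>{0..T}. u t \<in> sobolev s" by (simp add: hat_C_def)
    obtain C1 where C1: "\<And>t. t \<in> {0..T} \<Longrightarrow> sobolev_norm s (u t) \<le> C1"
      using u unfolding hat_C_def by blast
    obtain C2 where C2: "\<And>t r. (t, r) \<in> simplex2 T \<Longrightarrow> sobolev_norm s (delta_hat u t r) / \<bar>t - r\<bar> powr \<alpha> \<le> C2"
      using u unfolding hat_C_def C2_def by blast
    define C where "C = max (max C1 C2) 0"
    have "Y.bnd 0 C ?U" unfolding Y.bnd_def
    proof (intro conjI ballI allI impI)
      fix t assume t: "t \<in> {0..T}"
      then have "norm (?U t) \<le> C1" using C1[OF t] us by (simp add: norm_emb)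
      then show "norm (?U t) \<le> C * exp (0 * t)" by (simp add: C_def)
    next
      fix r t assume t: "0 \<le> r" "r \<le> t" "t \<le> T"
      show "norm (heat_l2.dlt ?U t r) \<le> C * exp (0 * t) * (t - r) powr \<alpha>"
      proof (cases "r = t")
        case True
        then show ?thesis by (simp add: heat_l2.dlt_def heat_l2.S_0)
      next
        case False
        then have r: "(t, r) \<in> simplex2 T" "t - r > 0" using t by (auto simp: simplex2_def)
        have "sobolev_norm s (delta_hat u t r) \<le> C2 * (t - r) powr \<alpha>"
          using C2[OF r(1)] r(2) by (simp add: divide_le_eq)
        also have "\<dots> \<le> C * (t - r) powr \<alpha>" by (intro mult_right_mono) (auto simp: C_def)
        finally show ?thesis using delta_hat_emb[of r t u] us t by (simp add: norm_emb[symmetric])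
      qed
    qed
    then show "\<exists>C\<ge>0. Y.bnd 0 C ?U" by (intro exI[of _ C]) (auto simp: C_def)
  next
    assume "(\<forall>t\<in>{0..T}. u t \<in> sobolev s) \<and> (\<exists>C\<ge>0. Y.bnd 0 C ?U)"
    then obtain C where us: "\<And>t. t\<in>{0..T} \<Longrightarrow> u t \<in> sobolev s" and C: "C \<ge> 0" "Y.bnd 0 C ?U" by blast
    have ds: "delta_hat u t r \<in> sobolev s" "emb s (delta_hat u t r) = heat_l2.dlt ?U t r"
      if "(t, r) \<in> simplex2 T" for t r using delta_hat_emb[of r t u] us that by (auto simp: simplex2_def)
    have d: "norm (heat_l2.dlt ?U t r) \<le> C * (t - r) powr \<alpha>" if "0 \<le> r" "r \<le> t" "t \<le> T" for r t
      using Y.bndD2[OF C(2) that] by simp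
    have "C2 (sobolev s) (sobolev_norm s) \<alpha> T (delta_hat u)"
      unfolding C2_def
    proof (intro conjI ballI)
      fix z assume z: "z \<in> simplex2 T"
      obtain t r where tr: "z = (t, r)" by force
      show "case z of (t, r) \<Rightarrow> delta_hat u t r \<in> sobolev s" using ds z tr by simp
      have "((\<lambda>(t', r'). heat_l2.dlt ?U t' r') \<longlongrightarrow> heat_l2.dlt ?U t r) (at (t, r) within simplex2 T)"
        by (rule heat_l2.dlt_continuous[OF _ C(1) d]) (use \<alpha> z tr in auto)
      then have "((\<lambda>z. norm ((case z of (t', r') \<Rightarrow> heat_l2.dlt ?U t' r') - heat_l2.dlt ?U t r)) \<longlongrightarrow> 0) (at (t, r) within simplex2 T)"
        by (intro tendsto_norm_zero LIM_zero)
      moreover have "\<forall>\<^sub>F z in at (t, r) within simplex2 T. norm ((case z of (t', r') \<Rightarrow> heat_l2.dlt ?U t' r') - heat_l2.dlt ?U t r)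
         = (case z of (t', r') \<Rightarrow> sobolev_norm s (delta_hat u t' r' - delta_hat u t r))"
        unfolding eventually_at_filter using z tr
        by (intro always_eventually) (auto simp: norm_emb[symmetric] sobolev_diff ds emb_diff)
      ultimately show "case z of (t, r) \<Rightarrow> ((\<lambda>(t', r'). sobolev_norm s (delta_hat u t' r' - delta_hat u t r)) \<longlongrightarrow> 0) (at (t, r) within simplex2 T)"
        unfolding tr prod.case by (rule Lim_transform_eventually)
    next
      have "sobolev_norm s (delta_hat u t r) / \<bar>t - r\<bar> powr \<alpha> \<le> C" if "(t, r) \<in> simplex2 T" for t r
        using d[of r t] ds[OF that] that by (simp add: simplex2_def divide_le_eq norm_emb[symmetric])
      then show "\<exists>C. \<forall>(t, r)\<in>simplex2 T. sobolev_norm s (delta_hat u t r) / \<bar>t - r\<bar> powr \<alpha> \<le> C" by (intro exI[of _ C]) auto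
    qed
    moreover have "sobolev_norm s (u t) \<le> C" if "t \<in> {0..T}" for t
      using Y.bndD1[OF C(2), of t] us that by (simp add: norm_emb[symmetric])
    ultimately show "u \<in> hat_C s \<alpha> T" using us unfolding hat_C_def by blast
  qed
qed

lemma young_integral_iff:
  assumes Y: "young_equation heat_l2 XL K \<gamma> \<alpha> T" and us: "\<And>t. t \<in> {0..T} \<Longrightarrow> u t \<in> sobolev s" and t: "t \<in> {0..T}"
  shows "has_young_integral s X u t J \<longleftrightarrow> J \<in> sobolev s \<and> young_equation.young_at heat_l2 XL (\<lambda>t. emb s (u t)) t (emb s J)"
proof (cases "J \<in> sobolev s")
  case True
  interpret Y: young_equation heat_l2 XL K \<gamma> \<alpha> T by (rule Y)
  have eq: "young_sum X u t N p = unemb s (Y.psum (\<lambda>t. emb s (u t)) t N p)" if p: "is_partition t N p" for N p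
  proof -
    have "heat (t - p j) (X (p j) (p (Suc j)) (u (p (Suc j)))) = unemb s (Y.inc (\<lambda>t. emb s (u t)) t (p (Suc j)) (p j))"
      if j: "j < N" for j
    proof -
      have "0 \<le> p (Suc j)" "p (Suc j) < p j" "p j \<le> t"
        using is_partition_range[OF p, of "Suc j"] is_partition_range[OF p, of j] j p by (auto simp: is_partition_def)
      then show ?thesis using us[of "p (Suc j)"] t by (simp add: Y.inc_def unemb_heat X_eq XL_def)
    qed
    then show ?thesis unfolding young_sum_def Y.psum_def unemb_sum by (intro ext sum.cong) auto
  qed
  have "sobolev_norm s (young_sum X u t N p - J) = norm (Y.psum (\<lambda>t. emb s (u t)) t N p - emb s J)"
     "young_sum X u t N p \<in> sobolev s" if "is_partition t N p" for N p
    unfolding eq[OF that] by (simp_all add: unemb_sobolev norm_emb[symmetric] sobolev_diff True emb_diff emb_unemb)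
  then show ?thesis unfolding has_young_integral_def Y.young_at_def using True by auto
next
  case False
  then show ?thesis by (simp add: has_young_integral_def)
qed

lemma mild_solution_iff:
  assumes T: "T > 0" and u0: "u\<^sub>0 \<in> sobolev s"
  shows "mild_solution s \<alpha> T X u\<^sub>0 u \<longleftrightarrow> (\<forall>t\<in>{0..T}. u t \<in> sobolev s) \<and> sol T (emb s u\<^sub>0) (\<lambda>t. emb s (u t))"
proof -
  obtain K where Y: "young_equation heat_l2 XL K \<gamma> \<alpha> T" using young_T[OF T] by blast
  interpret Y: young_equation heat_l2 XL K \<gamma> \<alpha> T by (rule Y)
  have "(\<exists>J. has_young_integral s X u t J \<and> u t = (\<lambda>n. heat t u\<^sub>0 n + J n)) \<longleftrightarrow>
     (\<exists>J. Y.young_at (\<lambda>t. emb s (u t)) t J \<and> emb s (u t) = heat_l2 t (emb s u\<^sub>0) + J)"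
    if us: "\<And>t. t \<in> {0..T} \<Longrightarrow> u t \<in> sobolev s" and t: "t \<in> {0..T}" for t
  proof -
    have yi: "has_young_integral s X u t J \<longleftrightarrow> J \<in> sobolev s \<and> Y.young_at (\<lambda>t. emb s (u t)) t (emb s J)" for J
      by (rule young_integral_iff[OF Y _ t]) (rule us)
    show ?thesis
  proof
    assume "\<exists>J. has_young_integral s X u t J \<and> u t = (\<lambda>n. heat t u\<^sub>0 n + J n)"
    then obtain J where J: "J \<in> sobolev s" "Y.young_at (\<lambda>t. emb s (u t)) t (emb s J)" "u t = (\<lambda>n. heat t u\<^sub>0 n + J n)"
      using yi by blast
    then show "\<exists>J. Y.young_at (\<lambda>t. emb s (u t)) t J \<and> emb s (u t) = heat_l2 t (emb s u\<^sub>0) + J"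
      using t u0 by (intro exI[of _ "emb s J"]) (auto simp: emb_add heat_sobolev emb_heat)
  next
    assume "\<exists>J. Y.young_at (\<lambda>t. emb s (u t)) t J \<and> emb s (u t) = heat_l2 t (emb s u\<^sub>0) + J"
    then obtain J where J: "Y.young_at (\<lambda>t. emb s (u t)) t J" "emb s (u t) = heat_l2 t (emb s u\<^sub>0) + J" by blast
    have "u t = (\<lambda>n. heat t u\<^sub>0 n + unemb s J n)"
      using arg_cong[OF J(2), of "unemb s"] us[OF t] t u0 by (simp add: unemb_emb unemb_add unemb_heat)
    moreover have "has_young_integral s X u t (unemb s J)"
      unfolding yi using J by (simp add: unemb_sobolev emb_unemb)
    ultimately show "\<exists>J. has_young_integral s X u t J \<and> u t = (\<lambda>n. heat t u\<^sub>0 n + J n)" by blast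
  qed
  qed
  then show ?thesis unfolding mild_solution_def hat_C_iff[OF T Y] Y.solves_def by auto
qed

lemma sol_restrict:
  assumes "sol T x U" "0 < T'" "T' \<le> T"
  shows "sol T' x U"
proof -
  have "T > 0" using assms by simp
  obtain K where Y: "young_equation heat_l2 XL K \<gamma> \<alpha> T" using young_T[OF \<open>T > 0\<close>] by blast
  obtain K' where Y': "young_equation heat_l2 XL K' \<gamma> \<alpha> T'" using young_T[OF \<open>T' > 0\<close>] by blast
  have "young_equation.bnd heat_l2 \<alpha> T 0 C U \<Longrightarrow> young_equation.bnd heat_l2 \<alpha> T' 0 C U" for C
    unfolding young_equation.bnd_def[OF Y] young_equation.bnd_def[OF Y'] using assms(3) by auto
  then show ?thesis using assms unfolding young_equation.solves_def[OF Y] young_equation.solves_def[OF Y'] by auto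
qed

lemma sol_cong:
  assumes "T > 0" "\<And>t. t \<in> {0..T} \<Longrightarrow> U t = V t" "sol T x U"
  shows "sol T x V"
proof -
  obtain K where Y: "young_equation heat_l2 XL K \<gamma> \<alpha> T" using young_T[OF \<open>T > 0\<close>] by blast
  interpret Y: young_equation heat_l2 XL K \<gamma> \<alpha> T by (rule Y)
  have "Y.young_at U t J = Y.young_at V t J" if "t \<in> {0..T}" for t J
    by (rule Y.young_at_cong) (use assms that in auto)
  then show ?thesis using assms Y.bnd_cong[of U V] unfolding Y.solves_def by auto
qed

lemma sol_unique: "T > 0 \<Longrightarrow> sol T x U \<Longrightarrow> sol T x V \<Longrightarrow> t \<in> {0..T} \<Longrightarrow> U t = V t"
  using young_T[of T] young_equation.solution_unique by blast

text \<open>By uniqueness the solutions on different intervals agree, so the value at \<open>t\<close> may be taken from the solution on \<open>[0, t + 1]\<close>.\<close>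
lemma sol_global: "\<exists>U. \<forall>T>0. sol T x U"
proof -
  have "\<exists>U. sol T x U" if "T > 0" for T using young_T[OF that] young_equation.solution_exists by blast
  then obtain V where V: "\<And>T. T > 0 \<Longrightarrow> sol T x (V T)" by metis
  have "sol T x (\<lambda>t. V (t + 1) t)" if T: "T > 0" for T
  proof (rule sol_cong[OF T _ V[OF T]])
    fix t assume t: "t \<in> {0..T}"
    let ?m = "min T (t + 1)"
    have "sol ?m x (V T)" "sol ?m x (V (t + 1))"
      using sol_restrict[OF V[of T], of ?m] sol_restrict[OF V[of "t + 1"], of ?m] T t by auto
    then show "V T t = V (t + 1) t" using sol_unique[of ?m x "V T" "V (t + 1)" t] t T by auto
  qed
  then show ?thesis by blast
qed

lemma global_unique:
  assumes u0: "u\<^sub>0 \<in> sobolev s"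
  shows "\<exists>!u. global_solution s \<alpha> X u\<^sub>0 u"
proof -
  obtain U where U: "\<And>T. T > 0 \<Longrightarrow> sol T (emb s u\<^sub>0) U" using sol_global by blast
  define u where "u = (\<lambda>t\<in>{0..}. unemb s (U t))"
  show ?thesis
  proof (rule ex1I[of _ u])
    have "mild_solution s \<alpha> T X u\<^sub>0 u" if T: "T > 0" for T
      unfolding mild_solution_iff[OF T u0]
      using sol_cong[OF T _ U[OF T], of "\<lambda>t. emb s (u t)"] by (auto simp: u_def unemb_sobolev emb_unemb)
    then show "global_solution s \<alpha> X u\<^sub>0 u" by (simp add: global_solution_def u_def)
  next
    fix v assume v: "global_solution s \<alpha> X u\<^sub>0 v"
    have "v t = u t" for t
    proof (cases "t \<ge> 0")
      case True
      then have T: "t + 1 > 0" by simp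
      have "mild_solution s \<alpha> (t + 1) X u\<^sub>0 v" using v T by (simp add: global_solution_def)
      then have w: "v t \<in> sobolev s" "sol (t + 1) (emb s u\<^sub>0) (\<lambda>t. emb s (v t))"
        unfolding mild_solution_iff[OF T u0] using True by auto
      have "emb s (v t) = U t" using sol_unique[OF T w(2) U[OF T]] True by simp
      then show ?thesis using unemb_emb[OF w(1)] True by (simp add: u_def)
    next
      case False
      then show ?thesis using v by (simp add: global_solution_def u_def extensional_def)
    qed
    then show "v = u" by blast
  qed
qed

theorem well_posed: "well_posed s \<alpha> X"
  unfolding well_posed_def
proof (intro conjI ballI allI impI global_unique)
  fix u\<^sub>0 T u v t assume u0: "u\<^sub>0 \<in> sobolev s" and T: "(0::real) < T" and t: "t \<in> {0..T}"
    and "mild_solution s \<alpha> T X u\<^sub>0 u" "mild_solution s \<alpha> T X u\<^sub>0 v"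
  then have w: "u t \<in> sobolev s" "sol T (emb s u\<^sub>0) (\<lambda>t. emb s (u t))" "v t \<in> sobolev s" "sol T (emb s u\<^sub>0) (\<lambda>t. emb s (v t))"
    unfolding mild_solution_iff[OF T u0] by auto
  show "u t = v t" using sol_unique[OF T w(2,4) t] w(1,3) by (rule emb_eqD)
next
  fix T :: real assume T: "T > 0"
  obtain K where Y: "young_equation heat_l2 XL K \<gamma> \<alpha> T" using young_T[OF T] by blast
  interpret Y: young_equation heat_l2 XL K \<gamma> \<alpha> T by (rule Y)
  let ?F = "solution_map s \<alpha> X"
  have F: "(\<forall>t\<in>{0..T}. ?F u\<^sub>0 t \<in> sobolev s) \<and> sol T (emb s u\<^sub>0) (\<lambda>t. emb s (?F u\<^sub>0 t))" if "u\<^sub>0 \<in> sobolev s" for u\<^sub>0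
  proof -
    have "global_solution s \<alpha> X u\<^sub>0 (?F u\<^sub>0)" unfolding solution_map_def by (rule theI'[OF global_unique[OF that]])
    then have "mild_solution s \<alpha> T X u\<^sub>0 (?F u\<^sub>0)" using T by (simp add: global_solution_def)
    then show ?thesis unfolding mild_solution_iff[OF T that] .
  qed
  obtain C where C: "C > 0" "\<And>x y u w t. sol T x u \<Longrightarrow> sol T y w \<Longrightarrow> t \<in> {0..T} \<Longrightarrow> norm (u t - w t) \<le> C * norm (x - y)"
    using Y.solution_gap by blast
  show "continuous_into_paths s T ?F"
    unfolding continuous_into_paths_def
  proof (intro conjI ballI allI impI)
    fix u\<^sub>0 assume u0: "u\<^sub>0 \<in> sobolev s"
    let ?U = "\<lambda>t. emb s (?F u\<^sub>0 t)"
    obtain B where B: "B \<ge> 0" "Y.bnd 0 B ?U" using F[OF u0] unfolding Y.solves_def by blast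
    show "continuous_path s T (?F u\<^sub>0)"
      unfolding continuous_path_def
    proof (intro conjI ballI)
      fix t assume t: "t \<in> {0..T}"
      show "?F u\<^sub>0 t \<in> sobolev s" using F[OF u0] t by blast
      have "(?U \<longlongrightarrow> ?U t) (at t within {0..T})"
        by (rule heat_l2.holder_continuous[of \<alpha> B]) (use \<alpha> B Y.bndD2[OF B(2)] t in auto)
      then have "((\<lambda>t'. norm (?U t' - ?U t)) \<longlongrightarrow> 0) (at t within {0..T})" by (intro tendsto_norm_zero LIM_zero)
      moreover have "\<forall>\<^sub>F t' in at t within {0..T}. norm (?U t' - ?U t) = sobolev_norm s (?F u\<^sub>0 t' - ?F u\<^sub>0 t)"
        unfolding eventually_at_filter using F[OF u0] t
        by (intro always_eventually) (auto simp: norm_emb[symmetric] sobolev_diff emb_diff)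
      ultimately show "((\<lambda>t'. sobolev_norm s (?F u\<^sub>0 t' - ?F u\<^sub>0 t)) \<longlongrightarrow> 0) (at t within {0..T})"
        by (rule Lim_transform_eventually)
    qed
  next
    fix u\<^sub>0 and \<epsilon> :: real assume u0: "u\<^sub>0 \<in> sobolev s" and \<epsilon>: "\<epsilon> > 0"
    have "sobolev_norm s (?F v\<^sub>0 t - ?F u\<^sub>0 t) < \<epsilon>"
      if v0: "v\<^sub>0 \<in> sobolev s" and d: "sobolev_norm s (v\<^sub>0 - u\<^sub>0) < \<epsilon> / C" and t: "t \<in> {0..T}" for v\<^sub>0 t
    proof -
      have "sobolev_norm s (?F v\<^sub>0 t - ?F u\<^sub>0 t) = norm (emb s (?F v\<^sub>0 t) - emb s (?F u\<^sub>0 t))"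
        using F[OF u0] F[OF v0] t by (simp add: norm_emb[symmetric] sobolev_diff emb_diff)
      also have "\<dots> \<le> C * norm (emb s v\<^sub>0 - emb s u\<^sub>0)" using C(2)[OF _ _ t] F[OF u0] F[OF v0] by blast
      also have "\<dots> = C * sobolev_norm s (v\<^sub>0 - u\<^sub>0)" using u0 v0 by (simp add: norm_emb[symmetric] sobolev_diff emb_diff)
      also have "\<dots> < \<epsilon>" using d C(1) by (simp add: field_simps)
      finally show ?thesis .
    qed
    then show "\<exists>\<delta>>0. \<forall>v\<^sub>0\<in>sobolev s. sobolev_norm s (v\<^sub>0 - u\<^sub>0) < \<delta> \<longrightarrow> (\<forall>t\<in>{0..T}. sobolev_norm s (?F v\<^sub>0 t - ?F u\<^sub>0 t) < \<epsilon>)"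
      using \<epsilon> C(1) by (intro exI[of _ "\<epsilon> / C"]) auto
  qed
qed

lemma X_bounded_op:
  assumes r: "0 \<le> r" "r < t"
  shows "X t r \<in> bounded_ops s"
proof -
  obtain C where C: "mat_bound (A t r) C" using A_bounded r by force
  note XX = X_eq[OF r]
  have lin: "linear (mat_apply (A t r))" by (rule mat_apply_linear[OF C])
  have scale: "(\<lambda>n. c * f n) \<in> sobolev s" if "f \<in> sobolev s" for c f
    using that unfolding sobolev_def
    by (auto simp: norm_mult power_mult_distrib mult.left_commute intro!: summable_on_cmult_right)
  have "X t r (\<lambda>n. c * f n) = (\<lambda>n. c * X t r f n)" if f: "f \<in> sobolev s" for c f
  proof
    fix n
    have "((\<lambda>m. c * (A t r n m * coord (emb s f) m)) has_sum c * coord (mat_apply (A t r) (emb s f)) n) UNIV"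
      by (intro has_sum_cmult_right mat_apply_has_sum[OF C])
    then have "coord (mat_apply (A t r) (emb s (\<lambda>n. c * f n))) n = c * coord (mat_apply (A t r) (emb s f)) n"
      by (intro mat_apply_coordI[OF C]) (simp add: coord_emb f scale mult.left_commute)
    then show "X t r (\<lambda>n. c * f n) n = c * X t r f n"
      by (simp add: XX f scale unemb_def mult.left_commute)
  qed
  moreover have "sobolev_norm s (X t r f) \<le> C * sobolev_norm s f" if f: "f \<in> sobolev s" for f
    using mat_apply(2)[OF C, of "emb s f"] f by (simp add: XX norm_emb[symmetric] unemb_sobolev emb_unemb)
  ultimately show ?thesis unfolding bounded_ops_def
    by (auto simp: XX unemb_sobolev sobolev_add emb_add linear_add[OF lin] unemb_add intro!: exI[of _ C])
qed

lemma op_norm_le: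
  assumes L: "\<And>f. f \<in> sobolev s \<Longrightarrow> L f = unemb s (mat_apply D (emb s f))" and D: "mat_bound D C"
  shows "op_norm s L \<le> C" "0 \<le> op_norm s L"
proof -
  let ?B = "{f \<in> sobolev s. sobolev_norm s f \<le> 1}"
  have z: "(\<lambda>_. 0) \<in> ?B" by (simp add: sobolev_def sobolev_norm_def)
  have b: "sobolev_norm s (L f) \<le> C" if "f \<in> ?B" for f
  proof -
    have "sobolev_norm s (L f) \<le> C * norm (emb s f)"
      using mat_apply(2)[OF D, of "emb s f"] that by (simp add: L norm_emb[symmetric] unemb_sobolev emb_unemb)
    also have "\<dots> \<le> C * 1" using that mat_bound_nonneg[OF D] by (intro mult_left_mono) (auto simp: norm_emb)
    finally show ?thesis by simp
  qed
  show "op_norm s L \<le> C" unfolding op_norm_def using z b by (intro cSUP_least) auto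
  have "0 \<le> sobolev_norm s (L (\<lambda>_. 0))" using z by (simp add: L norm_emb[symmetric] unemb_sobolev)
  also have "\<dots> \<le> op_norm s L" unfolding op_norm_def using z b by (intro cSUP_upper) (auto simp: bdd_above_def)
  finally show "0 \<le> op_norm s L" .
qed

theorem driver_C2:
  assumes T: "T > 0"
  shows "C2 (bounded_ops s) (op_norm s) \<gamma> T X"
  unfolding C2_def
proof (intro conjI ballI)
  fix z assume z: "z \<in> simplex2 T"
  obtain t r where tr: "z = (t, r)" by force
  have r: "0 \<le> r" "r < t" using z tr by (auto simp: simplex2_def)
  show "case z of (t, r) \<Rightarrow> X t r \<in> bounded_ops s" using X_bounded_op[OF r] tr by simp
  have "((\<lambda>(t', r'). op_norm s (X t' r' - X t r)) \<longlongrightarrow> 0) (at (t, r) within simplex2 T)"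
  proof (rule tendstoI)
    fix \<epsilon> :: real assume "\<epsilon> > 0"
    then have e: "\<epsilon> / 2 > 0" by simp
    have dom: "\<forall>\<^sub>F w in at (t, r) within simplex2 T. w \<in> simplex2 T" by (simp add: eventually_at_filter)
    show "\<forall>\<^sub>F w in at (t, r) within simplex2 T. dist (case w of (t', r') \<Rightarrow> op_norm s (X t' r' - X t r)) 0 < \<epsilon>"
      using A_continuous[OF z[unfolded tr] e] dom
    proof eventually_elim
      fix w assume w: "mat_bound (\<lambda>n m. A (fst w) (snd w) n m - A t r n m) (\<epsilon> / 2)" "w \<in> simplex2 T"
      obtain t' r' where w': "w = (t', r')" by force
      then have r': "0 \<le> r'" "r' < t'" using w(2) by (auto simp: simplex2_def)
      obtain C where C: "mat_bound (A t r) C" using A_bounded r by force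
      obtain C' where C': "mat_bound (A t' r') C'" using A_bounded r' by force
      let ?D = "\<lambda>n m. A t' r' n m - A t r n m"
      have D: "mat_bound ?D (\<epsilon> / 2)" using w w' by simp
      have "mat_apply ?D x = mat_apply (A t' r') x - mat_apply (A t r) x" for x
      proof (rule l2_eqI)
        fix n
        show "coord (mat_apply ?D x) n = coord (mat_apply (A t' r') x - mat_apply (A t r) x) n"
          using has_sum_add[OF mat_apply_has_sum[OF C', of n x] has_sum_uminusI[OF mat_apply_has_sum[OF C, of n x]]]
          by (intro mat_apply_coordI[OF D]) (simp add: minus_l2.rep_eq left_diff_distrib)
      qed
      then have "(X t' r' - X t r) f = unemb s (mat_apply ?D (emb s f))" if "f \<in> sobolev s" for f
        using X_eq[OF r that] X_eq[OF r' that] by (simp add: unemb_diff)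
      from op_norm_le[of "X t' r' - X t r", OF this D] show "dist (case w of (t', r') \<Rightarrow> op_norm s (X t' r' - X t r)) 0 < \<epsilon>"
        using \<open>\<epsilon> > 0\<close> unfolding w' prod.case dist_real_def by linarith
    qed
  qed
  then show "case z of (t, r) \<Rightarrow> ((\<lambda>(t', r'). op_norm s (X t' r' - X t r)) \<longlongrightarrow> 0) (at (t, r) within simplex2 T)"
    using tr by simp
next
  obtain K where K: "\<And>r t. 0 \<le> r \<Longrightarrow> r \<le> t \<Longrightarrow> t \<le> T \<Longrightarrow> mat_bound (A t r) (K * (t - r) powr \<gamma>)"
    using A_bound[OF T] by blast
  have "op_norm s (X t r) / \<bar>t - r\<bar> powr \<gamma> \<le> K" if "(t, r) \<in> simplex2 T" for t r
    using op_norm_le(1)[of "X t r" "A t r" "K * (t - r) powr \<gamma>"] X_eq[of r t] K[of r t] that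
    by (simp add: simplex2_def divide_le_eq)
  then show "\<exists>C. \<forall>(t, r)\<in>simplex2 T. op_norm s (X t r) / \<bar>t - r\<bar> powr \<gamma> \<le> C" by (intro exI[of _ K]) auto
qed

end

section \<open>Entries of the driver\<close>

text \<open>The integral \<open>\<integral>\<^sub>0\<^sup>t exp (c \<tau>) dw(\<tau>)\<close> integrated by parts, up to an additive constant.\<close>
definition prim :: "(real \<Rightarrow> complex) \<Rightarrow> real \<Rightarrow> real \<Rightarrow> complex" where
  "prim w c t = of_real (exp (c * t)) * w t - integral {0..t} (\<lambda>\<tau>. of_real (c * exp (c * \<tau>)) * w \<tau>)"

text \<open>The integral \<open>\<integral>\<^sub>r\<^sup>t exp (-(t - \<tau>) a) exp (-(\<tau> - r) b) dw(\<tau>)\<close>. Writing it as an exponential times an increment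
of one primitive makes Chen's relation and continuity in \<open>(t,r)\<close> evident.\<close>
definition kern :: "(real \<Rightarrow> complex) \<Rightarrow> real \<Rightarrow> real \<Rightarrow> real \<Rightarrow> real \<Rightarrow> complex" where
  "kern w a b t r = of_real (exp (r * b - t * a)) * (prim w (a - b) t - prim w (a - b) r)"

lemma kern_chen:
  "kern w a b t r = kern w a b t q * of_real (exp (- (q - r) * b)) + of_real (exp (- (t - q) * a)) * kern w a b q r"
proof -
  have "exp (q * b - t * a) * exp (- (q - r) * b) = exp (r * b - t * a)"
    "exp (- (t - q) * a) * exp (r * b - q * a) = exp (r * b - t * a)"
    by (simp_all add: exp_add[symmetric] algebra_simps)
  then have "of_real (exp (q * b - t * a)) * of_real (exp (- (q - r) * b)) = (of_real (exp (r * b - t * a)) :: complex)"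
    "of_real (exp (- (t - q) * a)) * of_real (exp (r * b - q * a)) = (of_real (exp (r * b - t * a)) :: complex)"
    by (simp_all only: of_real_mult[symmetric])
  moreover have "x * y = E \<Longrightarrow> z * u = E \<Longrightarrow> E * (p - p') = x * (p - p'') * y + z * (u * (p'' - p'))"
    for x y z u E p p' p'' :: complex
  proof -
    assume h: "x * y = E" "z * u = E"
    have "x * (p - p'') * y + z * (u * (p'' - p')) = (x * y) * (p - p'') + (z * u) * (p'' - p')"
      by (simp only: mult_ac)
    then show ?thesis unfolding h by (simp add: algebra_simps)
  qed
  ultimately show ?thesis unfolding kern_def by blast
qed

lemma prim_centered:
  assumes w: "continuous_on {0..t} w" and r: "0 \<le> r" "r \<le> t"
  shows "prim w c t - prim w c r = of_real (exp (c * t)) * (w t - v) - of_real (exp (c * r)) * (w r - v)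
     - integral {r..t} (\<lambda>\<tau>. of_real (c * exp (c * \<tau>)) * (w \<tau> - v))"
proof -
  let ?f = "\<lambda>\<tau>. of_real (c * exp (c * \<tau>)) * w \<tau>" and ?e = "\<lambda>\<tau>. of_real (c * exp (c * \<tau>)) * v"
  have f: "?f integrable_on {0..t}" by (intro integrable_continuous_interval continuous_intros w)
  have f': "?f integrable_on {r..t}" by (rule integrable_on_subinterval[OF f]) (use r in auto)
  have split: "integral {0..t} ?f = integral {0..r} ?f + integral {r..t} ?f"
    using Henstock_Kurzweil_Integration.integral_combine[OF r f] by simp
  have e: "(?e has_integral (of_real (exp (c * t)) * v - of_real (exp (c * r)) * v)) {r..t}"
  proof (rule fundamental_theorem_of_calculus[OF r(2)])
    fix x assume "x \<in> {r..t}"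
    have "((\<lambda>x. exp (c * x)) has_real_derivative c * exp (c * x)) (at x within {r..t})"
      by (auto intro!: derivative_eq_intros)
    then have "((\<lambda>x. of_real (exp (c * x)) * v) has_vector_derivative of_real (c * exp (c * x)) * v) (at x within {r..t})"
      by (intro has_vector_derivative_mult_left has_vector_derivative_of_real)
    then show "((\<lambda>x. of_real (exp (c * x)) * v) has_vector_derivative ?e x) (at x within {r..t})" .
  qed
  have "integral {r..t} (\<lambda>\<tau>. of_real (c * exp (c * \<tau>)) * (w \<tau> - v)) = integral {r..t} ?f - integral {r..t} ?e"
    unfolding right_diff_distrib using f' e by (intro Henstock_Kurzweil_Integration.integral_diff) (auto simp: integrable_on_def)
  then show ?thesis unfolding prim_def split integral_unique[OF e] by (simp add: algebra_simps)
qed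

text \<open>Subtracting a constant \<open>v\<close> from \<open>w\<close> does not change the integral. With \<open>v = w t\<close> or \<open>v = w r\<close> one boundary term
vanishes and the other carries the exponential of the frequency that is known to be large.\<close>
lemma kern_centered:
  assumes w: "continuous_on {0..t} w" and r: "0 \<le> r" "r \<le> t"
  shows "kern w a b t r = of_real (exp (- (t - r) * b)) * (w t - v) - of_real (exp (- (t - r) * a)) * (w r - v)
     - integral {r..t} (\<lambda>\<tau>. of_real ((a - b) * (exp (- (t - \<tau>) * a) * exp (- (\<tau> - r) * b))) * (w \<tau> - v))"
proof -
  let ?E = "complex_of_real (exp (r * b - t * a))"
  have "exp (r * b - t * a) * exp ((a - b) * t) = exp (- (t - r) * b)"
     "exp (r * b - t * a) * exp ((a - b) * r) = exp (- (t - r) * a)"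
    by (simp_all add: exp_add[symmetric] algebra_simps)
  then have 1: "?E * of_real (exp ((a - b) * t)) = of_real (exp (- (t - r) * b))"
     "?E * of_real (exp ((a - b) * r)) = of_real (exp (- (t - r) * a))"
    by (simp_all only: of_real_mult[symmetric])
  have 2: "?E * integral {r..t} (\<lambda>\<tau>. of_real ((a - b) * exp ((a - b) * \<tau>)) * (w \<tau> - v))
    = integral {r..t} (\<lambda>\<tau>. of_real ((a - b) * (exp (- (t - \<tau>) * a) * exp (- (\<tau> - r) * b))) * (w \<tau> - v))"
  proof -
    have "exp (r * b - t * a) * ((a - b) * exp ((a - b) * \<tau>)) = (a - b) * (exp (- (t - \<tau>) * a) * exp (- (\<tau> - r) * b))" for \<tau>
      by (simp add: exp_add[symmetric] algebra_simps)
    then have "?E * of_real ((a - b) * exp ((a - b) * \<tau>)) = of_real ((a - b) * (exp (- (t - \<tau>) * a) * exp (- (\<tau> - r) * b)))" for \<tau>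
      by (simp only: of_real_mult[symmetric])
    then show ?thesis
      unfolding integral_mult_right[symmetric] by (intro integral_cong) (simp only: mult.assoc[symmetric])
  qed
  show ?thesis unfolding kern_def prim_centered[OF w r, of _ v] right_diff_distrib[of ?E] 2 mult.assoc[symmetric] 1 ..
qed

lemma prim_continuous:
  assumes w: "continuous_on {0..T} w"
  shows "continuous_on {0..T} (prim w c)"
  unfolding prim_def
  by (intro continuous_intros w indefinite_integral_continuous_1 integrable_continuous_interval)

lemma kern_continuous:
  assumes w: "continuous_on {0..T} w"
  shows "continuous_on (simplex2 T) (\<lambda>z. kern w a b (fst z) (snd z))"
  unfolding kern_def
  by (intro continuous_intros continuous_on_compose2[OF prim_continuous[OF w]])
     (auto simp: simplex2_def)

section \<open>Bounds on frequency blocks\<close>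

definition bil :: "int set \<Rightarrow> int set \<Rightarrow> (int \<Rightarrow> complex) \<Rightarrow> (int \<Rightarrow> int \<Rightarrow> complex) \<Rightarrow> (int \<Rightarrow> complex) \<Rightarrow> complex" where
  "bil F G g D f = (\<Sum>n\<in>F. \<Sum>m\<in>G. g n * D n m * f m)"

abbreviation nrm :: "int set \<Rightarrow> (int \<Rightarrow> complex) \<Rightarrow> real" where
  "nrm F g \<equiv> L2_set (\<lambda>n. cmod (g n)) F"

definition block_bound :: "int set \<Rightarrow> int set \<Rightarrow> (int \<Rightarrow> int \<Rightarrow> complex) \<Rightarrow> real \<Rightarrow> bool" where
  "block_bound F G D P \<longleftrightarrow> (\<forall>g f. cmod (bil F G g D f) \<le> P * nrm F g * nrm G f)"

lemma nrm_weight: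
  assumes "\<And>n. n \<in> F \<Longrightarrow> cmod (x n) \<le> C" "C \<ge> 0"
  shows "nrm F (\<lambda>n. x n * g n) \<le> C * nrm F g"
proof -
  have "nrm F (\<lambda>n. x n * g n) \<le> L2_set (\<lambda>n. C * cmod (g n)) F"
    by (rule L2_set_mono) (auto simp: norm_mult intro: mult_right_mono assms)
  then show ?thesis using assms(2) by (simp add: L2_set_right_distrib)
qed

text \<open>Factors depending on the row or on the column alone can be absorbed into the test vectors; a factor depending on both could in general not be absorbed. This is why the exponentials are always kept in product form.\<close>
lemma block_bound_weight:
  assumes D: "block_bound F G D P" and P: "P \<ge> 0"
    and x: "\<And>n. n \<in> F \<Longrightarrow> cmod (x n) \<le> X" "X \<ge> 0" and y: "\<And>m. m \<in> G \<Longrightarrow> cmod (y m) \<le> Y" "Y \<ge> 0"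
  shows "block_bound F G (\<lambda>n m. x n * D n m * y m) (X * Y * P)"
  unfolding block_bound_def
proof (intro allI)
  fix g f
  have "bil F G g (\<lambda>n m. x n * D n m * y m) f = bil F G (\<lambda>n. x n * g n) D (\<lambda>m. y m * f m)"
    unfolding bil_def by (intro sum.cong refl) (simp add: mult_ac)
  then have "cmod (bil F G g (\<lambda>n m. x n * D n m * y m) f) \<le> P * nrm F (\<lambda>n. x n * g n) * nrm G (\<lambda>m. y m * f m)"
    using D unfolding block_bound_def by simp
  also have "\<dots> \<le> P * (X * nrm F g) * (Y * nrm G f)"
    using P x y by (intro mult_mono mult_nonneg_nonneg nrm_weight) (auto simp: L2_set_nonneg)
  finally show "cmod (bil F G g (\<lambda>n m. x n * D n m * y m) f) \<le> X * Y * P * nrm F g * nrm G f" by (simp add: mult_ac)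
qed

lemma block_bound_add:
  assumes "block_bound F G D P" "block_bound F G D' P'"
  shows "block_bound F G (\<lambda>n m. D n m + D' n m) (P + P')"
  unfolding block_bound_def
proof (intro allI)
  fix g f
  have "bil F G g (\<lambda>n m. D n m + D' n m) f = bil F G g D f + bil F G g D' f"
    unfolding bil_def by (simp add: sum.distrib[symmetric] algebra_simps)
  moreover have "cmod (bil F G g D f) \<le> P * nrm F g * nrm G f" "cmod (bil F G g D' f) \<le> P' * nrm F g * nrm G f"
    using assms by (auto simp: block_bound_def)
  ultimately show "cmod (bil F G g (\<lambda>n m. D n m + D' n m) f) \<le> (P + P') * nrm F g * nrm G f"
    using norm_triangle_ineq[of "bil F G g D f" "bil F G g D' f"] by (simp add: distrib_right)
qed

lemma block_bound_uminus: "block_bound F G D P \<Longrightarrow> block_bound F G (\<lambda>n m. - D n m) P"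
  unfolding block_bound_def bil_def by (simp add: sum_negf)

lemma block_bound_mono: "block_bound F G D P \<Longrightarrow> P \<le> P' \<Longrightarrow> block_bound F G D P'"
  unfolding block_bound_def by (meson mult_right_mono L2_set_nonneg order_trans)

lemma block_bound_cong: "(\<And>n m. n \<in> F \<Longrightarrow> m \<in> G \<Longrightarrow> D n m = D' n m) \<Longrightarrow> block_bound F G D P = block_bound F G D' P"
  unfolding block_bound_def bil_def by (simp cong: sum.cong)

lemma block_bound_integral:
  fixes r t :: real
  assumes H: "\<And>n m. n \<in> F \<Longrightarrow> m \<in> G \<Longrightarrow> continuous_on {r..t} (H n m)"
    and p: "p integrable_on {r..t}" and b: "\<And>\<tau>. \<tau> \<in> {r..t} \<Longrightarrow> block_bound F G (\<lambda>n m. H n m \<tau>) (p \<tau>)"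
  shows "block_bound F G (\<lambda>n m. integral {r..t} (H n m)) (integral {r..t} p)"
  unfolding block_bound_def
proof (intro allI)
  fix g f
  have i: "(\<lambda>\<tau>. g n * H n m \<tau> * f m) integrable_on {r..t}" if "n \<in> F" "m \<in> G" for n m
    by (intro integrable_continuous_interval continuous_intros H[OF that])
  have "bil F G g (\<lambda>n m. integral {r..t} (H n m)) f = (\<Sum>n\<in>F. \<Sum>m\<in>G. integral {r..t} (\<lambda>\<tau>. g n * H n m \<tau> * f m))"
    unfolding bil_def by simp
  also have "\<dots> = integral {r..t} (\<lambda>\<tau>. bil F G g (\<lambda>n m. H n m \<tau>) f)"
    unfolding bil_def
    by (cases "finite F"; cases "finite G")
       (simp_all add: Henstock_Kurzweil_Integration.integral_sum i integrable_sum)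
  finally have "cmod (bil F G g (\<lambda>n m. integral {r..t} (H n m)) f) = cmod (integral {r..t} (\<lambda>\<tau>. bil F G g (\<lambda>n m. H n m \<tau>) f))" by simp
  also have "\<dots> \<le> integral {r..t} (\<lambda>\<tau>. p \<tau> * (nrm F g * nrm G f))"
  proof (rule integral_norm_bound_integral)
    show "(\<lambda>\<tau>. bil F G g (\<lambda>n m. H n m \<tau>) f) integrable_on {r..t}"
      unfolding bil_def
      by (cases "finite F"; cases "finite G") (auto intro!: integrable_sum i integrable_0)
    show "(\<lambda>\<tau>. p \<tau> * (nrm F g * nrm G f)) integrable_on {r..t}" using p by (rule integrable_on_mult_left)
    show "norm (bil F G g (\<lambda>n m. H n m \<tau>) f) \<le> p \<tau> * (nrm F g * nrm G f)" if "\<tau> \<in> {r..t}" for \<tau>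
      using b[OF that] unfolding block_bound_def by (simp add: mult.assoc)
  qed
  also have "\<dots> = integral {r..t} p * nrm F g * nrm G f" by (simp add: mult.assoc)
  finally show "cmod (bil F G g (\<lambda>n m. integral {r..t} (H n m)) f) \<le> integral {r..t} p * nrm F g * nrm G f" .
qed

lemma exp_integral_bound:
  fixes c r t :: real
  assumes "c > 0" "r \<le> t"
  shows "(\<lambda>\<tau>. exp (- c * (t - \<tau>))) integrable_on {r..t}" "integral {r..t} (\<lambda>\<tau>. exp (- c * (t - \<tau>))) \<le> 1 / c"
    and "(\<lambda>\<tau>. exp (- c * (\<tau> - r))) integrable_on {r..t}" "integral {r..t} (\<lambda>\<tau>. exp (- c * (\<tau> - r))) \<le> 1 / c"
proof -
  have "((\<lambda>\<tau>. exp (- c * (t - \<tau>))) has_integral (exp (- c * (t - t)) / c - exp (- c * (t - r)) / c)) {r..t}"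
    unfolding has_real_derivative_iff_has_vector_derivative[symmetric] using assms
    by (intro fundamental_theorem_of_calculus)
       (auto intro!: derivative_eq_intros simp: has_real_derivative_iff_has_vector_derivative[symmetric])
  then show "(\<lambda>\<tau>. exp (- c * (t - \<tau>))) integrable_on {r..t}" "integral {r..t} (\<lambda>\<tau>. exp (- c * (t - \<tau>))) \<le> 1 / c"
    using assms by (auto simp: integrable_on_def integral_unique)
  have "((\<lambda>\<tau>. exp (- c * (\<tau> - r))) has_integral (- exp (- c * (t - r)) / c - (- exp (- c * (r - r)) / c))) {r..t}"
    using assms
    by (intro fundamental_theorem_of_calculus)
       (auto intro!: derivative_eq_intros simp: has_real_derivative_iff_has_vector_derivative[symmetric])
  then show "(\<lambda>\<tau>. exp (- c * (\<tau> - r))) integrable_on {r..t}" "integral {r..t} (\<lambda>\<tau>. exp (- c * (\<tau> - r))) \<le> 1 / c"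
    using assms by (auto simp: integrable_on_def integral_unique)
qed

text \<open>Regularity is traded for decay: of the Hoelder exponent \<open>\<beta>\<close> only \<open>\<gamma>\<close> is kept in time and the rest becomes a
negative power of the rate \<open>c\<close>.\<close>
lemma holder_exp_bound:
  fixes d h c \<beta> \<gamma> :: real
  assumes d: "0 \<le> d" "d \<le> h" and c: "c > 0" and \<gamma>: "\<gamma> \<ge> 0" "\<gamma> < \<beta>" "\<beta> - \<gamma> \<le> 1"
  shows "d powr \<beta> * exp (- c * d) \<le> h powr \<gamma> * c powr - (\<beta> - \<gamma>)"
proof -
  have "d powr \<beta> * exp (- c * d) = d powr \<gamma> * (d powr (\<beta> - \<gamma>) * exp (- c * d))"
    by (simp add: powr_add[symmetric])
  also have "\<dots> \<le> h powr \<gamma> * c powr - (\<beta> - \<gamma>)"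
    using d c \<gamma> by (intro mult_mono powr_exp_decay powr_mono2) auto
  finally show ?thesis .
qed

text \<open>Here \<open>d \<tau>\<close> is the distance of \<open>\<tau>\<close> to the endpoint at which the integration by parts is centred, and \<open>c\<close> the size of the rate
which damps away from that endpoint. The factor \<open>a n - b m\<close> is split into two terms of product form, each of size \<open>8 c\<close>. Half of
the damping \<open>exp (-c d)\<close> turns the Hoelder bound into \<open>(t - r)\<^sup>\<gamma> c\<^bsup>-(\<beta>-\<gamma>)\<^esup>\<close>; the other half makes the time
integral of size \<open>1 / c\<close>, which cancels the factor \<open>c\<close>.\<close>
lemma block_bound_convolution:
  fixes w :: "int \<Rightarrow> int \<Rightarrow> real \<Rightarrow> complex" and v :: "int \<Rightarrow> int \<Rightarrow> complex" and a b :: "int \<Rightarrow> real"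
  assumes rt: "r \<le> t" and c: "c > 0" and \<gamma>: "\<gamma> \<ge> 0" "\<gamma> < \<beta>" "\<beta> - \<gamma> \<le> 1" and Q: "Q \<ge> 0"
    and w: "\<And>n m. n \<in> F \<Longrightarrow> m \<in> G \<Longrightarrow> continuous_on {r..t} (w n m)"
    and a: "\<And>n. n \<in> F \<Longrightarrow> \<bar>a n\<bar> \<le> 8 * c" and b: "\<And>m. m \<in> G \<Longrightarrow> \<bar>b m\<bar> \<le> 8 * c"
    and d: "\<And>\<tau>. \<tau> \<in> {r..t} \<Longrightarrow> 0 \<le> d \<tau> \<and> d \<tau> \<le> t - r"
    and di: "(\<lambda>\<tau>. exp (- (c / 2) * d \<tau>)) integrable_on {r..t}" "integral {r..t} (\<lambda>\<tau>. exp (- (c / 2) * d \<tau>)) \<le> 1 / (c / 2)"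
    and e: "\<And>\<tau> n. \<tau> \<in> {r..t} \<Longrightarrow> n \<in> F \<Longrightarrow> exp (- (t - \<tau>) * a n) \<le> E1 \<tau>" 
      "\<And>\<tau> m. \<tau> \<in> {r..t} \<Longrightarrow> m \<in> G \<Longrightarrow> exp (- (\<tau> - r) * b m) \<le> E2 \<tau>"
      "\<And>\<tau>. E1 \<tau> \<ge> 0" "\<And>\<tau>. E2 \<tau> \<ge> 0"
      "\<And>\<tau>. \<tau> \<in> {r..t} \<Longrightarrow> E1 \<tau> * E2 \<tau> \<le> exp (- c * d \<tau>)"
    and D: "\<And>\<tau>. \<tau> \<in> {r..t} \<Longrightarrow> block_bound F G (\<lambda>n m. w n m \<tau> - v n m) (Q * d \<tau> powr \<beta>)"
  shows "block_bound F G (\<lambda>n m. integral {r..t} (\<lambda>\<tau>. of_real ((a n - b m) * (exp (- (t - \<tau>) * a n) * exp (- (\<tau> - r) * b m))) * (w n m \<tau> - v n m)))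
     (32 * Q * (t - r) powr \<gamma> * (c / 2) powr - (\<beta> - \<gamma>))"
proof -
  let ?H = "\<lambda>n m \<tau>. of_real ((a n - b m) * (exp (- (t - \<tau>) * a n) * exp (- (\<tau> - r) * b m))) * (w n m \<tau> - v n m)"
  define M where "M = 16 * c * Q * (t - r) powr \<gamma> * (c / 2) powr - (\<beta> - \<gamma>)"
  have M: "M \<ge> 0" using c Q by (simp add: M_def)
  have pt: "block_bound F G (\<lambda>n m. ?H n m \<tau>) (M * exp (- (c / 2) * d \<tau>))" if \<tau>: "\<tau> \<in> {r..t}" for \<tau>
  proof -
    let ?D = "\<lambda>n m. w n m \<tau> - v n m"
    let ?x = "\<lambda>n. complex_of_real (exp (- (t - \<tau>) * a n))" and ?y = "\<lambda>m. complex_of_real (exp (- (\<tau> - r) * b m))"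
    have P: "Q * d \<tau> powr \<beta> \<ge> 0" using Q by simp
    have 1: "block_bound F G (\<lambda>n m. (of_real (a n) * ?x n) * ?D n m * ?y m) (8 * c * E1 \<tau> * E2 \<tau> * (Q * d \<tau> powr \<beta>))"
    proof (rule block_bound_weight[OF D[OF \<tau>] P])
      show "cmod (of_real (a n) * ?x n) \<le> 8 * c * E1 \<tau>" if "n \<in> F" for n
        unfolding norm_mult using a[OF that] e(1)[OF \<tau> that] c by (intro mult_mono) auto
      show "cmod (?y m) \<le> E2 \<tau>" if "m \<in> G" for m using e(2)[OF \<tau> that] by simp
    qed (use e c in auto)
    have 2: "block_bound F G (\<lambda>n m. ?x n * ?D n m * (of_real (b m) * ?y m)) (E1 \<tau> * (8 * c * E2 \<tau>) * (Q * d \<tau> powr \<beta>))"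
    proof (rule block_bound_weight[OF D[OF \<tau>] P])
      show "cmod (of_real (b m) * ?y m) \<le> 8 * c * E2 \<tau>" if "m \<in> G" for m
        unfolding norm_mult using b[OF that] e(2)[OF \<tau> that] c by (intro mult_mono) auto
      show "cmod (?x n) \<le> E1 \<tau>" if "n \<in> F" for n using e(1)[OF \<tau> that] by simp
    qed (use e c in auto)
    have 3: "block_bound F G (\<lambda>n m. ?H n m \<tau>) (8 * c * E1 \<tau> * E2 \<tau> * (Q * d \<tau> powr \<beta>) + E1 \<tau> * (8 * c * E2 \<tau>) * (Q * d \<tau> powr \<beta>))"
      using block_bound_add[OF 1 block_bound_uminus[OF 2]] by (simp add: algebra_simps)
    show ?thesis
    proof (rule block_bound_mono[OF 3])
      have "d \<tau> powr \<beta> * exp (- c * d \<tau>) = (d \<tau> powr \<beta> * exp (- (c / 2) * d \<tau>)) * exp (- (c / 2) * d \<tau>)"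
        by (simp add: exp_add[symmetric])
      also have "\<dots> \<le> ((t - r) powr \<gamma> * (c / 2) powr - (\<beta> - \<gamma>)) * exp (- (c / 2) * d \<tau>)"
        using d[OF \<tau>] c \<gamma> by (intro mult_right_mono holder_exp_bound) auto
      finally have h: "d \<tau> powr \<beta> * exp (- c * d \<tau>) \<le> (t - r) powr \<gamma> * (c / 2) powr - (\<beta> - \<gamma>) * exp (- (c / 2) * d \<tau>)" .
      have "8 * c * E1 \<tau> * E2 \<tau> * (Q * d \<tau> powr \<beta>) + E1 \<tau> * (8 * c * E2 \<tau>) * (Q * d \<tau> powr \<beta>)
         = 16 * c * Q * (d \<tau> powr \<beta> * (E1 \<tau> * E2 \<tau>))" by (simp add: algebra_simps)
      also have "\<dots> \<le> 16 * c * Q * (d \<tau> powr \<beta> * exp (- c * d \<tau>))"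
        using c Q e(5)[OF \<tau>] by (intro mult_left_mono) auto
      also have "\<dots> \<le> 16 * c * Q * ((t - r) powr \<gamma> * (c / 2) powr - (\<beta> - \<gamma>) * exp (- (c / 2) * d \<tau>))"
        using c Q h by (intro mult_left_mono) auto
      finally show "8 * c * E1 \<tau> * E2 \<tau> * (Q * d \<tau> powr \<beta>) + E1 \<tau> * (8 * c * E2 \<tau>) * (Q * d \<tau> powr \<beta>) \<le> M * exp (- (c / 2) * d \<tau>)"
        by (simp add: M_def mult.assoc)
    qed
  qed
  have main: "block_bound F G (\<lambda>n m. integral {r..t} (?H n m)) (integral {r..t} (\<lambda>\<tau>. M * exp (- (c / 2) * d \<tau>)))"
  proof (rule block_bound_integral)
    show "continuous_on {r..t} (?H n m)" if "n \<in> F" "m \<in> G" for n m by (intro continuous_intros w that)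
  qed (rule integrable_on_mult_right[OF di(1)], rule pt)
  have "integral {r..t} (\<lambda>\<tau>. M * exp (- (c / 2) * d \<tau>)) \<le> M * (1 / (c / 2))"
    unfolding integral_mult_right using di(2) M by (rule mult_left_mono)
  also have "\<dots> = 32 * Q * (t - r) powr \<gamma> * (c / 2) powr - (\<beta> - \<gamma>)"
    using c by (simp add: M_def)
  finally show ?thesis by (rule block_bound_mono[OF main])
qed

lemma exp_rate_mono: "0 \<le> h \<Longrightarrow> c \<le> a \<Longrightarrow> exp (- h * a) \<le> exp (- c * h :: real)"
  using mult_left_mono[of c a h] by (simp add: mult.commute)

lemma exp_rate_le_1: "0 \<le> h \<Longrightarrow> 0 \<le> a \<Longrightarrow> exp (- h * a :: real) \<le> 1"
  by simp

text \<open>The rows are the large frequencies: the factor \<open>exp (-(t - \<tau>) a n)\<close> damps away from \<open>t\<close>, so the integration by parts is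
centred at \<open>t\<close>. The boundary term at \<open>r\<close> carries the full damping over \<open>[r,t]\<close>.\<close>
lemma block_bound_kern_output:
  fixes w :: "int \<Rightarrow> int \<Rightarrow> real \<Rightarrow> complex" and a b :: "int \<Rightarrow> real"
  assumes rt: "0 \<le> r" "r \<le> t" and c: "c > 0" and \<gamma>: "\<gamma> \<ge> 0" "\<gamma> < \<beta>" "\<beta> - \<gamma> \<le> 1" and Q: "Q \<ge> 0"
    and w: "\<And>n m. n \<in> F \<Longrightarrow> m \<in> G \<Longrightarrow> continuous_on {0..t} (w n m)"
    and a: "\<And>n. n \<in> F \<Longrightarrow> c \<le> a n \<and> a n \<le> 8 * c" and b: "\<And>m. m \<in> G \<Longrightarrow> 0 \<le> b m \<and> b m \<le> 8 * c"
    and D: "\<And>\<tau>. \<tau> \<in> {r..t} \<Longrightarrow> block_bound F G (\<lambda>n m. w n m \<tau> - w n m t) (Q * (t - \<tau>) powr \<beta>)"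
  shows "block_bound F G (\<lambda>n m. kern (w n m) (a n) (b m) t r) (33 * Q * (t - r) powr \<gamma> * (c / 2) powr - (\<beta> - \<gamma>))"
proof -
  let ?h = "(t - r) powr \<gamma> * (c / 2) powr - (\<beta> - \<gamma>)"
  have I: "block_bound F G (\<lambda>n m. integral {r..t} (\<lambda>\<tau>. of_real ((a n - b m) * (exp (- (t - \<tau>) * a n) * exp (- (\<tau> - r) * b m))) * (w n m \<tau> - w n m t)))
     (32 * Q * (t - r) powr \<gamma> * (c / 2) powr - (\<beta> - \<gamma>))"
  proof (rule block_bound_convolution[where d = "\<lambda>\<tau>. t - \<tau>" and ?E1.0 = "\<lambda>\<tau>. exp (- c * (t - \<tau>))" and ?E2.0 = "\<lambda>\<tau>. 1"])
    show "continuous_on {r..t} (w n m)" if "n \<in> F" "m \<in> G" for n m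
      by (rule continuous_on_subset[OF w[OF that]]) (use rt in auto)
    show "\<bar>a n\<bar> \<le> 8 * c" if "n \<in> F" for n using a[OF that] c by auto
    show "\<bar>b m\<bar> \<le> 8 * c" if "m \<in> G" for m using b[OF that] c by auto
    show "exp (- (t - \<tau>) * a n) \<le> exp (- c * (t - \<tau>))" if "\<tau> \<in> {r..t}" "n \<in> F" for \<tau> n
      by (rule exp_rate_mono) (use a[OF that(2)] that(1) in auto)
    show "exp (- (\<tau> - r) * b m) \<le> 1" if "\<tau> \<in> {r..t}" "m \<in> G" for \<tau> m
      by (rule exp_rate_le_1) (use b[OF that(2)] that(1) in auto)
  qed (use exp_integral_bound[of "c / 2" r t] rt c \<gamma> Q D in auto)
  have "block_bound F G (\<lambda>n m. of_real (exp (- (t - r) * a n)) * (w n m r - w n m t) * 1) (exp (- c * (t - r)) * 1 * (Q * (t - r) powr \<beta>))"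
    by (rule block_bound_weight[OF D]) (use rt Q a in \<open>auto intro!: exp_rate_mono[of "t - r", simplified]\<close>)
  moreover have "exp (- c * (t - r)) * 1 * (Q * (t - r) powr \<beta>) \<le> Q * ?h"
  proof -
    have "exp (- c * (t - r)) \<le> exp (- (c / 2) * (t - r))" using rt c by (simp add: mult_right_mono)
    then have "(t - r) powr \<beta> * exp (- c * (t - r)) \<le> (t - r) powr \<beta> * exp (- (c / 2) * (t - r))" by (intro mult_left_mono) auto
    also have "\<dots> \<le> ?h" using rt c \<gamma> by (intro holder_exp_bound) auto
    finally have "Q * ((t - r) powr \<beta> * exp (- c * (t - r))) \<le> Q * ?h" using Q by (rule mult_left_mono)
    then show ?thesis by (simp add: mult_ac)
  qed
  ultimately have "block_bound F G (\<lambda>n m. of_real (exp (- (t - r) * a n)) * (w n m r - w n m t) * 1) (Q * ?h)"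
    by (rule block_bound_mono)
  from block_bound_add[OF block_bound_uminus[OF this] block_bound_uminus[OF I]]
  have "block_bound F G (\<lambda>n m. kern (w n m) (a n) (b m) t r) (Q * ?h + 32 * Q * (t - r) powr \<gamma> * (c / 2) powr - (\<beta> - \<gamma>))"
  proof (rule block_bound_cong[THEN iffD1, rotated])
    fix n m assume nm: "n \<in> F" "m \<in> G"
    show "- (of_real (exp (- (t - r) * a n)) * (w n m r - w n m t) * 1) + - integral {r..t} (\<lambda>\<tau>. of_real ((a n - b m) * (exp (- (t - \<tau>) * a n) * exp (- (\<tau> - r) * b m))) * (w n m \<tau> - w n m t)) = kern (w n m) (a n) (b m) t r"
      using kern_centered[OF w[OF nm] rt, of "a n" "b m" "w n m t"] by (simp add: mult.commute)
  qed
  then show ?thesis by (rule block_bound_mono) (simp add: algebra_simps)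
qed

text \<open>The columns are the large frequencies: the damping \<open>exp (-(\<tau> - r) b m)\<close> is away from \<open>r\<close>, where the integration by parts is
centred.\<close>
lemma block_bound_kern_input:
  fixes w :: "int \<Rightarrow> int \<Rightarrow> real \<Rightarrow> complex" and a b :: "int \<Rightarrow> real"
  assumes rt: "0 \<le> r" "r \<le> t" and c: "c > 0" and \<gamma>: "\<gamma> \<ge> 0" "\<gamma> < \<beta>" "\<beta> - \<gamma> \<le> 1" and Q: "Q \<ge> 0"
    and w: "\<And>n m. n \<in> F \<Longrightarrow> m \<in> G \<Longrightarrow> continuous_on {0..t} (w n m)"
    and a: "\<And>n. n \<in> F \<Longrightarrow> 0 \<le> a n \<and> a n \<le> 8 * c" and b: "\<And>m. m \<in> G \<Longrightarrow> c \<le> b m \<and> b m \<le> 8 * c"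
    and D: "\<And>\<tau>. \<tau> \<in> {r..t} \<Longrightarrow> block_bound F G (\<lambda>n m. w n m \<tau> - w n m r) (Q * (\<tau> - r) powr \<beta>)"
  shows "block_bound F G (\<lambda>n m. kern (w n m) (a n) (b m) t r) (33 * Q * (t - r) powr \<gamma> * (c / 2) powr - (\<beta> - \<gamma>))"
proof -
  let ?h = "(t - r) powr \<gamma> * (c / 2) powr - (\<beta> - \<gamma>)"
  have I: "block_bound F G (\<lambda>n m. integral {r..t} (\<lambda>\<tau>. of_real ((a n - b m) * (exp (- (t - \<tau>) * a n) * exp (- (\<tau> - r) * b m))) * (w n m \<tau> - w n m r)))
     (32 * Q * (t - r) powr \<gamma> * (c / 2) powr - (\<beta> - \<gamma>))"
  proof (rule block_bound_convolution[where d = "\<lambda>\<tau>. \<tau> - r" and ?E1.0 = "\<lambda>\<tau>. 1" and ?E2.0 = "\<lambda>\<tau>. exp (- c * (\<tau> - r))"])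
    show "continuous_on {r..t} (w n m)" if "n \<in> F" "m \<in> G" for n m
      by (rule continuous_on_subset[OF w[OF that]]) (use rt in auto)
    show "\<bar>a n\<bar> \<le> 8 * c" if "n \<in> F" for n using a[OF that] c by auto
    show "\<bar>b m\<bar> \<le> 8 * c" if "m \<in> G" for m using b[OF that] c by auto
    show "exp (- (\<tau> - r) * b m) \<le> exp (- c * (\<tau> - r))" if "\<tau> \<in> {r..t}" "m \<in> G" for \<tau> m
      by (rule exp_rate_mono) (use b[OF that(2)] that(1) in auto)
    show "exp (- (t - \<tau>) * a n) \<le> 1" if "\<tau> \<in> {r..t}" "n \<in> F" for \<tau> n
      by (rule exp_rate_le_1) (use a[OF that(2)] that(1) in auto)
  qed (use exp_integral_bound[of "c / 2" r t] rt c \<gamma> Q D in auto)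
  have "block_bound F G (\<lambda>n m. 1 * (w n m t - w n m r) * of_real (exp (- (t - r) * b m))) (1 * exp (- c * (t - r)) * (Q * (t - r) powr \<beta>))"
    by (rule block_bound_weight[OF D]) (use rt Q b in \<open>auto intro!: exp_rate_mono[of "t - r", simplified]\<close>)
  moreover have "1 * exp (- c * (t - r)) * (Q * (t - r) powr \<beta>) \<le> Q * ?h"
  proof -
    have "exp (- c * (t - r)) \<le> exp (- (c / 2) * (t - r))" using rt c by (simp add: mult_right_mono)
    then have "(t - r) powr \<beta> * exp (- c * (t - r)) \<le> (t - r) powr \<beta> * exp (- (c / 2) * (t - r))" by (intro mult_left_mono) auto
    also have "\<dots> \<le> ?h" using rt c \<gamma> by (intro holder_exp_bound) auto
    finally have "Q * ((t - r) powr \<beta> * exp (- c * (t - r))) \<le> Q * ?h" using Q by (rule mult_left_mono)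
    then show ?thesis by (simp add: mult_ac)
  qed
  ultimately have "block_bound F G (\<lambda>n m. 1 * (w n m t - w n m r) * of_real (exp (- (t - r) * b m))) (Q * ?h)"
    by (rule block_bound_mono)
  from block_bound_add[OF this block_bound_uminus[OF I]]
  have "block_bound F G (\<lambda>n m. kern (w n m) (a n) (b m) t r) (Q * ?h + 32 * Q * (t - r) powr \<gamma> * (c / 2) powr - (\<beta> - \<gamma>))"
  proof (rule block_bound_cong[THEN iffD1, rotated])
    fix n m assume nm: "n \<in> F" "m \<in> G"
    show "1 * (w n m t - w n m r) * of_real (exp (- (t - r) * b m)) + - integral {r..t} (\<lambda>\<tau>. of_real ((a n - b m) * (exp (- (t - \<tau>) * a n) * exp (- (\<tau> - r) * b m))) * (w n m \<tau> - w n m r)) = kern (w n m) (a n) (b m) t r"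
      using kern_centered[OF w[OF nm] rt, of "a n" "b m" "w n m r"] by (simp add: mult.commute)
  qed
  then show ?thesis by (rule block_bound_mono) (simp add: algebra_simps)
qed

section \<open>Dyadic shells\<close>

definition freqs :: "nat \<Rightarrow> int set" where "freqs j = {n. \<bar>n\<bar> \<le> 2 ^ j}"
definition lev :: "int \<Rightarrow> nat" where "lev n = (LEAST j. \<bar>n\<bar> \<le> 2 ^ j)"

lemma finite_freqs: "finite (freqs j)"
proof -
  have "freqs j = {- (2 ^ j)..2 ^ j}" by (auto simp: freqs_def)
  then show ?thesis by simp
qed

lemma lev_le_iff: "lev n \<le> j \<longleftrightarrow> n \<in> freqs j"
proof
  have "\<bar>n\<bar> \<le> 2 ^ nat \<bar>n\<bar>"
  proof -
    have "nat \<bar>n\<bar> < 2 ^ nat \<bar>n\<bar>" by (rule less_exp)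
    then have "int (nat \<bar>n\<bar>) < int (2 ^ nat \<bar>n\<bar>)" by (simp only: of_nat_less_iff)
    then show ?thesis by simp
  qed
  then have l: "\<bar>n\<bar> \<le> 2 ^ lev n" unfolding lev_def by (rule LeastI)
  assume "lev n \<le> j"
  then have "(2::int) ^ lev n \<le> 2 ^ j" by (intro power_increasing) auto
  then show "n \<in> freqs j" using order_trans[OF l] by (simp add: freqs_def)
next
  assume "n \<in> freqs j"
  then show "lev n \<le> j" unfolding lev_def freqs_def by (intro Least_le) auto
qed

lemma jap_square: "(jap n)\<^sup>2 = 1 + (of_int n)\<^sup>2"
  by (simp add: jap_def add_nonneg_nonneg)

lemma jap_square_upper: assumes "n \<in> freqs j" shows "(jap n)\<^sup>2 \<le> 8 * (4 ^ j / 4)"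
proof -
  have "real_of_int \<bar>n\<bar> \<le> real_of_int (2 ^ j)" using assms unfolding freqs_def by (simp only: of_int_le_iff mem_Collect_eq)
  then have "\<bar>real_of_int n\<bar> \<le> 2 ^ j" by simp
  then have "\<bar>real_of_int n\<bar>\<^sup>2 \<le> (2 ^ j)\<^sup>2" by (intro power_mono) auto
  then have "(real_of_int n)\<^sup>2 \<le> 4 ^ j" by (simp add: power_mult[symmetric] mult.commute[of j] power_mult)
  moreover have "(1::real) \<le> 4 ^ j" by simp
  ultimately show ?thesis unfolding jap_square by linarith
qed

lemma jap_square_lower: assumes "lev n = j" shows "4 ^ j / 4 \<le> (jap n)\<^sup>2"
proof (cases j)
  case 0
  then show ?thesis by (simp add: jap_square)
next
  case (Suc i)
  then have "n \<notin> freqs i" using lev_le_iff[of n i] assms by simp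
  then have "real_of_int (2 ^ i) \<le> real_of_int \<bar>n\<bar>" unfolding freqs_def by (simp only: of_int_le_iff mem_Collect_eq)
  then have "2 ^ i \<le> \<bar>real_of_int n\<bar>" by simp
  then have "(2 ^ i)\<^sup>2 \<le> \<bar>real_of_int n\<bar>\<^sup>2" by (intro power_mono) auto
  then have "4 ^ i \<le> (real_of_int n)\<^sup>2" by (simp add: power_mult[symmetric] mult.commute[of i] power_mult)
  then show ?thesis using Suc by (simp add: jap_square)
qed

lemma jap_upper: assumes "n \<in> freqs j" shows "jap n \<le> 2 * 2 ^ j"
proof (rule power2_le_imp_le)
  have "(jap n)\<^sup>2 \<le> 8 * (4 ^ j / 4)" by (rule jap_square_upper[OF assms])
  also have "\<dots> \<le> (2 * 2 ^ j)\<^sup>2" by (simp add: power_mult_distrib power_mult[symmetric] mult.commute[of j] power_mult)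
  finally show "(jap n)\<^sup>2 \<le> (2 * 2 ^ j)\<^sup>2" .
qed simp

lemma block_bound_subset:
  assumes B: "block_bound F' G' D P" and P: "P \<ge> 0" and F: "F \<subseteq> F'" "G \<subseteq> G'" "finite F'" "finite G'"
  shows "block_bound F G D P"
  unfolding block_bound_def
proof (intro allI)
  fix g f :: "int \<Rightarrow> complex"
  let ?g = "\<lambda>n. if n \<in> F then g n else 0" and ?f = "\<lambda>m. if m \<in> G then f m else 0"
  have "bil F G g D f = bil F' G' ?g D ?f"
  proof -
    have "bil F' G' ?g D ?f = (\<Sum>n\<in>F'. if n \<in> F then \<Sum>m\<in>G'. if m \<in> G then g n * D n m * f m else 0 else 0)"
      unfolding bil_def by (intro sum.cong refl) (auto intro!: sum.cong sum.neutral)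
    also have "\<dots> = (\<Sum>n\<in>F' \<inter> F. \<Sum>m\<in>G' \<inter> G. g n * D n m * f m)"
      using F by (simp add: sum.inter_restrict)
    also have "\<dots> = bil F G g D f" using F by (simp add: bil_def Int_absorb1)
    finally show ?thesis ..
  qed
  moreover have "nrm F' ?g = nrm F g" "nrm G' ?f = nrm G f"
    unfolding L2_set_def using F
    by (auto simp: if_distrib[of "\<lambda>x. (cmod x)\<^sup>2"] sum.If_cases Int_absorb1 cong: if_cong)
  ultimately show "cmod (bil F G g D f) \<le> P * nrm F g * nrm G f"
    using B unfolding block_bound_def by metis
qed

lemma mat_bound_iff_block: "mat_bound A C \<longleftrightarrow> (\<forall>F G. finite F \<longrightarrow> finite G \<longrightarrow> block_bound F G A C)"
  unfolding mat_bound_def block_bound_def bil_def by blast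

lemma mat_bound_uminus: "mat_bound A C \<Longrightarrow> mat_bound (\<lambda>n m. - A n m) C"
  unfolding mat_bound_iff_block using block_bound_uminus by blast

lemma mat_bound_restrict:
  assumes B: "\<And>F G. finite F \<Longrightarrow> finite G \<Longrightarrow> F \<subseteq> P \<Longrightarrow> G \<subseteq> R \<Longrightarrow> block_bound F G A C" and C: "C \<ge> 0"
  shows "mat_bound (\<lambda>n m. if n \<in> P \<and> m \<in> R then A n m else 0) C"
  unfolding mat_bound_iff_block block_bound_def
proof (intro allI impI)
  fix F G :: "int set" and g f assume fin: "finite F" "finite G"
  have "bil F G g (\<lambda>n m. if n \<in> P \<and> m \<in> R then A n m else 0) f =
     (\<Sum>n\<in>F. if n \<in> P then \<Sum>m\<in>G. if m \<in> R then g n * A n m * f m else 0 else 0)"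
    unfolding bil_def by (intro sum.cong refl) (auto intro!: sum.cong sum.neutral)
  also have "\<dots> = bil (F \<inter> P) (G \<inter> R) g A f" unfolding bil_def using fin by (simp add: sum.inter_restrict)
  finally have "cmod (bil F G g (\<lambda>n m. if n \<in> P \<and> m \<in> R then A n m else 0) f) \<le> C * nrm (F \<inter> P) g * nrm (G \<inter> R) f"
    using B[of "F \<inter> P" "G \<inter> R"] fin by (simp add: block_bound_def)
  also have "\<dots> \<le> C * nrm F g * nrm G f"
    unfolding L2_set_def using fin C by (intro mult_mono mult_left_mono real_sqrt_le_mono sum_mono2 mult_nonneg_nonneg) (auto intro: sum_nonneg)
  finally show "cmod (bil F G g (\<lambda>n m. if n \<in> P \<and> m \<in> R then A n m else 0) f) \<le> C * nrm F g * nrm G f" .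
qed

definition tail_from :: "nat \<Rightarrow> (int \<Rightarrow> int \<Rightarrow> complex) \<Rightarrow> int \<Rightarrow> int \<Rightarrow> complex" where
  "tail_from J A n m = (if J \<le> max (lev n) (lev m) then A n m else 0)"

text \<open>The entries with \<open>max (lev n) (lev m) = j\<close> form two disjoint rectangles, one with \<open>lev n = j\<close> and one with \<open>lev n < j\<close>,
\<open>lev m = j\<close>. The shells are summed as a geometric series; every finite section meets finitely many.\<close>
lemma mat_bound_tail:
  assumes c: "c \<ge> 0" and q: "0 < q" "q < 1"
    and out: "\<And>j F G. finite F \<Longrightarrow> finite G \<Longrightarrow> F \<subseteq> {n. lev n = j} \<Longrightarrow> G \<subseteq> freqs j \<Longrightarrow> block_bound F G A (c * q ^ j)"
    and inp: "\<And>j F G. finite F \<Longrightarrow> finite G \<Longrightarrow> F \<subseteq> freqs j \<Longrightarrow> G \<subseteq> {n. lev n = j} \<Longrightarrow> block_bound F G A (c * q ^ j)"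
  shows "mat_bound (tail_from J A) (2 * c * q ^ J / (1 - q))"
proof -
  define Aj where "Aj j n m = (if max (lev n) (lev m) = j then A n m else 0)" for j n m
  have Aj: "mat_bound (Aj j) (2 * (c * q ^ j))" for j
  proof -
    have cq: "c * q ^ j \<ge> 0" using c q by simp
    have 1: "mat_bound (\<lambda>n m. if n \<in> {n. lev n = j} \<and> m \<in> freqs j then A n m else 0) (c * q ^ j)"
      by (rule mat_bound_restrict[OF out cq])
    have 2: "mat_bound (\<lambda>n m. if n \<in> {n. lev n < j} \<and> m \<in> {n. lev n = j} then A n m else 0) (c * q ^ j)"
    proof (rule mat_bound_restrict[OF _ cq])
      fix F G assume "finite F" "finite G" "F \<subseteq> {n. lev n < j}" "G \<subseteq> {n. lev n = j}"
      then show "block_bound F G A (c * q ^ j)" by (intro inp) (auto simp: lev_le_iff[symmetric])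
    qed
    have "Aj j = (\<lambda>n m. (if n \<in> {n. lev n = j} \<and> m \<in> freqs j then A n m else 0) +
        (if n \<in> {n. lev n < j} \<and> m \<in> {n. lev n = j} then A n m else 0))"
      by (intro ext) (auto simp: Aj_def lev_le_iff[symmetric] max_def)
    then show ?thesis using mat_bound_add[OF 1 2] by simp
  qed
  have Asum: "mat_bound (\<lambda>n m. \<Sum>j\<in>{J..<J + N}. Aj j n m) (\<Sum>j\<in>{J..<J + N}. 2 * (c * q ^ j))" for N
  proof (induction N)
    case 0
    then show ?case by (simp add: mat_bound_def)
  next
    case (Suc N)
    then show ?case using mat_bound_add[OF Suc Aj[of "J + N"]] by simp
  qed
  have geo: "(\<Sum>j\<in>{J..<J + N}. 2 * (c * q ^ j)) \<le> 2 * c * q ^ J / (1 - q)" for N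
  proof -
    have "(\<Sum>j\<in>{J..<J + N}. 2 * (c * q ^ j)) = 2 * c * q ^ J * (\<Sum>i<N. q ^ i)"
      using sum.shift_bounds_nat_ivl[of "\<lambda>j. 2 * (c * q ^ j)" 0 J N]
      by (simp add: sum_distrib_left lessThan_atLeast0 power_add mult_ac add.commute)
    also have "\<dots> \<le> 2 * c * q ^ J * (1 / (1 - q))"
    proof (rule mult_left_mono)
      have "(\<Sum>i<N. q ^ i) = (1 - q ^ N) / (1 - q)" using q by (subst sum_gp_strict) auto
      also have "\<dots> \<le> 1 / (1 - q)" using q by (intro divide_right_mono) auto
      finally show "(\<Sum>i<N. q ^ i) \<le> 1 / (1 - q)" .
    qed (use c q in auto)
    finally show ?thesis by simp
  qed
  show ?thesis unfolding mat_bound_iff_block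
  proof (intro allI impI)
    fix F G :: "int set" assume fin: "finite F" "finite G"
    define N where "N = Suc (Max (lev ` (F \<union> G \<union> {0})))"
    have N: "lev n < N" if "n \<in> F \<union> G" for n
      using that fin by (auto simp: N_def less_Suc_eq_le intro!: Max_ge)
    have "block_bound F G (\<lambda>n m. \<Sum>j\<in>{J..<J + N}. Aj j n m) (2 * c * q ^ J / (1 - q))"
      using mat_bound_mono[OF Asum geo] fin unfolding mat_bound_iff_block by blast
    then show "block_bound F G (tail_from J A) (2 * c * q ^ J / (1 - q))"
    proof (rule block_bound_cong[THEN iffD1, rotated])
      fix n m assume "n \<in> F" "m \<in> G"
      then have "max (lev n) (lev m) < J + N" using N[of n] N[of m] by auto
      then show "(\<Sum>j\<in>{J..<J + N}. Aj j n m) = tail_from J A n m"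
        unfolding Aj_def tail_from_def by (auto simp: sum.delta)
    qed
  qed
qed

lemma mat_bound_finite:
  assumes S: "finite S" and z: "\<And>n m. n \<notin> S \<or> m \<notin> S \<Longrightarrow> D n m = 0"
  shows "mat_bound D (\<Sum>n\<in>S. \<Sum>m\<in>S. cmod (D n m))"
proof -
  have D: "D = (\<lambda>n m. if n \<in> S \<and> m \<in> S then D n m else 0)" using z by (intro ext) auto
  show ?thesis
  proof (subst D, rule mat_bound_restrict)
    fix F G assume fin: "finite F" "finite G" "F \<subseteq> S" "G \<subseteq> S"
    show "block_bound F G D (\<Sum>n\<in>S. \<Sum>m\<in>S. cmod (D n m))"
      unfolding block_bound_def
    proof (intro allI)
      fix g f
      have "cmod (bil F G g D f) \<le> (\<Sum>n\<in>F. \<Sum>m\<in>G. cmod (D n m) * (nrm F g * nrm G f))"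
        unfolding bil_def
      proof (intro sum_norm_le)
        fix n m assume nm: "n \<in> F" "m \<in> G"
        have "cmod (g n) \<le> nrm F g" by (rule member_le_L2_set) (use fin nm in auto)
        moreover have "cmod (f m) \<le> nrm G f" by (rule member_le_L2_set) (use fin nm in auto)
        ultimately have "cmod (D n m) * (cmod (g n) * cmod (f m)) \<le> cmod (D n m) * (nrm F g * nrm G f)"
          by (intro mult_left_mono mult_mono) (auto simp: L2_set_nonneg)
        then show "cmod (g n * D n m * f m) \<le> cmod (D n m) * (nrm F g * nrm G f)" by (simp add: norm_mult mult_ac)
      qed
      also have "\<dots> = (\<Sum>n\<in>F. \<Sum>m\<in>G. cmod (D n m)) * (nrm F g * nrm G f)" by (simp add: sum_distrib_right)
      also have "\<dots> \<le> (\<Sum>n\<in>S. \<Sum>m\<in>S. cmod (D n m)) * (nrm F g * nrm G f)"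
      proof (rule mult_right_mono)
        have "(\<Sum>n\<in>F. \<Sum>m\<in>G. cmod (D n m)) \<le> (\<Sum>n\<in>F. \<Sum>m\<in>S. cmod (D n m))"
          using fin S by (intro sum_mono sum_mono2) auto
        also have "\<dots> \<le> (\<Sum>n\<in>S. \<Sum>m\<in>S. cmod (D n m))" using fin S by (intro sum_mono2) (auto intro: sum_nonneg)
        finally show "(\<Sum>n\<in>F. \<Sum>m\<in>G. cmod (D n m)) \<le> (\<Sum>n\<in>S. \<Sum>m\<in>S. cmod (D n m))" .
      qed (auto simp: L2_set_nonneg)
      finally show "cmod (bil F G g D f) \<le> (\<Sum>n\<in>S. \<Sum>m\<in>S. cmod (D n m)) * nrm F g * nrm G f" by (simp add: mult.assoc)
    qed
  qed (auto intro!: sum_nonneg)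
qed

text \<open>The matrix of the driver, conjugated by the weights of \<open>H\<^sup>s\<close> so that it acts on \<open>\<ell>\<^sup>2\<close>.\<close>
definition weighted_kern :: "real \<Rightarrow> (int \<Rightarrow> real \<Rightarrow> complex) \<Rightarrow> real \<Rightarrow> real \<Rightarrow> int \<Rightarrow> int \<Rightarrow> complex" where
  "weighted_kern s z t r n m = of_real (jap n powr s) * kern (z (n - m)) ((jap n)\<^sup>2) ((jap m)\<^sup>2) t r * of_real (jap m powr - s)"

text \<open>One path of the noise. The Toeplitz blocks of frequencies up to \<open>2\<^sup>j\<close> are Hoelder continuous in time, in operator norm, with constants
of growth \<open>2\<^bsup>\<kappa>j\<^esup>\<close>. The condition on \<open>\<kappa>\<close> balances this growth and the Sobolev weight against the heat gain
\<open>4\<^bsup>-j(\<beta>-\<gamma>)\<^esup>\<close>.\<close>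
locale noise_path =
  fixes z :: "int \<Rightarrow> real \<Rightarrow> complex" and s \<beta> \<gamma> \<kappa> :: real
  assumes s: "s \<ge> 0" and \<gamma>: "0 \<le> \<gamma>" and \<gamma>\<beta>: "\<gamma> < \<beta>" and \<beta>: "\<beta> \<le> 1" and \<kappa>: "\<kappa> + s < 2 * (\<beta> - \<gamma>)"
    and z_continuous: "T > 0 \<Longrightarrow> continuous_on {0..T} (z k)"
    and z_holder: "T > 0 \<Longrightarrow> \<exists>Q\<ge>0. \<forall>j. \<forall>t\<in>{0..T}. \<forall>t'\<in>{0..T}.
       block_bound (freqs j) (freqs j) (\<lambda>n m. z (n - m) t - z (n - m) t') (Q * 2 powr (\<kappa> * real j) * \<bar>t - t'\<bar> powr \<beta>)"
begin

text \<open>On shell \<open>j\<close> the rates \<open>\<langle>n\<rangle>\<^sup>2\<close> of the large frequencies lie between \<open>c\<close> and \<open>8 c\<close> for \<open>c = 4\<^sup>j / 4\<close>. The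
output weight costs \<open>2\<^bsup>sj\<^esup>\<close>, the input weight is at most one, and the total is a geometric sequence of ratio
\<open>2\<^bsup>\<kappa>+s-2(\<beta>-\<gamma>)\<^esup>\<close>. The case \<open>J = 0\<close> is the bound on the driver; large \<open>J\<close> serve for its continuity.\<close>
lemma level_bound:
  assumes T: "T > 0"
  shows "\<exists>c\<ge>0. \<exists>q>0. q < 1 \<and> (\<forall>r t J. 0 \<le> r \<longrightarrow> r \<le> t \<longrightarrow> t \<le> T \<longrightarrow>
     mat_bound (tail_from J (weighted_kern s z t r)) (2 * (c * (t - r) powr \<gamma>) * q ^ J / (1 - q)))"
proof -
  obtain Q where Q: "Q \<ge> 0" "\<And>j t t'. t\<in>{0..T} \<Longrightarrow> t'\<in>{0..T} \<Longrightarrow>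
       block_bound (freqs j) (freqs j) (\<lambda>n m. z (n - m) t - z (n - m) t') (Q * 2 powr (\<kappa> * real j) * \<bar>t - t'\<bar> powr \<beta>)"
    using z_holder[OF T] by blast
  define \<delta> where "\<delta> = \<beta> - \<gamma>"
  define q where "q = (2::real) powr (\<kappa> + s - 2 * \<delta>)"
  define c where "c = 33 * Q * 8 powr \<delta> * 2 powr s"
  have q: "0 < q" "q < 1"
  proof -
    have "(2::real) powr (\<kappa> + s - 2 * \<delta>) < 2 powr 0" using \<kappa> by (intro powr_less_mono) (auto simp: \<delta>_def)
    then show "q < 1" by (simp add: q_def)
  qed (simp add: q_def)
  have c: "c \<ge> 0" using Q by (simp add: c_def)
  have "mat_bound (tail_from J (weighted_kern s z t r)) (2 * (c * (t - r) powr \<gamma>) * q ^ J / (1 - q))"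
    if rt: "0 \<le> r" "r \<le> t" "t \<le> T" for r t J
  proof -
    let ?K = "\<lambda>n m. kern (z (n - m)) ((jap n)\<^sup>2) ((jap m)\<^sup>2) t r"
    let ?P = "\<lambda>j. 33 * (Q * 2 powr (\<kappa> * real j)) * (t - r) powr \<gamma> * ((4 ^ j / 4) / 2) powr - (\<beta> - \<gamma>)"
    have P: "?P j \<ge> 0" for j using Q by simp
    have zc: "continuous_on {0..t} (z k)" for k
      by (rule continuous_on_subset[OF z_continuous[OF T]]) (use rt in auto)
    have weight: "block_bound F G (weighted_kern s z t r) ((c * (t - r) powr \<gamma>) * q ^ j)"
      if K: "block_bound F G ?K (?P j)" and F: "F \<subseteq> freqs j" for F G j
    proof -
      have "block_bound F G (\<lambda>n m. of_real (jap n powr s) * ?K n m * of_real (jap m powr - s)) ((2 * 2 ^ j) powr s * 1 * ?P j)"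
      proof (rule block_bound_weight[OF K P])
        show "cmod (of_real (jap n powr s)) \<le> (2 * 2 ^ j) powr s" if "n \<in> F" for n
          using jap_upper[of n j] jap_pos[of n] F that s by (auto intro!: powr_mono2)
        show "cmod (of_real (jap m powr - s)) \<le> 1" for m
          using powr_mono2'[of "- s" 1 "jap m"] jap_ge_1[of m] s by simp
      qed auto
      also have "(2 * 2 ^ j) powr s * 1 * ?P j = (c * (t - r) powr \<gamma>) * q ^ j"
      proof -
        have 1: "(2 * 2 ^ j) powr s = 2 powr s * 2 powr (s * real j)"
          by (simp add: powr_mult powr_powr powr_realpow[symmetric] mult.commute)
        have 2: "((4 ^ j / 4) / 2) powr - (\<beta> - \<gamma>) = 8 powr \<delta> * 2 powr (- 2 * \<delta> * real j)"
        proof -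
          have "(4 ^ j / 4) / 2 = (2 powr (2 * real j) / 8 :: real)"
            by (simp add: powr_mult_base[symmetric] powr_powr[symmetric] powr_realpow[symmetric])
          then have "((4 ^ j / 4) / 2) powr - (\<beta> - \<gamma>) = (2 powr (2 * real j) / 8 :: real) powr (- \<delta>)" by (simp add: \<delta>_def)
          also have "\<dots> = 2 powr (2 * real j * (- \<delta>)) / 8 powr (- \<delta>)" by (simp only: powr_divide powr_powr)
          also have "\<dots> = 8 powr \<delta> * 2 powr (- 2 * \<delta> * real j)" by (simp add: powr_minus divide_inverse mult_ac)
          finally show ?thesis .
        qed
        have 3: "q ^ j = 2 powr (\<kappa> * real j) * 2 powr (s * real j) * 2 powr (- 2 * \<delta> * real j)"
          unfolding powr_realpow[OF q(1), symmetric] unfolding q_def powr_powr powr_add[symmetric]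
          by (rule arg_cong[of _ _ "\<lambda>e. 2 powr e"]) (simp add: algebra_simps)
        show ?thesis unfolding 1 2 3 c_def by (simp only: mult_ac mult_1_right)
      qed
      finally show ?thesis unfolding weighted_kern_def .
    qed
    have Dsub: "block_bound F G (\<lambda>n m. z (n - m) \<tau> - z (n - m) \<tau>') (Q * 2 powr (\<kappa> * real j) * \<bar>\<tau> - \<tau>'\<bar> powr \<beta>)"
      if "F \<subseteq> freqs j" "G \<subseteq> freqs j" "\<tau> \<in> {r..t}" "\<tau>' \<in> {r..t}" for F G j \<tau> \<tau>'
      by (rule block_bound_subset[OF Q(2)]) (use that rt Q finite_freqs in auto)
    have up: "0 \<le> (jap n)\<^sup>2 \<and> (jap n)\<^sup>2 \<le> 8 * (4 ^ j / 4)" if "n \<in> freqs j" for n j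
      using jap_square_upper[OF that] by simp
    have lo: "4 ^ j / 4 \<le> (jap n)\<^sup>2 \<and> (jap n)\<^sup>2 \<le> 8 * (4 ^ j / 4)" if "lev n = j" for n j
      using jap_square_upper[of n j] jap_square_lower[OF that] that lev_le_iff[of n j] by simp
    have pos: "(0::real) < 4 ^ j / 4" for j by simp
    have \<gamma>1: "\<beta> - \<gamma> \<le> 1" using \<gamma> \<beta> by simp
    have Qp: "Q * 2 powr (\<kappa> * real j) \<ge> 0" for j using Q by simp
    show ?thesis
    proof (rule mat_bound_tail[OF _ q])
      fix j F G assume FG: "finite F" "finite G" "F \<subseteq> {n. lev n = j}" "G \<subseteq> freqs j"
      then have F: "F \<subseteq> freqs j" by (auto simp: lev_le_iff[symmetric])
      show "block_bound F G (weighted_kern s z t r) (c * (t - r) powr \<gamma> * q ^ j)"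
      proof (rule weight[OF _ F], rule block_bound_kern_output[OF rt(1,2) pos \<gamma> \<gamma>\<beta> \<gamma>1 Qp zc])
        show "4 ^ j / 4 \<le> (jap n)\<^sup>2 \<and> (jap n)\<^sup>2 \<le> 8 * (4 ^ j / 4)" if "n \<in> F" for n using lo FG(3) that by blast
        show "0 \<le> (jap n)\<^sup>2 \<and> (jap n)\<^sup>2 \<le> 8 * (4 ^ j / 4)" if "n \<in> G" for n using up FG(4) that by blast
        fix \<tau> assume "\<tau> \<in> {r..t}"
        then show "block_bound F G (\<lambda>n m. z (n - m) \<tau> - z (n - m) t) (Q * 2 powr (\<kappa> * real j) * (t - \<tau>) powr \<beta>)"
          using Dsub[OF F FG(4), of \<tau> t] rt by (simp add: abs_minus_commute)
      qed
    next
      fix j F G assume FG: "finite F" "finite G" "F \<subseteq> freqs j" "G \<subseteq> {n. lev n = j}"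
      then have G: "G \<subseteq> freqs j" by (auto simp: lev_le_iff[symmetric])
      show "block_bound F G (weighted_kern s z t r) (c * (t - r) powr \<gamma> * q ^ j)"
      proof (rule weight[OF _ FG(3)], rule block_bound_kern_input[OF rt(1,2) pos \<gamma> \<gamma>\<beta> \<gamma>1 Qp zc])
        show "0 \<le> (jap n)\<^sup>2 \<and> (jap n)\<^sup>2 \<le> 8 * (4 ^ j / 4)" if "n \<in> F" for n using up FG(3) that by blast
        show "4 ^ j / 4 \<le> (jap n)\<^sup>2 \<and> (jap n)\<^sup>2 \<le> 8 * (4 ^ j / 4)" if "n \<in> G" for n using lo FG(4) that by blast
        fix \<tau> assume "\<tau> \<in> {r..t}"
        then show "block_bound F G (\<lambda>n m. z (n - m) \<tau> - z (n - m) r) (Q * 2 powr (\<kappa> * real j) * (\<tau> - r) powr \<beta>)"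
          using Dsub[OF FG(3) G, of \<tau> r] rt by simp
      qed
    qed (use c in auto)
  qed
  then show ?thesis using c q by blast
qed

text \<open>Continuity in operator norm: the high shells are uniformly small, and the remaining finite matrix depends continuously on
\<open>(t,r)\<close> entry by entry.\<close>
theorem driver_path:
  assumes \<alpha>: "1 / 2 < \<alpha>" "\<alpha> < \<gamma>" "\<gamma> < 1"
    and X: "\<And>t r f. 0 \<le> r \<Longrightarrow> r < t \<Longrightarrow> f \<in> sobolev s \<Longrightarrow> X t r f = unemb s (mat_apply (weighted_kern s z t r) (emb s f))"
  shows "driver_path s \<alpha> \<gamma> (weighted_kern s z) X"
proof
  fix T :: real assume T: "T > 0"
  obtain c q where cq: "c \<ge> 0" "0 < q" "q < 1" "\<And>r t J. 0 \<le> r \<Longrightarrow> r \<le> t \<Longrightarrow> t \<le> T \<Longrightarrow>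
     mat_bound (tail_from J (weighted_kern s z t r)) (2 * (c * (t - r) powr \<gamma>) * q ^ J / (1 - q))"
    using level_bound[OF T] by blast
  have "tail_from 0 B = B" for B by (intro ext) (simp add: tail_from_def)
  then show "\<exists>K. \<forall>r t. 0 \<le> r \<longrightarrow> r \<le> t \<longrightarrow> t \<le> T \<longrightarrow> mat_bound (weighted_kern s z t r) (K * (t - r) powr \<gamma>)"
    using cq(4)[where J = 0] by (intro exI[of _ "2 * c / (1 - q)"]) (simp add: mult_ac)
next
  fix r q t :: real and n m
  have "kern (z (n - m)) ((jap n)\<^sup>2) ((jap m)\<^sup>2) t r = kern (z (n - m)) ((jap n)\<^sup>2) ((jap m)\<^sup>2) t q * of_real (exp (- (q - r) * (jap m)\<^sup>2)) +
     of_real (exp (- (t - q) * (jap n)\<^sup>2)) * kern (z (n - m)) ((jap n)\<^sup>2) ((jap m)\<^sup>2) q r"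
    by (rule kern_chen)
  then show "weighted_kern s z t r n m = weighted_kern s z t q n m * of_real (exp (- (q - r) * (jap m)\<^sup>2)) +
     of_real (exp (- (t - q) * (jap n)\<^sup>2)) * weighted_kern s z q r n m"
    unfolding weighted_kern_def by (simp only: distrib_left distrib_right mult_ac)
next
  fix t r T \<epsilon> :: real
  assume tr: "(t, r) \<in> simplex2 T" and \<epsilon>: "\<epsilon> > 0"
  then have T: "T > 0" by (auto simp: simplex2_def)
  obtain c q where cq: "c \<ge> 0" "0 < q" "q < 1" "\<And>r t J. 0 \<le> r \<Longrightarrow> r \<le> t \<Longrightarrow> t \<le> T \<Longrightarrow>
     mat_bound (tail_from J (weighted_kern s z t r)) (2 * (c * (t - r) powr \<gamma>) * q ^ J / (1 - q))"
    using level_bound[OF T] by blast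
  define M where "M = 2 * (c * T powr \<gamma>) / (1 - q)"
  have M: "M \<ge> 0" using cq by (simp add: M_def)
  have "\<exists>J. q ^ J < \<epsilon> / (4 * (M + 1))" using cq \<epsilon> M by (intro real_arch_pow_inv) auto
  then obtain J where J: "q ^ J < \<epsilon> / (4 * (M + 1))" ..
  have MJ: "M * q ^ J \<le> \<epsilon> / 4"
  proof -
    have "M * q ^ J \<le> (M + 1) * (\<epsilon> / (4 * (M + 1)))" using J M cq by (intro mult_mono) auto
    also have "\<dots> = \<epsilon> / 4"
    proof -
      have "M + 1 \<noteq> 0" using M by simp
      then show ?thesis by (simp add: divide_simps)
    qed
    finally show ?thesis .
  qed
  have tail: "mat_bound (tail_from (Suc J) (weighted_kern s z t r)) (\<epsilon> / 4)" if "(t, r) \<in> simplex2 T" for t r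
  proof (rule mat_bound_mono)
    have rt: "0 \<le> r" "r \<le> t" "t \<le> T" using that by (auto simp: simplex2_def)
    show "mat_bound (tail_from (Suc J) (weighted_kern s z t r)) (2 * (c * (t - r) powr \<gamma>) * q ^ Suc J / (1 - q))" by (rule cq(4)[OF rt])
    have "2 * (c * (t - r) powr \<gamma>) * q ^ Suc J / (1 - q) \<le> 2 * (c * T powr \<gamma>) * q ^ J / (1 - q)"
      using rt cq \<gamma> by (intro divide_right_mono mult_mono mult_left_mono powr_mono2 power_decreasing mult_nonneg_nonneg) auto
    also have "\<dots> = M * q ^ J" by (simp add: M_def)
    also note MJ
    finally show "2 * (c * (t - r) powr \<gamma>) * q ^ Suc J / (1 - q) \<le> \<epsilon> / 4" .
  qed
  let ?D = "\<lambda>w n m. weighted_kern s z (fst w) (snd w) n m - weighted_kern s z t r n m"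
  have low: "\<forall>\<^sub>F w in at (t, r) within simplex2 T. (\<Sum>n\<in>freqs J. \<Sum>m\<in>freqs J. cmod (?D w n m)) < \<epsilon> / 2"
  proof -
    have "((\<lambda>w. \<Sum>n\<in>freqs J. \<Sum>m\<in>freqs J. cmod (?D w n m)) \<longlongrightarrow> (\<Sum>n\<in>freqs J. \<Sum>m\<in>freqs J. cmod (?D (t, r) n m))) (at (t, r) within simplex2 T)"
    proof (intro tendsto_sum tendsto_norm tendsto_diff tendsto_const)
      fix n m
      have "continuous_on (simplex2 T) (\<lambda>w. weighted_kern s z (fst w) (snd w) n m)"
        unfolding weighted_kern_def by (intro continuous_intros kern_continuous z_continuous T)
      then show "((\<lambda>w. weighted_kern s z (fst w) (snd w) n m) \<longlongrightarrow> weighted_kern s z (fst (t, r)) (snd (t, r)) n m) (at (t, r) within simplex2 T)"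
        using tr unfolding continuous_on_def by blast
    qed
    then show ?thesis by (rule order_tendstoD) (use \<epsilon> in auto)
  qed
  have dom: "\<forall>\<^sub>F w in at (t, r) within simplex2 T. w \<in> simplex2 T" by (simp add: eventually_at_filter)
  show "\<forall>\<^sub>F w in at (t, r) within simplex2 T. mat_bound (?D w) \<epsilon>"
    using low dom
  proof eventually_elim
    fix w assume w: "(\<Sum>n\<in>freqs J. \<Sum>m\<in>freqs J. cmod (?D w n m)) < \<epsilon> / 2" "w \<in> simplex2 T"
    let ?L = "\<lambda>n m. if n \<in> freqs J \<and> m \<in> freqs J then ?D w n m else 0"
    have "mat_bound ?L (\<Sum>n\<in>freqs J. \<Sum>m\<in>freqs J. cmod (?L n m))" by (rule mat_bound_finite[OF finite_freqs]) auto
    moreover have "(\<Sum>n\<in>freqs J. \<Sum>m\<in>freqs J. cmod (?L n m)) = (\<Sum>n\<in>freqs J. \<Sum>m\<in>freqs J. cmod (?D w n m))"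
      by (intro sum.cong refl) auto
    ultimately have L: "mat_bound ?L (\<epsilon> / 2)" using w(1) by (auto elim: mat_bound_mono)
    have 1: "mat_bound (tail_from (Suc J) (weighted_kern s z (fst w) (snd w))) (\<epsilon> / 4)"
      "mat_bound (\<lambda>n m. - tail_from (Suc J) (weighted_kern s z t r) n m) (\<epsilon> / 4)"
      using mat_bound_uminus[OF tail[OF tr]] tail[of "fst w" "snd w"] w(2) by auto
    have "?D w = (\<lambda>n m. ?L n m + (tail_from (Suc J) (weighted_kern s z (fst w) (snd w)) n m + - tail_from (Suc J) (weighted_kern s z t r) n m))"
      by (intro ext) (auto simp: tail_from_def lev_le_iff[symmetric] not_le Suc_le_eq less_max_iff_disj)
    moreover have "\<epsilon> / 2 + (\<epsilon> / 4 + \<epsilon> / 4) = \<epsilon>" by simp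
    ultimately show "mat_bound (?D w) \<epsilon>" using mat_bound_add[OF L mat_bound_add[OF 1]] by simp
  qed
qed (use \<alpha> X in auto)

end

section \<open>Toeplitz blocks and trigonometric polynomials\<close>

definition node :: "nat \<Rightarrow> nat \<Rightarrow> real" where
  "node L l = 2 * pi * real l / real L"

text \<open>For \<open>k \<noteq> 0\<close> this is a geometric sum over all powers of an \<open>L\<close>-th root of unity, which differs from one since \<open>L\<close> does not
divide \<open>k\<close>.\<close>
lemma character_sum:
  fixes k :: int
  assumes k: "\<bar>k\<bar> < int L"
  shows "(\<Sum>l<L. cis (of_int k * node L l)) = (if k = 0 then of_nat L else 0)"
proof (cases "k = 0")
  case False
  have L: "real L > 0" using k by auto
  define w where "w = cis (2 * pi * of_int k / real L)"
  have pw: "cis (of_int k * node L l) = w ^ l" for l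
  proof -
    have "w ^ l = cis (real l * (2 * pi * of_int k / real L))" unfolding w_def by (rule Complex.DeMoivre)
    then show ?thesis by (simp add: node_def mult_ac)
  qed
  have "w ^ L = cis (real L * (2 * pi * of_int k / real L))" unfolding w_def by (rule Complex.DeMoivre)
  then have "w ^ L = cis (2 * pi * of_int k)" using L by simp
  then have wL: "w ^ L = 1" by (simp add: cis_multiple_2pi)
  have "w \<noteq> 1"
  proof
    assume "w = 1"
    then have "cos (2 * pi * of_int k / real L) = 1" by (simp add: w_def complex_eq_iff)
    then obtain n :: int where "2 * pi * of_int k / real L = of_int n * 2 * pi" using cos_one_2pi_int by blast
    then have "of_int k = of_int n * real L" using L by (simp add: field_simps)
    then have e: "k = n * int L" by (metis of_int_eq_iff of_int_mult of_int_of_nat_eq)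
    then have "1 \<le> \<bar>n\<bar>" using False by auto
    then have "1 * int L \<le> \<bar>n\<bar> * int L" by (rule mult_right_mono) simp
    then show False using k unfolding e abs_mult by simp
  qed
  then have "(\<Sum>l<L. w ^ l) = 0" using wL by (simp add: geometric_sum)
  then show ?thesis using False pw by simp
qed simp

definition trig :: "int set \<Rightarrow> (int \<Rightarrow> complex) \<Rightarrow> real \<Rightarrow> complex" where
  "trig F g x = (\<Sum>n\<in>F. g n * cis (of_int n * x))"

lemma trig_parseval:
  assumes F: "finite F" "\<And>n n'. n \<in> F \<Longrightarrow> n' \<in> F \<Longrightarrow> \<bar>n - n'\<bar> < int L"
  shows "L2_set (\<lambda>l. cmod (trig F g (node L l))) {..<L} = sqrt (real L) * nrm F g"
proof -
  have cc: "cis (of_int n * x) * cnj (cis (of_int n' * x)) = cis (of_int (n - n') * x)" for n n' x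
    by (simp add: cis_cnj cis_mult left_diff_distrib)
  have "(\<Sum>l<L. trig F g (node L l) * cnj (trig F g (node L l)))
     = (\<Sum>l<L. \<Sum>n\<in>F. \<Sum>n'\<in>F. g n * cnj (g n') * cis (of_int (n - n') * node L l))"
    unfolding trig_def cnj_sum sum_product complex_cnj_mult cc[symmetric]
    by (intro sum.cong refl) (simp only: mult_ac)
  also have "\<dots> = (\<Sum>n\<in>F. \<Sum>n'\<in>F. g n * cnj (g n') * (\<Sum>l<L. cis (of_int (n - n') * node L l)))"
    unfolding sum_distrib_left by (subst sum.swap, rule sum.cong[OF refl], rule sum.swap)
  also have "\<dots> = (\<Sum>n\<in>F. \<Sum>n'\<in>F. if n' = n then g n * cnj (g n) * of_nat L else 0)"
    by (intro sum.cong refl, subst character_sum) (use F in auto)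
  also have "\<dots> = of_nat L * (\<Sum>n\<in>F. g n * cnj (g n))"
    using F(1) by (simp add: sum_distrib_left mult_ac)
  finally have "(\<Sum>l<L. trig F g (node L l) * cnj (trig F g (node L l))) = of_nat L * (\<Sum>n\<in>F. g n * cnj (g n))" .
  then have "complex_of_real (\<Sum>l<L. (cmod (trig F g (node L l)))\<^sup>2) = complex_of_real (real L * (\<Sum>n\<in>F. (cmod (g n))\<^sup>2))"
    by (simp add: complex_norm_square del: of_real_power)
  then have "(\<Sum>l<L. (cmod (trig F g (node L l)))\<^sup>2) = real L * (\<Sum>n\<in>F. (cmod (g n))\<^sup>2)"
    by (simp only: of_real_eq_iff)
  then show ?thesis unfolding L2_set_def by (simp add: real_sqrt_mult)
qed

lemma sum_product3:
  fixes a b c :: "int \<Rightarrow> complex"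
  shows "(\<Sum>n\<in>F. a n) * (\<Sum>k\<in>R. b k) * (\<Sum>m\<in>G. c m) = (\<Sum>n\<in>F. \<Sum>k\<in>R. \<Sum>m\<in>G. a n * b k * c m)"
proof -
  have r: "(\<Sum>n\<in>F. \<Sum>k\<in>R. a n * b k) * x = (\<Sum>n\<in>F. \<Sum>k\<in>R. a n * b k * x)" for x
    by (simp only: sum_distrib_right)
  show ?thesis unfolding sum_product[of a F b R] r by (simp only: sum_distrib_left)
qed

text \<open>A Toeplitz form is an integral of a product of three trigonometric polynomials. The frequencies in the product are below
\<open>L\<close> in modulus, so the quadrature with \<open>L\<close> equidistant nodes is exact.\<close>
lemma toeplitz_expansion:
  assumes F: "finite F" "finite G" "finite R" and R: "\<And>n m. n \<in> F \<Longrightarrow> m \<in> G \<Longrightarrow> n - m \<in> R"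
    and L: "\<And>n m k. n \<in> F \<Longrightarrow> m \<in> G \<Longrightarrow> k \<in> R \<Longrightarrow> \<bar>k + m - n\<bar> < int L"
  shows "(\<Sum>l<L. cnj (trig F g (node L l)) * trig R y (node L l) * trig G f (node L l))
     = of_nat L * bil F G (\<lambda>n. cnj (g n)) (\<lambda>n m. y (n - m)) f"
proof -
  have c: "cis (- (of_int n * x)) * cis (of_int k * x) * cis (of_int m * x) = cis (of_int (k + m - n) * x)" for n k m x
    unfolding cis_mult by (rule arg_cong[of _ _ cis]) (simp add: algebra_simps)
  have "(\<Sum>l<L. cnj (trig F g (node L l)) * trig R y (node L l) * trig G f (node L l))
     = (\<Sum>l<L. \<Sum>n\<in>F. \<Sum>m\<in>G. \<Sum>k\<in>R. (cnj (g n) * y k * f m) * cis (of_int (k + m - n) * node L l))"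
  proof (intro sum.cong refl)
    fix l
    let ?x = "node L l"
    have "cnj (trig F g ?x) * trig R y ?x * trig G f ?x =
      (\<Sum>n\<in>F. \<Sum>k\<in>R. \<Sum>m\<in>G. (cnj (g n) * cis (- (of_int n * ?x))) * (y k * cis (of_int k * ?x)) * (f m * cis (of_int m * ?x)))"
      unfolding trig_def cnj_sum complex_cnj_mult cis_cnj by (rule sum_product3)
    also have "\<dots> = (\<Sum>n\<in>F. \<Sum>k\<in>R. \<Sum>m\<in>G. (cnj (g n) * y k * f m) * cis (of_int (k + m - n) * ?x))"
      unfolding c[symmetric] by (intro sum.cong refl) (simp only: mult_ac)
    also have "\<dots> = (\<Sum>n\<in>F. \<Sum>m\<in>G. \<Sum>k\<in>R. (cnj (g n) * y k * f m) * cis (of_int (k + m - n) * ?x))"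
      by (rule sum.cong[OF refl], rule sum.swap)
    finally show "cnj (trig F g ?x) * trig R y ?x * trig G f ?x = (\<Sum>n\<in>F. \<Sum>m\<in>G. \<Sum>k\<in>R. (cnj (g n) * y k * f m) * cis (of_int (k + m - n) * ?x))" .
  qed
  also have "\<dots> = (\<Sum>n\<in>F. \<Sum>m\<in>G. \<Sum>k\<in>R. \<Sum>l<L. (cnj (g n) * y k * f m) * cis (of_int (k + m - n) * node L l))"
    by (subst sum.swap, rule sum.cong[OF refl], subst sum.swap, rule sum.cong[OF refl], rule sum.swap)
  also have "\<dots> = (\<Sum>n\<in>F. \<Sum>m\<in>G. \<Sum>k\<in>R. if k = n - m then cnj (g n) * y (n - m) * f m * of_nat L else 0)"
    unfolding sum_distrib_left[symmetric] by (intro sum.cong refl, subst character_sum) (use L in auto)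
  also have "\<dots> = (\<Sum>n\<in>F. \<Sum>m\<in>G. cnj (g n) * y (n - m) * f m * of_nat L)"
    using R F by (intro sum.cong refl) (simp add: sum.delta')
  also have "\<dots> = of_nat L * bil F G (\<lambda>n. cnj (g n)) (\<lambda>n m. y (n - m)) f"
    unfolding bil_def by (simp add: sum_distrib_left mult_ac)
  finally show ?thesis .
qed

text \<open>With \<open>4 \<sdot> 2\<^sup>j + 1\<close> nodes the quadrature is exact for the frequencies \<open>k + m - n\<close> in question. Bounding the symbol by its maximum over
the nodes, the Cauchy-Schwarz inequality and the discrete Parseval identity finish the estimate. Finitely many nodes
matter: in the application a union over them replaces a supremum over the circle.\<close>
lemma toeplitz_grid_bound:
  assumes L: "L = 4 * 2 ^ j + 1" and P: "\<And>l. l < L \<Longrightarrow> cmod (trig (freqs (Suc j)) y (node L l)) \<le> P"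
  shows "block_bound (freqs j) (freqs j) (\<lambda>n m. y (n - m)) P"
  unfolding block_bound_def
proof (intro allI)
  fix g f :: "int \<Rightarrow> complex"
  let ?F = "freqs j" and ?R = "freqs (Suc j)"
  have "L > 0" unfolding L by (rule add_nonneg_pos) auto
  then have L0: "real L > 0" by simp
  have "0 < L" using L0 by simp
  then have P0: "P \<ge> 0" by (rule order_trans[OF norm_ge_zero P])
  let ?g = "\<lambda>n. cnj (g n)"
  let ?G = "\<lambda>l. trig ?F ?g (node L l)" and ?Y = "\<lambda>l. trig ?R y (node L l)" and ?H = "\<lambda>l. trig ?F f (node L l)"
  have e: "(\<Sum>l<L. cnj (?G l) * ?Y l * ?H l) = of_nat L * bil ?F ?F (\<lambda>n. cnj (?g n)) (\<lambda>n m. y (n - m)) f"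
    by (rule toeplitz_expansion[OF finite_freqs finite_freqs finite_freqs]) (auto simp: freqs_def L)
  have par: "L2_set (\<lambda>l. cmod (trig ?F h (node L l))) {..<L} = sqrt (real L) * nrm ?F h" for h
    by (rule trig_parseval[OF finite_freqs]) (auto simp: freqs_def L)
  have "real L * cmod (bil ?F ?F g (\<lambda>n m. y (n - m)) f) = cmod (\<Sum>l<L. cnj (?G l) * ?Y l * ?H l)"
    unfolding e by (simp add: norm_mult)
  also have "\<dots> \<le> (\<Sum>l<L. P * (cmod (?G l) * cmod (?H l)))"
  proof (rule sum_norm_le)
    fix l assume "l \<in> {..<L}"
    then have "cmod (?Y l) * (cmod (?G l) * cmod (?H l)) \<le> P * (cmod (?G l) * cmod (?H l))" using P by (intro mult_right_mono) auto
    then show "cmod (cnj (?G l) * ?Y l * ?H l) \<le> P * (cmod (?G l) * cmod (?H l))" by (simp add: norm_mult mult_ac)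
  qed
  also have "\<dots> = P * (\<Sum>l<L. \<bar>cmod (?G l)\<bar> * \<bar>cmod (?H l)\<bar>)" by (simp add: sum_distrib_left)
  also have "\<dots> \<le> P * ((sqrt (real L) * nrm ?F ?g) * (sqrt (real L) * nrm ?F f))"
    unfolding par[symmetric] using P0 by (intro mult_left_mono L2_set_mult_ineq)
  also have "\<dots> = real L * (P * nrm ?F g * nrm ?F f)"
    using L0 by (simp add: mult_ac real_sqrt_mult_self)
  finally show "cmod (bil ?F ?F g (\<lambda>n m. y (n - m)) f) \<le> P * nrm ?F g * nrm ?F f"
    using L0 by (simp add: mult_le_cancel_left_pos)
qed

section \<open>Continuous modifications along dyadic points\<close>

definition dyadic_floor :: "nat \<Rightarrow> real \<Rightarrow> real" where
  "dyadic_floor i t = real (nat \<lfloor>t * 2 ^ i\<rfloor>) / 2 ^ i"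

text \<open>Depends on the values of \<open>y\<close> at dyadic points only; for a process this selects a modification.\<close>
definition dyadic_limit :: "(real \<Rightarrow> complex) \<Rightarrow> real \<Rightarrow> complex" where
  "dyadic_limit y t = lim (\<lambda>i. y (dyadic_floor i t))"

definition dyadic_holder :: "real \<Rightarrow> nat \<Rightarrow> real \<Rightarrow> (real \<Rightarrow> complex) \<Rightarrow> bool" where
  "dyadic_holder \<beta> T q y \<longleftrightarrow> (\<forall>i. \<forall>l < T * 2 ^ i.
     cmod (y (real (Suc l) / 2 ^ i) - y (real l / 2 ^ i)) \<le> q * (1 / 2 ^ i) powr \<beta>)"

lemma dyadic_floor_bounds:
  assumes "t \<ge> 0"
  shows "0 \<le> dyadic_floor i t" "dyadic_floor i t \<le> t" "t < dyadic_floor i t + 1 / 2 ^ i"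
proof -
  have n: "real (nat \<lfloor>t * 2 ^ i\<rfloor>) = of_int \<lfloor>t * 2 ^ i\<rfloor>" using assms by simp
  have "real (nat \<lfloor>t * 2 ^ i\<rfloor>) \<le> t * 2 ^ i" "t * 2 ^ i < real (nat \<lfloor>t * 2 ^ i\<rfloor>) + 1" unfolding n by linarith+
  then show "0 \<le> dyadic_floor i t" "dyadic_floor i t \<le> t" "t < dyadic_floor i t + 1 / 2 ^ i"
    by (simp_all add: dyadic_floor_def field_simps)
qed

lemma dyadic_holder_nonneg:
  assumes "dyadic_holder \<beta> T q y" "T > 0" shows "q \<ge> 0"
proof -
  have "cmod (y 1 - y 0) \<le> q" using assms unfolding dyadic_holder_def by (auto dest!: spec[of _ 0])
  then show ?thesis by (meson norm_ge_zero order_trans)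
qed

text \<open>Consecutive dyadic approximations from below are equal or neighbours in the finer grid.\<close>
lemma dyadic_floor_step:
  assumes y: "dyadic_holder \<beta> T q y" and t: "0 \<le> t" "t \<le> real T" and T: "T > 0"
  shows "cmod (y (dyadic_floor (Suc i) t) - y (dyadic_floor i t)) \<le> q * (1 / 2 ^ Suc i) powr \<beta>"
proof -
  let ?m = "nat \<lfloor>t * 2 ^ i\<rfloor>" and ?m' = "nat \<lfloor>t * 2 ^ Suc i\<rfloor>"
  have n: "real (nat \<lfloor>t * 2 ^ k\<rfloor>) = of_int \<lfloor>t * 2 ^ k\<rfloor>" for k using t by simp
  have le: "real ?m \<le> t * 2 ^ i" "t * 2 ^ i < real ?m + 1" "real ?m' \<le> t * 2 ^ Suc i" "t * 2 ^ Suc i < real ?m' + 1"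
    unfolding n by linarith+
  define M M' where M: "M = ?m" "M' = ?m'"
  have "2 * real M < real M' + 1" "real M' < 2 * real M + 2" using le unfolding M[symmetric] by simp_all
  then have "?m' = 2 * ?m \<or> ?m' = Suc (2 * ?m)" unfolding M[symmetric] by linarith
  then consider "?m' = 2 * ?m" | "?m' = Suc (2 * ?m)" by blast
  then show ?thesis
  proof cases
    case 1
    then have "dyadic_floor (Suc i) t = dyadic_floor i t" unfolding dyadic_floor_def by simp
    then show ?thesis using dyadic_holder_nonneg[OF y T] by simp
  next
    case 2
    have "real ?m' \<le> real T * 2 ^ Suc i" using le(3) t by (meson mult_right_mono order_trans zero_le_numeral zero_le_power)
    then have "real ?m' \<le> real (T * 2 ^ Suc i)" by simp
    then have "2 * ?m < T * 2 ^ Suc i" unfolding 2 by (simp only: of_nat_le_iff)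
    then have "cmod (y (real (Suc (2 * ?m)) / 2 ^ Suc i) - y (real (2 * ?m) / 2 ^ Suc i)) \<le> q * (1 / 2 ^ Suc i) powr \<beta>"
      using y unfolding dyadic_holder_def by blast
    moreover have "real (2 * ?m) / 2 ^ Suc i = dyadic_floor i t" unfolding dyadic_floor_def by simp
    moreover have "real (Suc (2 * ?m)) / 2 ^ Suc i = dyadic_floor (Suc i) t" unfolding dyadic_floor_def 2 ..
    ultimately show ?thesis by simp
  qed
qed

text \<open>The chaining argument. Each point is joined to its approximation of generation \<open>n\<close> by a geometric series of neighbouring
increments; two points with \<open>|t - t'|\<close> of order \<open>2\<^bsup>-n\<^esup>\<close> have approximations of generation \<open>n\<close> at most \<open>T\<close> steps apart. The
last number is larger than one only because generation \<open>0\<close> has to serve all distances above one, and it accounts for the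
dependence of the constant on \<open>T\<close>.\<close>
lemma dyadic_limit_holder:
  fixes \<beta> :: real
  assumes y: "dyadic_holder \<beta> T q y" and T: "T > 0" and \<beta>: "0 < \<beta>" "\<beta> \<le> 1"
  shows dyadic_limit_converges: "\<And>t. t \<in> {0..real T} \<Longrightarrow> (\<lambda>i. y (dyadic_floor i t)) \<longlonglongrightarrow> dyadic_limit y t"
    and "\<And>t t'. t \<in> {0..real T} \<Longrightarrow> t' \<in> {0..real T} \<Longrightarrow>
      cmod (dyadic_limit y t - dyadic_limit y t') \<le> (6 * real T / (1 - 2 powr - \<beta>)) * q * \<bar>t - t'\<bar> powr \<beta>"
proof -
  define \<theta> where "\<theta> = (2::real) powr - \<beta>"
  have \<theta>: "0 < \<theta>" "\<theta> < 1"
  proof -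
    have "(2::real) powr - \<beta> < 2 powr 0" using \<beta> by (intro powr_less_mono) auto
    then show "\<theta> < 1" by (simp add: \<theta>_def)
  qed (simp add: \<theta>_def)
  have pw: "(1 / 2 ^ i) powr \<beta> = \<theta> ^ i" for i
    unfolding \<theta>_def by (simp add: powr_divide powr_realpow[symmetric] powr_powr powr_minus inverse_eq_divide power_divide mult.commute)
  have q: "q \<ge> 0" by (rule dyadic_holder_nonneg[OF y T])
  let ?a = "\<lambda>t i. y (dyadic_floor i t)"
  have step: "cmod (?a t (Suc i) - ?a t i) \<le> q * \<theta> ^ Suc i" if "t \<in> {0..real T}" for t i
    using dyadic_floor_step[OF y _ _ T, of t i] that unfolding pw by simp
  have geo: "(\<lambda>i. q * \<theta> ^ Suc (i + n)) sums (q * \<theta> ^ Suc n / (1 - \<theta>))" for n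
    using sums_mult[OF geometric_sums[of \<theta>], of "q * \<theta> ^ Suc n"] \<theta> by (simp add: power_add mult_ac)
  show conv: "(\<lambda>i. y (dyadic_floor i t)) \<longlonglongrightarrow> dyadic_limit y t" if t: "t \<in> {0..real T}" for t
  proof -
    have "summable (\<lambda>i. q * \<theta> ^ Suc i)" using sums_summable[OF geo[of 0]] by simp
    then have "summable (\<lambda>i. ?a t (Suc i) - ?a t i)" by (rule summable_comparison_test') (rule step[OF t])
    then have "(\<lambda>n. \<Sum>i<n. ?a t (Suc i) - ?a t i) \<longlonglongrightarrow> (\<Sum>i. ?a t (Suc i) - ?a t i)" by (rule summable_LIMSEQ)
    then have "(\<lambda>n. (?a t n - ?a t 0) + ?a t 0) \<longlonglongrightarrow> (\<Sum>i. ?a t (Suc i) - ?a t i) + ?a t 0"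
      unfolding sum_lessThan_telescope[of "?a t"] by (intro tendsto_add tendsto_const)
    then have "convergent (?a t)" unfolding convergent_def by auto
    then show ?thesis unfolding dyadic_limit_def by (simp add: convergent_LIMSEQ_iff)
  qed
  have close: "cmod (dyadic_limit y t - ?a t n) \<le> q * \<theta> ^ n / (1 - \<theta>)" if t: "t \<in> {0..real T}" for t n
  proof -
    have "(\<lambda>i. ?a t (Suc (i + n)) - ?a t (i + n)) sums (dyadic_limit y t - ?a t (0 + n))"
      using telescope_sums[OF LIMSEQ_ignore_initial_segment[OF conv[OF t], of n]] by simp
    then have e: "dyadic_limit y t - ?a t n = (\<Sum>i. ?a t (Suc (i + n)) - ?a t (i + n))" using sums_unique by simp
    have "cmod (\<Sum>i. ?a t (Suc (i + n)) - ?a t (i + n)) \<le> (\<Sum>i. q * \<theta> ^ Suc (i + n))"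
      using step[OF t] sums_summable[OF geo] by (rule norm_suminf_le)
    also have "\<dots> = q * \<theta> ^ Suc n / (1 - \<theta>)" using sums_unique[OF geo] by simp
    also have "\<dots> \<le> q * \<theta> ^ n / (1 - \<theta>)"
      using q \<theta> by (intro divide_right_mono mult_left_mono power_decreasing) auto
    finally show ?thesis unfolding e .
  qed
  define M where "M = 6 * real T / (1 - \<theta>)"
  have main: "cmod (dyadic_limit y t - dyadic_limit y t') \<le> M * q * (t - t') powr \<beta>"
    if t: "t \<in> {0..real T}" "t' \<in> {0..real T}" "t' < t" for t t'
  proof -
    \<comment> \<open>\<open>n\<close> is chosen so that \<open>t\<close> and \<open>t'\<close> lie in dyadic cells of generation \<open>n\<close> at bounded distance\<close>
    have ex: "\<exists>n. 1 / 2 ^ Suc n < t - t'"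
    proof -
      obtain N where N: "1 / (t - t') < 2 ^ N" using real_arch_pow[of 2 "1 / (t - t')"] by auto
      then have "1 / 2 ^ N < t - t'" using t by (simp add: field_simps)
      moreover have "1 / 2 ^ Suc N \<le> (1 / 2 ^ N :: real)" by (simp add: field_simps)
      ultimately show ?thesis by (intro exI[of _ N]) linarith
    qed
    define n where "n = (LEAST n. 1 / 2 ^ Suc n < t - t')"
    have n1: "1 / 2 ^ Suc n < t - t'" unfolding n_def by (rule LeastI_ex[OF ex])
    have n2: "t - t' \<le> real T * (1 / 2 ^ n)"
    proof (cases n)
      case 0
      then show ?thesis using t by simp
    next
      case (Suc k)
      then have "k < n" by simp
      then have "\<not> 1 / 2 ^ Suc k < t - t'" unfolding n_def by (rule not_less_Least)
      then have "t - t' \<le> 1 / 2 ^ n" unfolding Suc by linarith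
      also have "\<dots> \<le> real T * (1 / 2 ^ n)" using T mult_right_mono[of 1 "real T" "1 / 2 ^ n"] by simp
      finally show ?thesis .
    qed
    let ?m = "nat \<lfloor>t * 2 ^ n\<rfloor>" and ?m' = "nat \<lfloor>t' * 2 ^ n\<rfloor>"
    have mm: "?m' \<le> ?m" using t by (intro nat_mono floor_mono mult_right_mono) auto
    have f: "dyadic_floor n t = real ?m / 2 ^ n" "dyadic_floor n t' = real ?m' / 2 ^ n" by (simp_all add: dyadic_floor_def)
    have "real ?m / 2 ^ n - real ?m' / 2 ^ n < real T * (1 / 2 ^ n) + 1 / 2 ^ n"
      using dyadic_floor_bounds[of t n] dyadic_floor_bounds[of t' n] t n2 unfolding f by simp
    then have "(real ?m - real ?m') / 2 ^ n < (real T + 1) / 2 ^ n"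
      by (simp add: diff_divide_distrib add_divide_distrib)
    then have "real ?m - real ?m' < real T + 1" by (rule divide_less_cancel[THEN iffD1, THEN conjunct1, rule_format]) simp
    then have mT: "?m \<le> ?m' + T" by linarith
    have "real ?m / 2 ^ n \<le> real T" using dyadic_floor_bounds(2)[of t n] t unfolding f by simp
    then have "real ?m \<le> real (T * 2 ^ n)" by (simp add: field_simps)
    then have mT2: "?m \<le> T * 2 ^ n" by (simp only: of_nat_le_iff)
    have "?a t n - ?a t' n = (\<Sum>l\<in>{?m'..<?m}. y (real (Suc l) / 2 ^ n) - y (real l / 2 ^ n))"
      unfolding f using sum_Suc_diff'[OF mm, of "\<lambda>l. y (real l / 2 ^ n)"] by simp
    then have "cmod (?a t n - ?a t' n) = cmod (\<Sum>l\<in>{?m'..<?m}. y (real (Suc l) / 2 ^ n) - y (real l / 2 ^ n))" by simp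
    also have "\<dots> \<le> (\<Sum>l\<in>{?m'..<?m}. q * \<theta> ^ n)"
    proof (rule sum_norm_le)
      fix l assume "l \<in> {?m'..<?m}"
      then have "l < T * 2 ^ n" using mT2 by simp
      then show "norm (y (real (Suc l) / 2 ^ n) - y (real l / 2 ^ n)) \<le> q * \<theta> ^ n"
        using y unfolding dyadic_holder_def pw[symmetric] by blast
    qed
    also have "\<dots> \<le> real T * (q * \<theta> ^ n)"
    proof -
      have "real (?m - ?m') \<le> real T" using mT by simp
      then show ?thesis using q \<theta> by (simp add: mult_right_mono)
    qed
    also have "\<dots> \<le> real T * (q * \<theta> ^ n / (1 - \<theta>))"
      using q \<theta> by (intro mult_left_mono) (auto simp: pos_le_divide_eq intro: mult_left_le)
    finally have a: "cmod (?a t n - ?a t' n) \<le> real T * (q * \<theta> ^ n / (1 - \<theta>))" .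
    have "dyadic_limit y t - dyadic_limit y t' = (dyadic_limit y t - ?a t n) - (dyadic_limit y t' - ?a t' n) + (?a t n - ?a t' n)" by simp
    then have "cmod (dyadic_limit y t - dyadic_limit y t') \<le> cmod (dyadic_limit y t - ?a t n) + cmod (dyadic_limit y t' - ?a t' n) + cmod (?a t n - ?a t' n)"
      by (metis (no_types, lifting) add_right_mono norm_triangle_ineq norm_triangle_ineq4 order_trans)
    also have "\<dots> \<le> q * \<theta> ^ n / (1 - \<theta>) + q * \<theta> ^ n / (1 - \<theta>) + real T * (q * \<theta> ^ n / (1 - \<theta>))"
      using close[OF t(1), of n] close[OF t(2), of n] a by linarith
    also have "\<dots> \<le> 4 * real T * (q * \<theta> ^ n / (1 - \<theta>)) - real T * (q * \<theta> ^ n / (1 - \<theta>))"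
    proof -
      have "1 * (q * \<theta> ^ n / (1 - \<theta>)) \<le> real T * (q * \<theta> ^ n / (1 - \<theta>))" using T q \<theta> by (intro mult_right_mono) auto
      moreover have "1 * E \<le> real T * E \<Longrightarrow> E + E + real T * E \<le> 4 * real T * E - real T * E" for E
        by (simp add: algebra_simps)
      ultimately show ?thesis by blast
    qed
    also have "\<dots> = 3 * real T * (q * \<theta> ^ n / (1 - \<theta>))"
    proof -
      have "4 * real T * E - real T * E = 3 * real T * E" for E by simp
      then show ?thesis .
    qed
    finally have b: "cmod (dyadic_limit y t - dyadic_limit y t') \<le> 3 * real T * (q * \<theta> ^ n / (1 - \<theta>))" .
    have "\<theta> ^ n = (1 / 2 ^ n) powr \<beta>" by (simp only: pw)
    also have "\<dots> \<le> (2 * (t - t')) powr \<beta>" using n1 \<beta> by (intro powr_mono2) auto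
    also have "\<dots> = 2 powr \<beta> * (t - t') powr \<beta>" using t powr_mult[of 2 "t - t'" \<beta>] by simp
    also have "\<dots> \<le> 2 * (t - t') powr \<beta>" using powr_mono[of \<beta> 1 "2 :: real"] \<beta> by (intro mult_right_mono) auto
    finally have c: "\<theta> ^ n \<le> 2 * (t - t') powr \<beta>" .
    have "3 * real T * (q * \<theta> ^ n / (1 - \<theta>)) \<le> 3 * real T * (q * (2 * (t - t') powr \<beta>) / (1 - \<theta>))"
      using c q \<theta> by (intro mult_left_mono divide_right_mono) auto
    also have "\<dots> = M * q * (t - t') powr \<beta>" by (simp add: M_def)
    finally show ?thesis using b by linarith
  qed
  show "cmod (dyadic_limit y t - dyadic_limit y t') \<le> (6 * real T / (1 - 2 powr - \<beta>)) * q * \<bar>t - t'\<bar> powr \<beta>"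
    if t: "t \<in> {0..real T}" "t' \<in> {0..real T}" for t t'
    using main[of t t'] main[of t' t] t unfolding M_def \<theta>_def
    by (cases t t' rule: linorder_cases) (auto simp: norm_minus_commute abs_if)
qed

section \<open>Gaussian moments of the noise\<close>

definition gauss_moment :: "nat \<Rightarrow> real" where
  "gauss_moment q = fact (2 * q) / (2 ^ q * fact q)"

lemma gauss_moment_pos: "gauss_moment q > 0"
  by (simp add: gauss_moment_def)

lemma normal_moment_value: "\<sigma> > 0 \<Longrightarrow> fact (2 * q) / ((2 / \<sigma>\<^sup>2) ^ q * fact q) = gauss_moment q * \<sigma> ^ (2 * q)"
  by (simp add: gauss_moment_def power_divide power_mult[symmetric] field_simps)

context prob_space
begin

lemma normal_even_moment:
  assumes \<sigma>: "\<sigma> > 0" and X: "distributed M lborel X (normal_density 0 \<sigma>)"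
  shows "(\<integral>\<^sup>+\<omega>. ennreal (X \<omega> ^ (2 * q)) \<partial>M) = ennreal (gauss_moment q * \<sigma> ^ (2 * q))"
proof -
  have h: "has_bochner_integral lborel (\<lambda>x. normal_density 0 \<sigma> x * x ^ (2 * q)) (gauss_moment q * \<sigma> ^ (2 * q))"
    using normal_moment_even[OF \<sigma>, of 0 q] normal_moment_value[OF \<sigma>] by simp
  have "(\<integral>\<^sup>+\<omega>. ennreal (X \<omega> ^ (2 * q)) \<partial>M) = (\<integral>\<^sup>+x. ennreal (normal_density 0 \<sigma> x) * ennreal (x ^ (2 * q)) \<partial>lborel)"
    by (rule distributed_nn_integral[OF X, symmetric]) simp
  also have "\<dots> = (\<integral>\<^sup>+x. ennreal (normal_density 0 \<sigma> x * x ^ (2 * q)) \<partial>lborel)"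
    by (intro nn_integral_cong) (simp add: ennreal_mult')
  also have "\<dots> = ennreal (integral\<^sup>L lborel (\<lambda>x. normal_density 0 \<sigma> x * x ^ (2 * q)))"
    using h by (intro nn_integral_eq_integral) (auto simp: has_bochner_integral_iff)
  also have "\<dots> = ennreal (gauss_moment q * \<sigma> ^ (2 * q))" using h by (simp add: has_bochner_integral_iff)
  finally show ?thesis .
qed

lemma normal_second_moment:
  assumes \<sigma>: "\<sigma> > 0" and X: "distributed M lborel X (normal_density 0 \<sigma>)"
  shows "integrable M (\<lambda>\<omega>. (X \<omega>)\<^sup>2)" "(LINT \<omega>|M. (X \<omega>)\<^sup>2) = \<sigma>\<^sup>2"
proof -
  have h: "has_bochner_integral lborel (\<lambda>x. normal_density 0 \<sigma> x * x\<^sup>2) (\<sigma>\<^sup>2)"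
    using normal_moment_even[OF \<sigma>, of 0 1] normal_moment_value[OF \<sigma>, of 1] by (simp add: gauss_moment_def)
  show "integrable M (\<lambda>\<omega>. (X \<omega>)\<^sup>2)"
    using distributed_integrable[OF X, of "\<lambda>x. x\<^sup>2"] h by (auto simp: has_bochner_integral_iff)
  show "(LINT \<omega>|M. (X \<omega>)\<^sup>2) = \<sigma>\<^sup>2"
    using distributed_integral[OF X, of "\<lambda>x. x\<^sup>2"] h by (auto simp: has_bochner_integral_iff)
qed

lemma centered_gaussian_square_integrable:
  assumes "centered_gaussian M X" shows "integrable M (\<lambda>\<omega>. (X \<omega>)\<^sup>2)"
proof (cases "AE \<omega> in M. X \<omega> = 0")
  case True
  have [measurable]: "X \<in> borel_measurable M" using assms by (simp add: centered_gaussian_def)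
  have "integrable M (\<lambda>\<omega>. (X \<omega>)\<^sup>2) \<longleftrightarrow> integrable M (\<lambda>\<omega>. 0 :: real)"
    using True by (intro integrable_cong_AE) auto
  then show ?thesis by simp
next
  case False
  then obtain \<sigma> where "\<sigma> > 0" "distributed M lborel X (normal_density 0 \<sigma>)" using assms by (auto simp: centered_gaussian_def)
  then show ?thesis by (rule normal_second_moment)
qed

lemma fbm_gaussian: "fbm M \<beta> Y \<Longrightarrow> finite F \<Longrightarrow> F \<subseteq> {0..} \<Longrightarrow> centered_gaussian M (\<lambda>\<omega>. \<Sum>u\<in>F. c u * Y u \<omega>)"
  by (simp add: fbm_def)

lemma fbm_measurable: assumes "fbm M \<beta> Y" "t \<ge> 0" shows "Y t \<in> borel_measurable M"
  using fbm_gaussian[OF assms(1), of "{t}" "\<lambda>_. 1"] assms(2) by (simp add: centered_gaussian_def)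

text \<open>An increment is centred Gaussian or almost surely zero; its variance, computed from the covariance, excludes the second possibility and
determines the density.\<close>
lemma fbm_increment:
  assumes Y: "fbm M \<beta> Y" and t: "s \<ge> 0" "t \<ge> 0" "s \<noteq> t"
  shows "distributed M lborel (\<lambda>\<omega>. Y t \<omega> - Y s \<omega>) (normal_density 0 (\<bar>t - s\<bar> powr \<beta>))"
proof -
  note g = fbm_gaussian[OF Y]
  have cov: "(LINT \<omega>|M. Y a \<omega> * Y b \<omega>) = (a powr (2 * \<beta>) + b powr (2 * \<beta>) - \<bar>a - b\<bar> powr (2 * \<beta>)) / 2" if "a \<ge> 0" "b \<ge> 0" for a b
    using Y that by (simp add: fbm_def)
  have sq: "integrable M (\<lambda>\<omega>. (Y u \<omega>)\<^sup>2)" if "u \<ge> 0" for u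
    using centered_gaussian_square_integrable[OF g[of "{u}" "\<lambda>_. 1"]] that by simp
  have [measurable]: "Y s \<in> borel_measurable M" "Y t \<in> borel_measurable M" using fbm_measurable[OF Y] t by auto
  have pr: "integrable M (\<lambda>\<omega>. Y t \<omega> * Y s \<omega>)"
  proof (rule Bochner_Integration.integrable_bound[OF Bochner_Integration.integrable_add[OF sq[OF t(1)] sq[OF t(2)]]])
    have "\<bar>a * b\<bar> \<le> b\<^sup>2 + a\<^sup>2" for a b :: real
    proof -
      have "2 * \<bar>a * b\<bar> \<le> a\<^sup>2 + b\<^sup>2" using zero_le_power2[of "\<bar>a\<bar> - \<bar>b\<bar>"] by (simp add: power2_diff abs_mult)
      then show ?thesis using abs_ge_zero[of "a * b"] by linarith
    qed
    then show "AE \<omega> in M. norm (Y t \<omega> * Y s \<omega>) \<le> norm ((Y s \<omega>)\<^sup>2 + (Y t \<omega>)\<^sup>2)"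
      by (intro AE_I2) (simp add: add_nonneg_nonneg)
  qed simp
  let ?D = "\<lambda>\<omega>. Y t \<omega> - Y s \<omega>"
  have D: "centered_gaussian M ?D"
    using g[of "{s, t}" "\<lambda>u. if u = t then 1 else - 1"] t by (simp add: algebra_simps)
  have "(LINT \<omega>|M. (?D \<omega>)\<^sup>2) = (LINT \<omega>|M. (Y t \<omega>)\<^sup>2 + (Y s \<omega>)\<^sup>2 - 2 * (Y t \<omega> * Y s \<omega>))"
    by (intro Bochner_Integration.integral_cong) (auto simp: power2_diff)
  also have "\<dots> = (LINT \<omega>|M. (Y t \<omega>)\<^sup>2) + (LINT \<omega>|M. (Y s \<omega>)\<^sup>2) - 2 * (LINT \<omega>|M. Y t \<omega> * Y s \<omega>)"
    using sq t pr by simp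
  also have "\<dots> = (\<bar>t - s\<bar> powr \<beta>)\<^sup>2"
    using cov[of t t] cov[of s s] cov[of t s] t by (simp add: power2_eq_square powr_add[symmetric])
  finally have E: "(LINT \<omega>|M. (?D \<omega>)\<^sup>2) = (\<bar>t - s\<bar> powr \<beta>)\<^sup>2" .
  have pos: "\<bar>t - s\<bar> powr \<beta> > 0" using t by simp
  have "\<not> (AE \<omega> in M. ?D \<omega> = 0)"
  proof
    assume "AE \<omega> in M. ?D \<omega> = 0"
    then have "(LINT \<omega>|M. (?D \<omega>)\<^sup>2) = (LINT \<omega>|M. 0)" by (intro integral_cong_AE) auto
    then show False using E pos by simp
  qed
  then obtain \<sigma> where \<sigma>: "\<sigma> > 0" "distributed M lborel ?D (normal_density 0 \<sigma>)" using D by (auto simp: centered_gaussian_def)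
  have "\<sigma>\<^sup>2 = (\<bar>t - s\<bar> powr \<beta>)\<^sup>2" using normal_second_moment(2)[OF \<sigma>] E by simp
  then have "\<sigma> = \<bar>t - s\<bar> powr \<beta>" using \<sigma>(1) pos by (simp add: power2_eq_iff_nonneg)
  then show ?thesis using \<sigma>(2) by simp
qed

end

locale noise = prob_space M for M :: "'a measure" +
  fixes \<beta> :: real and B :: "int \<Rightarrow> real \<Rightarrow> 'a \<Rightarrow> complex"
  assumes \<beta>: "1 / 2 < \<beta>" "\<beta> < 1" and B: "fbm_noise M \<beta> B"
begin

definition comp_inc :: "real \<Rightarrow> real \<Rightarrow> int \<Rightarrow> 'a \<Rightarrow> real" where
  "comp_inc t s k \<omega> = noise_component B k t \<omega> - noise_component B k s \<omega>"

lemma comp_measurable: "t \<ge> 0 \<Longrightarrow> noise_component B k t \<in> borel_measurable M"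
  using B fbm_measurable unfolding fbm_noise_def by blast

lemma comp_inc_measurable: "s \<ge> 0 \<Longrightarrow> t \<ge> 0 \<Longrightarrow> comp_inc t s k \<in> borel_measurable M"
  unfolding comp_inc_def using comp_measurable by auto

lemma comp_inc_indep:
  assumes "s \<ge> 0" "t \<ge> 0"
  shows "indep_vars (\<lambda>_. borel) (\<lambda>k \<omega>. c k * comp_inc t s k \<omega>) F"
proof -
  let ?P = "PiM {0..} (\<lambda>_. borel) :: (real \<Rightarrow> real) measure"
  have "indep_vars (\<lambda>_. ?P) (\<lambda>k \<omega>. \<lambda>t\<in>{0..}. noise_component B k t \<omega>) UNIV"
    using B by (simp add: fbm_noise_def)
  then have "indep_vars (\<lambda>_. ?P) (\<lambda>k \<omega>. \<lambda>t\<in>{0..}. noise_component B k t \<omega>) F" by (rule indep_vars_subset) simp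
  then have "indep_vars (\<lambda>_. borel) (\<lambda>k \<omega>. (\<lambda>y. c k * (y t - y s)) (\<lambda>t\<in>{0..}. noise_component B k t \<omega>)) F"
  proof (rule indep_vars_compose2)
    fix k
    have [measurable]: "(\<lambda>y. y t) \<in> borel_measurable ?P" "(\<lambda>y. y s) \<in> borel_measurable ?P"
      using assms by (auto intro!: measurable_component_singleton)
    show "(\<lambda>y. c k * (y t - y s)) \<in> borel_measurable ?P" by simp
  qed
  then show ?thesis using assms by (simp add: comp_inc_def)
qed

text \<open>The sum of independent Gaussian variables is Gaussian with variance \<open>(\<Sum> c\<^sub>k\<^sup>2) |t - s|\<^bsup>2\<beta>\<^esup>\<close>. Vanishing coefficients are
discarded first because a degenerate summand has no density.\<close>
lemma real_moment:
  assumes t: "s \<ge> 0" "t \<ge> 0" and q: "q > 0" and F: "finite F"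
  shows "(\<integral>\<^sup>+\<omega>. ennreal ((\<Sum>k\<in>F. c k * comp_inc t s k \<omega>) ^ (2 * q)) \<partial>M)
     \<le> ennreal (gauss_moment q * (\<Sum>k\<in>F. (c k)\<^sup>2) ^ q * (\<bar>t - s\<bar> powr \<beta>) ^ (2 * q))"
proof -
  define F' where "F' = {k \<in> F. c k \<noteq> 0}"
  have F': "finite F'" "F' \<subseteq> F" using F by (auto simp: F'_def)
  have sums: "(\<Sum>k\<in>F. c k * comp_inc t s k \<omega>) = (\<Sum>k\<in>F'. c k * comp_inc t s k \<omega>)" "(\<Sum>k\<in>F. (c k)\<^sup>2) = (\<Sum>k\<in>F'. (c k)\<^sup>2)" for \<omega>
    using F by (auto intro!: sum.mono_neutral_right simp: F'_def)
  show ?thesis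
  proof (cases "s = t \<or> F' = {}")
    case True
    then have "(\<Sum>k\<in>F. c k * comp_inc t s k \<omega>) = 0" for \<omega> unfolding sums by (auto simp: comp_inc_def)
    then have z: "ennreal ((\<Sum>k\<in>F. c k * comp_inc t s k \<omega>) ^ (2 * q)) = 0" for \<omega> using q by (simp add: power_0_left)
    show ?thesis unfolding z by simp
  next
    case False
    then have st: "s \<noteq> t" and ne: "F' \<noteq> {}" by auto
    let ?v = "\<bar>t - s\<bar> powr \<beta>"
    have v: "?v > 0" using st by simp
    have n: "distributed M lborel (\<lambda>\<omega>. c k * comp_inc t s k \<omega>) (normal_density 0 (\<bar>c k\<bar> * ?v))" if "k \<in> F'" for k
    proof -
      have "fbm M \<beta> (noise_component B k)" using B by (simp add: fbm_noise_def)
      from normal_density_affine[OF fbm_increment[OF this t st] v, of "c k" 0]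
      show ?thesis using that by (simp add: F'_def comp_inc_def)
    qed
    define \<sigma> where "\<sigma> = sqrt (\<Sum>k\<in>F'. (\<bar>c k\<bar> * ?v)\<^sup>2)"
    have "distributed M lborel (\<lambda>\<omega>. \<Sum>k\<in>F'. c k * comp_inc t s k \<omega>) (normal_density (\<Sum>k\<in>F'. 0) \<sigma>)"
      unfolding \<sigma>_def
      by (rule sum_indep_normal[OF F'(1) ne comp_inc_indep[OF t] _ n]) (use v in \<open>auto simp: F'_def\<close>)
    then have d: "distributed M lborel (\<lambda>\<omega>. \<Sum>k\<in>F'. c k * comp_inc t s k \<omega>) (normal_density 0 \<sigma>)" by simp
    have \<sigma>2: "\<sigma>\<^sup>2 = (\<Sum>k\<in>F'. (c k)\<^sup>2) * ?v\<^sup>2"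
      unfolding \<sigma>_def by (simp add: sum_nonneg power_mult_distrib sum_distrib_right)
    have "(\<Sum>k\<in>F'. (c k)\<^sup>2) > 0" using F' ne by (intro sum_pos) (auto simp: F'_def)
    then have "\<sigma>\<^sup>2 > 0" unfolding \<sigma>2 using v by simp
    moreover have "\<sigma> \<ge> 0" unfolding \<sigma>_def by (simp add: sum_nonneg)
    ultimately have \<sigma>: "\<sigma> > 0" by (simp add: less_le)
    have "\<sigma> ^ (2 * q) = (\<Sum>k\<in>F'. (c k)\<^sup>2) ^ q * ?v ^ (2 * q)" unfolding power_mult \<sigma>2 power_mult_distrib ..
    then show ?thesis unfolding sums using normal_even_moment[OF \<sigma> d, of q] by (simp add: mult.assoc)
  qed
qed

text \<open>Coefficients expressing \<open>B\<^sub>k\<close> by the two independent real components with indices \<open>k\<close> and \<open>-k\<close>.\<close>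
definition wgt1 :: "int \<Rightarrow> complex" where "wgt1 k = (if k = 0 then 1 else if k > 0 then 1 / sqrt 2 else - \<i> / sqrt 2)"
definition wgt2 :: "int \<Rightarrow> complex" where "wgt2 k = (if k = 0 then 0 else if k > 0 then \<i> / sqrt 2 else 1 / sqrt 2)"

lemma wgt_le: "cmod (wgt1 k) \<le> 1" "cmod (wgt2 k) \<le> 1"
  by (auto simp: wgt1_def wgt2_def norm_divide)

lemma B_components:
  assumes "t \<ge> 0" "\<omega> \<in> space M"
  shows "B k t \<omega> = wgt1 k * of_real (noise_component B k t \<omega>) + wgt2 k * of_real (noise_component B (- k) t \<omega>)"
proof -
  have cnj: "B (- n) t \<omega> = cnj (B n t \<omega>)" for n using B assms by (simp add: fbm_noise_def)
  consider "k = 0" | "k > 0" | "k < 0" by linarith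
  then show ?thesis
  proof cases
    case 1
    have "Im (B 0 t \<omega>) = 0" using cnj[of 0] by (simp add: complex_eq_iff)
    then show ?thesis using 1 by (simp add: noise_component_def wgt1_def wgt2_def complex_eq_iff)
  next
    case 2
    then show ?thesis by (simp add: noise_component_def wgt1_def wgt2_def complex_eq_iff)
  next
    case 3
    then show ?thesis using cnj[of "- k"] by (simp add: noise_component_def wgt1_def wgt2_def complex_eq_iff)
  qed
qed

lemma B_measurable [measurable]: "t \<ge> 0 \<Longrightarrow> B k t \<in> borel_measurable M"
proof -
  assume t: "t \<ge> 0"
  note [measurable] = comp_measurable[OF t]
  have "(\<lambda>\<omega>. wgt1 k * of_real (noise_component B k t \<omega>) + wgt2 k * of_real (noise_component B (- k) t \<omega>)) \<in> borel_measurable M" by simp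
  then show ?thesis by (rule measurable_cong[THEN iffD1, rotated]) (simp add: B_components[OF t])
qed

definition Lin :: "int set \<Rightarrow> (int \<Rightarrow> complex) \<Rightarrow> real \<Rightarrow> 'a \<Rightarrow> complex" where
  "Lin F c t \<omega> = (\<Sum>k\<in>F. c k * B k t \<omega>)"

lemma Lin_measurable [measurable]: "t \<ge> 0 \<Longrightarrow> Lin F c t \<in> borel_measurable M"
  unfolding Lin_def by measurable

definition moment_const :: "nat \<Rightarrow> real" where
  "moment_const q = 4 * 4 ^ (2 * q) * gauss_moment q"

lemma moment_const_nonneg: "moment_const q \<ge> 0"
  using gauss_moment_pos[of q] by (simp add: moment_const_def)

text \<open>The modes \<open>B\<^sub>k\<close> and \<open>B\<^sub>-\<^sub>k\<close> are dependent, so real and imaginary part are each split into a sum over components with index in \<open>F\<close>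
and one over components with index in \<open>-F\<close>. Within each of the four sums the components are independent, and the even
moments of the four are compared with that of the modulus by brute force.\<close>
lemma Lin_moment:
  assumes t: "s \<ge> 0" "t \<ge> 0" and q: "q > 0" and F: "finite F"
  shows "(\<integral>\<^sup>+\<omega>. ennreal (cmod (Lin F c t \<omega> - Lin F c s \<omega>) ^ (2 * q)) \<partial>M)
     \<le> ennreal (moment_const q * (\<Sum>k\<in>F. (cmod (c k))\<^sup>2) ^ q * (\<bar>t - s\<bar> powr \<beta>) ^ (2 * q))"
proof -
  let ?N = "uminus ` F"
  define S where "S G a \<omega> = (\<Sum>k\<in>G. a k * comp_inc t s k \<omega>)" for G a and \<omega>
  define x1 x2 x3 x4 where "x1 = S F (\<lambda>k. Re (c k * wgt1 k))" and "x2 = S F (\<lambda>k. Im (c k * wgt1 k))"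
    and "x3 = S ?N (\<lambda>k. Re (c (- k) * wgt2 (- k)))" and "x4 = S ?N (\<lambda>k. Im (c (- k) * wgt2 (- k)))"
  note xdef = x1_def x2_def x3_def x4_def
  have re: "(\<Sum>k\<in>?N. h k) = (\<Sum>k\<in>F. h (- k))" for h :: "int \<Rightarrow> 'b::comm_monoid_add"
    by (subst sum.reindex) auto
  have dec: "Lin F c t \<omega> - Lin F c s \<omega> = Complex (x1 \<omega> + x3 \<omega>) (x2 \<omega> + x4 \<omega>)" if "\<omega> \<in> space M" for \<omega>
  proof -
    have "Lin F c t \<omega> - Lin F c s \<omega> = (\<Sum>k\<in>F. c k * wgt1 k * of_real (comp_inc t s k \<omega>) + c k * wgt2 k * of_real (comp_inc t s (- k) \<omega>))"
      unfolding Lin_def sum_subtractf[symmetric]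
      by (intro sum.cong refl) (simp add: B_components[OF t(1) that] B_components[OF t(2) that] comp_inc_def algebra_simps)
    then show ?thesis unfolding xdef S_def re by (simp add: complex_eq_iff sum.distrib)
  qed
  have bound: "cmod (Complex (a + b) (c + d)) ^ (2 * q) \<le> 4 ^ (2 * q) * (a ^ (2 * q) + c ^ (2 * q) + b ^ (2 * q) + d ^ (2 * q))" for a b c d :: real
  proof -
    define m where "m = max (max \<bar>a\<bar> \<bar>b\<bar>) (max \<bar>c\<bar> \<bar>d\<bar>)"
    have "cmod (Complex (a + b) (c + d)) \<le> \<bar>a + b\<bar> + \<bar>c + d\<bar>" using cmod_le[of "Complex (a + b) (c + d)"] by simp
    also have "\<dots> \<le> 4 * m"
    proof -
      have "\<bar>a\<bar> \<le> m" "\<bar>b\<bar> \<le> m" "\<bar>c\<bar> \<le> m" "\<bar>d\<bar> \<le> m" by (simp_all add: m_def le_max_iff_disj)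
      then show ?thesis using abs_triangle_ineq[of a b] abs_triangle_ineq[of c d] by linarith
    qed
    finally have "cmod (Complex (a + b) (c + d)) ^ (2 * q) \<le> (4 * m) ^ (2 * q)" by (intro power_mono) auto
    also have "\<dots> = 4 ^ (2 * q) * m ^ (2 * q)" by (rule power_mult_distrib)
    also have "m ^ (2 * q) \<le> a ^ (2 * q) + c ^ (2 * q) + b ^ (2 * q) + d ^ (2 * q)"
    proof -
      have nn: "0 \<le> y ^ (2 * q)" and ab: "\<bar>y\<bar> ^ (2 * q) = y ^ (2 * q)" for y :: real
        by (simp add: zero_le_even_power, rule power_even_abs, simp)
      have "m = \<bar>a\<bar> \<or> m = \<bar>b\<bar> \<or> m = \<bar>c\<bar> \<or> m = \<bar>d\<bar>" unfolding m_def max_def by simp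
      then have "m ^ (2 * q) = a ^ (2 * q) \<or> m ^ (2 * q) = b ^ (2 * q) \<or> m ^ (2 * q) = c ^ (2 * q) \<or> m ^ (2 * q) = d ^ (2 * q)"
        using ab by metis
      then show ?thesis using nn[of a] nn[of b] nn[of c] nn[of d] by linarith
    qed
    finally show ?thesis by simp
  qed
  have Smeas: "S G a \<in> borel_measurable M" for G a
    unfolding S_def using comp_inc_measurable[OF t] by measurable
  let ?V = "(\<Sum>k\<in>F. (cmod (c k))\<^sup>2)" and ?h = "(\<bar>t - s\<bar> powr \<beta>) ^ (2 * q)"
  have mom: "(\<integral>\<^sup>+\<omega>. ennreal (S G a \<omega> ^ (2 * q)) \<partial>M) \<le> ennreal (gauss_moment q * ?V ^ q * ?h)"
    if G: "finite G" and le: "(\<Sum>k\<in>G. (a k)\<^sup>2) \<le> ?V" for G a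
  proof -
    have "(\<integral>\<^sup>+\<omega>. ennreal (S G a \<omega> ^ (2 * q)) \<partial>M) \<le> ennreal (gauss_moment q * (\<Sum>k\<in>G. (a k)\<^sup>2) ^ q * ?h)"
      unfolding S_def by (rule real_moment[OF t q G])
    also have "\<dots> \<le> ennreal (gauss_moment q * ?V ^ q * ?h)"
      using le gauss_moment_pos[of q] by (intro ennreal_leI mult_right_mono mult_left_mono power_mono) (auto intro: sum_nonneg)
    finally show ?thesis .
  qed
  have coef: "(Re (c k * w))\<^sup>2 \<le> (cmod (c k))\<^sup>2" "(Im (c k * w))\<^sup>2 \<le> (cmod (c k))\<^sup>2" if "cmod w \<le> 1" for k w
  proof -
    have "cmod (c k * w) \<le> cmod (c k)" using that by (simp add: norm_mult mult_left_le)
    then have "(cmod (c k * w))\<^sup>2 \<le> (cmod (c k))\<^sup>2" by (intro power_mono) auto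
    then show "(Re (c k * w))\<^sup>2 \<le> (cmod (c k))\<^sup>2" "(Im (c k * w))\<^sup>2 \<le> (cmod (c k))\<^sup>2"
      unfolding cmod_power2 by (smt (verit) zero_le_power2)+
  qed
  have m1: "(\<integral>\<^sup>+\<omega>. ennreal (x1 \<omega> ^ (2 * q)) \<partial>M) \<le> ennreal (gauss_moment q * ?V ^ q * ?h)"
    unfolding xdef by (rule mom[OF F]) (intro sum_mono coef wgt_le)
  have m2: "(\<integral>\<^sup>+\<omega>. ennreal (x2 \<omega> ^ (2 * q)) \<partial>M) \<le> ennreal (gauss_moment q * ?V ^ q * ?h)"
    unfolding xdef by (rule mom[OF F]) (intro sum_mono coef wgt_le)
  have m3: "(\<integral>\<^sup>+\<omega>. ennreal (x3 \<omega> ^ (2 * q)) \<partial>M) \<le> ennreal (gauss_moment q * ?V ^ q * ?h)"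
    unfolding xdef
  proof (rule mom)
    show "(\<Sum>k\<in>?N. (Re (c (- k) * wgt2 (- k)))\<^sup>2) \<le> ?V" unfolding re minus_minus by (intro sum_mono coef wgt_le)
  qed (use F in auto)
  have m4: "(\<integral>\<^sup>+\<omega>. ennreal (x4 \<omega> ^ (2 * q)) \<partial>M) \<le> ennreal (gauss_moment q * ?V ^ q * ?h)"
    unfolding xdef
  proof (rule mom)
    show "(\<Sum>k\<in>?N. (Im (c (- k) * wgt2 (- k)))\<^sup>2) \<le> ?V" unfolding re minus_minus by (intro sum_mono coef wgt_le)
  qed (use F in auto)
  have [measurable]: "x1 \<in> borel_measurable M" "x2 \<in> borel_measurable M" "x3 \<in> borel_measurable M" "x4 \<in> borel_measurable M"
    unfolding xdef by (rule Smeas)+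
  let ?e = "\<lambda>x \<omega>. ennreal (x \<omega> ^ (2 * q))"
  have "(\<integral>\<^sup>+\<omega>. ennreal (cmod (Lin F c t \<omega> - Lin F c s \<omega>) ^ (2 * q)) \<partial>M) \<le> (\<integral>\<^sup>+\<omega>. ennreal (4 ^ (2 * q)) * (?e x1 \<omega> + ?e x2 \<omega> + ?e x3 \<omega> + ?e x4 \<omega>) \<partial>M)"
  proof (rule nn_integral_mono)
    fix \<omega> assume \<omega>: "\<omega> \<in> space M"
    have "ennreal (cmod (Lin F c t \<omega> - Lin F c s \<omega>) ^ (2 * q)) \<le> ennreal (4 ^ (2 * q) * (x1 \<omega> ^ (2 * q) + x2 \<omega> ^ (2 * q) + x3 \<omega> ^ (2 * q) + x4 \<omega> ^ (2 * q)))"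
      unfolding dec[OF \<omega>] by (rule ennreal_leI[OF bound])
    also have "\<dots> = ennreal (4 ^ (2 * q)) * (?e x1 \<omega> + ?e x2 \<omega> + ?e x3 \<omega> + ?e x4 \<omega>)"
      by (subst ennreal_mult) (auto simp: ennreal_plus[symmetric] add_nonneg_nonneg simp del: ennreal_plus)
    finally show "ennreal (cmod (Lin F c t \<omega> - Lin F c s \<omega>) ^ (2 * q)) \<le> ennreal (4 ^ (2 * q)) * (?e x1 \<omega> + ?e x2 \<omega> + ?e x3 \<omega> + ?e x4 \<omega>)" .
  qed
  also have "\<dots> = ennreal (4 ^ (2 * q)) * ((\<integral>\<^sup>+\<omega>. ?e x1 \<omega> \<partial>M) + (\<integral>\<^sup>+\<omega>. ?e x2 \<omega> \<partial>M) + (\<integral>\<^sup>+\<omega>. ?e x3 \<omega> \<partial>M) + (\<integral>\<^sup>+\<omega>. ?e x4 \<omega> \<partial>M))"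
    by (subst nn_integral_cmult) (auto simp: nn_integral_add)
  also have "\<dots> \<le> ennreal (4 ^ (2 * q)) * (ennreal (gauss_moment q * ?V ^ q * ?h) + ennreal (gauss_moment q * ?V ^ q * ?h) + ennreal (gauss_moment q * ?V ^ q * ?h) + ennreal (gauss_moment q * ?V ^ q * ?h))"
    by (intro mult_left_mono add_mono m1 m2 m3 m4) auto
  also have "\<dots> = ennreal (4 ^ (2 * q) * (4 * (gauss_moment q * ?V ^ q * ?h)))"
  proof -
    have "ennreal a * (ennreal y + ennreal y + ennreal y + ennreal y) = ennreal (a * (4 * y))" if "0 \<le> a" "0 \<le> y" for a y
    proof -
      have "ennreal y + ennreal y + ennreal y + ennreal y = ennreal (y + y + y + y)"
        using that by (simp only: ennreal_plus add_nonneg_nonneg)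
      also have "y + y + y + y = 4 * y" by simp
      finally have e: "ennreal y + ennreal y + ennreal y + ennreal y = ennreal (4 * y)" .
      show ?thesis unfolding e using that by (subst ennreal_mult[symmetric]) auto
    qed
    moreover have "0 \<le> gauss_moment q * ?V ^ q * ?h" using gauss_moment_pos[of q] by (simp add: sum_nonneg)
    ultimately show ?thesis by simp
  qed
  also have "4 ^ (2 * q) * (4 * (gauss_moment q * ?V ^ q * ?h)) = moment_const q * ?V ^ q * ?h" by (simp add: moment_const_def)
  finally show ?thesis .
qed

end

section \<open>Dyadic increments of the noise\<close>

lemma two_powr_power: "(2 powr u) ^ n = (2 powr (u * real n) :: real)"
proof -
  have "(2 powr u) ^ n = ((2::real) powr u) powr real n" by (rule powr_realpow[symmetric]) simp
  then show ?thesis by (simp only: powr_powr)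
qed

lemma two_power_powr: "(2 ^ i) powr u = (2 powr (real i * u) :: real)"
proof -
  have "(2::real) ^ i = 2 powr real i" by (simp add: powr_realpow)
  then show ?thesis by (simp only: powr_powr)
qed

lemma half_power_powr: "(1 / 2 ^ i) powr u = (2 powr (- (real i * u)) :: real)"
  using two_power_powr[of i u] by (simp add: powr_divide powr_minus_divide)

text \<open>The random variable of Kolmogorov's continuity theorem: it dominates the \<open>p\<close>-th power of every rescaled dyadic increment, and its
expectation is a sum of moments.\<close>
definition dsum :: "nat \<Rightarrow> real \<Rightarrow> nat \<Rightarrow> (real \<Rightarrow> complex) \<Rightarrow> ennreal" where
  "dsum p \<beta> T y = (\<Sum>i. \<Sum>l<T * 2 ^ i. ennreal (((2 ^ i) powr \<beta> * cmod (y (real (Suc l) / 2 ^ i) - y (real l / 2 ^ i))) ^ p))"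

lemma dsum_term_le:
  assumes "l < T * 2 ^ i"
  shows "ennreal (((2 ^ i) powr \<beta> * cmod (y (real (Suc l) / 2 ^ i) - y (real l / 2 ^ i))) ^ p) \<le> dsum p \<beta> T y"
proof -
  let ?f = "\<lambda>i l. ennreal (((2 ^ i) powr \<beta> * cmod (y (real (Suc l) / 2 ^ i) - y (real l / 2 ^ i))) ^ p)"
  have "?f i l \<le> (\<Sum>l<T * 2 ^ i. ?f i l)" using assms by (intro member_le_sum) auto
  also have "\<dots> \<le> (\<Sum>i\<in>{i}. \<Sum>l<T * 2 ^ i. ?f i l)" by simp
  also have "\<dots> \<le> dsum p \<beta> T y" unfolding dsum_def by (rule sum_le_suminf) (auto intro: summableI)
  finally show ?thesis .
qed

lemma dsum_holder:
  assumes d: "dsum p \<beta> T y \<le> ennreal (a ^ p)" and p: "p > 0" and a: "a \<ge> 0"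
  shows "dyadic_holder \<beta> T a y"
  unfolding dyadic_holder_def
proof (intro allI impI)
  fix i l assume l: "l < T * 2 ^ i"
  let ?x = "cmod (y (real (Suc l) / 2 ^ i) - y (real l / 2 ^ i))"
  have "ennreal (((2 ^ i) powr \<beta> * ?x) ^ p) \<le> ennreal (a ^ p)" using dsum_term_le[OF l] d by (rule order_trans)
  then have "((2 ^ i) powr \<beta> * ?x) ^ p \<le> a ^ p" using a by (simp add: ennreal_le_iff)
  then have "(2 ^ i) powr \<beta> * ?x \<le> a" using p a by (metis Suc_pred' power_le_imp_le_base)
  then show "?x \<le> a * (1 / 2 ^ i) powr \<beta>" by (simp add: powr_divide field_simps)
qed

lemma finite_bound_power:
  assumes "x < \<infinity>" "p > 0"
  obtains a :: real where "a \<ge> 0" "x \<le> ennreal (a ^ p)"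
proof -
  define a where "a = enn2real x + 1"
  have a: "a \<ge> 1" by (simp add: a_def)
  have "a ^ 1 \<le> a ^ p" using a assms by (intro power_increasing) auto
  then have "enn2real x \<le> a ^ p" using a by (simp add: a_def)
  then have "x \<le> ennreal (a ^ p)" using assms(1) by (metis ennreal_enn2real ennreal_leI infinity_ennreal_def)
  then show thesis using that[of a] a by simp
qed

lemma geometric_ennreal:
  assumes "0 < x" "x < 1" "c \<ge> 0"
  shows "(\<Sum>i. ennreal (c * x ^ i)) = ennreal (c / (1 - x))"
  using sums_mult[OF geometric_sums[of x], of c] assms by (intro suminf_ennreal_eq) auto

context noise
begin

lemma dsum_measurable:
  assumes [measurable]: "\<And>t. t \<ge> 0 \<Longrightarrow> Z t \<in> borel_measurable M"
  shows "(\<lambda>\<omega>. dsum p \<beta>' T (\<lambda>t. Z t \<omega>)) \<in> borel_measurable M"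
proof -
  have [measurable]: "Z (real l / 2 ^ i) \<in> borel_measurable M" for l i by simp
  show ?thesis unfolding dsum_def by measurable
qed

text \<open>Generation \<open>i\<close> has \<open>T 2\<^sup>i\<close> increments, each with rescaled moment \<open>2\<^bsup>-2qi(\<beta>-\<beta>')\<^esup>\<close>; the condition on \<open>q\<close> makes the
total a convergent geometric series.\<close>
lemma dsum_moment:
  assumes q: "q > 0" and F: "finite F" and \<beta>': "2 * real q * (\<beta> - \<beta>') > 1"
  shows "(\<integral>\<^sup>+\<omega>. dsum (2 * q) \<beta>' T (\<lambda>t. Lin F c t \<omega>) \<partial>M)
    \<le> ennreal (moment_const q * (\<Sum>k\<in>F. (cmod (c k))\<^sup>2) ^ q * (real T / (1 - 2 powr (1 - 2 * real q * (\<beta> - \<beta>')))))"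
proof -
  let ?V = "(\<Sum>k\<in>F. (cmod (c k))\<^sup>2) ^ q"
  define x where "x = (2::real) powr (1 - 2 * real q * (\<beta> - \<beta>'))"
  have x: "0 < x" "x < 1"
  proof -
    have "(2::real) powr (1 - 2 * real q * (\<beta> - \<beta>')) < 2 powr 0" using \<beta>' by (intro powr_less_mono) auto
    then show "x < 1" by (simp add: x_def)
  qed (simp add: x_def)
  define D where "D i l \<omega> = Lin F c (real (Suc l) / 2 ^ i) \<omega> - Lin F c (real l / 2 ^ i) \<omega>" for i l and \<omega>
  have [measurable]: "D i l \<in> borel_measurable M" for i l unfolding D_def by measurable
  have V: "?V \<ge> 0" by (simp add: sum_nonneg)
  have one: "(\<integral>\<^sup>+\<omega>. ennreal (((2 ^ i) powr \<beta>' * cmod (D i l \<omega>)) ^ (2 * q)) \<partial>M) \<le> ennreal (moment_const q * ?V * (x / 2) ^ i)" for i l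
  proof -
    have "(\<integral>\<^sup>+\<omega>. ennreal (((2 ^ i) powr \<beta>' * cmod (D i l \<omega>)) ^ (2 * q)) \<partial>M)
       = (\<integral>\<^sup>+\<omega>. ennreal (((2 ^ i) powr \<beta>') ^ (2 * q)) * ennreal (cmod (D i l \<omega>) ^ (2 * q)) \<partial>M)"
      by (intro nn_integral_cong) (simp add: power_mult_distrib ennreal_mult)
    also have "\<dots> = ennreal (((2 ^ i) powr \<beta>') ^ (2 * q)) * (\<integral>\<^sup>+\<omega>. ennreal (cmod (D i l \<omega>) ^ (2 * q)) \<partial>M)"
      by (rule nn_integral_cmult) measurable
    also have "\<dots> \<le> ennreal (((2 ^ i) powr \<beta>') ^ (2 * q)) * ennreal (moment_const q * ?V * (\<bar>real (Suc l) / 2 ^ i - real l / 2 ^ i\<bar> powr \<beta>) ^ (2 * q))"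
      unfolding D_def by (intro mult_left_mono Lin_moment q F) auto
    also have "\<dots> = ennreal (moment_const q * ?V * (((2 ^ i) powr \<beta>') ^ (2 * q) * ((1 / 2 ^ i) powr \<beta>) ^ (2 * q)))"
    proof -
      have "\<bar>real (Suc l) / 2 ^ i - real l / 2 ^ i\<bar> = 1 / 2 ^ i" by (simp add: diff_divide_distrib[symmetric])
      then show ?thesis using V moment_const_nonneg[of q] by (subst ennreal_mult[symmetric]) (auto simp: mult_ac)
    qed
    also have "((2 ^ i) powr \<beta>') ^ (2 * q) * ((1 / 2 ^ i) powr \<beta>) ^ (2 * q) = (x / 2) ^ i"
    proof -
      have "x / 2 = 2 powr (- 2 * real q * (\<beta> - \<beta>'))"
        unfolding x_def using powr_diff[of 2 "1 - 2 * real q * (\<beta> - \<beta>')" 1] by simp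
      then have e: "(x / 2) ^ i = 2 powr (- 2 * real q * (\<beta> - \<beta>') * real i)" by (simp only: two_powr_power)
      have "((2 ^ i) powr \<beta>') ^ (2 * q) * ((1 / 2 ^ i) powr \<beta>) ^ (2 * q) =
         2 powr (real i * \<beta>' * real (2 * q) + - (real i * \<beta>) * real (2 * q))"
        by (simp only: two_power_powr half_power_powr two_powr_power powr_add)
      also have "\<dots> = (x / 2) ^ i" unfolding e by (rule arg_cong[of _ _ "\<lambda>e. 2 powr e"]) (simp add: algebra_simps)
      finally show ?thesis .
    qed
    finally show ?thesis .
  qed
  have "(\<integral>\<^sup>+\<omega>. dsum (2 * q) \<beta>' T (\<lambda>t. Lin F c t \<omega>) \<partial>M) = (\<Sum>i. \<integral>\<^sup>+\<omega>. (\<Sum>l<T * 2 ^ i. ennreal (((2 ^ i) powr \<beta>' * cmod (D i l \<omega>)) ^ (2 * q))) \<partial>M)"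
    unfolding dsum_def D_def[symmetric] by (rule nn_integral_suminf) measurable
  also have "\<dots> = (\<Sum>i. \<Sum>l<T * 2 ^ i. \<integral>\<^sup>+\<omega>. ennreal (((2 ^ i) powr \<beta>' * cmod (D i l \<omega>)) ^ (2 * q)) \<partial>M)"
    by (intro suminf_cong nn_integral_sum) measurable
  also have "\<dots> \<le> (\<Sum>i. ennreal (moment_const q * ?V * real T * x ^ i))"
  proof (rule suminf_le)
    fix i
    have "(\<Sum>l<T * 2 ^ i. \<integral>\<^sup>+\<omega>. ennreal (((2 ^ i) powr \<beta>' * cmod (D i l \<omega>)) ^ (2 * q)) \<partial>M) \<le> (\<Sum>l<T * 2 ^ i. ennreal (moment_const q * ?V * (x / 2) ^ i))"
      by (intro sum_mono one)
    also have "\<dots> = ennreal (real (T * 2 ^ i) * (moment_const q * ?V * (x / 2) ^ i))"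
      using V moment_const_nonneg[of q] x by (simp add: ennreal_of_nat_eq_real_of_nat ennreal_mult'')
    also have "real (T * 2 ^ i) * (moment_const q * ?V * (x / 2) ^ i) = moment_const q * ?V * real T * x ^ i"
      by (simp add: power_divide)
    finally show "(\<Sum>l<T * 2 ^ i. \<integral>\<^sup>+\<omega>. ennreal (((2 ^ i) powr \<beta>' * cmod (D i l \<omega>)) ^ (2 * q)) \<partial>M) \<le> ennreal (moment_const q * ?V * real T * x ^ i)" .
  qed (auto intro: summableI)
  also have "\<dots> = ennreal (moment_const q * ?V * real T / (1 - x))"
    using V moment_const_nonneg[of q] x by (intro geometric_ennreal) auto
  also have "moment_const q * ?V * real T / (1 - x) = moment_const q * ?V * (real T / (1 - 2 powr (1 - 2 * real q * (\<beta> - \<beta>'))))"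
    by (simp add: x_def)
  finally show ?thesis .
qed

text \<open>The \<open>2q\<close>-th moments of the errors are summable over the generations, so almost surely the sum of the \<open>2q\<close>-th powers is
finite and the errors tend to zero.\<close>
lemma Lin_dyadic_AE:
  assumes q: "q > 0" and F: "finite F" and t: "t \<ge> 0" and \<beta>': "2 * real q * \<beta> > 1"
  shows "AE \<omega> in M. (\<lambda>i. Lin F c (dyadic_floor i t) \<omega>) \<longlonglongrightarrow> Lin F c t \<omega>"
proof -
  let ?V = "(\<Sum>k\<in>F. (cmod (c k))\<^sup>2) ^ q"
  have V: "?V \<ge> 0" by (simp add: sum_nonneg)
  define x where "x = (2::real) powr (- (2 * real q * \<beta>))"
  have x: "0 < x" "x < 1"
  proof -
    have "- (2 * real q * \<beta>) < 0" using \<beta>' by linarith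
    then have "(2::real) powr (- (2 * real q * \<beta>)) < 2 powr 0" by (intro powr_less_mono) auto
    then show "x < 1" by (simp add: x_def)
  qed (simp add: x_def)
  define D where "D i \<omega> = cmod (Lin F c t \<omega> - Lin F c (dyadic_floor i t) \<omega>) ^ (2 * q)" for i \<omega>
  have [measurable]: "Lin F c t \<in> borel_measurable M" "Lin F c (dyadic_floor i t) \<in> borel_measurable M" for i
    using t dyadic_floor_bounds(1)[OF t] by auto
  have [measurable]: "D i \<in> borel_measurable M" for i unfolding D_def by measurable
  have "(\<integral>\<^sup>+\<omega>. ennreal (D i \<omega>) \<partial>M) \<le> ennreal (moment_const q * ?V * x ^ i)" for i
  proof -
    have b: "0 \<le> t - dyadic_floor i t" "t - dyadic_floor i t \<le> 1 / 2 ^ i" using dyadic_floor_bounds[OF t, of i] by auto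
    have "(\<integral>\<^sup>+\<omega>. ennreal (D i \<omega>) \<partial>M) \<le> ennreal (moment_const q * ?V * (\<bar>t - dyadic_floor i t\<bar> powr \<beta>) ^ (2 * q))"
      unfolding D_def by (rule Lin_moment[OF _ t q F]) (rule dyadic_floor_bounds(1)[OF t])
    also have "\<dots> \<le> ennreal (moment_const q * ?V * ((1 / 2 ^ i) powr \<beta>) ^ (2 * q))"
      using b V moment_const_nonneg[of q] \<beta> by (intro ennreal_leI mult_left_mono power_mono powr_mono2) auto
    also have "((1 / 2 ^ i) powr \<beta>) ^ (2 * q) = x ^ i"
      unfolding x_def half_power_powr two_powr_power
      by (rule arg_cong[of _ _ "\<lambda>e. 2 powr e"]) (simp add: algebra_simps)
    finally show ?thesis .
  qed
  then have "(\<Sum>i. \<integral>\<^sup>+\<omega>. ennreal (D i \<omega>) \<partial>M) \<le> (\<Sum>i. ennreal (moment_const q * ?V * x ^ i))"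
    by (intro suminf_le) (auto intro: summableI)
  also have "\<dots> = ennreal (moment_const q * ?V / (1 - x))" using V moment_const_nonneg[of q] x by (intro geometric_ennreal) auto
  finally have "(\<integral>\<^sup>+\<omega>. (\<Sum>i. ennreal (D i \<omega>)) \<partial>M) \<noteq> \<infinity>"
    by (subst nn_integral_suminf) (auto simp: top_unique)
  then have "AE \<omega> in M. (\<Sum>i. ennreal (D i \<omega>)) \<noteq> \<infinity>" by (intro nn_integral_noteq_infinite) auto
  then show ?thesis
  proof eventually_elim
    fix \<omega> assume fin: "(\<Sum>i. ennreal (D i \<omega>)) \<noteq> \<infinity>"
    have "summable (\<lambda>i. D i \<omega>)" by (rule summable_suminf_not_top) (use fin in \<open>auto simp: D_def\<close>)
    then have "(\<lambda>i. D i \<omega>) \<longlonglongrightarrow> 0" by (rule summable_LIMSEQ_zero)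
    then have "(\<lambda>i. root (2 * q) (D i \<omega>)) \<longlonglongrightarrow> root (2 * q) 0" by (intro tendsto_real_root)
    then have "(\<lambda>i. cmod (Lin F c t \<omega> - Lin F c (dyadic_floor i t) \<omega>)) \<longlonglongrightarrow> 0"
      unfolding D_def using q by (simp add: real_root_power_cancel)
    then have "(\<lambda>i. Lin F c t \<omega> - Lin F c (dyadic_floor i t) \<omega>) \<longlonglongrightarrow> 0" by (rule tendsto_norm_zero_cancel)
    then have "(\<lambda>i. Lin F c t \<omega> - (Lin F c t \<omega> - Lin F c (dyadic_floor i t) \<omega>)) \<longlonglongrightarrow> Lin F c t \<omega> - 0"
      by (intro tendsto_diff tendsto_const)
    then show "(\<lambda>i. Lin F c (dyadic_floor i t) \<omega>) \<longlonglongrightarrow> Lin F c t \<omega>" by simp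
  qed
qed

end

section \<open>Almost sure bounds on the noise\<close>

lemma hilbert_schmidt_multiplier:
  assumes "hilbert_schmidt \<sigma> (fourier_multiplier \<phi>)"
  shows "(\<lambda>n. jap n powr (2 * \<sigma>) * (cmod (\<phi> n))\<^sup>2) summable_on UNIV"
proof -
  have "(sobolev_norm \<sigma> (fourier_multiplier \<phi> (mode n)))\<^sup>2 = jap n powr (2 * \<sigma>) * (cmod (\<phi> n))\<^sup>2" for n
  proof -
    have "(\<Sum>\<^sub>\<infinity>k. jap k powr (2 * \<sigma>) * (cmod (fourier_multiplier \<phi> (mode n) k))\<^sup>2) = jap n powr (2 * \<sigma>) * (cmod (\<phi> n))\<^sup>2"
      using infsum_cong_neutral[of UNIV "{n}" "\<lambda>k. jap k powr (2 * \<sigma>) * (cmod (fourier_multiplier \<phi> (mode n) k))\<^sup>2" "\<lambda>k. jap k powr (2 * \<sigma>) * (cmod (\<phi> k))\<^sup>2"]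
      by (simp add: fourier_multiplier_def mode_def)
    then show ?thesis by (simp add: sobolev_norm_def)
  qed
  then show ?thesis using assms by (simp add: hilbert_schmidt_def)
qed

text \<open>The Hilbert-Schmidt norm controls \<open>\<phi>\<close> with weight \<open>\<langle>k\<rangle>\<^bsup>2\<sigma>\<^esup>\<close>; when \<open>\<sigma>\<close> is negative this weight is removed at the price of a power of
the largest frequency in the block.\<close>
lemma multiplier_block_sum:
  assumes H: "(\<lambda>n. jap n powr (2 * \<sigma>) * (cmod (\<phi> n))\<^sup>2) summable_on UNIV" and \<sigma>': "\<sigma>' \<ge> 0" "- \<sigma> \<le> \<sigma>'"
  shows "(\<Sum>k\<in>freqs (Suc j). (cmod (\<phi> k))\<^sup>2) \<le> (4 * 2 ^ j) powr (2 * \<sigma>') * (\<Sum>\<^sub>\<infinity>n. jap n powr (2 * \<sigma>) * (cmod (\<phi> n))\<^sup>2)"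
proof -
  have "(cmod (\<phi> k))\<^sup>2 \<le> (4 * 2 ^ j) powr (2 * \<sigma>') * (jap k powr (2 * \<sigma>) * (cmod (\<phi> k))\<^sup>2)" if k: "k \<in> freqs (Suc j)" for k
  proof -
    have "1 = jap k powr (- 2 * \<sigma>) * jap k powr (2 * \<sigma>)" using jap_pos[of k] by (simp add: powr_add[symmetric])
    also have "\<dots> \<le> (4 * 2 ^ j) powr (2 * \<sigma>') * jap k powr (2 * \<sigma>)"
    proof (rule mult_right_mono)
      have "jap k powr (- 2 * \<sigma>) \<le> jap k powr (2 * \<sigma>')" using jap_ge_1[of k] \<sigma>' by (intro powr_mono) auto
      also have "\<dots> \<le> (4 * 2 ^ j) powr (2 * \<sigma>')" using jap_upper[OF k] jap_pos[of k] \<sigma>' by (intro powr_mono2) auto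
      finally show "jap k powr (- 2 * \<sigma>) \<le> (4 * 2 ^ j) powr (2 * \<sigma>')" .
    qed simp
    finally have "1 * (cmod (\<phi> k))\<^sup>2 \<le> ((4 * 2 ^ j) powr (2 * \<sigma>') * jap k powr (2 * \<sigma>)) * (cmod (\<phi> k))\<^sup>2" by (rule mult_right_mono) simp
    then show ?thesis by (simp add: mult.assoc)
  qed
  then have "(\<Sum>k\<in>freqs (Suc j). (cmod (\<phi> k))\<^sup>2) \<le> (\<Sum>k\<in>freqs (Suc j). (4 * 2 ^ j) powr (2 * \<sigma>') * (jap k powr (2 * \<sigma>) * (cmod (\<phi> k))\<^sup>2))"
    by (rule sum_mono)
  also have "\<dots> = (4 * 2 ^ j) powr (2 * \<sigma>') * (\<Sum>k\<in>freqs (Suc j). jap k powr (2 * \<sigma>) * (cmod (\<phi> k))\<^sup>2)" by (simp add: sum_distrib_left)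
  also have "\<dots> \<le> (4 * 2 ^ j) powr (2 * \<sigma>') * (\<Sum>\<^sub>\<infinity>n. jap n powr (2 * \<sigma>) * (cmod (\<phi> n))\<^sup>2)"
    by (intro mult_left_mono finite_sum_le_infsum H finite_freqs) auto
  finally show ?thesis .
qed

text \<open>The exponent \<open>\<sigma>'\<close> is the growth of the coefficients \<open>\<phi>\<close> in the mean square sense over dyadic blocks, \<open>\<kappa>\<close> the slightly larger growth rate
granted to the Hoelder constants, and \<open>\<beta>'\<close> the Hoelder exponent granted to the paths. The moment \<open>2 q\<close> is
high enough to pay for both losses.\<close>
locale noise_multiplier = noise M \<beta> B for M :: "'a measure" and \<beta> B +
  fixes \<phi> :: "int \<Rightarrow> complex" and \<sigma> \<sigma>' \<beta>' \<kappa> :: real and q :: nat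
  assumes hs: "hilbert_schmidt \<sigma> (fourier_multiplier \<phi>)"
    and \<sigma>': "\<sigma>' \<ge> 0" "- \<sigma> \<le> \<sigma>'" and \<beta>': "0 < \<beta>'" "2 * real q * (\<beta> - \<beta>') > 1" and \<kappa>: "2 * real q * (\<kappa> - \<sigma>') > 1"
    and q: "q > 0"
begin

definition grid :: "nat \<Rightarrow> nat" where "grid j = 4 * 2 ^ j + 1"

text \<open>The symbol of the Toeplitz block of generation \<open>j\<close> at the \<open>l\<close>-th grid point.\<close>
definition Z :: "nat \<Rightarrow> nat \<Rightarrow> real \<Rightarrow> 'a \<Rightarrow> complex" where
  "Z j l = Lin (freqs (Suc j)) (\<lambda>k. \<phi> k * cis (of_int k * node (grid j) l))"

text \<open>One random variable controlling all blocks: the weights are those that correspond to Hoelder constants of growth \<open>2\<^bsup>\<kappa>j\<^esup>\<close>, and the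
maximum over grid points is replaced by the sum.\<close>
definition R :: "nat \<Rightarrow> 'a \<Rightarrow> ennreal" where
  "R T \<omega> = (\<Sum>j. ennreal (2 powr (- \<kappa> * real j * real (2 * q))) * (\<Sum>l<grid j. dsum (2 * q) \<beta>' T (\<lambda>t. Z j l t \<omega>)))"

definition good :: "'a set" where
  "good = {\<omega> \<in> space M. \<forall>T. R T \<omega> \<noteq> \<infinity> \<and> (\<forall>k. dsum (2 * q) \<beta>' T (\<lambda>t. B k t \<omega>) \<noteq> \<infinity>)}"

lemma Z_measurable [measurable]: "t \<ge> 0 \<Longrightarrow> Z j l t \<in> borel_measurable M"
  unfolding Z_def by measurable

lemma dsum_Z_measurable [measurable]: "(\<lambda>\<omega>. dsum p b T (\<lambda>t. Z j l t \<omega>)) \<in> borel_measurable M"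
  and dsum_B_measurable [measurable]: "(\<lambda>\<omega>. dsum p b T (\<lambda>t. B k t \<omega>)) \<in> borel_measurable M"
  by (rule dsum_measurable, measurable)+

lemma R_measurable [measurable]: "R T \<in> borel_measurable M"
  unfolding R_def by measurable

lemma good_sets [measurable]: "good \<in> sets M"
  unfolding good_def by measurable

text \<open>In expectation, generation \<open>j\<close> contributes \<open>2\<^sup>j\<close> grid points, the weight \<open>2\<^bsup>-2q\<kappa>j\<^esup>\<close> and a moment of size \<open>2\<^bsup>2q\<sigma>'j\<^esup>\<close>.
The number of grid points is harmless because \<open>2 q (\<kappa> - \<sigma>') > 1\<close>.\<close>
lemma R_finite_AE: "AE \<omega> in M. R T \<omega> \<noteq> \<infinity>"
proof -
  define H where "H = (\<Sum>\<^sub>\<infinity>n. jap n powr (2 * \<sigma>) * (cmod (\<phi> n))\<^sup>2)"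
  note hs' = hilbert_schmidt_multiplier[OF hs]
  have H: "H \<ge> 0" unfolding H_def by (intro infsum_nonneg) auto
  define dc where "dc = real T / (1 - 2 powr (1 - 2 * real q * (\<beta> - \<beta>')))"
  have dc: "dc \<ge> 0"
  proof -
    have "(2::real) powr (1 - 2 * real q * (\<beta> - \<beta>')) \<le> 2 powr 0" using \<beta>' by (intro powr_mono) auto
    then show ?thesis by (simp add: dc_def)
  qed
  define C where "C = 5 * moment_const q * (4 powr (2 * \<sigma>') * H) ^ q * dc"
  have C: "C \<ge> 0" using moment_const_nonneg H dc by (simp add: C_def)
  define x where "x = (2::real) powr (1 - 2 * real q * (\<kappa> - \<sigma>'))"
  have x: "0 < x" "x < 1"
  proof -
    have "(2::real) powr (1 - 2 * real q * (\<kappa> - \<sigma>')) < 2 powr 0" using \<kappa> by (intro powr_less_mono) auto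
    then show "x < 1" by (simp add: x_def)
  qed (simp add: x_def)
  have one: "(\<integral>\<^sup>+\<omega>. dsum (2 * q) \<beta>' T (\<lambda>t. Z j l t \<omega>) \<partial>M) \<le> ennreal (moment_const q * ((4 * 2 ^ j) powr (2 * \<sigma>') * H) ^ q * dc)" for j l
  proof -
    have "(\<integral>\<^sup>+\<omega>. dsum (2 * q) \<beta>' T (\<lambda>t. Z j l t \<omega>) \<partial>M) \<le>
      ennreal (moment_const q * (\<Sum>k\<in>freqs (Suc j). (cmod (\<phi> k * cis (of_int k * node (grid j) l)))\<^sup>2) ^ q * dc)"
      unfolding Z_def dc_def by (rule dsum_moment[OF q finite_freqs \<beta>'(2)])
    also have "\<dots> \<le> ennreal (moment_const q * ((4 * 2 ^ j) powr (2 * \<sigma>') * H) ^ q * dc)"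
      using multiplier_block_sum[OF hs' \<sigma>', of j] moment_const_nonneg[of q] dc
      by (intro ennreal_leI mult_right_mono mult_left_mono power_mono) (auto simp: norm_mult H_def intro: sum_nonneg)
    finally show ?thesis .
  qed
  have "(\<integral>\<^sup>+\<omega>. R T \<omega> \<partial>M) = (\<Sum>j. \<integral>\<^sup>+\<omega>. ennreal (2 powr (- \<kappa> * real j * real (2 * q))) * (\<Sum>l<grid j. dsum (2 * q) \<beta>' T (\<lambda>t. Z j l t \<omega>)) \<partial>M)"
    unfolding R_def by (rule nn_integral_suminf) measurable
  also have "\<dots> = (\<Sum>j. ennreal (2 powr (- \<kappa> * real j * real (2 * q))) * (\<Sum>l<grid j. \<integral>\<^sup>+\<omega>. dsum (2 * q) \<beta>' T (\<lambda>t. Z j l t \<omega>) \<partial>M))"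
    by (simp add: nn_integral_cmult nn_integral_sum)
  also have "\<dots> \<le> (\<Sum>j. ennreal (C * x ^ j))"
  proof (rule suminf_le)
    fix j
    let ?e = "moment_const q * ((4 * 2 ^ j) powr (2 * \<sigma>') * H) ^ q * dc"
    have e: "?e \<ge> 0" using moment_const_nonneg H dc by simp
    have "ennreal (2 powr (- \<kappa> * real j * real (2 * q))) * (\<Sum>l<grid j. \<integral>\<^sup>+\<omega>. dsum (2 * q) \<beta>' T (\<lambda>t. Z j l t \<omega>) \<partial>M)
      \<le> ennreal (2 powr (- \<kappa> * real j * real (2 * q))) * (\<Sum>l<grid j. ennreal ?e)"
      by (intro mult_left_mono sum_mono one) auto
    also have "\<dots> = ennreal (2 powr (- \<kappa> * real j * real (2 * q)) * (real (grid j) * ?e))"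
      using e by (simp add: ennreal_of_nat_eq_real_of_nat ennreal_mult)
    also have "\<dots> \<le> ennreal (2 powr (- \<kappa> * real j * real (2 * q)) * (5 * 2 ^ j * ?e))"
    proof (intro ennreal_leI mult_left_mono mult_right_mono)
      have "(1::real) \<le> 2 ^ j" by simp
      then show "real (grid j) \<le> 5 * 2 ^ j" unfolding grid_def by simp
    qed (use e in auto)
    also have "2 powr (- \<kappa> * real j * real (2 * q)) * (5 * 2 ^ j * ?e) = C * x ^ j"
    proof -
      have "(4 * 2 ^ j) powr (2 * \<sigma>') = 4 powr (2 * \<sigma>') * 2 powr (2 * \<sigma>' * real j)"
        using two_power_powr[of j "2 * \<sigma>'"] by (simp add: powr_mult mult.commute)
      then have "((4 * 2 ^ j) powr (2 * \<sigma>') * H) ^ q = (4 powr (2 * \<sigma>') * H) ^ q * 2 powr (2 * \<sigma>' * real j * real q)"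
        by (simp only: power_mult_distrib two_powr_power mult_ac)
      moreover have "x ^ j = 2 powr (- \<kappa> * real j * real (2 * q)) * 2 ^ j * 2 powr (2 * \<sigma>' * real j * real q)"
      proof -
        have "x ^ j = 2 powr ((1 - 2 * real q * (\<kappa> - \<sigma>')) * real j)" unfolding x_def by (rule two_powr_power)
        also have "\<dots> = 2 powr (- \<kappa> * real j * real (2 * q) + real j + 2 * \<sigma>' * real j * real q)"
          by (rule arg_cong[of _ _ "\<lambda>e. 2 powr e"]) (simp add: algebra_simps)
        also have "\<dots> = 2 powr (- \<kappa> * real j * real (2 * q)) * 2 ^ j * 2 powr (2 * \<sigma>' * real j * real q)"
          unfolding powr_add by (simp add: powr_realpow)
        finally show ?thesis .
      qed
      ultimately show ?thesis unfolding C_def by (simp only: mult_ac)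
    qed
    finally show "ennreal (2 powr (- \<kappa> * real j * real (2 * q))) * (\<Sum>l<grid j. \<integral>\<^sup>+\<omega>. dsum (2 * q) \<beta>' T (\<lambda>t. Z j l t \<omega>) \<partial>M) \<le> ennreal (C * x ^ j)" .
  qed (auto intro: summableI)
  also have "\<dots> = ennreal (C / (1 - x))" by (rule geometric_ennreal[OF x C])
  finally have "(\<integral>\<^sup>+\<omega>. R T \<omega> \<partial>M) \<noteq> \<infinity>" by (auto simp: top_unique)
  then show ?thesis by (intro nn_integral_noteq_infinite) auto
qed


lemma dsum_B_moment: "(\<integral>\<^sup>+\<omega>. dsum (2 * q) \<beta>' T (\<lambda>t. B k t \<omega>) \<partial>M) < \<infinity>"
proof -
  have "(\<integral>\<^sup>+\<omega>. dsum (2 * q) \<beta>' T (\<lambda>t. Lin {k} (\<lambda>_. 1) t \<omega>) \<partial>M) < \<infinity>"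
    by (rule le_less_trans[OF dsum_moment[OF q _ \<beta>'(2)]]) simp_all
  then show ?thesis by (simp add: Lin_def)
qed

lemma good_AE: "AE \<omega> in M. \<omega> \<in> good"
proof -
  have "AE \<omega> in M. dsum (2 * q) \<beta>' T (\<lambda>t. B k t \<omega>) \<noteq> \<infinity>" for T k
    by (rule nn_integral_noteq_infinite) (use dsum_B_moment[of T k] in auto)
  then have "AE \<omega> in M. \<forall>T. R T \<omega> \<noteq> \<infinity> \<and> (\<forall>k. dsum (2 * q) \<beta>' T (\<lambda>t. B k t \<omega>) \<noteq> \<infinity>)"
    using R_finite_AE unfolding AE_all_countable AE_conj_iff by blast
  then show ?thesis using AE_space by eventually_elim (simp add: good_def)
qed

text \<open>The continuous modification of the noise, defined for every \<open>\<omega>\<close> and useful on \<open>good\<close>.\<close>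
definition Bt :: "int \<Rightarrow> real \<Rightarrow> 'a \<Rightarrow> complex" where
  "Bt k t \<omega> = dyadic_limit (\<lambda>u. B k u \<omega>) t"

lemma Bt_measurable [measurable]: "t \<ge> 0 \<Longrightarrow> Bt k t \<in> borel_measurable M"
proof -
  assume t: "t \<ge> 0"
  have [measurable]: "B k (dyadic_floor i t) \<in> borel_measurable M" for i using dyadic_floor_bounds(1)[OF t] by simp
  show ?thesis unfolding Bt_def dyadic_limit_def by measurable
qed

lemma Bt_AE: assumes "t \<ge> 0" shows "AE \<omega> in M. Bt k t \<omega> = B k t \<omega>"
proof -
  have "2 * real q * \<beta> > 1" using \<beta>' q by (smt (verit) mult_pos_pos of_nat_0_less_iff right_diff_distrib)
  then have "AE \<omega> in M. (\<lambda>i. Lin {k} (\<lambda>_. 1) (dyadic_floor i t) \<omega>) \<longlonglongrightarrow> Lin {k} (\<lambda>_. 1) t \<omega>"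
    by (intro Lin_dyadic_AE[OF q _ assms]) auto
  then show ?thesis
    by eventually_elim (simp add: Bt_def dyadic_limit_def limI Lin_def)
qed

lemma good_component:
  assumes "\<omega> \<in> good"
  obtains a where "dyadic_holder \<beta>' T a (\<lambda>u. B k u \<omega>)" "a \<ge> 0"
proof -
  have "dsum (2 * q) \<beta>' T (\<lambda>t. B k t \<omega>) < \<infinity>" using assms by (auto simp: good_def less_top)
  then obtain a where a: "a \<ge> 0" "dsum (2 * q) \<beta>' T (\<lambda>t. B k t \<omega>) \<le> ennreal (a ^ (2 * q))"
    using finite_bound_power[of _ "2 * q"] q by auto
  have "dyadic_holder \<beta>' T a (\<lambda>t. B k t \<omega>)" by (rule dsum_holder[OF a(2) _ a(1)]) (use q in simp)
  then show thesis using that a(1) by blast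
qed

lemma \<beta>'_le: "\<beta>' \<le> 1" "\<beta>' < \<beta>"
proof -
  show "\<beta>' < \<beta>" using \<beta>'(2) q by (smt (verit) mult_nonneg_nonpos of_nat_0_le_iff)
  then show "\<beta>' \<le> 1" using \<beta> by simp
qed

definition hconst :: "nat \<Rightarrow> real" where "hconst T = 6 * real T / (1 - 2 powr - \<beta>')"

lemma hconst_nonneg: "hconst T \<ge> 0"
proof -
  have "(2::real) powr - \<beta>' \<le> 2 powr 0" using \<beta>' by (intro powr_mono) auto
  then show ?thesis by (simp add: hconst_def)
qed

lemma good_converges: "\<omega> \<in> good \<Longrightarrow> t \<ge> 0 \<Longrightarrow> (\<lambda>i. B k (dyadic_floor i t) \<omega>) \<longlonglongrightarrow> Bt k t \<omega>"
proof -
  assume g: "\<omega> \<in> good" and t: "t \<ge> 0"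
  define T where "T = Suc (nat \<lceil>t\<rceil>)"
  have T: "T > 0" "t \<in> {0..real T}" using t by (auto simp: T_def) linarith
  obtain a where "dyadic_holder \<beta>' T a (\<lambda>u. B k u \<omega>)" using good_component[OF g] by blast
  then show ?thesis unfolding Bt_def using dyadic_limit_converges T \<beta>' \<beta>'_le by blast
qed

lemma dyadic_B_holder:
  assumes "dyadic_holder \<beta>' T a (\<lambda>u. B k u \<omega>)" "T > 0" "t \<in> {0..real T}" "t' \<in> {0..real T}"
  shows "cmod (Bt k t \<omega> - Bt k t' \<omega>) \<le> hconst T * a * \<bar>t - t'\<bar> powr \<beta>'"
  unfolding Bt_def hconst_def using dyadic_limit_holder(2)[OF assms(1,2) \<beta>'(1) \<beta>'_le(1) assms(3,4)] .

lemma Bt_continuous: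
  assumes g: "\<omega> \<in> good"
  shows "continuous_on {0..T} (\<lambda>t. Bt k t \<omega>)"
proof -
  define N where "N = Suc (nat \<lceil>T\<rceil>)"
  have N: "N > 0" "T \<le> real N" by (auto simp: N_def) linarith
  obtain a where a: "dyadic_holder \<beta>' N a (\<lambda>u. B k u \<omega>)" using good_component[OF g] by blast
  have "((\<lambda>t. Bt k t \<omega>) \<longlongrightarrow> Bt k t' \<omega>) (at t' within {0..T})" if t': "t' \<in> {0..T}" for t'
  proof (rule LIM_zero_cancel, rule Lim_null_comparison)
    show "\<forall>\<^sub>F t in at t' within {0..T}. cmod (Bt k t \<omega> - Bt k t' \<omega>) \<le> hconst N * a * \<bar>t - t'\<bar> powr \<beta>'"
      unfolding eventually_at_filter
      by (intro always_eventually allI impI) (rule dyadic_B_holder[OF a N(1)], use t' N in auto)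
    have "((\<lambda>t. hconst N * a * \<bar>t - t'\<bar> powr \<beta>') \<longlongrightarrow> hconst N * a * \<bar>t' - t'\<bar> powr \<beta>') (at t' within {0..T})"
      using \<beta>' by (intro tendsto_mult tendsto_const tendsto_powr' tendsto_intros) auto
    then show "((\<lambda>t. hconst N * a * \<bar>t - t'\<bar> powr \<beta>') \<longlongrightarrow> 0) (at t' within {0..T})" using \<beta>' by simp
  qed
  then show ?thesis by (simp add: continuous_on_def)
qed

lemma Z_trig: "Z j l t \<omega> = trig (freqs (Suc j)) (\<lambda>k. \<phi> k * B k t \<omega>) (node (grid j) l)"
  unfolding Z_def Lin_def trig_def by (intro sum.cong refl) (simp only: mult_ac)

lemma good_grid:
  assumes g: "\<omega> \<in> good"
  obtains a where "a \<ge> 0" "\<And>j l. l < grid j \<Longrightarrow> dyadic_holder \<beta>' T (a * 2 powr (\<kappa> * real j)) (\<lambda>u. Z j l u \<omega>)"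
proof -
  have "R T \<omega> < \<infinity>" using g by (auto simp: good_def less_top)
  then obtain a where a: "a \<ge> 0" "R T \<omega> \<le> ennreal (a ^ (2 * q))"
    using finite_bound_power[of _ "2 * q"] q by auto
  have "dyadic_holder \<beta>' T (a * 2 powr (\<kappa> * real j)) (\<lambda>u. Z j l u \<omega>)" if l: "l < grid j" for j l
  proof (rule dsum_holder)
    let ?w = "2 powr (- \<kappa> * real j * real (2 * q))"
    let ?d = "dsum (2 * q) \<beta>' T (\<lambda>u. Z j l u \<omega>)"
    let ?f = "\<lambda>j. ennreal (2 powr (- \<kappa> * real j * real (2 * q))) * (\<Sum>l<grid j. dsum (2 * q) \<beta>' T (\<lambda>t. Z j l t \<omega>))"
    have "?d \<le> (\<Sum>l<grid j. dsum (2 * q) \<beta>' T (\<lambda>t. Z j l t \<omega>))" using l by (intro member_le_sum[of l "{..<grid j}" "\<lambda>l. dsum (2 * q) \<beta>' T (\<lambda>t. Z j l t \<omega>)"]) auto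
    then have "ennreal ?w * ?d \<le> (\<Sum>j\<in>{j}. ?f j)" by (simp add: mult_left_mono)
    also have "\<dots> \<le> R T \<omega>" unfolding R_def by (rule sum_le_suminf) (auto intro: summableI)
    also note a(2)
    finally have 1: "ennreal ?w * ?d \<le> ennreal (a ^ (2 * q))" .
    have 2: "ennreal (1 / ?w) * ennreal ?w = 1" by (subst ennreal_mult[symmetric]) auto
    have "?d = ennreal (1 / ?w) * (ennreal ?w * ?d)" unfolding mult.assoc[symmetric] 2 by simp
    also have "\<dots> \<le> ennreal (1 / ?w) * ennreal (a ^ (2 * q))" by (rule mult_left_mono[OF 1]) simp
    also have "\<dots> = ennreal (1 / ?w * a ^ (2 * q))" using a by (subst ennreal_mult[symmetric]) auto
    also have "1 / ?w * a ^ (2 * q) = (a * 2 powr (\<kappa> * real j)) ^ (2 * q)"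
      unfolding power_mult_distrib two_powr_power
      by (simp add: powr_minus_divide mult.commute)
    finally show "?d \<le> ennreal ((a * 2 powr (\<kappa> * real j)) ^ (2 * q))" .
  qed (use q a in auto)
  then show thesis using that a(1) by blast
qed

text \<open>At each grid point the symbol has Hoelder continuous dyadic limits by the choice of \<open>good\<close>. These limits are the symbols of the
modified noise, since each symbol is a finite combination of modes which converge themselves.\<close>
theorem good_noise_path:
  assumes g: "\<omega> \<in> good" and s: "s \<ge> 0" "0 \<le> \<gamma>" "\<gamma> < \<beta>'" "\<kappa> + s < 2 * (\<beta>' - \<gamma>)"
  shows "noise_path (\<lambda>k t. \<phi> k * Bt k t \<omega>) s \<beta>' \<gamma> \<kappa>"
proof
  show "0 \<le> s" "0 \<le> \<gamma>" "\<gamma> < \<beta>'" "\<kappa> + s < 2 * (\<beta>' - \<gamma>)" "\<beta>' \<le> 1" using s \<beta>'_le by auto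
  fix T :: real assume T: "T > 0"
  show "continuous_on {0..T} (\<lambda>t. \<phi> k * Bt k t \<omega>)" for k
    by (intro continuous_intros Bt_continuous g)
  define N where "N = Suc (nat \<lceil>T\<rceil>)"
  have N: "N > 0" "T \<le> real N" by (auto simp: N_def) linarith
  obtain a where a: "a \<ge> 0" "\<And>j l. l < grid j \<Longrightarrow> dyadic_holder \<beta>' N (a * 2 powr (\<kappa> * real j)) (\<lambda>u. Z j l u \<omega>)"
    using good_grid[OF g] by blast
  have "block_bound (freqs j) (freqs j) (\<lambda>n m. \<phi> (n - m) * Bt (n - m) t \<omega> - \<phi> (n - m) * Bt (n - m) t' \<omega>)
      (hconst N * a * 2 powr (\<kappa> * real j) * \<bar>t - t'\<bar> powr \<beta>')" if t: "t \<in> {0..T}" "t' \<in> {0..T}" for j t t'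
  proof (rule toeplitz_grid_bound[of "grid j", where y = "\<lambda>k. \<phi> k * Bt k t \<omega> - \<phi> k * Bt k t' \<omega>"])
    show "grid j = 4 * 2 ^ j + 1" by (rule grid_def)
    fix l assume l: "l < grid j"
    have tn: "t \<in> {0..real N}" "t' \<in> {0..real N}" using t N by auto
    note conv = dyadic_limit_converges[OF a(2)[OF l] N(1) \<beta>'(1) \<beta>'_le(1)]
    have lim: "dyadic_limit (\<lambda>u. Z j l u \<omega>) u = trig (freqs (Suc j)) (\<lambda>k. \<phi> k * Bt k u \<omega>) (node (grid j) l)" if u: "u \<in> {0..real N}" for u
    proof (rule LIMSEQ_unique[OF conv[OF u]])
      show "(\<lambda>i. Z j l (dyadic_floor i u) \<omega>) \<longlonglongrightarrow> trig (freqs (Suc j)) (\<lambda>k. \<phi> k * Bt k u \<omega>) (node (grid j) l)"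
        unfolding Z_trig trig_def using u by (intro tendsto_sum tendsto_mult tendsto_const good_converges g) auto
    qed
    have "trig (freqs (Suc j)) (\<lambda>k. \<phi> k * Bt k t \<omega> - \<phi> k * Bt k t' \<omega>) (node (grid j) l)
      = dyadic_limit (\<lambda>u. Z j l u \<omega>) t - dyadic_limit (\<lambda>u. Z j l u \<omega>) t'"
      unfolding lim[OF tn(1)] lim[OF tn(2)] trig_def by (simp add: sum_subtractf left_diff_distrib)
    then show "cmod (trig (freqs (Suc j)) (\<lambda>k. \<phi> k * Bt k t \<omega> - \<phi> k * Bt k t' \<omega>) (node (grid j) l))
      \<le> hconst N * a * 2 powr (\<kappa> * real j) * \<bar>t - t'\<bar> powr \<beta>'"
      using dyadic_limit_holder(2)[OF a(2)[OF l] N(1) \<beta>'(1) \<beta>'_le(1) tn] by (simp add: hconst_def mult_ac)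
  qed
  then show "\<exists>Q\<ge>0. \<forall>j. \<forall>t\<in>{0..T}. \<forall>t'\<in>{0..T}.
     block_bound (freqs j) (freqs j) (\<lambda>n m. \<phi> (n - m) * Bt (n - m) t \<omega> - \<phi> (n - m) * Bt (n - m) t' \<omega>)
       (Q * 2 powr (\<kappa> * real j) * \<bar>t - t'\<bar> powr \<beta>')"
    using a(1) hconst_nonneg by (intro exI[of _ "hconst N * a"]) auto
qed

end

section \<open>Wiener integrals\<close>

lemma exp_nonpos_lipschitz:
  fixes u v :: real
  assumes "u \<le> 0" "v \<le> 0"
  shows "\<bar>exp u - exp v\<bar> \<le> \<bar>u - v\<bar>"
proof -
  have *: "exp y - exp x \<le> y - x" if "x \<le> y" "y \<le> 0" for x y :: real
  proof -
    have "exp y - exp x = exp y * (1 - exp (x - y))" by (simp add: right_diff_distrib exp_add[symmetric])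
    also have "\<dots> \<le> 1 * (y - x)"
    proof (rule mult_mono)
      show "1 - exp (x - y) \<le> y - x" using exp_ge_add_one_self[of "x - y"] by linarith
    qed (use that in auto)
    finally show ?thesis by simp
  qed
  show ?thesis using *[of u v] *[of v u] assms by (cases "u \<le> v") (auto simp: abs_if)
qed

text \<open>The integrand of the entry with rates \<open>a\<close> (output) and \<open>b\<close> (input).\<close>
definition ek :: "real \<Rightarrow> real \<Rightarrow> real \<Rightarrow> real \<Rightarrow> real \<Rightarrow> real" where
  "ek a b t r x = exp (- (t - x) * a) * exp (- (x - r) * b)"

lemma ek_bounds:
  assumes "a \<ge> 0" "b \<ge> 0" "x \<in> {r..t}"
  shows "0 \<le> ek a b t r x" "ek a b t r x \<le> 1"
proof -
  have "exp (- (t - x) * a) \<le> 1" "exp (- (x - r) * b) \<le> 1" using assms by (auto intro!: exp_rate_le_1[of "t - x", simplified] exp_rate_le_1[of "x - r", simplified])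
  then have "exp (- (t - x) * a) * exp (- (x - r) * b) \<le> 1 * 1" by (intro mult_mono) auto
  then show "ek a b t r x \<le> 1" by (simp add: ek_def)
qed (simp add: ek_def)

lemma ek_exp: "ek a b t r x = exp (r * b - t * a) * exp ((a - b) * x)"
  unfolding ek_def exp_add[symmetric] by (rule arg_cong[of _ _ exp]) (simp add: algebra_simps)

lemma ek_lipschitz:
  assumes "a \<ge> 0" "b \<ge> 0" "x \<in> {r..t}" "y \<in> {r..t}"
  shows "\<bar>ek a b t r x - ek a b t r y\<bar> \<le> \<bar>a - b\<bar> * \<bar>x - y\<bar>"
proof -
  let ?e = "\<lambda>x. - (t - x) * a + - (x - r) * b"
  have le: "?e x \<le> 0" if "x \<in> {r..t}" for x
  proof -
    have "0 \<le> (t - x) * a" "0 \<le> (x - r) * b" using that assms by auto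
    moreover have "?e x = - ((t - x) * a) - (x - r) * b" by (simp add: algebra_simps)
    ultimately show ?thesis by linarith
  qed
  have "\<bar>ek a b t r x - ek a b t r y\<bar> \<le> \<bar>?e x - ?e y\<bar>"
    unfolding ek_def exp_add[symmetric] by (rule exp_nonpos_lipschitz[OF le le]) fact+
  also have "?e x - ?e y = (a - b) * (x - y)" by (simp add: algebra_simps)
  finally show ?thesis by (simp add: abs_mult)
qed

definition mesh :: "real \<Rightarrow> real \<Rightarrow> nat \<Rightarrow> nat \<Rightarrow> real" where
  "mesh r t n i = r + real i * ((t - r) / real n)"

lemma mesh_props:
  assumes "r < t" "n > 0"
  shows "mesh r t n 0 = r" "mesh r t n n = t" "mesh r t n (Suc i) - mesh r t n i = (t - r) / real n"
    "i \<le> j \<Longrightarrow> mesh r t n i \<le> mesh r t n j" "i \<le> n \<Longrightarrow> mesh r t n i \<in> {r..t}"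
proof -
  show 1: "mesh r t n 0 = r" by (simp add: mesh_def)
  show 2: "mesh r t n n = t" using assms by (simp add: mesh_def)
  show "mesh r t n (Suc i) - mesh r t n i = (t - r) / real n" by (simp add: mesh_def add_divide_distrib distrib_right)
  have mono: "i \<le> j \<Longrightarrow> mesh r t n i \<le> mesh r t n j" for i j
    using assms unfolding mesh_def by (intro add_left_mono mult_right_mono) auto
  then show "i \<le> j \<Longrightarrow> mesh r t n i \<le> mesh r t n j" .
  show "i \<le> n \<Longrightarrow> mesh r t n i \<in> {r..t}" using mono[of 0 i] mono[of i n] 1 2 by simp
qed

definition mesh_step :: "(real \<Rightarrow> real) \<Rightarrow> real \<Rightarrow> real \<Rightarrow> nat \<Rightarrow> (real \<times> real \<times> real) list" where
  "mesh_step f r t n = map (\<lambda>i. (f (mesh r t n i), mesh r t n i, mesh r t n (Suc i))) [0..<n]"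

lemma step_integral_mesh:
  "step_integral Y (mesh_step f r t n) \<omega> = (\<Sum>i<n. f (mesh r t n i) * (Y (mesh r t n (Suc i)) \<omega> - Y (mesh r t n i) \<omega>))"
  unfolding step_integral_def mesh_step_def by (simp add: sum_list_map_eq_sum_count interv_sum_list_conv_sum_set_nat lessThan_atLeast0 comp_def)

lemma step_fun_mesh:
  assumes r: "r < t" and n: "n > 0" and x: "r < x" "x \<le> t"
  obtains i where "i < n" "mesh r t n i < x" "x \<le> mesh r t n (Suc i)" "step_fun (mesh_step f r t n) x = f (mesh r t n i)"
proof -
  note mp = mesh_props[OF r n]
  define j where "j = (LEAST j. x \<le> mesh r t n j)"
  have ex: "x \<le> mesh r t n n" using x mp(2) by simp
  have j1: "x \<le> mesh r t n j" unfolding j_def by (rule LeastI[of _ n]) (rule ex)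
  have j2: "j \<le> n" unfolding j_def by (rule Least_le) (rule ex)
  have "j \<noteq> 0" using j1 x mp(1) by (metis not_le)
  then obtain i where i: "j = Suc i" using not0_implies_Suc by blast
  have "i < j" using i by simp
  then have i1: "\<not> x \<le> mesh r t n i" unfolding j_def by (rule not_less_Least)
  have ind: "indicator {mesh r t n k<..mesh r t n (Suc k)} x = (if k = i then 1 else 0 :: real)" for k
  proof -
    consider "k < i" | "k = i" | "k > i" by linarith
    then show ?thesis
    proof cases
      case 1
      then have "mesh r t n (Suc k) \<le> mesh r t n i" by (intro mp(4)) simp
      then show ?thesis using i1 1 by (auto simp: indicator_def)
    next
      case 2
      then show ?thesis using i1 j1 i by (auto simp: indicator_def)
    next
      case 3
      then have "mesh r t n (Suc i) \<le> mesh r t n k" by (intro mp(4)) simp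
      then show ?thesis using j1 i 3 by (auto simp: indicator_def)
    qed
  qed
  have "step_fun (mesh_step f r t n) x = (\<Sum>k<n. f (mesh r t n k) * indicator {mesh r t n k<..mesh r t n (Suc k)} x)"
    unfolding step_fun_def mesh_step_def by (simp add: interv_sum_list_conv_sum_set_nat lessThan_atLeast0 comp_def)
  also have "\<dots> = f (mesh r t n i)" unfolding ind using j2 i by (simp add: if_distrib cong: if_cong)
  finally show thesis using that[of i] i1 j1 j2 i by simp
qed

lemma mesh_step_error:
  assumes r: "r < t" and n: "n > 0" and x: "r < x" "x \<le> t" and ab: "a \<ge> 0" "b \<ge> 0"
  shows "\<bar>ek a b t r x - step_fun (mesh_step (ek a b t r) r t n) x\<bar> \<le> \<bar>a - b\<bar> * ((t - r) / real n)"
proof -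
  obtain i where i: "i < n" "mesh r t n i < x" "x \<le> mesh r t n (Suc i)" "step_fun (mesh_step (ek a b t r) r t n) x = ek a b t r (mesh r t n i)"
    using step_fun_mesh[OF r n x] by blast
  have "mesh r t n i \<in> {r..t}" using mesh_props(5)[OF r n, of i] i by simp
  then have "\<bar>ek a b t r x - ek a b t r (mesh r t n i)\<bar> \<le> \<bar>a - b\<bar> * \<bar>x - mesh r t n i\<bar>"
    using x ab by (intro ek_lipschitz) auto
  also have "\<dots> \<le> \<bar>a - b\<bar> * ((t - r) / real n)"
    using i mesh_props(3)[OF r n, of i] by (intro mult_left_mono) auto
  finally show ?thesis using i by simp
qed

text \<open>The singularity \<open>|u|\<^sup>a\<close> is integrable at the origin exactly for \<open>a > -1\<close>; for \<open>a = 2 \<beta> - 2\<close> this is the condition \<open>\<beta> > 1/2\<close>.\<close>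
lemma singular_kernel_finite:
  fixes a h :: real
  assumes a: "-1 < a" and h: "h \<ge> 0"
  shows "(\<integral>\<^sup>+u. ennreal (\<bar>u\<bar> powr a) * indicator {-h..h} u \<partial>lborel) < \<infinity>"
proof -
  define g where "g u = (if u \<in> {0..h} then u powr a else 0)" for u
  have hi: "(g has_integral (h powr (a + 1) / (a + 1))) UNIV"
    unfolding g_def using has_integral_powr_from_0[OF a h] by (subst has_integral_restrict_UNIV)
  have "(\<lambda>u. indicator {0..h} u * u powr a) \<in> borel_measurable borel" by measurable
  moreover have "(\<lambda>u. indicator {0..h} u * u powr a) = g" by (auto simp: indicator_def g_def)
  ultimately have gm: "g \<in> borel_measurable borel" by simp
  then have I: "(\<integral>\<^sup>+u. ennreal (g u) \<partial>lborel) = ennreal (h powr (a + 1) / (a + 1))"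
    by (rule nn_integral_has_integral_lborel[OF _ _ hi]) (auto simp: g_def)
  have m: "(\<lambda>u. ennreal (g u)) \<in> borel_measurable borel" using gm by simp
  have J: "(\<integral>\<^sup>+u. ennreal (g (- u)) \<partial>lborel) = (\<integral>\<^sup>+u. ennreal (g u) \<partial>lborel)"
    using nn_integral_real_affine[OF m, of "-1" 0] by simp
  have "(\<integral>\<^sup>+u. ennreal (\<bar>u\<bar> powr a) * indicator {-h..h} u \<partial>lborel) \<le> (\<integral>\<^sup>+u. ennreal (g u) + ennreal (g (- u)) \<partial>lborel)"
    by (rule nn_integral_mono) (auto simp: g_def indicator_def abs_if)
  also have "\<dots> = (\<integral>\<^sup>+u. ennreal (g u) \<partial>lborel) + (\<integral>\<^sup>+u. ennreal (g (- u)) \<partial>lborel)"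
  proof (rule nn_integral_add)
    show "(\<lambda>u. ennreal (g u)) \<in> borel_measurable lborel" using m by simp
    show "(\<lambda>u. ennreal (g (- u))) \<in> borel_measurable lborel" using measurable_compose[OF _ m, of uminus lborel] by simp
  qed
  also have "\<dots> < \<infinity>" unfolding J I by simp
  finally show ?thesis .
qed

text \<open>Uniform convergence of integrands implies convergence in the integrand space. The left endpoint is excluded, as step functions built on
half-open cells vanish there.\<close>
lemma integrand_norm2_uniform:
  assumes \<beta>: "1 / 2 < \<beta>" and r: "r \<le> t"
  obtains K :: real where "K \<ge> 0" "\<And>f \<epsilon>. \<epsilon> \<ge> 0 \<Longrightarrow> (\<And>x. r < x \<Longrightarrow> x \<le> t \<Longrightarrow> \<bar>f x\<bar> \<le> \<epsilon>) \<Longrightarrow> integrand_norm2 \<beta> r t f \<le> ennreal (K * \<epsilon>\<^sup>2)"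
proof -
  define a where "a = 2 * \<beta> - 2"
  define c where "c = \<beta> * (2 * \<beta> - 1)"
  have c: "c \<ge> 0" using \<beta> by (simp add: c_def)
  define h where "h = t - r"
  have h: "h \<ge> 0" using r by (simp add: h_def)
  define K0 where "K0 = (\<integral>\<^sup>+u. ennreal (\<bar>u\<bar> powr a) * indicator {-h..h} u \<partial>lborel)"
  have K0: "K0 < \<infinity>" unfolding K0_def by (rule singular_kernel_finite) (use \<beta> h in \<open>auto simp: a_def\<close>)
  define K where "K = c * enn2real K0 * h"
  have K: "K \<ge> 0" using c h by (simp add: K_def)
  have shift: "(\<integral>\<^sup>+y. ennreal (\<bar>x - y\<bar> powr a) * indicator {r..t} y \<partial>lborel) \<le> K0" if x: "x \<in> {r..t}" for x
  proof -
    have "(\<integral>\<^sup>+y. ennreal (\<bar>x - y\<bar> powr a) * indicator {r..t} y \<partial>lborel) \<le> (\<integral>\<^sup>+y. ennreal (\<bar>- x + 1 * y\<bar> powr a) * indicator {-h..h} (- x + 1 * y) \<partial>lborel)"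
    proof (rule nn_integral_mono)
      fix y
      show "ennreal (\<bar>x - y\<bar> powr a) * indicator {r..t} y \<le> ennreal (\<bar>- x + 1 * y\<bar> powr a) * indicator {-h..h} (- x + 1 * y)"
        using x by (auto simp: indicator_def h_def abs_minus_commute)
    qed
    also have "\<dots> = K0"
      unfolding K0_def using nn_integral_real_affine[of "\<lambda>u. ennreal (\<bar>u\<bar> powr a) * indicator {-h..h} u" 1 "- x"] by simp
    finally show ?thesis .
  qed
  have "integrand_norm2 \<beta> r t f \<le> ennreal (K * \<epsilon>\<^sup>2)"
    if \<epsilon>: "\<epsilon> \<ge> 0" and f: "\<And>x. r < x \<Longrightarrow> x \<le> t \<Longrightarrow> \<bar>f x\<bar> \<le> \<epsilon>" for f and \<epsilon> :: real
  proof -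
    have ae: "AE x in lborel. x \<noteq> r" by (rule AE_lborel_singleton)
    have "integrand_norm2 \<beta> r t f \<le> (\<integral>\<^sup>+x. (\<integral>\<^sup>+y. ennreal (c * \<epsilon>\<^sup>2) * (ennreal (\<bar>x - y\<bar> powr a) * indicator {r..t} y) \<partial>lborel) * indicator {r..t} x \<partial>lborel)"
      unfolding integrand_norm2_def
    proof (rule nn_integral_mono_AE, use ae in eventually_elim)
      fix x assume xr: "x \<noteq> r"
      show "(\<integral>\<^sup>+y. ennreal (\<beta> * (2 * \<beta> - 1) * \<bar>f x\<bar> * \<bar>f y\<bar> * \<bar>x - y\<bar> powr (2 * \<beta> - 2)) * indicator {r..t} y \<partial>lborel) * indicator {r..t} x
        \<le> (\<integral>\<^sup>+y. ennreal (c * \<epsilon>\<^sup>2) * (ennreal (\<bar>x - y\<bar> powr a) * indicator {r..t} y) \<partial>lborel) * indicator {r..t} x"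
      proof (cases "x \<in> {r..t}")
        case True
        then have fx: "\<bar>f x\<bar> \<le> \<epsilon>" using f xr by auto
        have "(\<integral>\<^sup>+y. ennreal (\<beta> * (2 * \<beta> - 1) * \<bar>f x\<bar> * \<bar>f y\<bar> * \<bar>x - y\<bar> powr (2 * \<beta> - 2)) * indicator {r..t} y \<partial>lborel)
          \<le> (\<integral>\<^sup>+y. ennreal (c * \<epsilon>\<^sup>2) * (ennreal (\<bar>x - y\<bar> powr a) * indicator {r..t} y) \<partial>lborel)"
        proof (rule nn_integral_mono_AE, use ae in eventually_elim)
          fix y assume yr: "y \<noteq> r"
          show "ennreal (\<beta> * (2 * \<beta> - 1) * \<bar>f x\<bar> * \<bar>f y\<bar> * \<bar>x - y\<bar> powr (2 * \<beta> - 2)) * indicator {r..t} y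
             \<le> ennreal (c * \<epsilon>\<^sup>2) * (ennreal (\<bar>x - y\<bar> powr a) * indicator {r..t} y)"
          proof (cases "y \<in> {r..t}")
            case True
            then have fy: "\<bar>f y\<bar> \<le> \<epsilon>" using f yr by auto
            have "c * (\<bar>f x\<bar> * \<bar>f y\<bar>) * \<bar>x - y\<bar> powr a \<le> c * (\<epsilon> * \<epsilon>) * \<bar>x - y\<bar> powr a"
              using fx fy c \<epsilon> by (intro mult_right_mono mult_left_mono mult_mono) auto
            then show ?thesis using True c \<epsilon>
              by (simp add: ennreal_mult[symmetric] c_def[symmetric] a_def[symmetric] power2_eq_square mult.assoc ennreal_leI)
          qed simp
        qed
        then show ?thesis using True by simp
      qed simp
    qed
    also have "\<dots> \<le> (\<integral>\<^sup>+x. (ennreal (c * \<epsilon>\<^sup>2) * K0) * indicator {r..t} x \<partial>lborel)"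
    proof (rule nn_integral_mono)
      fix x
      show "(\<integral>\<^sup>+y. ennreal (c * \<epsilon>\<^sup>2) * (ennreal (\<bar>x - y\<bar> powr a) * indicator {r..t} y) \<partial>lborel) * indicator {r..t} x
         \<le> (ennreal (c * \<epsilon>\<^sup>2) * K0) * indicator {r..t} x"
      proof (cases "x \<in> {r..t}")
        case True
        have "(\<integral>\<^sup>+y. ennreal (c * \<epsilon>\<^sup>2) * (ennreal (\<bar>x - y\<bar> powr a) * indicator {r..t} y) \<partial>lborel)
          = ennreal (c * \<epsilon>\<^sup>2) * (\<integral>\<^sup>+y. ennreal (\<bar>x - y\<bar> powr a) * indicator {r..t} y \<partial>lborel)"
          by (rule nn_integral_cmult) measurable
        then show ?thesis using shift[OF True] True by (simp add: mult_left_mono)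
      qed simp
    qed
    also have "\<dots> = (ennreal (c * \<epsilon>\<^sup>2) * K0) * ennreal h" using r by (simp add: nn_integral_cmult_indicator h_def)
    also have "\<dots> = ennreal (K * \<epsilon>\<^sup>2)"
    proof -
      have "K0 = ennreal (enn2real K0)" using K0 by simp
      then have "(ennreal (c * \<epsilon>\<^sup>2) * K0) * ennreal h = (ennreal (c * \<epsilon>\<^sup>2) * ennreal (enn2real K0)) * ennreal h" by simp
      also have "\<dots> = ennreal (c * \<epsilon>\<^sup>2 * enn2real K0 * h)" using c h by (simp add: ennreal_mult)
      finally show ?thesis by (simp add: K_def mult_ac)
    qed
    finally show ?thesis .
  qed
  then show thesis using that[of K] K by blast
qed

text \<open>On each cell the entry is integrated by parts with centre at the right endpoint. The boundary term is then precisely the summand of the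
Riemann-Stieltjes sum, and the remaining integral is of size \<open>|a - b| Q h\<^sup>\<beta> h\<close>.\<close>
lemma kern_riemann_error:
  assumes r: "0 \<le> r" "r < t" and n: "n > 0" and ab: "a \<ge> 0" "b \<ge> 0"
    and w: "continuous_on {0..t} w" and Q: "Q \<ge> 0" and \<beta>: "\<beta> > 0"
    and hol: "\<And>x y. x \<in> {0..t} \<Longrightarrow> y \<in> {0..t} \<Longrightarrow> cmod (w x - w y) \<le> Q * \<bar>x - y\<bar> powr \<beta>"
  shows "cmod ((\<Sum>i<n. of_real (ek a b t r (mesh r t n i)) * (w (mesh r t n (Suc i)) - w (mesh r t n i))) - kern w a b t r)
     \<le> \<bar>a - b\<bar> * (t - r) * Q * ((t - r) / real n) powr \<beta>"
proof -
  note mp = mesh_props[OF r(2) n]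
  let ?h = "(t - r) / real n" and ?m = "mesh r t n"
  have h: "?h > 0" using r n by simp
  let ?E = "complex_of_real (exp (r * b - t * a))"
  have cell: "cmod (of_real (ek a b t r (?m i)) * (w (?m (Suc i)) - w (?m i)) - ?E * (prim w (a - b) (?m (Suc i)) - prim w (a - b) (?m i)))
     \<le> \<bar>a - b\<bar> * Q * ?h powr \<beta> * ?h" if i: "i < n" for i
  proof -
    have mi: "?m i \<in> {r..t}" "?m (Suc i) \<in> {r..t}" "?m i \<le> ?m (Suc i)" using mp(5)[of i] mp(5)[of "Suc i"] mp(4)[of i "Suc i"] i by auto
    have wc: "continuous_on {0..?m (Suc i)} w" by (rule continuous_on_subset[OF w]) (use mi in auto)
    let ?f = "\<lambda>\<tau>. of_real ((a - b) * exp ((a - b) * \<tau>)) * (w \<tau> - w (?m (Suc i)))"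
    have "prim w (a - b) (?m (Suc i)) - prim w (a - b) (?m i) = - (of_real (exp ((a - b) * ?m i)) * (w (?m i) - w (?m (Suc i))))
       - integral {?m i..?m (Suc i)} ?f"
      using prim_centered[OF wc, of "?m i" "a - b" "w (?m (Suc i))"] mi r by simp
    moreover have "E * p = (E * x) * (v - u) - E * J"
      if h: "p = - (x * (u - v)) - J" for p x u v J E :: complex
      unfolding h by (simp add: algebra_simps)
    ultimately have "?E * (prim w (a - b) (?m (Suc i)) - prim w (a - b) (?m i)) =
        (?E * of_real (exp ((a - b) * ?m i))) * (w (?m (Suc i)) - w (?m i)) - ?E * integral {?m i..?m (Suc i)} ?f"
      by blast
    also have "?E * of_real (exp ((a - b) * ?m i)) = of_real (ek a b t r (?m i))" unfolding ek_exp of_real_mult ..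
    also have "?E * integral {?m i..?m (Suc i)} ?f = integral {?m i..?m (Suc i)} (\<lambda>\<tau>. ?E * ?f \<tau>)" by simp
    finally have e: "of_real (ek a b t r (?m i)) * (w (?m (Suc i)) - w (?m i)) - ?E * (prim w (a - b) (?m (Suc i)) - prim w (a - b) (?m i))
       = integral {?m i..?m (Suc i)} (\<lambda>\<tau>. ?E * ?f \<tau>)" by simp
    have "cmod (integral {?m i..?m (Suc i)} (\<lambda>\<tau>. ?E * ?f \<tau>)) \<le> (\<bar>a - b\<bar> * Q * ?h powr \<beta>) * (?m (Suc i) - ?m i)"
    proof (rule integral_bound[OF mi(3)])
      show "continuous_on {?m i..?m (Suc i)} (\<lambda>\<tau>. ?E * ?f \<tau>)"
        by (intro continuous_intros continuous_on_subset[OF w]) (use mi r in auto)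
      fix \<tau> assume \<tau>: "\<tau> \<in> {?m i..?m (Suc i)}"
      have e2: "?E * ?f \<tau> = of_real ((a - b) * ek a b t r \<tau>) * (w \<tau> - w (?m (Suc i)))" by (simp add: ek_exp)
      have "cmod (?E * ?f \<tau>) = \<bar>a - b\<bar> * \<bar>ek a b t r \<tau>\<bar> * cmod (w \<tau> - w (?m (Suc i)))"
        unfolding e2 norm_mult[of "of_real _"] norm_of_real abs_mult ..
      also have "\<dots> \<le> \<bar>a - b\<bar> * 1 * (Q * ?h powr \<beta>)"
      proof (intro mult_mono mult_left_mono)
        have \<tau>t: "\<tau> \<in> {r..t}" using \<tau> mi by auto
        show "\<bar>ek a b t r \<tau>\<bar> \<le> 1" using ek_bounds[OF ab \<tau>t] by simp
        have "cmod (w \<tau> - w (?m (Suc i))) \<le> Q * \<bar>\<tau> - ?m (Suc i)\<bar> powr \<beta>" using \<tau>t mi r by (intro hol) auto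
        also have "\<dots> \<le> Q * ?h powr \<beta>" using \<tau> mp(3)[of i] Q \<beta> by (intro mult_left_mono powr_mono2) auto
        finally show "cmod (w \<tau> - w (?m (Suc i))) \<le> Q * ?h powr \<beta>" .
      qed (use Q in auto)
      finally show "cmod (?E * ?f \<tau>) \<le> \<bar>a - b\<bar> * Q * ?h powr \<beta>" by (simp add: mult_ac)
    qed
    then show ?thesis unfolding e mp(3) .
  qed
  have tel: "(\<Sum>i<n. ?E * (prim w (a - b) (?m (Suc i)) - prim w (a - b) (?m i))) = kern w a b t r"
    unfolding sum_distrib_left[symmetric] using sum_lessThan_telescope[of "\<lambda>i. prim w (a - b) (?m i)" n] mp(1,2)
    by (simp add: kern_def)
  have "cmod ((\<Sum>i<n. of_real (ek a b t r (?m i)) * (w (?m (Suc i)) - w (?m i))) - kern w a b t r)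
     \<le> (\<Sum>i<n. \<bar>a - b\<bar> * Q * ?h powr \<beta> * ?h)"
    unfolding tel[symmetric] sum_subtractf[symmetric] by (rule sum_norm_le) (use cell in auto)
  also have "\<dots> = \<bar>a - b\<bar> * (t - r) * Q * ?h powr \<beta>" using n by (simp add: mult_ac)
  finally show ?thesis .
qed

lemma mesh_size_tendsto: "\<beta> > 0 \<Longrightarrow> r < t \<Longrightarrow> (\<lambda>n. ((t - r) / real (Suc n)) powr \<beta>) \<longlonglongrightarrow> 0"
proof -
  assume \<beta>: "\<beta> > 0" and r: "r < t"
  have "(\<lambda>n. (t - r) / real (Suc n)) \<longlonglongrightarrow> 0" by (rule LIMSEQ_Suc[OF lim_const_over_n])
  then show ?thesis using \<beta> r by (intro tendsto_zero_powrI[OF _ tendsto_const]) auto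
qed

lemma kern_scale: "kern (\<lambda>\<tau>. c * w \<tau>) a b t r = c * kern w a b t r"
proof -
  have "prim (\<lambda>\<tau>. c * w \<tau>) d u = c * prim w d u" for d u
    unfolding prim_def by (simp add: mult.left_commute[of _ c] right_diff_distrib)
  then show ?thesis by (simp add: kern_def right_diff_distrib mult.left_commute)
qed

lemma symmetric_intervals_cofinal: "filterlim (\<lambda>N. {- int N..int N}) (finite_subsets_at_top UNIV) sequentially"
  unfolding filterlim_finite_subsets_at_top
proof (intro allI impI)
  fix F :: "int set" assume F: "finite F \<and> F \<subseteq> UNIV"
  then obtain m where m: "\<And>n. n \<in> F \<Longrightarrow> \<bar>n\<bar> \<le> m" using bdd_above_finite[of "abs ` F"] by (auto simp: bdd_above_def)
  have "F \<subseteq> {- int N..int N}" if "N \<ge> nat m" for N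
  proof
    fix n assume "n \<in> F"
    then have "\<bar>n\<bar> \<le> m" by (rule m)
    then show "n \<in> {- int N..int N}" using that by auto
  qed
  then show "\<forall>\<^sub>F N in sequentially. finite {- int N..int N} \<and> F \<subseteq> {- int N..int N} \<and> {- int N..int N} \<subseteq> UNIV"
    unfolding eventually_sequentially by (intro exI[of _ "nat m"]) auto
qed

context noise_multiplier
begin

definition wint :: "int \<Rightarrow> real \<Rightarrow> real \<Rightarrow> real \<Rightarrow> real \<Rightarrow> 'a \<Rightarrow> complex" where
  "wint k a b t r \<omega> = (if \<omega> \<in> good then kern (\<lambda>\<tau>. Bt k \<tau> \<omega>) a b t r else 0)"

definition wsum :: "int \<Rightarrow> real \<Rightarrow> real \<Rightarrow> real \<Rightarrow> real \<Rightarrow> nat \<Rightarrow> 'a \<Rightarrow> complex" where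
  "wsum k a b t r n \<omega> = (if \<omega> \<in> good then \<Sum>i<n. of_real (ek a b t r (mesh r t n i)) * (Bt k (mesh r t n (Suc i)) \<omega> - Bt k (mesh r t n i) \<omega>) else 0)"

text \<open>Up to a deterministic factor, a Hoelder constant of the mode \<open>B\<^sub>k\<close> on the event \<open>good\<close>, given explicitly so that its moments are at hand.\<close>
definition qconst :: "int \<Rightarrow> nat \<Rightarrow> 'a \<Rightarrow> real" where
  "qconst k T \<omega> = root (2 * q) (enn2real (dsum (2 * q) \<beta>' T (\<lambda>u. B k u \<omega>)))"

lemma qconst_nonneg: "qconst k T \<omega> \<ge> 0"
  unfolding qconst_def by (rule real_root_ge_zero) simp

lemma qconst_holder: "\<omega> \<in> good \<Longrightarrow> dyadic_holder \<beta>' T (qconst k T \<omega>) (\<lambda>u. B k u \<omega>)"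
proof -
  assume g: "\<omega> \<in> good"
  have "dsum (2 * q) \<beta>' T (\<lambda>u. B k u \<omega>) = ennreal (qconst k T \<omega> ^ (2 * q))"
    using g q by (auto simp: good_def qconst_def less_top)
  then show ?thesis using dsum_holder[of "2 * q" \<beta>' T _ "qconst k T \<omega>"] q qconst_nonneg by simp
qed

lemma qconst_square: "ennreal ((qconst k T \<omega>)\<^sup>2) \<le> 1 + dsum (2 * q) \<beta>' T (\<lambda>u. B k u \<omega>)"
proof -
  let ?x = "qconst k T \<omega>" and ?d = "dsum (2 * q) \<beta>' T (\<lambda>u. B k u \<omega>)"
  have "?x\<^sup>2 \<le> 1 + ?x ^ (2 * q)"
  proof (cases "?x \<le> 1")
    case True
    then have "?x\<^sup>2 \<le> 1" using qconst_nonneg by (intro power_le_one) auto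
    then show ?thesis using qconst_nonneg[of k T \<omega>] by (simp add: add_increasing2)
  next
    case False
    then have "?x ^ 2 \<le> ?x ^ (2 * q)" using q by (intro power_increasing) auto
    then show ?thesis by simp
  qed
  then have "ennreal (?x\<^sup>2) \<le> ennreal (1 + ?x ^ (2 * q))" by (rule ennreal_leI)
  also have "\<dots> = 1 + ennreal (?x ^ (2 * q))" using qconst_nonneg[of k T \<omega>] by simp
  also have "?x ^ (2 * q) = enn2real ?d" using q by (simp add: qconst_def)
  also have "1 + ennreal (enn2real ?d) \<le> 1 + ?d" by (intro add_left_mono) (cases ?d; simp)
  finally show ?thesis .
qed

lemma wsum_error:
  assumes r: "0 \<le> r" "r < t" and n: "n > 0" and ab: "a \<ge> 0" "b \<ge> 0" and T: "T > 0" "t \<le> real T"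
  shows "cmod (wsum k a b t r n \<omega> - wint k a b t r \<omega>)
     \<le> \<bar>a - b\<bar> * (t - r) * (hconst T * qconst k T \<omega>) * ((t - r) / real n) powr \<beta>'"
proof (cases "\<omega> \<in> good")
  case True
  have "cmod ((\<Sum>i<n. of_real (ek a b t r (mesh r t n i)) * (Bt k (mesh r t n (Suc i)) \<omega> - Bt k (mesh r t n i) \<omega>)) - kern (\<lambda>\<tau>. Bt k \<tau> \<omega>) a b t r)
    \<le> \<bar>a - b\<bar> * (t - r) * (hconst T * qconst k T \<omega>) * ((t - r) / real n) powr \<beta>'"
  proof (rule kern_riemann_error[OF r n ab Bt_continuous[OF True]])
    show "cmod (Bt k x \<omega> - Bt k y \<omega>) \<le> hconst T * qconst k T \<omega> * \<bar>x - y\<bar> powr \<beta>'" if "x \<in> {0..t}" "y \<in> {0..t}" for x y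
      by (rule dyadic_B_holder[OF qconst_holder[OF True] T(1)]) (use that T in auto)
  qed (use \<beta>' hconst_nonneg qconst_nonneg in auto)
  then show ?thesis using True by (simp add: wsum_def wint_def)
next
  case False
  then show ?thesis using r hconst_nonneg[of T] qconst_nonneg[of k T \<omega>] by (simp add: wsum_def wint_def)
qed

lemma wsum_tendsto:
  assumes r: "0 \<le> r" "r < t" and ab: "a \<ge> 0" "b \<ge> 0"
  shows "(\<lambda>n. wsum k a b t r (Suc n) \<omega>) \<longlonglongrightarrow> wint k a b t r \<omega>"
proof -
  define T where "T = Suc (nat \<lceil>t\<rceil>)"
  have T: "T > 0" "t \<le> real T" by (auto simp: T_def) linarith
  let ?c = "\<bar>a - b\<bar> * (t - r) * (hconst T * qconst k T \<omega>)"
  have g: "(\<lambda>n. ?c * ((t - r) / real (Suc n)) powr \<beta>') \<longlonglongrightarrow> 0"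
    by (rule tendsto_mult_right_zero[OF mesh_size_tendsto[OF \<beta>'(1) r(2)]])
  have "(\<lambda>n. wsum k a b t r (Suc n) \<omega> - wint k a b t r \<omega>) \<longlonglongrightarrow> 0"
    by (rule Lim_null_comparison[OF always_eventually g]) (use wsum_error[OF r _ ab T] in blast)
  then show ?thesis by (rule LIM_zero_cancel)
qed

lemma wint_measurable:
  assumes r: "0 \<le> r" "r < t" and ab: "a \<ge> 0" "b \<ge> 0"
  shows "wint k a b t r \<in> borel_measurable M"
proof (rule borel_measurable_LIMSEQ_metric)
  show "wsum k a b t r (Suc n) \<in> borel_measurable M" for n
  proof -
    have m: "mesh r t (Suc n) i \<ge> 0" for i using r by (simp add: mesh_def)
    have [measurable]: "Bt k (mesh r t (Suc n) i) \<in> borel_measurable M" for i by (rule Bt_measurable[OF m])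
    show ?thesis unfolding wsum_def by measurable
  qed
  show "(\<lambda>n. wsum k a b t r (Suc n) \<omega>) \<longlonglongrightarrow> wint k a b t r \<omega>" for \<omega> by (rule wsum_tendsto[OF r ab])
qed

text \<open>Step functions on equidistant meshes witness the Wiener integral. Their integrands converge uniformly, and their integrals converge pathwise with a rate times a
Hoelder constant of finite second moment, hence in \<open>L\<^sup>2\<close>. The linear functional \<open>L\<close> stands for the real or the imaginary part.\<close>
lemma wint_wiener_part:
  fixes L :: "complex \<Rightarrow> real"
  assumes L: "bounded_linear L" "\<And>z. \<bar>L z\<bar> \<le> cmod z"
    and r: "0 \<le> r" "r < t" and ab: "a \<ge> 0" "b \<ge> 0"
  shows "wiener_integral M \<beta> (\<lambda>x \<omega>. L (B k x \<omega>)) r t (ek a b t r) (\<lambda>\<omega>. L (wint k a b t r \<omega>))"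
proof -
  interpret L: bounded_linear L by (rule L(1))
  have Lscale: "L (of_real c * z) = c * L z" for c z using L.scaleR[of c z] by (simp add: scaleR_conv_of_real)
  have [measurable]: "L \<in> borel_measurable borel" by (intro borel_measurable_continuous_onI L.continuous_on continuous_on_id)
  note [measurable] = wint_measurable[OF r ab]
  define T where "T = Suc (nat \<lceil>t\<rceil>)"
  have T: "T > 0" "t \<le> real T" by (auto simp: T_def) linarith
  let ?f = "ek a b t r"
  let ?xs = "\<lambda>n. mesh_step ?f r t (Suc n)"
  let ?d = "\<lambda>n. (t - r) / real (Suc n)"
  have 1: "\<forall>n. \<forall>(c, u, v)\<in>set (?xs n). r \<le> u \<and> u \<le> v \<and> v \<le> t"
  proof (intro allI ballI)
    fix n x assume "x \<in> set (?xs n)"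
    then obtain i where i: "i < Suc n" "x = (?f (mesh r t (Suc n) i), mesh r t (Suc n) i, mesh r t (Suc n) (Suc i))"
      unfolding mesh_step_def set_map set_upt by auto
    then show "case x of (c, u, v) \<Rightarrow> r \<le> u \<and> u \<le> v \<and> v \<le> t"
      using mesh_props(5)[OF r(2), of "Suc n" i] mesh_props(5)[OF r(2), of "Suc n" "Suc i"] mesh_props(4)[OF r(2), of "Suc n" i "Suc i"] by auto
  qed
  have 2: "(\<lambda>n. integrand_norm2 \<beta> r t (\<lambda>x. ?f x - step_fun (?xs n) x)) \<longlonglongrightarrow> 0"
  proof -
    obtain K where K: "K \<ge> 0" "\<And>f \<epsilon>. \<epsilon> \<ge> 0 \<Longrightarrow> (\<And>x. r < x \<Longrightarrow> x \<le> t \<Longrightarrow> \<bar>f x\<bar> \<le> \<epsilon>) \<Longrightarrow> integrand_norm2 \<beta> r t f \<le> ennreal (K * \<epsilon>\<^sup>2)"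
      using integrand_norm2_uniform[OF \<beta>(1), of r t] r by auto
    have b: "integrand_norm2 \<beta> r t (\<lambda>x. ?f x - step_fun (?xs n) x) \<le> ennreal (K * (\<bar>a - b\<bar> * ?d n)\<^sup>2)" for n
    proof (rule K(2))
      show "\<bar>?f x - step_fun (?xs n) x\<bar> \<le> \<bar>a - b\<bar> * ?d n" if "r < x" "x \<le> t" for x
        by (rule mesh_step_error[OF r(2) zero_less_Suc that ab])
    qed (use r in auto)
    have "(\<lambda>n. K * (\<bar>a - b\<bar> * ?d n)\<^sup>2) \<longlonglongrightarrow> K * (\<bar>a - b\<bar> * 0)\<^sup>2"
      by (intro tendsto_intros LIMSEQ_Suc[OF lim_const_over_n])
    then have "(\<lambda>n. ennreal (K * (\<bar>a - b\<bar> * ?d n)\<^sup>2)) \<longlonglongrightarrow> ennreal 0" by (intro tendsto_ennrealI) simp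
    then have g: "(\<lambda>n. ennreal (K * (\<bar>a - b\<bar> * ?d n)\<^sup>2)) \<longlonglongrightarrow> 0" by simp
    show ?thesis by (rule tendsto_sandwich[OF _ _ tendsto_const g]) (use b in \<open>auto intro: always_eventually\<close>)
  qed
  have 3: "(\<lambda>n. \<integral>\<^sup>+\<omega>. ennreal ((step_integral (\<lambda>x \<omega>. L (B k x \<omega>)) (?xs n) \<omega> - L (wint k a b t r \<omega>))\<^sup>2) \<partial>M) \<longlonglongrightarrow> 0"
  proof -
    define E where "E = (\<integral>\<^sup>+\<omega>. (1 + dsum (2 * q) \<beta>' T (\<lambda>u. B k u \<omega>)) \<partial>M)"
    have "E = (\<integral>\<^sup>+\<omega>. 1 \<partial>M) + (\<integral>\<^sup>+\<omega>. dsum (2 * q) \<beta>' T (\<lambda>u. B k u \<omega>) \<partial>M)"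
      unfolding E_def by (rule nn_integral_add) auto
    then have E: "E < \<infinity>" using dsum_B_moment[of T k] by (simp add: emeasure_space_1)
    define c where "c = \<bar>a - b\<bar> * (t - r) * hconst T"
    have b: "(\<integral>\<^sup>+\<omega>. ennreal ((step_integral (\<lambda>x \<omega>. L (B k x \<omega>)) (?xs n) \<omega> - L (wint k a b t r \<omega>))\<^sup>2) \<partial>M)
        \<le> ennreal ((c * ?d n powr \<beta>')\<^sup>2) * E" for n
    proof -
      let ?m = "mesh r t (Suc n)"
      have m0: "?m i \<ge> 0" for i using r by (simp add: mesh_def)
      have "AE \<omega> in M. \<forall>i. Bt k (?m i) \<omega> = B k (?m i) \<omega>"
        unfolding AE_all_countable using Bt_AE[OF m0] by blast
      then have "AE \<omega> in M. ennreal ((step_integral (\<lambda>x \<omega>. L (B k x \<omega>)) (?xs n) \<omega> - L (wint k a b t r \<omega>))\<^sup>2)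
          \<le> ennreal ((c * ?d n powr \<beta>')\<^sup>2) * (1 + dsum (2 * q) \<beta>' T (\<lambda>u. B k u \<omega>))"
        using good_AE
      proof eventually_elim
        fix \<omega> assume \<omega>: "\<forall>i. Bt k (?m i) \<omega> = B k (?m i) \<omega>" "\<omega> \<in> good"
        have "step_integral (\<lambda>x \<omega>. L (B k x \<omega>)) (?xs n) \<omega> = L (wsum k a b t r (Suc n) \<omega>)"
          unfolding step_integral_mesh wsum_def using \<omega> by (simp add: L.sum Lscale L.diff L.add)
        then have "\<bar>step_integral (\<lambda>x \<omega>. L (B k x \<omega>)) (?xs n) \<omega> - L (wint k a b t r \<omega>)\<bar> \<le> cmod (wsum k a b t r (Suc n) \<omega> - wint k a b t r \<omega>)"
          using L(2) by (simp add: L.diff[symmetric])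
        also have "\<dots> \<le> (c * ?d n powr \<beta>') * qconst k T \<omega>"
          using wsum_error[OF r _ ab T, of "Suc n" k \<omega>] by (simp add: c_def mult_ac)
        finally have "\<bar>step_integral (\<lambda>x \<omega>. L (B k x \<omega>)) (?xs n) \<omega> - L (wint k a b t r \<omega>)\<bar>\<^sup>2 \<le> ((c * ?d n powr \<beta>') * qconst k T \<omega>)\<^sup>2"
          by (intro power_mono) auto
        then have "ennreal ((step_integral (\<lambda>x \<omega>. L (B k x \<omega>)) (?xs n) \<omega> - L (wint k a b t r \<omega>))\<^sup>2) \<le> ennreal ((c * ?d n powr \<beta>')\<^sup>2 * (qconst k T \<omega>)\<^sup>2)"
          by (intro ennreal_leI) (simp add: power_mult_distrib)
        also have "\<dots> = ennreal ((c * ?d n powr \<beta>')\<^sup>2) * ennreal ((qconst k T \<omega>)\<^sup>2)" by (rule ennreal_mult) auto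
        also have "\<dots> \<le> ennreal ((c * ?d n powr \<beta>')\<^sup>2) * (1 + dsum (2 * q) \<beta>' T (\<lambda>u. B k u \<omega>))"
          by (intro mult_left_mono qconst_square) simp
        finally show "ennreal ((step_integral (\<lambda>x \<omega>. L (B k x \<omega>)) (?xs n) \<omega> - L (wint k a b t r \<omega>))\<^sup>2)
          \<le> ennreal ((c * ?d n powr \<beta>')\<^sup>2) * (1 + dsum (2 * q) \<beta>' T (\<lambda>u. B k u \<omega>))" .
      qed
      then have "(\<integral>\<^sup>+\<omega>. ennreal ((step_integral (\<lambda>x \<omega>. L (B k x \<omega>)) (?xs n) \<omega> - L (wint k a b t r \<omega>))\<^sup>2) \<partial>M)
        \<le> (\<integral>\<^sup>+\<omega>. ennreal ((c * ?d n powr \<beta>')\<^sup>2) * (1 + dsum (2 * q) \<beta>' T (\<lambda>u. B k u \<omega>)) \<partial>M)"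
        by (rule nn_integral_mono_AE)
      also have "\<dots> = ennreal ((c * ?d n powr \<beta>')\<^sup>2) * E" unfolding E_def by (rule nn_integral_cmult) measurable
      finally show ?thesis .
    qed
    have "(\<lambda>n. (c * ?d n powr \<beta>')\<^sup>2 * enn2real E) \<longlonglongrightarrow> (c * 0)\<^sup>2 * enn2real E"
      by (intro tendsto_intros mesh_size_tendsto \<beta>' r)
    then have "(\<lambda>n. ennreal ((c * ?d n powr \<beta>')\<^sup>2 * enn2real E)) \<longlonglongrightarrow> ennreal 0" by (intro tendsto_ennrealI) simp
    moreover have "ennreal ((c * ?d n powr \<beta>')\<^sup>2 * enn2real E) = ennreal ((c * ?d n powr \<beta>')\<^sup>2) * E" for n
      using E by (simp add: ennreal_mult)
    ultimately have g: "(\<lambda>n. ennreal ((c * ?d n powr \<beta>')\<^sup>2) * E) \<longlonglongrightarrow> 0" by simp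
    show ?thesis by (rule tendsto_sandwich[OF _ _ tendsto_const g]) (use b in \<open>auto intro: always_eventually\<close>)
  qed
  have "(\<lambda>\<omega>. L (wint k a b t r \<omega>)) \<in> borel_measurable M" by measurable
  then show ?thesis unfolding wiener_integral_def by (intro conjI exI[of _ ?xs]) (rule 1 2 3 | assumption)+
qed

lemma wint_wiener:
  assumes r: "0 \<le> r" "r < t" and ab: "a \<ge> 0" "b \<ge> 0"
  shows "wiener_integral_complex M \<beta> (B k) r t (ek a b t r) (wint k a b t r)"
  unfolding wiener_integral_complex_def
  by (rule conjI[OF wint_wiener_part[OF bounded_linear_Re abs_Re_le_cmod r ab] wint_wiener_part[OF bounded_linear_Im abs_Im_le_cmod r ab]])

text \<open>Set to zero off the event \<open>good\<close>, which makes it measurable for every pair of times.\<close>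
definition driver :: "real \<Rightarrow> 'a \<Rightarrow> real \<Rightarrow> real \<Rightarrow> torus_fun \<Rightarrow> torus_fun" where
  "driver s \<omega> t r f = (if \<omega> \<in> good then unemb s (mat_apply (weighted_kern s (\<lambda>k u. \<phi> k * Bt k u \<omega>) t r) (emb s f)) else (\<lambda>_. 0))"

text \<open>Both sides carry the Sobolev weights in conjugated form; they cancel, leaving the Fourier expansion with the integrals \<open>wint\<close>. It holds for every
\<open>\<omega>\<close>, as both sides vanish off \<open>good\<close>.\<close>
lemma driver_has_sum:
  assumes np: "\<And>\<omega>. \<omega> \<in> good \<Longrightarrow> noise_path (\<lambda>k t. \<phi> k * Bt k t \<omega>) s \<beta>' \<gamma> \<kappa>"
    and r: "0 \<le> r" "r < t" and f: "f \<in> sobolev s"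
  shows "((\<lambda>m. f m * \<phi> (n - m) * wint (n - m) ((jap (n - m + m))\<^sup>2) ((jap m)\<^sup>2) t r \<omega>) has_sum driver s \<omega> t r f n) UNIV"
proof (cases "\<omega> \<in> good")
  case True
  let ?z = "\<lambda>k u. \<phi> k * Bt k u \<omega>"
  interpret np: noise_path ?z s \<beta>' \<gamma> \<kappa> by (rule np[OF True])
  obtain c q' where cq: "\<forall>u v J. 0 \<le> u \<longrightarrow> u \<le> v \<longrightarrow> v \<le> t \<longrightarrow>
     mat_bound (tail_from J (weighted_kern s ?z v u)) (2 * (c * (v - u) powr \<gamma>) * q' ^ J / (1 - q'))"
    using np.level_bound[OF order_le_less_trans[OF r]] by (elim exE conjE)
  then have "mat_bound (tail_from 0 (weighted_kern s ?z t r)) (2 * (c * (t - r) powr \<gamma>) * q' ^ 0 / (1 - q'))" using cq[rule_format, of r t 0] r by simp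
  moreover have "tail_from 0 D = D" for D by (intro ext) (simp add: tail_from_def)
  ultimately obtain C where C: "mat_bound (weighted_kern s ?z t r) C" by auto
  have "((\<lambda>m. of_real (jap n powr - s) * (weighted_kern s ?z t r n m * coord (emb s f) m)) has_sum driver s \<omega> t r f n) UNIV"
    unfolding driver_def unemb_def using True by (simp add: has_sum_cmult_right[OF mat_apply_has_sum[OF C]])
  moreover have "of_real (jap n powr - s) * (weighted_kern s ?z t r n m * coord (emb s f) m)
     = f m * \<phi> (n - m) * wint (n - m) ((jap (n - m + m))\<^sup>2) ((jap m)\<^sup>2) t r \<omega>" for m
  proof -
    have "jap k powr - s * jap k powr s = 1" for k using jap_pos[of k] by (simp add: powr_add[symmetric])
    then have one: "complex_of_real (jap k powr - s) * of_real (jap k powr s) = 1" for k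
      by (simp only: of_real_mult[symmetric] of_real_1)
    have "of_real (jap n powr - s) * (weighted_kern s ?z t r n m * coord (emb s f) m)
      = (of_real (jap n powr - s) * of_real (jap n powr s)) * (of_real (jap m powr - s) * of_real (jap m powr s))
        * (f m * kern (?z (n - m)) ((jap n)\<^sup>2) ((jap m)\<^sup>2) t r)"
      unfolding weighted_kern_def coord_emb[OF f] by (simp only: mult_ac)
    then show ?thesis unfolding one using True by (simp add: kern_scale wint_def)
  qed
  ultimately show ?thesis by simp
next
  case False
  then show ?thesis by (simp add: driver_def wint_def)
qed

lemma driver_is_version:
  assumes np: "\<And>\<omega>. \<omega> \<in> good \<Longrightarrow> noise_path (\<lambda>k t. \<phi> k * Bt k t \<omega>) s \<beta>' \<gamma> \<kappa>"
  shows "driver_version M \<beta> B \<phi> s (driver s)"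
  unfolding driver_version_def
proof (intro allI impI conjI ballI)
  fix t r f and n :: int assume r: "(0::real) \<le> r" "r < t" and f: "f \<in> sobolev s"
  let ?g = "\<lambda>m \<omega>. f m * \<phi> (n - m) * wint (n - m) ((jap (n - m + m))\<^sup>2) ((jap m)\<^sup>2) t r \<omega>"
  show "(\<lambda>\<omega>. driver s \<omega> t r f n) \<in> borel_measurable M"
  proof (rule borel_measurable_LIMSEQ_metric)
    show "(\<lambda>\<omega>. \<Sum>m\<in>{- int N..int N}. ?g m \<omega>) \<in> borel_measurable M" for N
    proof -
      have [measurable]: "wint (n - m) ((jap (n - m + m))\<^sup>2) ((jap m)\<^sup>2) t r \<in> borel_measurable M" for m
        by (rule wint_measurable[OF r]) auto
      show ?thesis by measurable
    qed
    show "(\<lambda>N. \<Sum>m\<in>{- int N..int N}. ?g m \<omega>) \<longlonglongrightarrow> driver s \<omega> t r f n" for \<omega>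
      using filterlim_compose[OF driver_has_sum[OF np r f, of n \<omega>, unfolded has_sum_def] symmetric_intervals_cofinal] by simp
  qed
next
  fix t r assume r: "(0::real) \<le> r" "r < t"
  let ?I = "\<lambda>n1 n2. wint n1 ((jap (n1 + n2))\<^sup>2) ((jap n2)\<^sup>2) t r"
  show "\<exists>I. (\<forall>n1 n2. wiener_integral_complex M \<beta> (B n1) r t
        (\<lambda>t'. exp (- (t - t') * (jap (n1 + n2))\<^sup>2) * exp (- (t' - r) * (jap n2)\<^sup>2)) (I n1 n2)) \<and>
      (AE \<omega> in M. \<forall>f\<in>sobolev s. \<forall>n. ((\<lambda>n2. f n2 * \<phi> (n - n2) * I (n - n2) n2 \<omega>) has_sum driver s \<omega> t r f n) UNIV)"
  proof (intro exI[of _ ?I] conjI allI)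
    show "wiener_integral_complex M \<beta> (B n1) r t
        (\<lambda>t'. exp (- (t - t') * (jap (n1 + n2))\<^sup>2) * exp (- (t' - r) * (jap n2)\<^sup>2)) (?I n1 n2)" for n1 n2
      using wint_wiener[OF r, of "(jap (n1 + n2))\<^sup>2" "(jap n2)\<^sup>2" n1] by (simp add: ek_def[abs_def])
    show "AE \<omega> in M. \<forall>f\<in>sobolev s. \<forall>n. ((\<lambda>n2. f n2 * \<phi> (n - n2) * ?I (n - n2) n2 \<omega>) has_sum driver s \<omega> t r f n) UNIV"
      by (intro AE_I2 ballI allI driver_has_sum[OF np r])
  qed
qed

end

section \<open>Well-posedness of the stochastic heat equation\<close>

theorem theorem1p1:
  fixes \<beta> \<sigma> :: real
  assumes "1 / 2 < \<beta>" and "\<beta> < 1" and "\<sigma> > - 2 * \<beta> + 1"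
  shows "\<exists>s>0. \<forall>(M :: 'a measure) (B :: int \<Rightarrow> real \<Rightarrow> 'a \<Rightarrow> complex) (\<phi> :: int \<Rightarrow> complex).
           prob_space M \<longrightarrow> fbm_noise M \<beta> B \<longrightarrow> hilbert_schmidt \<sigma> (fourier_multiplier \<phi>) \<longrightarrow>
           pathwise_globally_well_posed M \<beta> B \<phi> s"
proof -
  define \<sigma>' where "\<sigma>' = max 0 (- \<sigma>)"
  define d where "d = 2 * \<beta> - 1 - \<sigma>'"
  have \<sigma>': "\<sigma>' \<ge> 0" "- \<sigma> \<le> \<sigma>'" by (auto simp: \<sigma>'_def)
  have d: "d > 0" "d \<le> 2 * \<beta> - 1" using assms by (auto simp: d_def \<sigma>'_def)
  \<comment> \<open>The available room is \<open>d = 2 \<beta> - 1 - \<sigma>'\<close>. The choices give \<open>\<kappa> + s = 2 \<beta> - 1 - d / 2\<close> and \<open>2 (\<beta>' - \<gamma>) = 2 \<beta> - 1 - d / 4\<close>.\<close>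
  define \<beta>' where "\<beta>' = \<beta> - d / 16"
  define \<gamma> where "\<gamma> = 1 / 2 + d / 16"
  define \<alpha> where "\<alpha> = 1 / 2 + d / 32"
  define \<kappa> where "\<kappa> = \<sigma>' + d / 4"
  define s where "s = d / 4"
  \<comment> \<open>The losses \<open>\<beta> - \<beta>' = d / 16\<close> and \<open>\<kappa> - \<sigma>' = d / 4\<close> are paid for by moments with \<open>2 q\<close> times the loss above one.\<close>
  obtain q0 :: nat where q0: "8 / d < real q0" using reals_Archimedean2 by blast
  define q where "q = Suc q0"
  have q: "q > 0" "8 < d * real q" using q0 d by (auto simp: q_def field_simps)
  have "pathwise_globally_well_posed M \<beta> B \<phi> s"
    if M: "prob_space M" and B: "fbm_noise M \<beta> B" and hs: "hilbert_schmidt \<sigma> (fourier_multiplier \<phi>)"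
    for M :: "'a measure" and B :: "int \<Rightarrow> real \<Rightarrow> 'a \<Rightarrow> complex" and \<phi> :: "int \<Rightarrow> complex"
  proof -
    have "noise M \<beta> B" using M B assms by (intro noise.intro noise_axioms.intro) auto
    moreover have "noise_multiplier_axioms \<beta> \<phi> \<sigma> \<sigma>' \<beta>' \<kappa> q"
    proof
      have "2 * real q * (\<beta> - \<beta>') = d * real q / 8" "2 * real q * (\<kappa> - \<sigma>') = d * real q / 2"
        by (simp_all add: \<beta>'_def \<kappa>_def)
      moreover have "1 < d * real q / 8" "1 < d * real q / 2" using q(2) by simp_all
      ultimately show "1 < 2 * real q * (\<beta> - \<beta>')" "1 < 2 * real q * (\<kappa> - \<sigma>')" by (simp_all only:)
    qed (use hs \<sigma>' q d assms in \<open>auto simp: \<beta>'_def\<close>)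
    ultimately interpret noise_multiplier M \<beta> B \<phi> \<sigma> \<sigma>' \<beta>' \<kappa> q by (rule noise_multiplier.intro)
    have np: "noise_path (\<lambda>k t. \<phi> k * Bt k t \<omega>) s \<beta>' \<gamma> \<kappa>" if "\<omega> \<in> good" for \<omega>
    proof (rule good_noise_path[OF that])
      show "0 \<le> s" "0 \<le> \<gamma>" using d by (simp_all add: s_def \<gamma>_def)
      show "\<gamma> < \<beta>'" using d unfolding \<gamma>_def \<beta>'_def by linarith
      show "\<kappa> + s < 2 * (\<beta>' - \<gamma>)"
      proof -
        have "\<kappa> + s = 2 * \<beta> - 1 - d / 2" "2 * (\<beta>' - \<gamma>) = 2 * \<beta> - 1 - d / 4"
          using d_def by (simp_all add: \<kappa>_def s_def \<gamma>_def \<beta>'_def field_simps)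
        then show ?thesis using d(1) by simp
      qed
    qed
    have dp: "driver_path s \<alpha> \<gamma> (weighted_kern s (\<lambda>k t. \<phi> k * Bt k t \<omega>)) (driver s \<omega>)" if g: "\<omega> \<in> good" for \<omega>
      by (rule noise_path.driver_path[OF np[OF g]]) (use d assms g in \<open>auto simp: \<alpha>_def \<gamma>_def driver_def\<close>)
    have "1 / 2 < \<alpha>" "\<alpha> < \<gamma>" "\<gamma> < 1" using d assms by (auto simp: \<alpha>_def \<gamma>_def)
    moreover have "driver_version M \<beta> B \<phi> s (driver s)" by (rule driver_is_version[OF np])
    moreover have "measure M good = 1" using prob_eq_1[OF good_sets] good_AE by blast
    moreover have "(\<forall>T>0. C2 (bounded_ops s) (op_norm s) \<gamma> T (driver s \<omega>)) \<and> well_posed s \<alpha> (driver s \<omega>)" if "\<omega> \<in> good" for \<omega>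
      using driver_path.driver_C2[OF dp[OF that]] driver_path.well_posed[OF dp[OF that]] by blast
    ultimately show ?thesis unfolding pathwise_globally_well_posed_def using good_sets by blast
  qed
  moreover have "s > 0" using d by (simp add: s_def)
  ultimately show ?thesis by blast
qed

end
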